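(* Let $H$ be a Lie group, not necessarily second countable, and let $M$ be a second countable manifold equipped with a smooth, locally free right $H$-action. Let $H_0$ be the identity component of $H$, and let $\mathcal F$ be the foliation of $M$ by the $H_0$-orbits. Set $X:=M/H_0$ and $K:=H/H_0$, with the induced right action of $K$ on $X$. Assume that at least one of the following holds: (a) $H$ is second countable; (b) the canonical map $$\Delta:X\times K\longrightarrow X\times_{X/K}X,\qquad (x,k)\longmapsto(x,x\cdot k),$$ is a subduction, where $X\times K$ has the product diffeology and $X\times_{X/K}X$ has the subset diffeology inherited from $X\times X$. Then pullback by the quotient map $\pi_H:M\to M/H$ (with $M/H$ carrying the quotient diffeology) induces a natural isomorphism of cochain complexes $$\pi_H^*:\Omega^\bullet(M/H)\xrightarrow{\;\cong\;}\Omega^\bullet(M,\mathcal F)^H,$$ and consequently a natural isomorphism in cohomology $$H^\bullet_{\mathrm{dR}}(M/H)\cong H^\bullet\bigl(\Omega^\bullet(M,\mathcal F)^H,d\bigr).$$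
   Context: **Diffeology.** A parametrization of a set $X$ is a map $\alpha:U\to X$ with $U$ an open subset of some $\mathbb R^n$, $n\ge 0$. A diffeology $\mathcal D$ on $X$ is a family of parametrizations (called plots) such that: (1) every constant parametrization is in $\mathcal D$; (2) if $\alpha:U\to X$ is in $\mathcal D$ and $h:V\to U$ is a smooth map between open subsets of Euclidean spaces, then $\alpha\circ h\in\mathcal D$; (3) a parametrization $\alpha:U\to X$ such that each point of $U$ has an open neighborhood $V$ with $\alpha|_V\in\mathcal D$ is itself in $\mathcal D$. A map between diffeological spaces is smooth if it sends plots to plots by composition. The manifold diffeology of a smooth manifold has as plots exactly the smooth maps from open subsets of Euclidean spaces. The subset diffeology on $A\subset X$ consists of the parametrizations of $A$ that are plots of $X$ after inclusion. The product diffeology on $X\times Y$ consists of the parametrizations both of whose components are plots. If $\sim$ is an equivalence relation on $X$ with quotient map $\pi$, the quotient diffeology on $X/\!\sim$ consists of the parametrizations $\gamma:U\to X/\!\sim$ such that either $\gamma$ is constant or every $x\in U$ has an open neighborhood $V\subset U$ and a plot $\alpha:V\to X$ with $\gamma|_V=\pi\circ\alpha$. A subduction is a surjective smooth map $p:X\to Y$ such that $Y$ carries the quotient diffeology induced by $p$; equivalently, a smooth surjection such that every plot $f:U\to Y$ lifts, near each point of $U$, to a plot $g:V\to X$ with $f|_V=p\circ g$. **Forms.** A differential $k$-form $\gamma$ on a diffeological space $X$ assigns to each plot $\alpha:U\to X$ a differential $k$-form $\gamma_\alpha\in\Omega^k(U)$ such that $\gamma_{\alpha\circ f}=f^*\gamma_\alpha$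 for every smooth map $f:V\to U$ between open subsets of Euclidean spaces. The differential is $d\{\gamma_\alpha\}=\{d\gamma_\alpha\}$; $\Omega^\bullet(X)$ is the resulting complex and $H^\bullet_{\mathrm{dR}}(X)$ its cohomology. For smooth $f:X\to Y$, $(f^*\gamma)_\alpha:=\gamma_{f\circ\alpha}$. On a manifold with its manifold diffeology this is the usual de Rham complex. **Setting.** Lie groups here may have non-second-countable underlying manifolds (e.g. uncountable discrete groups). A smooth action is locally free if all its stabilizers are discrete in $H$. Then the $H_0$-orbits are the leaves of a regular foliation $\mathcal F$ of $M$. A form $\omega$ on $M$ is basic for $\mathcal F$ if $\iota_Y\omega=0$ and $\mathcal L_Y\omega=0$ for every vector field $Y$ tangent to $\mathcal F$; $\Omega^\bullet(M,\mathcal F)$ is the complex of basic forms, and $\Omega^\bullet(M,\mathcal F)^H$ is the subcomplex of those basic forms $\omega$ with $R_h^*\omega=\omega$ for all $h\in H$, where $R_h(x)=x\cdot h$. The space $X=M/H_0$ has the quotient diffeology. The component group $K=H/H_0$ is a discrete group with the discrete diffeology (plots are the locally constant parametrizations), and it acts on $X$ on the right by $[m]\cdot(hH_0)=[m\cdot h]$ ($H_0$ is normal in $H$). The quotient $X/K$, with the quotient diffeology, is identified with $M/H$, and $X\times_{X/K}X=\{(x,y)\in X\times X: x\text{ and }y\text{ have the same image in }X/K\}$. *)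

theory Defs
  imports "HOL-Analysis.Analysis" "HOL-Algebra.Coset" "HOL-Library.Function_Algebras"
begin

section \<open>Function spaces as real vector spaces\<close>

instantiation "fun" :: (type, real_vector) real_vector
begin

definition scaleR_fun :: "real \<Rightarrow> ('a \<Rightarrow> 'b) \<Rightarrow> 'a \<Rightarrow> 'b"
  where "scaleR_fun r f = (\<lambda>x. r *\<^sub>R f x)"

instance
  by standard (simp_all add: scaleR_fun_def fun_eq_iff scaleR_add_right scaleR_add_left)

end


section \<open>Cochain complexes of real vector spaces\<close>

text \<open>A complex is a family \<open>C\<close> of linear subspaces of one ambient real vector space, together
  with an operator \<open>d\<close> on the ambient space that restricts to the differentials.\<close>

definition linear_map_on :: "'a::real_vector set \<Rightarrow> ('a \<Rightarrow> 'b::real_vector) \<Rightarrow> bool" where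
  "linear_map_on C f \<longleftrightarrow>
     (\<forall>x\<in>C. \<forall>y\<in>C. \<forall>a b. f (a *\<^sub>R x + b *\<^sub>R y) = a *\<^sub>R f x + b *\<^sub>R f y)"

definition cochain_complex :: "(nat \<Rightarrow> 'a::real_vector set) \<Rightarrow> ('a \<Rightarrow> 'a) \<Rightarrow> bool" where
  "cochain_complex C d \<longleftrightarrow>
     (\<forall>k. subspace (C k) \<and> linear_map_on (C k) d \<and> d ` C k \<subseteq> C (Suc k) \<and>
          (\<forall>x\<in>C k. d (d x) = 0))"

definition cochain_iso ::
  "(nat \<Rightarrow> 'a::real_vector set) \<Rightarrow> ('a \<Rightarrow> 'a) \<Rightarrow>
   (nat \<Rightarrow> 'b::real_vector set) \<Rightarrow> ('b \<Rightarrow> 'b) \<Rightarrow> ('a \<Rightarrow> 'b) \<Rightarrow> bool" where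
  "cochain_iso C d C' d' f \<longleftrightarrow>
     cochain_complex C d \<and> cochain_complex C' d' \<and>
     (\<forall>k. linear_map_on (C k) f \<and> bij_betw f (C k) (C' k) \<and> (\<forall>x\<in>C k. f (d x) = d' (f x)))"

definition cocycles :: "(nat \<Rightarrow> 'a::real_vector set) \<Rightarrow> ('a \<Rightarrow> 'a) \<Rightarrow> nat \<Rightarrow> 'a set" where
  "cocycles C d k = {x \<in> C k. d x = 0}"

definition coboundaries :: "(nat \<Rightarrow> 'a::real_vector set) \<Rightarrow> ('a \<Rightarrow> 'a) \<Rightarrow> nat \<Rightarrow> 'a set" where
  "coboundaries C d k = (case k of 0 \<Rightarrow> {0} | Suc j \<Rightarrow> d ` C j)"

definition cohomologous ::
  "(nat \<Rightarrow> 'a::real_vector set) \<Rightarrow> ('a \<Rightarrow> 'a) \<Rightarrow> nat \<Rightarrow> ('a \<times> 'a) set" where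
  "cohomologous C d k =
     {(x, y). x \<in> cocycles C d k \<and> y \<in> cocycles C d k \<and> x - y \<in> coboundaries C d k}"

definition cohomology ::
  "(nat \<Rightarrow> 'a::real_vector set) \<Rightarrow> ('a \<Rightarrow> 'a) \<Rightarrow> nat \<Rightarrow> 'a set set" where
  "cohomology C d k = cocycles C d k // cohomologous C d k"

text \<open>The operations on cohomology classes, and the map induced by a cochain map, are unions over
  all representatives; when the operation is well defined on classes all members of the union
  coincide.\<close>

definition cohomology_add ::
  "(nat \<Rightarrow> 'a::real_vector set) \<Rightarrow> ('a \<Rightarrow> 'a) \<Rightarrow> nat \<Rightarrow> 'a set \<Rightarrow> 'a set \<Rightarrow> 'a set" where
  "cohomology_add C d k S T = (\<Union>x\<in>S. \<Union>y\<in>T. cohomologous C d k `` {x + y})"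

definition cohomology_scale ::
  "(nat \<Rightarrow> 'a::real_vector set) \<Rightarrow> ('a \<Rightarrow> 'a) \<Rightarrow> nat \<Rightarrow> real \<Rightarrow> 'a set \<Rightarrow> 'a set" where
  "cohomology_scale C d k a S = (\<Union>x\<in>S. cohomologous C d k `` {a *\<^sub>R x})"

definition cohomology_map ::
  "(nat \<Rightarrow> 'b::real_vector set) \<Rightarrow> ('b \<Rightarrow> 'b) \<Rightarrow> nat \<Rightarrow> ('a \<Rightarrow> 'b) \<Rightarrow> 'a set \<Rightarrow> 'b set" where
  "cohomology_map C' d' k f S = (\<Union>x\<in>S. cohomologous C' d' k `` {f x})"

definition cohomology_iso ::
  "(nat \<Rightarrow> 'a::real_vector set) \<Rightarrow> ('a \<Rightarrow> 'a) \<Rightarrow>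
   (nat \<Rightarrow> 'b::real_vector set) \<Rightarrow> ('b \<Rightarrow> 'b) \<Rightarrow> nat \<Rightarrow> ('a set \<Rightarrow> 'b set) \<Rightarrow> bool" where
  "cohomology_iso C d C' d' k F \<longleftrightarrow>
     bij_betw F (cohomology C d k) (cohomology C' d' k) \<and>
     (\<forall>S\<in>cohomology C d k. \<forall>T\<in>cohomology C d k.
        F (cohomology_add C d k S T) = cohomology_add C' d' k (F S) (F T)) \<and>
     (\<forall>a. \<forall>S\<in>cohomology C d k.
        F (cohomology_scale C d k a S) = cohomology_scale C' d' k a (F S))"


section \<open>Calculus on open subsets of Euclidean spaces of arbitrary dimension\<close>

text \<open>As in the library's \<open>Euclidean_space n\<close>, the points of the \<open>n\<close>-dimensional space are the
  sequences \<open>x :: nat \<Rightarrow> real\<close> with \<open>x i = 0\<close> for \<open>i \<ge> n\<close>. Thus \<open>n\<close> is an ordinary variable.\<close>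

abbreviation Rn :: "nat \<Rightarrow> (nat \<Rightarrow> real) set" where
  "Rn n \<equiv> topspace (Euclidean_space n)"

definition partial :: "nat \<Rightarrow> ((nat \<Rightarrow> real) \<Rightarrow> real) \<Rightarrow> (nat \<Rightarrow> real) \<Rightarrow> real" where
  "partial i f x = deriv (\<lambda>t. f (x(i := t))) (x i)"

definition has_partial :: "nat \<Rightarrow> ((nat \<Rightarrow> real) \<Rightarrow> real) \<Rightarrow> (nat \<Rightarrow> real) \<Rightarrow> bool" where
  "has_partial i f x \<longleftrightarrow> (\<lambda>t. f (x(i := t))) differentiable at (x i)"

text \<open>\<open>Ck r n U f\<close>: all iterated partial derivatives of \<open>f\<close> up to order \<open>r\<close> exist and are
  continuous on the open subset \<open>U\<close> of \<open>n\<close>-space.\<close>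

primrec Ck :: "nat \<Rightarrow> nat \<Rightarrow> (nat \<Rightarrow> real) set \<Rightarrow> ((nat \<Rightarrow> real) \<Rightarrow> real) \<Rightarrow> bool" where
  "Ck 0 n U f \<longleftrightarrow> continuous_on U f"
| "Ck (Suc r) n U f \<longleftrightarrow>
     continuous_on U f \<and> (\<forall>i<n. (\<forall>x\<in>U. has_partial i f x) \<and> Ck r n U (partial i f))"

definition smooth_fun :: "nat \<Rightarrow> (nat \<Rightarrow> real) set \<Rightarrow> ((nat \<Rightarrow> real) \<Rightarrow> real) \<Rightarrow> bool" where
  "smooth_fun n U f \<longleftrightarrow> (\<forall>r. Ck r n U f)"

definition smooth_between ::
  "nat \<Rightarrow> (nat \<Rightarrow> real) set \<Rightarrow> nat \<Rightarrow> (nat \<Rightarrow> real) set \<Rightarrow> ((nat \<Rightarrow> real) \<Rightarrow> nat \<Rightarrow> real) \<Rightarrow> bool" where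
  "smooth_between n U m V f \<longleftrightarrow> f \<in> U \<rightarrow> V \<and> (\<forall>j<m. smooth_fun n U (\<lambda>x. f x j))"

definition dir_deriv ::
  "nat \<Rightarrow> (nat \<Rightarrow> real) \<Rightarrow> ((nat \<Rightarrow> real) \<Rightarrow> real) \<Rightarrow> (nat \<Rightarrow> real) \<Rightarrow> real" where
  "dir_deriv n v f x = (\<Sum>i<n. v i * partial i f x)"

text \<open>\<open>tangent_map n f x\<close> is the differential of \<open>f\<close> at the point \<open>x\<close> of \<open>n\<close>-space.\<close>

definition tangent_map ::
  "nat \<Rightarrow> ((nat \<Rightarrow> real) \<Rightarrow> nat \<Rightarrow> real) \<Rightarrow> (nat \<Rightarrow> real) \<Rightarrow> (nat \<Rightarrow> real) \<Rightarrow> nat \<Rightarrow> real" where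
  "tangent_map n f x v = (\<lambda>j. dir_deriv n v (\<lambda>y. f y j) x)"


section \<open>Differential forms on open subsets of Euclidean spaces\<close>

text \<open>A \<open>k\<close>-form takes a point and the list of its \<open>k\<close> vector arguments. It vanishes by convention
  on all other arguments, so that equality of forms is equality of functions.\<close>

type_synonym eform = "(nat \<Rightarrow> real) \<Rightarrow> (nat \<Rightarrow> real) list \<Rightarrow> real"

definition eforms :: "nat \<Rightarrow> (nat \<Rightarrow> real) set \<Rightarrow> nat \<Rightarrow> eform set" where
  "eforms n U k = {\<omega>.
     (\<forall>x vs. \<not> (x \<in> U \<and> length vs = k \<and> set vs \<subseteq> Rn n) \<longrightarrow> \<omega> x vs = 0) \<and>
     (\<forall>x\<in>U. \<forall>vs. length vs = k \<and> set vs \<subseteq> Rn n \<longrightarrow>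
        (\<forall>i<k. \<forall>v\<in>Rn n. \<forall>w\<in>Rn n. \<forall>a b.
           \<omega> x (vs[i := a *\<^sub>R v + b *\<^sub>R w]) = a * \<omega> x (vs[i := v]) + b * \<omega> x (vs[i := w])) \<and>
        (\<forall>i<k. \<forall>j<k. i \<noteq> j \<and> vs ! i = vs ! j \<longrightarrow> \<omega> x vs = 0)) \<and>
     (\<forall>vs. length vs = k \<and> set vs \<subseteq> Rn n \<longrightarrow> smooth_fun n U (\<lambda>x. \<omega> x vs))}"

definition eform_pull ::
  "nat \<Rightarrow> (nat \<Rightarrow> real) set \<Rightarrow> ((nat \<Rightarrow> real) \<Rightarrow> nat \<Rightarrow> real) \<Rightarrow> eform \<Rightarrow> eform" where
  "eform_pull n V f \<omega> = (\<lambda>x vs.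
     if x \<in> V \<and> set vs \<subseteq> Rn n then \<omega> (f x) (map (tangent_map n f x) vs) else 0)"

text \<open>The invariant formula for the exterior derivative, evaluated on constant vector fields (whose
  brackets vanish).\<close>

definition eform_d :: "nat \<Rightarrow> (nat \<Rightarrow> real) set \<Rightarrow> eform \<Rightarrow> eform" where
  "eform_d n U \<omega> = (\<lambda>x vs.
     if x \<in> U \<and> set vs \<subseteq> Rn n
     then \<Sum>i<length vs. (-1) ^ i * dir_deriv n (vs ! i) (\<lambda>y. \<omega> y (take i vs @ drop (Suc i) vs)) x
     else 0)"

definition eform_interior :: "((nat \<Rightarrow> real) \<Rightarrow> nat \<Rightarrow> real) \<Rightarrow> eform \<Rightarrow> eform" where
  "eform_interior Y \<omega> = (\<lambda>x vs. \<omega> x (Y x # vs))"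

text \<open>The Lie derivative
  \<open>(L\<^sub>Y \<omega>)(v\<^sub>1, \<dots>, v\<^sub>k) = Y (\<omega>(v\<^sub>1, \<dots>, v\<^sub>k)) - (\<Sum>i. \<omega>(v\<^sub>1, \<dots>, [Y, v\<^sub>i], \<dots>, v\<^sub>k))\<close>, evaluated on
  constant vector fields \<open>v\<^sub>i\<close>, for which \<open>[Y, v\<^sub>i]\<close> is minus the derivative of \<open>Y\<close> in the
  direction \<open>v\<^sub>i\<close>.\<close>

definition eform_lie ::
  "nat \<Rightarrow> (nat \<Rightarrow> real) set \<Rightarrow> ((nat \<Rightarrow> real) \<Rightarrow> nat \<Rightarrow> real) \<Rightarrow> eform \<Rightarrow> eform" where
  "eform_lie n U Y \<omega> = (\<lambda>x vs.
     if x \<in> U \<and> set vs \<subseteq> Rn n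
     then dir_deriv n (Y x) (\<lambda>y. \<omega> y vs) x
          + (\<Sum>i<length vs. \<omega> x (vs[i := tangent_map n Y x (vs ! i)]))
     else 0)"


section \<open>Diffeological spaces\<close>

text \<open>A parametrization \<open>\<alpha> : U \<rightarrow> X\<close>, \<open>U\<close> open in \<open>n\<close>-space, is the triple \<open>(n, U, \<alpha>)\<close> with
  \<open>\<alpha>\<close> extensional, and a diffeology is given by its set of plots.\<close>

type_synonym 'x param = "nat \<times> (nat \<Rightarrow> real) set \<times> ((nat \<Rightarrow> real) \<Rightarrow> 'x)"

definition params :: "'x set \<Rightarrow> 'x param set" where
  "params X = {(n, U, \<alpha>). openin (Euclidean_space n) U \<and> \<alpha> \<in> U \<rightarrow>\<^sub>E X}"

definition param_comp :: "('x \<Rightarrow> 'y) \<Rightarrow> 'x param \<Rightarrow> 'y param" where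
  "param_comp f = (\<lambda>(n, U, \<alpha>). (n, U, restrict (f \<circ> \<alpha>) U))"

definition diffeo_smooth :: "'x param set \<Rightarrow> 'y param set \<Rightarrow> ('x \<Rightarrow> 'y) \<Rightarrow> bool" where
  "diffeo_smooth D E f \<longleftrightarrow> param_comp f ` D \<subseteq> E"

definition subset_diffeology :: "'x param set \<Rightarrow> 'x set \<Rightarrow> 'x param set" where
  "subset_diffeology D A = D \<inter> params A"

definition product_diffeology :: "'x param set \<Rightarrow> 'y param set \<Rightarrow> ('x \<times> 'y) param set" where
  "product_diffeology D E =
     {p \<in> params UNIV. param_comp fst p \<in> D \<and> param_comp snd p \<in> E}"

definition quotient_diffeology ::
  "'x param set \<Rightarrow> ('x \<Rightarrow> 'y) \<Rightarrow> 'y set \<Rightarrow> 'y param set" where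
  "quotient_diffeology D p Y = {(n, U, \<gamma>) \<in> params Y.
     (\<exists>y. \<forall>x\<in>U. \<gamma> x = y) \<or>
     (\<forall>x\<in>U. \<exists>V \<alpha>. openin (Euclidean_space n) V \<and> x \<in> V \<and> V \<subseteq> U \<and>
                  (n, V, \<alpha>) \<in> D \<and> (\<forall>z\<in>V. \<gamma> z = p (\<alpha> z)))}"

definition discrete_diffeology :: "'x set \<Rightarrow> 'x param set" where
  "discrete_diffeology X = {(n, U, \<alpha>) \<in> params X.
     \<forall>x\<in>U. \<exists>V. openin (Euclidean_space n) V \<and> x \<in> V \<and> V \<subseteq> U \<and> (\<forall>z\<in>V. \<alpha> z = \<alpha> x)}"

definition subduction ::
  "'x set \<Rightarrow> 'x param set \<Rightarrow> 'y set \<Rightarrow> 'y param set \<Rightarrow> ('x \<Rightarrow> 'y) \<Rightarrow> bool" where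
  "subduction X D Y E p \<longleftrightarrow>
     p ` X = Y \<and> diffeo_smooth D E p \<and> E = quotient_diffeology D p Y"

text \<open>Like \<open>eform\<close>s, diffeological forms are made extensional by the value \<open>0\<close> off the plots.\<close>

type_synonym 'x dform = "'x param \<Rightarrow> eform"

definition dforms :: "'x param set \<Rightarrow> nat \<Rightarrow> 'x dform set" where
  "dforms D k = {\<gamma>.
     (\<forall>p. p \<notin> D \<longrightarrow> \<gamma> p = 0) \<and>
     (\<forall>(n, U, \<alpha>)\<in>D. \<gamma> (n, U, \<alpha>) \<in> eforms n U k \<and>
        (\<forall>m V f. openin (Euclidean_space m) V \<and> smooth_between m V n U f \<longrightarrow>
           \<gamma> (m, V, restrict (\<alpha> \<circ> f) V) = eform_pull m V f (\<gamma> (n, U, \<alpha>))))}"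

definition dform_d :: "'x dform \<Rightarrow> 'x dform" where
  "dform_d \<gamma> = (\<lambda>(n, U, \<alpha>). eform_d n U (\<gamma> (n, U, \<alpha>)))"

definition dform_pull :: "'x param set \<Rightarrow> ('x \<Rightarrow> 'y) \<Rightarrow> 'y dform \<Rightarrow> 'x dform" where
  "dform_pull D f \<gamma> = (\<lambda>p. if p \<in> D then \<gamma> (param_comp f p) else 0)"


section \<open>Smooth manifolds\<close>

type_synonym 'a chart = "'a set \<times> ('a \<Rightarrow> nat \<Rightarrow> real)"

record 'a manifold =
  mtop :: "'a topology"
  mdim :: nat
  atlas :: "'a chart set"

definition smooth_manifold :: "'a manifold \<Rightarrow> bool" where
  "smooth_manifold M \<longleftrightarrow>
     Hausdorff_space (mtop M) \<and>
     topspace (mtop M) = (\<Union>(U, \<phi>)\<in>atlas M. U) \<and>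
     (\<forall>(U, \<phi>)\<in>atlas M. openin (mtop M) U \<and> openin (Euclidean_space (mdim M)) (\<phi> ` U) \<and>
        homeomorphic_map (subtopology (mtop M) U)
          (subtopology (Euclidean_space (mdim M)) (\<phi> ` U)) \<phi>) \<and>
     (\<forall>(U, \<phi>)\<in>atlas M. \<forall>(V, \<psi>)\<in>atlas M.
        smooth_between (mdim M) (\<phi> ` (U \<inter> V)) (mdim M) (\<psi> ` (U \<inter> V)) (\<psi> \<circ> inv_into U \<phi>))"

definition smooth_map :: "'a manifold \<Rightarrow> 'b manifold \<Rightarrow> ('a \<Rightarrow> 'b) \<Rightarrow> bool" where
  "smooth_map M N f \<longleftrightarrow>
     continuous_map (mtop M) (mtop N) f \<and>
     (\<forall>(U, \<phi>)\<in>atlas M. \<forall>(V, \<psi>)\<in>atlas N.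
        smooth_between (mdim M) (\<phi> ` (U \<inter> f -` V)) (mdim N) (\<psi> ` V) (\<psi> \<circ> f \<circ> inv_into U \<phi>))"

definition prod_manifold :: "'a manifold \<Rightarrow> 'b manifold \<Rightarrow> ('a \<times> 'b) manifold" where
  "prod_manifold M N =
     \<lparr>mtop = prod_topology (mtop M) (mtop N),
      mdim = mdim M + mdim N,
      atlas = {(U \<times> V, \<lambda>(x, y) i. if i < mdim M then \<phi> x i else \<psi> y (i - mdim M)) |U \<phi> V \<psi>.
                 (U, \<phi>) \<in> atlas M \<and> (V, \<psi>) \<in> atlas N}\<rparr>"

definition eucl_manifold :: "nat \<Rightarrow> (nat \<Rightarrow> real) set \<Rightarrow> (nat \<Rightarrow> real) manifold" where
  "eucl_manifold n U =
     \<lparr>mtop = subtopology (Euclidean_space n) U, mdim = n, atlas = {(U, \<lambda>x. x)}\<rparr>"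

definition manifold_diffeology :: "'a manifold \<Rightarrow> 'a param set" where
  "manifold_diffeology M =
     {(n, U, \<alpha>) \<in> params (topspace (mtop M)). smooth_map (eucl_manifold n U) M \<alpha>}"

text \<open>A differential form on \<open>M\<close> is a form for the manifold diffeology. Its expression in a chart is
  its value on the plot inverse to the chart.\<close>

definition chart_plot :: "'a manifold \<Rightarrow> 'a chart \<Rightarrow> 'a param" where
  "chart_plot M = (\<lambda>(U, \<phi>). (mdim M, \<phi> ` U, restrict (inv_into U \<phi>) (\<phi> ` U)))"

text \<open>A vector field is given by its components in all charts of the atlas, which transform by the
  differentials of the coordinate changes.\<close>

type_synonym 'a vfield = "'a chart \<Rightarrow> (nat \<Rightarrow> real) \<Rightarrow> nat \<Rightarrow> real"

definition vector_field :: "'a manifold \<Rightarrow> 'a vfield \<Rightarrow> bool" where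
  "vector_field M Y \<longleftrightarrow>
     (\<forall>(U, \<phi>)\<in>atlas M. smooth_between (mdim M) (\<phi> ` U) (mdim M) (Rn (mdim M)) (Y (U, \<phi>))) \<and>
     (\<forall>(U, \<phi>)\<in>atlas M. \<forall>(V, \<psi>)\<in>atlas M. \<forall>p\<in>U \<inter> V.
        Y (V, \<psi>) (\<psi> p) = tangent_map (mdim M) (\<psi> \<circ> inv_into U \<phi>) (\<phi> p) (Y (U, \<phi>) (\<phi> p)))"


section \<open>Lie groups and their actions\<close>

definition lie_group :: "('h, 'b) monoid_scheme \<Rightarrow> 'h manifold \<Rightarrow> bool" where
  "lie_group H HM \<longleftrightarrow>
     group H \<and> smooth_manifold HM \<and> topspace (mtop HM) = carrier H \<and>
     smooth_map (prod_manifold HM HM) HM (\<lambda>(g, h). g \<otimes>\<^bsub>H\<^esub> h) \<and>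
     smooth_map HM HM (\<lambda>h. inv\<^bsub>H\<^esub> h)"

definition identity_component :: "('h, 'b) monoid_scheme \<Rightarrow> 'h manifold \<Rightarrow> 'h set" where
  "identity_component H HM = connected_component_of_set (mtop HM) \<one>\<^bsub>H\<^esub>"

definition smooth_right_action ::
  "'a manifold \<Rightarrow> ('h, 'b) monoid_scheme \<Rightarrow> 'h manifold \<Rightarrow> ('a \<Rightarrow> 'h \<Rightarrow> 'a) \<Rightarrow> bool" where
  "smooth_right_action M H HM act \<longleftrightarrow>
     smooth_map (prod_manifold M HM) M (\<lambda>(x, h). act x h) \<and>
     (\<forall>x\<in>topspace (mtop M). act x \<one>\<^bsub>H\<^esub> = x) \<and>
     (\<forall>x\<in>topspace (mtop M). \<forall>g\<in>carrier H. \<forall>h\<in>carrier H. act (act x g) h = act x (g \<otimes>\<^bsub>H\<^esub> h))"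

definition locally_free ::
  "'a manifold \<Rightarrow> ('h, 'b) monoid_scheme \<Rightarrow> 'h manifold \<Rightarrow> ('a \<Rightarrow> 'h \<Rightarrow> 'a) \<Rightarrow> bool" where
  "locally_free M H HM act \<longleftrightarrow>
     (\<forall>x\<in>topspace (mtop M). let S = {h \<in> carrier H. act x h = x} in
        subtopology (mtop HM) S = discrete_topology S)"

definition orbit_rel :: "'x set \<Rightarrow> 'g set \<Rightarrow> ('x \<Rightarrow> 'g \<Rightarrow> 'x) \<Rightarrow> ('x \<times> 'x) set" where
  "orbit_rel X G act = {(x, y). x \<in> X \<and> y \<in> X \<and> (\<exists>g\<in>G. y = act x g)}"

definition orbit_proj :: "'x set \<Rightarrow> 'g set \<Rightarrow> ('x \<Rightarrow> 'g \<Rightarrow> 'x) \<Rightarrow> 'x \<Rightarrow> 'x set" where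
  "orbit_proj X G act x = orbit_rel X G act `` {x}"

definition orbit_space :: "'x set \<Rightarrow> 'g set \<Rightarrow> ('x \<Rightarrow> 'g \<Rightarrow> 'x) \<Rightarrow> 'x set set" where
  "orbit_space X G act = X // orbit_rel X G act"

definition orbit_diffeology ::
  "'a manifold \<Rightarrow> 'g set \<Rightarrow> ('a \<Rightarrow> 'g \<Rightarrow> 'a) \<Rightarrow> 'a set param set" where
  "orbit_diffeology M G act =
     quotient_diffeology (manifold_diffeology M)
       (orbit_proj (topspace (mtop M)) G act) (orbit_space (topspace (mtop M)) G act)"

text \<open>The action of \<open>H/H\<^sub>0\<close> on \<open>M/H\<^sub>0\<close>: since \<open>H\<^sub>0\<close> is normal, the set of all products of members of
  the class of \<open>m\<close> and of the coset of \<open>h\<close> is the class of \<open>m \<cdot> h\<close>.\<close>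

definition coset_act :: "('x \<Rightarrow> 'g \<Rightarrow> 'x) \<Rightarrow> 'x set \<Rightarrow> 'g set \<Rightarrow> 'x set" where
  "coset_act act A k = {act m h |m h. m \<in> A \<and> h \<in> k}"

text \<open>The pairs with the same image in \<open>X/G\<close>.\<close>

definition orbit_fibre_product :: "'x set \<Rightarrow> 'g set \<Rightarrow> ('x \<Rightarrow> 'g \<Rightarrow> 'x) \<Rightarrow> ('x \<times> 'x) set" where
  "orbit_fibre_product X G act =
     {(x, y). x \<in> X \<and> y \<in> X \<and> orbit_proj X G act x = orbit_proj X G act y}"

definition shear_is_subduction ::
  "'a manifold \<Rightarrow> ('h, 'b) monoid_scheme \<Rightarrow> 'h manifold \<Rightarrow> ('a \<Rightarrow> 'h \<Rightarrow> 'a) \<Rightarrow> bool" where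
  "shear_is_subduction M H HM act \<longleftrightarrow>
     (let H\<^sub>0 = identity_component H HM;
          X = orbit_space (topspace (mtop M)) H\<^sub>0 act;
          DX = orbit_diffeology M H\<^sub>0 act;
          K = carrier (H Mod H\<^sub>0);
          P = orbit_fibre_product X K (coset_act act)
      in subduction (X \<times> K) (product_diffeology DX (discrete_diffeology K))
           P (subset_diffeology (product_diffeology DX DX) P)
           (\<lambda>(x, k). (x, coset_act act x k)))"


section \<open>Basic forms for the orbit foliation\<close>

text \<open>The tangent space at \<open>p\<close> of the leaf \<open>p \<cdot> H\<^sub>0\<close>, in the coordinates of a chart at \<open>p\<close>: the image of
  the differential at the identity of the orbit map of \<open>p\<close>. As \<open>H\<^sub>0\<close> is open in \<open>H\<close>, the orbit
  maps of \<open>H\<close> and of \<open>H\<^sub>0\<close> have the same differential there.\<close>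

definition leaf_tangent_space ::
  "('h, 'b) monoid_scheme \<Rightarrow> 'h manifold \<Rightarrow> ('a \<Rightarrow> 'h \<Rightarrow> 'a) \<Rightarrow> 'a chart \<Rightarrow> 'a \<Rightarrow> (nat \<Rightarrow> real) set" where
  "leaf_tangent_space H HM act = (\<lambda>(U, \<phi>) p.
     {tangent_map (mdim HM) (\<phi> \<circ> act p \<circ> inv_into W \<psi>) (\<psi> \<one>\<^bsub>H\<^esub>) v |W \<psi> v.
        (W, \<psi>) \<in> atlas HM \<and> \<one>\<^bsub>H\<^esub> \<in> W \<and> v \<in> Rn (mdim HM)})"

definition tangent_to_leaves ::
  "'a manifold \<Rightarrow> ('h, 'b) monoid_scheme \<Rightarrow> 'h manifold \<Rightarrow> ('a \<Rightarrow> 'h \<Rightarrow> 'a) \<Rightarrow> 'a vfield \<Rightarrow> bool" where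
  "tangent_to_leaves M H HM act Y \<longleftrightarrow>
     (\<forall>(U, \<phi>)\<in>atlas M. \<forall>p\<in>U. Y (U, \<phi>) (\<phi> p) \<in> leaf_tangent_space H HM act (U, \<phi>) p)"

definition basic_forms ::
  "'a manifold \<Rightarrow> ('h, 'b) monoid_scheme \<Rightarrow> 'h manifold \<Rightarrow> ('a \<Rightarrow> 'h \<Rightarrow> 'a) \<Rightarrow> nat \<Rightarrow> 'a dform set" where
  "basic_forms M H HM act k = {\<omega> \<in> dforms (manifold_diffeology M) k.
     \<forall>Y. vector_field M Y \<and> tangent_to_leaves M H HM act Y \<longrightarrow>
       (\<forall>(U, \<phi>)\<in>atlas M.
          eform_interior (Y (U, \<phi>)) (\<omega> (chart_plot M (U, \<phi>))) = 0 \<and>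
          eform_lie (mdim M) (\<phi> ` U) (Y (U, \<phi>)) (\<omega> (chart_plot M (U, \<phi>))) = 0)}"

definition invariant_basic_forms ::
  "'a manifold \<Rightarrow> ('h, 'b) monoid_scheme \<Rightarrow> 'h manifold \<Rightarrow> ('a \<Rightarrow> 'h \<Rightarrow> 'a) \<Rightarrow> nat \<Rightarrow> 'a dform set" where
  "invariant_basic_forms M H HM act k = {\<omega> \<in> basic_forms M H HM act k.
     \<forall>h\<in>carrier H. dform_pull (manifold_diffeology M) (\<lambda>x. act x h) \<omega> = \<omega>}"

end

theory Submission
  imports Defs
begin

text \<open>
  Two lifts \<open>\<beta>, \<beta>'\<close> to \<open>M\<close> of a plot of \<open>M/H\<close> differ by some function \<open>\<beta>' = \<beta> \<cdot> h\<close> that need not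
  even be continuous, and a form \<open>\<omega>\<close> descends to \<open>M/H\<close> exactly if \<open>\<beta>\<^sup>*\<omega> = \<beta>'\<^sup>*\<omega>\<close> for all such pairs.
  If \<open>h\<close> takes values in a countable union of charts, then Baire's theorem yields a dense set of
  points \<open>x\<close> such that near \<open>x\<close> one may choose \<open>h\<close> close to \<open>h(x)\<close>. As the action is locally free, the
  orbit maps are immersions, so the difference quotients of \<open>h\<close> at \<open>x\<close> are bounded, and hence the
  derivatives of \<open>\<beta>'\<close> and of \<open>\<beta> \<cdot> h(x)\<close> at \<open>x\<close> differ by vectors tangent to the leaf only. Invariance
  and basicness give \<open>\<beta>\<^sup>*\<omega> = \<beta>'\<^sup>*\<omega>\<close> at \<open>x\<close>, and everywhere by continuity. Hypothesis (a) covers \<open>H\<close> by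
  countably many charts; hypothesis (b) allows, locally and after a translation, to choose \<open>h\<close> in
  the identity component, which is contained in a \<open>\<sigma>\<close>-compact subgroup.
\<close>

section \<open>Calculus in coordinates\<close>

text \<open>Some countability is unavoidable. If the real numbers with the discrete topology act on
  the line by translations, then \<open>M/H\<close> is a point, although \<open>dx\<close> is basic
  and invariant. For \<open>\<beta>\<close> constant and \<open>\<beta>'\<close> the identity, the
  sets on which \<open>h\<close> stays in a given compact set are then finite, and Baire's theorem
  has nothing to work with. Compact pieces \<open>K\<close> of \<open>H\<close> are used because the
  points \<open>y\<close> with \<open>\<beta>' y\<close> in \<open>\<beta> y \<cdot> K\<close> form
  a closed set, and a closed set has nowhere dense boundary. Since \<open>h\<close> cannot be
  differentiated, derivatives are compared through bounded difference quotients and a compactness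
  argument in the coordinates of \<open>H\<close>. That orbit maps are immersions is usually read
  off the exponential map; here powers of elements close to the identity, controlled in a chart,
  take its place. Basicness is a condition on all vector fields tangent to the leaves. By Cartan's
  formula it is traded for a condition at single points: both \<open>\<omega>\<close> and
  \<open>d\<omega>\<close> annihilate the leaf vectors. This is the form in which it is verified for
  pullbacks and used for descent.\<close>

lemma Euclidean_space_eq: "Euclidean_space n = top_of_set (Rn n)"
  unfolding Euclidean_space_def by (simp add: euclidean_product_topology)

lemma openin_E: "openin (Euclidean_space n) U \<longleftrightarrow> openin (top_of_set (Rn n)) U"
  by (metis Euclidean_space_eq)

lemma Rn_iff: "x \<in> Rn n \<longleftrightarrow> (\<forall>i\<ge>n. x i = 0)"
  by (simp add: topspace_Euclidean_space)

lemma RnD: "x \<in> Rn n \<Longrightarrow> n \<le> i \<Longrightarrow> x i = 0"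
  by (simp add: Rn_iff)

lemma Rn_ext: "x \<in> Rn n \<Longrightarrow> y \<in> Rn n \<Longrightarrow> (\<And>i. i < n \<Longrightarrow> x i = y i) \<Longrightarrow> x = y"
  by (metis Rn_iff ext not_le_imp_less)

lemma Rn_upd [simp]: "x \<in> Rn n \<Longrightarrow> i < n \<Longrightarrow> x(i := t) \<in> Rn n"
  by (simp add: Rn_iff)

lemma scaleR_fun_apply [simp]: "(r *\<^sub>R f) x = r *\<^sub>R f x"
  by (simp add: scaleR_fun_def)

lemma Rn_zero [simp]: "0 \<in> Rn n" "(\<lambda>i. 0) \<in> Rn n"
  by (auto simp: Rn_iff)

lemma Rn_add [simp]: "x \<in> Rn n \<Longrightarrow> y \<in> Rn n \<Longrightarrow> x + y \<in> Rn n"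
  by (simp add: Rn_iff)

lemma Rn_scaleR [simp]: "x \<in> Rn n \<Longrightarrow> r *\<^sub>R x \<in> Rn n"
  by (simp add: Rn_iff)

lemma Rn_diff [simp]: "x \<in> Rn n \<Longrightarrow> y \<in> Rn n \<Longrightarrow> x - y \<in> Rn n"
  by (simp add: Rn_iff)

section \<open>Boxes as a neighbourhood base of \<open>n\<close>-space\<close>

definition ebox :: "nat \<Rightarrow> (nat \<Rightarrow> real) \<Rightarrow> real \<Rightarrow> (nat \<Rightarrow> real) set" where
  "ebox n x e = {y \<in> Rn n. \<forall>i<n. \<bar>y i - x i\<bar> < e}"

lemma ebox_refl: "x \<in> Rn n \<Longrightarrow> 0 < e \<Longrightarrow> x \<in> ebox n x e"
  by (simp add: ebox_def)

lemma ebox_mono: "d \<le> e \<Longrightarrow> ebox n x d \<subseteq> ebox n x e"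
  by (auto simp: ebox_def)

lemma ebox_subset_Rn: "ebox n x e \<subseteq> Rn n"
  by (auto simp: ebox_def)

lemma openin_ebox: "openin (Euclidean_space n) (ebox n x e)"
proof -
  have "ebox n x e = Rn n \<inter> (\<Inter>i\<in>{..<n}. {y. \<bar>y i - x i\<bar> < e})"
    by (auto simp: ebox_def)
  moreover have "open (\<Inter>i\<in>{..<n}. {y::nat\<Rightarrow>real. \<bar>y i - x i\<bar> < e})"
    by (intro open_INT ballI open_Collect_less continuous_intros) auto
  ultimately show ?thesis
    by (simp add: openin_E openin_open_Int)
qed

text \<open>Coordinates of index \<open>n\<close> and above vanish at all points of
  \<open>Rn n\<close>, so a basic open set of the product topology is governed there by its first
  \<open>n\<close> factors, and a positive minimum over finitely many radii exists.\<close>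

lemma openin_ebox_iff:
  "openin (Euclidean_space n) U \<longleftrightarrow> U \<subseteq> Rn n \<and> (\<forall>x\<in>U. \<exists>e>0. ebox n x e \<subseteq> U)"
proof safe
  fix x assume U: "openin (Euclidean_space n) U"
  { assume "x \<in> U" then show "x \<in> Rn n" using U openin_subset by blast }
  assume x: "x \<in> U"
  obtain T where T: "open T" "U = Rn n \<inter> T"
    using U unfolding openin_E by (metis openin_open)
  then obtain X where X: "x \<in> Pi\<^sub>E UNIV X" "\<And>i. open (X i)" "finite {i. X i \<noteq> UNIV}" "Pi\<^sub>E UNIV X \<subseteq> T"
    using product_topology_open_contains_basis[of "\<lambda>_. euclidean" UNIV T x] x
    unfolding open_fun_def by auto
  have "\<exists>e>0. \<forall>t. \<bar>t - x i\<bar> < e \<longrightarrow> t \<in> X i" for i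
    using X(1) X(2)[of i] by (auto simp: open_dist dist_real_def PiE_iff)
  then obtain e where e: "\<And>i. e i > 0" "\<And>i t. \<bar>t - x i\<bar> < e i \<Longrightarrow> t \<in> X i" by metis
  \<comment> \<open>The inserted 1 keeps \<open>Min\<close> meaningful when
    \<open>n = 0\<close>.\<close>
  define d where "d = Min (insert 1 (e ` {..<n}))"
  have "d > 0" using e by (auto simp: d_def)
  moreover have "ebox n x d \<subseteq> U"
  proof
    fix y assume y: "y \<in> ebox n x d"
    have "y i \<in> X i" for i
    proof (cases "i < n")
      case True
      then have "d \<le> e i" by (auto simp: d_def)
      then show ?thesis using y True e(2)[of "y i" i] by (force simp: ebox_def)
    next
      case False
      then have "y i = x i" using y x T by (auto simp: ebox_def Rn_iff)
      then show ?thesis using X(1) by (auto simp: PiE_iff)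
    qed
    then show "y \<in> U" using X(4) T(2) y by (auto simp: ebox_def PiE_iff)
  qed
  ultimately show "\<exists>e>0. ebox n x e \<subseteq> U" by blast
next
  assume U: "U \<subseteq> Rn n" and e: "\<forall>x\<in>U. \<exists>e>0. ebox n x e \<subseteq> U"
  have "\<exists>T. openin (Euclidean_space n) T \<and> x \<in> T \<and> T \<subseteq> U" if "x \<in> U" for x
    using e that openin_ebox ebox_refl U by (metis subsetD)
  then show "openin (Euclidean_space n) U"
    by (meson openin_subopen)
qed

lemma openin_E_subset: "openin (Euclidean_space n) U \<Longrightarrow> U \<subseteq> Rn n"
  by (rule openin_subset)

lemma openin_top_of_set_E:
  assumes "openin (Euclidean_space n) U"
  shows "openin (top_of_set U) W \<longleftrightarrow> openin (Euclidean_space n) W \<and> W \<subseteq> U"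
proof -
  have "top_of_set U = subtopology (Euclidean_space n) U"
    using openin_E_subset[OF assms]
    by (metis Euclidean_space_eq subtopology_subtopology inf.absorb_iff2)
  then show ?thesis using assms by (simp add: openin_open_subtopology)
qed

lemma subtopology_E:
  assumes "U \<subseteq> Rn n" shows "subtopology (Euclidean_space n) U = top_of_set U"
  using assms by (metis Euclidean_space_eq subtopology_subtopology inf.absorb_iff2)

lemma continuous_on_E_preimage:
  assumes "openin (Euclidean_space n) U" and "continuous_on U f" and "open B"
  shows "openin (Euclidean_space n) {x\<in>U. f x \<in> B}"
proof -
  have "openin (top_of_set U) (U \<inter> f -` B)"
    using assms(2,3) by (simp add: continuous_openin_preimage_gen)
  then show ?thesis using assms(1) by (simp add: openin_top_of_set_E Collect_conj_eq vimage_def)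
qed

lemma continuous_on_E_D:
  fixes f :: "(nat \<Rightarrow> real) \<Rightarrow> real"
  assumes "openin (Euclidean_space n) U" "continuous_on U f" "x \<in> U" "e > 0"
  obtains d where "d > 0" "ebox n x d \<subseteq> U" "\<And>y. y \<in> ebox n x d \<Longrightarrow> \<bar>f y - f x\<bar> < e"
proof -
  have "openin (Euclidean_space n) {y\<in>U. f y \<in> ball (f x) e}"
    by (rule continuous_on_E_preimage) (use assms in auto)
  moreover have "x \<in> {y\<in>U. f y \<in> ball (f x) e}" using assms by auto
  ultimately obtain d where "d > 0" "ebox n x d \<subseteq> {y\<in>U. f y \<in> ball (f x) e}"
    by (metis (no_types, lifting) openin_ebox_iff)
  then show thesis by (intro that[of d]) (auto simp: dist_real_def abs_minus_commute subset_iff)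
qed

lemma continuous_on_E_local:
  fixes f :: "(nat \<Rightarrow> real) \<Rightarrow> 'b::topological_space"
  assumes "openin (Euclidean_space n) U"
    and "\<And>x. x \<in> U \<Longrightarrow> \<exists>V. openin (Euclidean_space n) V \<and> x \<in> V \<and> V \<subseteq> U \<and> continuous_on V f"
  shows "continuous_on U f"
proof -
  have "openin (top_of_set U) (U \<inter> f -` B)" if B: "open B" for B
  proof -
    have "openin (Euclidean_space n) (U \<inter> f -` B)"
    proof (subst openin_subopen, safe)
      fix x assume x: "x \<in> U" "f x \<in> B"
      obtain V where V: "openin (Euclidean_space n) V" "x \<in> V" "V \<subseteq> U" "continuous_on V f"
        using assms(2)[OF x(1)] by blast
      show "\<exists>T. openin (Euclidean_space n) T \<and> x \<in> T \<and> T \<subseteq> U \<inter> f -` B"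
        using continuous_on_E_preimage[OF V(1,4) B] V x by (intro exI[of _ "{x\<in>V. f x \<in> B}"]) auto
    qed
    then show ?thesis using openin_top_of_set_E[OF assms(1)] by simp
  qed
  then show ?thesis by (simp add: continuous_on_open_gen continuous_openin_preimage_eq)
qed

section \<open>Partial derivatives, functions of class C^r and smooth functions\<close>

lemma partial_cong:
  assumes "openin (Euclidean_space n) U" "x \<in> U" "i < n" "\<And>y. y \<in> U \<Longrightarrow> f y = g y"
  shows "partial i f x = partial i g x" "has_partial i f x \<longleftrightarrow> has_partial i g x"
proof -
  obtain e where e: "e > 0" "ebox n x e \<subseteq> U"
    using assms(1,2) openin_ebox_iff by blast
  have x: "x \<in> Rn n" using assms(1,2) openin_E_subset by blast
  \<comment> \<open>Here \<open>i < n\<close> enters: changing a coordinate of index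
    \<open>n\<close> or more would leave \<open>Rn n\<close>, and with it every open subset.\<close>
  have "x(i := t) \<in> U" if "t \<in> ball (x i) e" for t
    using that e x assms(3) by (intro subsetD[OF e(2)]) (auto simp: ebox_def dist_real_def)
  then have eq: "\<And>t. t \<in> ball (x i) e \<Longrightarrow> f (x(i := t)) = g (x(i := t))"
    using assms(4) by blast
  have ev: "\<forall>\<^sub>F t in nhds (x i). f (x(i := t)) = g (x(i := t))"
    using eq e(1) by (intro eventually_nhds_in_open[of "ball (x i) e", THEN eventually_mono]) auto
  show "partial i f x = partial i g x"
    unfolding partial_def by (rule deriv_cong_ev[OF ev]) simp
  show "has_partial i f x \<longleftrightarrow> has_partial i g x"
    unfolding has_partial_def real_differentiable_def using DERIV_cong_ev[OF refl ev] by auto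
qed

lemma has_partialD: "has_partial i f x \<Longrightarrow> ((\<lambda>t. f (x(i := t))) has_real_derivative partial i f x) (at (x i))"
  unfolding has_partial_def partial_def by (simp add: DERIV_deriv_iff_real_differentiable)

lemma has_partialI:
  assumes "((\<lambda>t. f (x(i := t))) has_real_derivative D) (at (x i))"
  shows "has_partial i f x" "partial i f x = D"
  using assms unfolding has_partial_def partial_def
  by (auto simp: real_differentiable_def DERIV_imp_deriv)

lemma Ck_mono: "Ck (Suc r) n U f \<Longrightarrow> Ck r n U f"
  by (induction r arbitrary: f) auto

lemma Ck_continuous: "Ck r n U f \<Longrightarrow> continuous_on U f"
  by (cases r) auto

lemma Ck_cong:
  assumes U: "openin (Euclidean_space n) U" and "\<And>y. y \<in> U \<Longrightarrow> f y = g y" and "Ck r n U f"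
  shows "Ck r n U g"
  using assms(2,3)
proof (induction r arbitrary: f g)
  case 0 then show ?case by (simp cong: continuous_on_cong)
next
  case (Suc r)
  have "continuous_on U g" using Suc.prems by (simp cong: continuous_on_cong)
  moreover have "has_partial i g x" if "i < n" "x \<in> U" for i x
    using Suc.prems partial_cong(2)[OF U that(2,1), of f g] that by auto
  moreover have "Ck r n U (partial i g)" if "i < n" for i
    by (rule Suc.IH[of "partial i f"]) (use Suc.prems partial_cong(1)[OF U _ that, of _ f g] that in auto)
  ultimately show ?case by simp
qed

lemma Ck_subset: "Ck r n U f \<Longrightarrow> V \<subseteq> U \<Longrightarrow> Ck r n V f"
  by (induction r arbitrary: f) (auto intro: continuous_on_subset)

lemma Ck_local:
  assumes "openin (Euclidean_space n) U"
    and "\<And>x. x \<in> U \<Longrightarrow> \<exists>V. openin (Euclidean_space n) V \<and> x \<in> V \<and> V \<subseteq> U \<and> Ck r n V f"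
  shows "Ck r n U f"
  using assms(2)
proof (induction r arbitrary: f)
  case 0
  show ?case unfolding Ck.simps(1) by (rule continuous_on_E_local[OF assms(1)]) (use 0 in simp)
next
  case (Suc r)
  obtain V where V: "\<And>x. x \<in> U \<Longrightarrow> openin (Euclidean_space n) (V x) \<and> x \<in> V x \<and> V x \<subseteq> U \<and> Ck (Suc r) n (V x) f"
    using Suc.prems by metis
  have "continuous_on U f"
    by (rule continuous_on_E_local[OF assms(1)], rule_tac x="V x" in exI)
      (use V Ck_continuous[of "Suc r"] in simp)
  moreover have "has_partial i f x" if "i < n" "x \<in> U" for i x
    using V[OF that(2)] that(1) by simp
  moreover have "Ck r n U (partial i f)" if i: "i < n" for i
  proof (rule Suc.IH)
    fix x assume "x \<in> U"
    from V[OF this] i have "Ck r n (V x) (partial i f)" by simp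
    with V[OF \<open>x \<in> U\<close>] show "\<exists>V. openin (Euclidean_space n) V \<and> x \<in> V \<and> V \<subseteq> U \<and> Ck r n V (partial i f)"
      by blast
  qed
  ultimately show ?case by simp
qed

lemma Ck_const: "Ck r n U (\<lambda>x. c)"
proof (induction r arbitrary: c)
  case (Suc r)
  have "has_partial i (\<lambda>x. c) x" "partial i (\<lambda>x. c) = (\<lambda>x. 0)" for i x
    using has_partialI[of "\<lambda>x. c" _ i 0] by auto
  then show ?case using Suc by simp
qed simp

lemma continuous_on_coord: "continuous_on U (\<lambda>x::nat \<Rightarrow> real. x j)"
  by (rule continuous_on_subset[OF continuous_on_product_coordinates]) simp

lemma Ck_proj: "Ck r n U (\<lambda>x. x j)"
proof (cases r)
  case (Suc s)
  have "((\<lambda>t. (x(i := t)) j) has_real_derivative (if i = j then 1 else 0)) (at (x i))" for i and x :: "nat \<Rightarrow> real"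
    by (auto intro!: derivative_eq_intros)
  then have "has_partial i (\<lambda>x. x j) x" "partial i (\<lambda>x. x j) = (\<lambda>x. if i = j then 1 else 0)" for i x
    using has_partialI[of "\<lambda>x. x j" _ i] by (blast, fastforce)
  then show ?thesis using Suc Ck_const continuous_on_coord by simp
qed (simp add: continuous_on_coord)

lemma partial_add:
  assumes "has_partial i f x" "has_partial i g x"
  shows "has_partial i (\<lambda>y. f y + g y) x" "partial i (\<lambda>y. f y + g y) x = partial i f x + partial i g x"
  using has_partialI[OF DERIV_add[OF has_partialD[OF assms(1)] has_partialD[OF assms(2)]]] by auto

lemma partial_mult:
  assumes "has_partial i f x" "has_partial i g x"
  shows "has_partial i (\<lambda>y. f y * g y) x"
    "partial i (\<lambda>y. f y * g y) x = partial i f x * g x + partial i g x * f x"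
  using has_partialI[OF DERIV_mult[OF has_partialD[OF assms(1)] has_partialD[OF assms(2)]]] by auto

lemma Ck_add:
  assumes "openin (Euclidean_space n) U" "Ck r n U f" "Ck r n U g"
  shows "Ck r n U (\<lambda>x. f x + g x)"
  using assms(2,3)
proof (induction r arbitrary: f g)
  case (Suc r)
  have "Ck r n U (partial i (\<lambda>x. f x + g x))" if "i < n" for i
    by (rule Ck_cong[OF assms(1) _ Suc.IH[of "partial i f" "partial i g"]])
      (use Suc.prems that in \<open>auto simp: partial_add\<close>)
  then show ?case using Suc.prems by (auto intro: continuous_intros partial_add)
qed (auto intro: continuous_intros)

lemma Ck_mult:
  assumes "openin (Euclidean_space n) U" "Ck r n U f" "Ck r n U g"
  shows "Ck r n U (\<lambda>x. f x * g x)"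
  using assms(2,3)
proof (induction r arbitrary: f g)
  case (Suc r)
  have "Ck r n U (partial i (\<lambda>x. f x * g x))" if "i < n" for i
    by (rule Ck_cong[OF assms(1) _ Ck_add[OF assms(1) Suc.IH[of "partial i f" g] Suc.IH[of "partial i g" f]]])
      (use Suc.prems that Ck_mono[OF Suc.prems(1)] Ck_mono[OF Suc.prems(2)] in \<open>auto simp: partial_mult\<close>)
  then show ?case using Suc.prems by (auto intro: continuous_intros partial_mult)
qed (auto intro: continuous_intros)

lemma Ck_sum:
  assumes "openin (Euclidean_space n) U" "\<And>j. j \<in> S \<Longrightarrow> Ck r n U (f j)"
  shows "Ck r n U (\<lambda>x. \<Sum>j\<in>S. f j x)"
  using assms(2)
  by (induction S rule: infinite_finite_induct) (simp_all add: Ck_const Ck_add[OF assms(1)])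

lemma smooth_cong:
  "openin (Euclidean_space n) U \<Longrightarrow> (\<And>y. y \<in> U \<Longrightarrow> f y = g y) \<Longrightarrow> smooth_fun n U f \<Longrightarrow> smooth_fun n U g"
  unfolding smooth_fun_def using Ck_cong by blast

lemma smooth_subset: "smooth_fun n U f \<Longrightarrow> V \<subseteq> U \<Longrightarrow> smooth_fun n V f"
  unfolding smooth_fun_def using Ck_subset by blast

lemma smooth_local:
  assumes "openin (Euclidean_space n) U"
    and "\<And>x. x \<in> U \<Longrightarrow> \<exists>V. openin (Euclidean_space n) V \<and> x \<in> V \<and> V \<subseteq> U \<and> smooth_fun n V f"
  shows "smooth_fun n U f"
  using Ck_local[OF assms(1)] assms(2) unfolding smooth_fun_def by meson

lemma smooth_const [simp]: "smooth_fun n U (\<lambda>x. c)"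
  unfolding smooth_fun_def using Ck_const by blast

lemma smooth_proj [simp]: "smooth_fun n U (\<lambda>x. x j)"
  unfolding smooth_fun_def using Ck_proj by blast

lemma smooth_add: "openin (Euclidean_space n) U \<Longrightarrow> smooth_fun n U f \<Longrightarrow> smooth_fun n U g \<Longrightarrow> smooth_fun n U (\<lambda>x. f x + g x)"
  unfolding smooth_fun_def using Ck_add by blast

lemma smooth_mult: "openin (Euclidean_space n) U \<Longrightarrow> smooth_fun n U f \<Longrightarrow> smooth_fun n U g \<Longrightarrow> smooth_fun n U (\<lambda>x. f x * g x)"
  unfolding smooth_fun_def using Ck_mult by blast

lemma smooth_cmult: "openin (Euclidean_space n) U \<Longrightarrow> smooth_fun n U f \<Longrightarrow> smooth_fun n U (\<lambda>x. c * f x)"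
  using smooth_mult[of n U "\<lambda>x. c"] by simp

lemma smooth_minus: "openin (Euclidean_space n) U \<Longrightarrow> smooth_fun n U f \<Longrightarrow> smooth_fun n U (\<lambda>x. - f x)"
  using smooth_cmult[of n U f "-1"] by simp

lemma smooth_diff: "openin (Euclidean_space n) U \<Longrightarrow> smooth_fun n U f \<Longrightarrow> smooth_fun n U g \<Longrightarrow> smooth_fun n U (\<lambda>x. f x - g x)"
  using smooth_add[of n U f "\<lambda>x. - g x"] smooth_minus[of n U g] by simp

lemma smooth_sum:
  "openin (Euclidean_space n) U \<Longrightarrow> (\<And>j. j \<in> S \<Longrightarrow> smooth_fun n U (f j)) \<Longrightarrow> smooth_fun n U (\<lambda>x. \<Sum>j\<in>S. f j x)"
  unfolding smooth_fun_def by (intro allI Ck_sum) simp_all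

lemma smooth_partial: "smooth_fun n U f \<Longrightarrow> i < n \<Longrightarrow> smooth_fun n U (partial i f)"
  unfolding smooth_fun_def
proof
  fix r assume "\<forall>r. Ck r n U f" "i < n"
  then have "Ck (Suc r) n U f" by blast
  with \<open>i < n\<close> show "Ck r n U (partial i f)" by simp
qed

lemma smooth_has_partial:
  assumes "smooth_fun n U f" "i < n" "x \<in> U"
  shows "has_partial i f x"
proof -
  have "Ck (Suc 0) n U f" using assms(1) by (simp only: smooth_fun_def)
  then show ?thesis using assms(2,3) by (simp only: Ck.simps(2) Ball_def)
qed

lemma smooth_continuous:
  assumes "smooth_fun n U f" shows "continuous_on U f"
proof -
  have "Ck 0 n U f" using assms by (simp only: smooth_fun_def)
  then show ?thesis by (simp only: Ck.simps(1))
qed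

lemma smooth_dir_deriv:
  "openin (Euclidean_space n) U \<Longrightarrow> smooth_fun n U f \<Longrightarrow> smooth_fun n U (dir_deriv n v f)"
  unfolding dir_deriv_def[abs_def] by (intro smooth_sum smooth_cmult smooth_partial) auto

section \<open>Strict differentiability and the chain rule\<close>

definition nrm :: "nat \<Rightarrow> (nat \<Rightarrow> real) \<Rightarrow> real" where
  "nrm n v = (\<Sum>i<n. \<bar>v i\<bar>)"

lemma nrm_nonneg [simp]: "0 \<le> nrm n v"
  by (simp add: nrm_def sum_nonneg)

lemma nrm_coord: "i < n \<Longrightarrow> \<bar>v i\<bar> \<le> nrm n v"
  unfolding nrm_def by (rule member_le_sum) auto

lemma nrm_triangle: "nrm n (v + w) \<le> nrm n v + nrm n w"
  unfolding nrm_def sum.distrib[symmetric] by (intro sum_mono) (simp add: abs_triangle_ineq)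

lemma nrm_scaleR: "nrm n (r *\<^sub>R v) = \<bar>r\<bar> * nrm n v"
  by (simp add: nrm_def abs_mult sum_distrib_left)

lemma nrm_minus: "nrm n (v - w) = nrm n (w - v)"
  by (simp add: nrm_def abs_minus_commute)

lemma nrm_triangle_diff: "nrm n (a - c) \<le> nrm n (a - b) + nrm n (b - c)"
  using nrm_triangle[of n "a - b" "b - c"] by simp

lemma ebox_nrm: "y \<in> Rn n \<Longrightarrow> nrm n (y - x) < e \<Longrightarrow> y \<in> ebox n x e"
  unfolding ebox_def using nrm_coord[of _ n "y - x"] by fastforce

text \<open>No order between \<open>a\<close> and \<open>b\<close> is assumed, since the coordinates
  of two points of a box compare either way.\<close>

lemma mvt_real:
  fixes g :: "real \<Rightarrow> real"
  assumes "\<And>t. t \<in> closed_segment a b \<Longrightarrow> (g has_real_derivative g' t) (at t)"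
  obtains z where "z \<in> closed_segment a b" "g b - g a = (b - a) * g' z"
proof -
  consider "a < b" | "b < a" | "a = b" by linarith
  then show thesis
  proof cases
    case 1
    then obtain z where "a < z" "z < b" "g b - g a = (b - a) * g' z"
      using MVT2[of a b g g'] assms by (auto simp: closed_segment_eq_real_ivl)
    then show thesis using that[of z] 1 by (auto simp: closed_segment_eq_real_ivl)
  next
    case 2
    then obtain z where "b < z" "z < a" "g a - g b = (a - b) * g' z"
      using MVT2[of b a g g'] assms by (auto simp: closed_segment_eq_real_ivl)
    moreover from this have "g b - g a = (b - a) * g' z" by (simp add: algebra_simps)
    ultimately show thesis using that[of z] 2 by (auto simp: closed_segment_eq_real_ivl)
  next
    case 3
    then show thesis using that[of a] by simp
  qed
qed

lemma closed_segment_abs: "t \<in> closed_segment a (b::real) \<Longrightarrow> \<bar>a - c\<bar> < d \<Longrightarrow> \<bar>b - c\<bar> < d \<Longrightarrow> \<bar>t - c\<bar> < d"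
  by (auto simp: closed_segment_eq_real_ivl split: if_splits)

text \<open>Changing the coordinates of \<open>x\<close> into those of \<open>y\<close> one at a time stays inside a box.\<close>

lemma strict_diff:
  assumes U: "openin (Euclidean_space n) U" and f: "smooth_fun n U f" and x0: "x0 \<in> U" and e: "e > 0"
  obtains d where "d > 0" "ebox n x0 d \<subseteq> U"
    "\<And>x y. x \<in> ebox n x0 d \<Longrightarrow> y \<in> ebox n x0 d \<Longrightarrow>
       \<bar>f y - f x - dir_deriv n (y - x) f x0\<bar> \<le> e * nrm n (y - x)"
proof -
  have "\<exists>d>0. ebox n x0 d \<subseteq> U \<and> (\<forall>y\<in>ebox n x0 d. \<bar>partial i f y - partial i f x0\<bar> < e)" if "i < n" for i
    using continuous_on_E_D[OF U smooth_continuous[OF smooth_partial[OF f that]] x0 e] by metis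
  then obtain D where D: "\<And>i. i < n \<Longrightarrow> D i > 0"
    "\<And>i y. i < n \<Longrightarrow> y \<in> ebox n x0 (D i) \<Longrightarrow> \<bar>partial i f y - partial i f x0\<bar> < e"
    by metis
  obtain d0 where d0: "d0 > 0" "ebox n x0 d0 \<subseteq> U"
    using U x0 openin_ebox_iff by blast
  define d where "d = Min (insert d0 (D ` {..<n}))"
  have d: "d > 0" using D d0 by (auto simp: d_def)
  have dD: "d \<le> D i" if "i < n" for i using that by (auto simp: d_def)
  have dU: "ebox n x0 d \<subseteq> U"
    using d0(2) ebox_mono[of d d0 n x0] by (auto simp: d_def)
  \<comment> \<open>Both points vary while the derivative stays at \<open>x0\<close>. The later
    estimates, which compare points neither of which is the base point, rely on this
    uniformity.\<close>
  have "\<bar>f y - f x - dir_deriv n (y - x) f x0\<bar> \<le> e * nrm n (y - x)"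
    if x: "x \<in> ebox n x0 d" and y: "y \<in> ebox n x0 d" for x y
  proof -
    define z where "z k = (\<lambda>i. if i < k then y i else x i)" for k
    have xy: "x \<in> Rn n" "y \<in> Rn n" using x y by (auto simp: ebox_def)
    have zn: "z n = y" "z 0 = x"
      using xy by (auto simp: z_def Rn_iff fun_eq_iff)
    have step: "\<bar>f (z (Suc k)) - f (z k) - (y k - x k) * partial k f x0\<bar> \<le> e * \<bar>y k - x k\<bar>" if k: "k < n" for k
    proof -
      have in_box: "(z k)(k := t) \<in> ebox n x0 d" if "t \<in> closed_segment (x k) (y k)" for t
      proof -
        have "\<bar>t - x0 k\<bar> < d"
          by (rule closed_segment_abs[OF that]) (use x y k in \<open>auto simp: ebox_def\<close>)
        then show ?thesis using x y k by (auto simp: ebox_def z_def Rn_iff)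
      qed
      have der: "((\<lambda>t. f ((z k)(k := t))) has_real_derivative partial k f ((z k)(k := t))) (at t)"
        if "t \<in> closed_segment (x k) (y k)" for t
        using has_partialD[OF smooth_has_partial[OF f k], of "(z k)(k := t)"] in_box[OF that] dU by auto
      obtain s where s: "s \<in> closed_segment (x k) (y k)"
        "f ((z k)(k := y k)) - f ((z k)(k := x k)) = (y k - x k) * partial k f ((z k)(k := s))"
        using mvt_real[OF der] by metis
      have eqs: "(z k)(k := y k) = z (Suc k)" "(z k)(k := x k) = z k"
        by (auto simp: z_def fun_eq_iff)
      have "\<bar>partial k f ((z k)(k := s)) - partial k f x0\<bar> < e"
        using D(2)[OF k] in_box[OF s(1)] ebox_mono[OF dD[OF k]] by blast
      then have "\<bar>(y k - x k) * (partial k f ((z k)(k := s)) - partial k f x0)\<bar> \<le> \<bar>y k - x k\<bar> * e"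
        unfolding abs_mult by (intro mult_left_mono) auto
      then show ?thesis using s(2) unfolding eqs by (simp add: algebra_simps)
    qed
    have "(\<Sum>k<n. f (z (Suc k)) - f (z k)) = f y - f x"
      using sum_lessThan_telescope[of "\<lambda>k. f (z k)" n] zn by simp
    then have "f y - f x - dir_deriv n (y - x) f x0 = (\<Sum>k<n. f (z (Suc k)) - f (z k) - (y k - x k) * partial k f x0)"
      unfolding sum_subtractf[where g = "\<lambda>k. (y k - x k) * partial k f x0"] dir_deriv_def
      by simp
    also have "\<bar>\<dots>\<bar> \<le> (\<Sum>k<n. e * \<bar>y k - x k\<bar>)"
      by (rule order_trans[OF sum_abs sum_mono]) (use step in auto)
    also have "\<dots> = e * nrm n (y - x)" by (simp add: nrm_def sum_distrib_left)
    finally show ?thesis .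
  qed
  then show thesis using that d dU by blast
qed

text \<open>Strict differentiability replaces the difference quotient of \<open>f\<close> along
  \<open>c\<close> by a linear combination of the difference quotients \<open>q\<close> of the
  coordinates, with an error that is a small multiple of the sum of the
  \<open>\<bar>q i t\<bar>\<close>. This sum converges and therefore stays bounded.\<close>

lemma chain_curve:
  assumes U: "openin (Euclidean_space n) U" and f: "smooth_fun n U f" and c0: "c t0 \<in> U"
    and ev: "\<forall>\<^sub>F t in nhds t0. c t \<in> Rn n"
    and der: "\<And>i. i < n \<Longrightarrow> ((\<lambda>t. c t i) has_real_derivative c' i) (at t0)"
  shows "((\<lambda>t. f (c t)) has_real_derivative dir_deriv n c' f (c t0)) (at t0)"
proof -
  define q where "q i t = (c t i - c t0 i) / (t - t0)" for i t
  have q: "((\<lambda>t. q i t) \<longlongrightarrow> c' i) (at t0)" if "i < n" for i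
    using der[OF that] unfolding has_field_derivative_iff q_def .
  define S where "S t = (\<Sum>i<n. q i t * partial i f (c t0))" for t
  have S: "(S \<longlongrightarrow> dir_deriv n c' f (c t0)) (at t0)"
    unfolding S_def[abs_def] dir_deriv_def by (intro tendsto_intros q) auto
  have "((\<lambda>t. (f (c t) - f (c t0)) / (t - t0) - S t) \<longlongrightarrow> 0) (at t0)"
  proof (rule tendstoI)
    fix r :: real assume r: "r > 0"
    \<comment> \<open>A strict upper bound for the limit of the sums of
      \<open>\<bar>q i t\<bar>\<close>, hence for these sums when \<open>t\<close> is near
      \<open>t0\<close>; the added 1 also makes it positive.\<close>
    define C where "C = (\<Sum>i<n. \<bar>c' i\<bar>) + 1"
    have C: "C > 0" unfolding C_def by (smt (verit) sum_nonneg abs_ge_zero)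
    have rC: "r / (2*C) > 0" using r C by simp
    obtain d where d: "d > 0" "ebox n (c t0) d \<subseteq> U"
      "\<And>x y. x \<in> ebox n (c t0) d \<Longrightarrow> y \<in> ebox n (c t0) d \<Longrightarrow>
         \<bar>f y - f x - dir_deriv n (y - x) f (c t0)\<bar> \<le> r / (2*C) * nrm n (y - x)"
      using strict_diff[OF U f c0 rC] by metis
    have "((\<lambda>t. \<Sum>i<n. \<bar>q i t\<bar>) \<longlongrightarrow> (\<Sum>i<n. \<bar>c' i\<bar>)) (at t0)"
      by (intro tendsto_intros q) auto
    then have ev1: "\<forall>\<^sub>F t in at t0. (\<Sum>i<n. \<bar>q i t\<bar>) < C"
      by (rule order_tendstoD) (simp add: C_def)
    have "\<forall>\<^sub>F t in at t0. \<bar>c t i - c t0 i\<bar> < d" if "i < n" for i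
    proof -
      have "((\<lambda>t. c t i) \<longlongrightarrow> c t0 i) (at t0)"
        using DERIV_isCont[OF der[OF that]] by (simp add: isCont_def)
      from tendstoD[OF this d(1)] show ?thesis by (simp add: dist_real_def)
    qed
    then have ev2: "\<forall>\<^sub>F t in at t0. \<forall>i\<in>{..<n}. \<bar>c t i - c t0 i\<bar> < d"
      by (intro eventually_ball_finite) auto
    have ev3: "\<forall>\<^sub>F t in at t0. c t \<in> Rn n"
      unfolding eventually_at_filter by (rule eventually_mono[OF ev]) simp
    have ev4: "\<forall>\<^sub>F t in at t0. t \<noteq> t0" by (simp add: eventually_at_filter)
    show "\<forall>\<^sub>F t in at t0. dist ((f (c t) - f (c t0)) / (t - t0) - S t) 0 < r"
      using ev1 ev2 ev3 ev4
    proof eventually_elim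
      case (elim t)
      have inb: "c t \<in> ebox n (c t0) d" "c t0 \<in> ebox n (c t0) d"
        using elim d(1) c0 openin_E_subset[OF U] by (auto simp: ebox_def)
      have "(f (c t) - f (c t0)) / (t - t0) - S t
          = (f (c t) - f (c t0) - dir_deriv n (c t - c t0) f (c t0)) / (t - t0)"
        unfolding S_def q_def dir_deriv_def diff_divide_distrib[of "f (c t) - f (c t0)"] sum_divide_distrib
        by simp
      then have "\<bar>(f (c t) - f (c t0)) / (t - t0) - S t\<bar>
          = \<bar>f (c t) - f (c t0) - dir_deriv n (c t - c t0) f (c t0)\<bar> / \<bar>t - t0\<bar>" by simp
      also have "\<dots> \<le> (r / (2*C) * nrm n (c t - c t0)) / \<bar>t - t0\<bar>"
        by (intro divide_right_mono d(3) inb) auto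
      also have "\<dots> = r / (2*C) * (\<Sum>i<n. \<bar>q i t\<bar>)"
        by (simp add: nrm_def q_def sum_divide_distrib[symmetric])
      also have "\<dots> \<le> r / (2*C) * C" using elim(1) rC by (intro mult_left_mono) auto
      also have "\<dots> < r" using C r by simp
      finally show ?case by (simp add: dist_real_def)
    qed
  qed
  from tendsto_add[OF this S] show ?thesis by (simp add: has_field_derivative_iff)
qed

lemma dir_deriv_cong:
  assumes "openin (Euclidean_space n) U" "x \<in> U" "\<And>y. y \<in> U \<Longrightarrow> f y = g y"
  shows "dir_deriv n v f x = dir_deriv n v g x"
  unfolding dir_deriv_def using partial_cong(1)[OF assms(1,2) _ assms(3)] by (auto intro!: sum.cong)

lemma dir_deriv_const [simp]: "dir_deriv n v (\<lambda>y. c) x = 0"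
proof -
  have "partial i (\<lambda>y. c) x = 0" for i by (rule has_partialI) simp
  then show ?thesis by (simp add: dir_deriv_def)
qed

lemma dir_deriv_proj: "j < n \<Longrightarrow> dir_deriv n v (\<lambda>y. y j) x = v j"
proof -
  assume j: "j < n"
  have "partial i (\<lambda>y. y j) x = (if i = j then 1 else 0)" for i
    by (rule has_partialI) (auto intro!: derivative_eq_intros)
  then have "dir_deriv n v (\<lambda>y. y j) x = (\<Sum>i<n. if i = j then v i else 0)"
    unfolding dir_deriv_def by (intro sum.cong) simp_all
  then show ?thesis using j by simp
qed

lemma dir_deriv_linear:
  "dir_deriv n (a *\<^sub>R v + b *\<^sub>R w) f x = a * dir_deriv n v f x + b * dir_deriv n w f x"
  by (simp add: dir_deriv_def algebra_simps sum.distrib sum_distrib_left)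

lemma dir_deriv_scale: "dir_deriv n (a *\<^sub>R v) f x = a * dir_deriv n v f x"
  by (simp add: dir_deriv_def algebra_simps sum_distrib_left)

lemma dir_deriv_plus: "dir_deriv n (v + w) f x = dir_deriv n v f x + dir_deriv n w f x"
  by (simp add: dir_deriv_def algebra_simps sum.distrib)

lemma dir_deriv_minus: "dir_deriv n (v - w) f x = dir_deriv n v f x - dir_deriv n w f x"
  by (simp add: dir_deriv_def algebra_simps sum_subtractf)

lemma dir_deriv_add:
  assumes "smooth_fun n U f" "smooth_fun n U g" "x \<in> U"
  shows "dir_deriv n v (\<lambda>y. f y + g y) x = dir_deriv n v f x + dir_deriv n v g x"
proof -
  have "partial i (\<lambda>y. f y + g y) x = partial i f x + partial i g x" if "i < n" for i
    by (rule partial_add; rule smooth_has_partial) (use assms that in auto)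
  then show ?thesis by (simp add: dir_deriv_def algebra_simps sum.distrib)
qed

lemma dir_deriv_mult:
  assumes "smooth_fun n U f" "smooth_fun n U g" "x \<in> U"
  shows "dir_deriv n v (\<lambda>y. f y * g y) x = dir_deriv n v f x * g x + f x * dir_deriv n v g x"
proof -
  have "partial i (\<lambda>y. f y * g y) x = partial i f x * g x + partial i g x * f x" if "i < n" for i
    by (rule partial_mult; rule smooth_has_partial) (use assms that in auto)
  then show ?thesis by (simp add: dir_deriv_def algebra_simps sum.distrib sum_distrib_left)
qed

lemma dir_deriv_cmult:
  assumes "smooth_fun n U g" "x \<in> U"
  shows "dir_deriv n v (\<lambda>y. c * g y) x = c * dir_deriv n v g x"
  using dir_deriv_mult[of n U "\<lambda>y. c" g x v] assms by simp

lemma dir_deriv_sum: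
  assumes U: "openin (Euclidean_space n) U" and "\<And>j. j \<in> S \<Longrightarrow> smooth_fun n U (f j)" "x \<in> U"
  shows "dir_deriv n v (\<lambda>y. \<Sum>j\<in>S. f j y) x = (\<Sum>j\<in>S. dir_deriv n v (f j) x)"
  using assms(2)
proof (induction S rule: infinite_finite_induct)
  case (insert a S)
  then show ?case
    using dir_deriv_add[of n U "f a" "\<lambda>y. \<Sum>j\<in>S. f j y" x v] smooth_sum[OF U, of S f] assms(3) by simp
qed auto

lemma partial_comp:
  assumes U: "openin (Euclidean_space n) U" and W: "openin (Euclidean_space m) W"
    and f: "f \<in> U \<rightarrow> W" "\<And>j. j < m \<Longrightarrow> smooth_fun n U (\<lambda>x. f x j)"
    and g: "smooth_fun m W g" and i: "i < n" and x: "x \<in> U"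
  shows "has_partial i (\<lambda>y. g (f y)) x"
    "partial i (\<lambda>y. g (f y)) x = (\<Sum>j<m. partial i (\<lambda>y. f y j) x * partial j g (f x))"
proof -
  have xx: "x(i := x i) = x" by simp
  obtain e where e: "e > 0" "ebox n x e \<subseteq> U" using U x openin_ebox_iff by blast
  have xR: "x \<in> Rn n" using U x openin_E_subset by blast
  have "((\<lambda>t. g (f (x(i := t)))) has_real_derivative
      dir_deriv m (\<lambda>j. partial i (\<lambda>y. f y j) x) g (f (x(i := x i)))) (at (x i))"
  proof (rule chain_curve[OF W g])
    show "f (x(i := x i)) \<in> W" using f(1) x by auto
    have "\<forall>\<^sub>F t in nhds (x i). t \<in> ball (x i) e"
      using e(1) by (intro eventually_nhds_in_open) auto
    then show "\<forall>\<^sub>F t in nhds (x i). f (x(i := t)) \<in> Rn m"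
    proof eventually_elim
      case (elim t)
      then have "x(i := t) \<in> ebox n x e" using xR i by (auto simp: ebox_def dist_real_def abs_minus_commute)
      then show ?case using e(2) f(1) openin_E_subset[OF W] by blast
    qed
    show "((\<lambda>t. f (x(i := t)) j) has_real_derivative partial i (\<lambda>y. f y j) x) (at (x i))" if "j < m" for j
      using has_partialD[OF smooth_has_partial[OF f(2)[OF that] i x]] .
  qed
  from has_partialI[where f = "\<lambda>y. g (f y)" and x = x, OF this[unfolded xx]]
  show "has_partial i (\<lambda>y. g (f y)) x"
    "partial i (\<lambda>y. g (f y)) x = (\<Sum>j<m. partial i (\<lambda>y. f y j) x * partial j g (f x))"
    by (auto simp: dir_deriv_def)
qed

lemma continuous_on_E_comp:
  fixes f :: "(nat \<Rightarrow> real) \<Rightarrow> nat \<Rightarrow> real" and g :: "(nat \<Rightarrow> real) \<Rightarrow> real"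
  assumes W: "W \<subseteq> Rn m" and f: "f \<in> U \<rightarrow> W" "\<And>j. j < m \<Longrightarrow> continuous_on U (\<lambda>x. f x j)"
    and g: "continuous_on W g"
  shows "continuous_on U (\<lambda>x. g (f x))"
proof (rule continuous_on_compose2[OF g])
  have "continuous_on U (\<lambda>x. f x j)" for j
  proof (cases "j < m")
    case False
    then have "f x j = 0" if "x \<in> U" for x using f(1) W that by (auto simp: RnD)
    then show ?thesis by (simp cong: continuous_on_cong)
  qed (rule f(2))
  then show "continuous_on U f" by (rule continuous_on_coordinatewise_then_product)
  show "f ` U \<subseteq> W" using f(1) by auto
qed

text \<open>By the chain rule a partial derivative of \<open>g \<circ> f\<close> is a sum of
  products of a smooth function with some \<open>partial j g\<close> after \<open>f\<close>. The
  induction on the order therefore runs over all smooth \<open>g\<close> at once, with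
  \<open>f\<close> fixed.\<close>

lemma smooth_comp:
  assumes U: "openin (Euclidean_space n) U" and W: "openin (Euclidean_space m) W"
    and f: "f \<in> U \<rightarrow> W" "\<And>j. j < m \<Longrightarrow> smooth_fun n U (\<lambda>x. f x j)"
    and g: "smooth_fun m W g"
  shows "smooth_fun n U (\<lambda>x. g (f x))"
proof -
  have "Ck r n U (\<lambda>x. g (f x))" if "smooth_fun m W g" for r g
    using that
  proof (induction r arbitrary: g)
    case 0
    show ?case unfolding Ck.simps
      by (rule continuous_on_E_comp[OF openin_E_subset[OF W] f(1) smooth_continuous[OF f(2)] smooth_continuous[OF 0]])
  next
    case (Suc r)
    have "continuous_on U (\<lambda>x. g (f x))" using Ck_continuous[OF Suc.IH[OF Suc.prems]] .
    moreover have "\<forall>x\<in>U. has_partial i (\<lambda>x. g (f x)) x" if "i < n" for i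
      using partial_comp(1)[OF U W f Suc.prems that] by blast
    moreover have "Ck r n U (partial i (\<lambda>x. g (f x)))" if i: "i < n" for i
    proof (rule Ck_cong[OF U])
      show "Ck r n U (\<lambda>x. \<Sum>j<m. partial i (\<lambda>y. f y j) x * partial j g (f x))"
      proof (intro Ck_sum[OF U] Ck_mult[OF U])
        fix j assume "j \<in> {..<m}"
        then have j: "j < m" by simp
        show "Ck r n U (partial i (\<lambda>y. f y j))"
          using smooth_partial[OF f(2)[OF j] i] by (simp only: smooth_fun_def)
        show "Ck r n U (\<lambda>x. partial j g (f x))"
          by (rule Suc.IH[OF smooth_partial[OF Suc.prems j]])
      qed
      show "(\<Sum>j<m. partial i (\<lambda>y. f y j) y * partial j g (f y)) = partial i (\<lambda>x. g (f x)) y" if "y \<in> U" for y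
        using partial_comp(2)[OF U W f Suc.prems i that] by simp
    qed
    ultimately show ?case by (simp only: Ck.simps) blast
  qed
  then show ?thesis using g unfolding smooth_fun_def[of n] by blast
qed

lemma dir_deriv_comp:
  assumes U: "openin (Euclidean_space n) U" and W: "openin (Euclidean_space m) W"
    and f: "f \<in> U \<rightarrow> W" "\<And>j. j < m \<Longrightarrow> smooth_fun n U (\<lambda>x. f x j)"
    and g: "smooth_fun m W g" and x: "x \<in> U"
  shows "dir_deriv n v (\<lambda>y. g (f y)) x = dir_deriv m (tangent_map n f x v) g (f x)"
proof -
  have "dir_deriv n v (\<lambda>y. g (f y)) x = (\<Sum>i<n. \<Sum>j<m. v i * (partial i (\<lambda>y. f y j) x * partial j g (f x)))"
    unfolding dir_deriv_def using partial_comp(2)[OF U W f g _ x]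
    by (simp add: sum_distrib_left)
  also have "\<dots> = (\<Sum>j<m. \<Sum>i<n. v i * (partial i (\<lambda>y. f y j) x * partial j g (f x)))"
    by (rule sum.swap)
  also have "\<dots> = dir_deriv m (tangent_map n f x v) g (f x)"
    unfolding dir_deriv_def tangent_map_def by (simp add: sum_distrib_right mult.assoc)
  finally show ?thesis .
qed

text \<open>The mean value theorem in direction \<open>i\<close> is applied to the increment in
  direction \<open>j\<close>, and then in direction \<open>j\<close> to \<open>partial i f\<close>.
  The second difference is symmetric in \<open>i\<close> and \<open>j\<close>, while the right side
  is not; this is the source of \<open>partial_commute\<close>.\<close>

lemma mixed_difference:
  assumes U: "openin (Euclidean_space n) U" and f: "smooth_fun n U f" and ij: "i < n" "j < n" "i \<noteq> j"
    and sub: "ebox n x d \<subseteq> U" and x: "x \<in> Rn n" and s: "0 < s" "s < d"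
  obtains p where "p \<in> ebox n x d"
    "f (x(i := x i + s, j := x j + s)) - f (x(i := x i + s)) - f (x(j := x j + s)) + f x
       = s * s * partial j (partial i f) p"
proof -
  have inb: "x(i := u, j := v) \<in> ebox n x d" if "\<bar>u - x i\<bar> < d" "\<bar>v - x j\<bar> < d" for u v
    using that s x ij by (auto simp: ebox_def)
  define g where "g u = f (x(i := u, j := x j + s)) - f (x(i := u, j := x j))" for u
  define g' where "g' u = partial i f (x(i := u, j := x j + s)) - partial i f (x(i := u, j := x j))" for u
  have der1: "((\<lambda>u. f (x(i := u, j := v))) has_real_derivative partial i f (x(i := u, j := v))) (at u)"
    if "\<bar>u - x i\<bar> < d" "\<bar>v - x j\<bar> < d" for u v
    using has_partialD[OF smooth_has_partial[OF f ij(1)], of "x(i := u, j := v)"] inb[OF that] sub ij(3)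
    by (auto simp: fun_upd_twist)
  have "(g has_real_derivative g' u) (at u)" if "u \<in> closed_segment (x i) (x i + s)" for u
    unfolding g_def[abs_def] g'_def
    by (intro DERIV_diff der1) (use that s in \<open>auto simp: closed_segment_eq_real_ivl\<close>)
  then obtain u where u: "u \<in> closed_segment (x i) (x i + s)" "g (x i + s) - g (x i) = (x i + s - x i) * g' u"
    by (rule mvt_real)
  have u': "\<bar>u - x i\<bar> < d" using u(1) s by (auto simp: closed_segment_eq_real_ivl)
  have "((\<lambda>v. partial i f (x(i := u, j := v))) has_real_derivative partial j (partial i f) (x(i := u, j := v))) (at v)"
    if "v \<in> closed_segment (x j) (x j + s)" for v
  proof -
    have "x(i := u, j := v) \<in> ebox n x d" using inb u' that s by (auto simp: closed_segment_eq_real_ivl)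
    then show ?thesis
      using has_partialD[OF smooth_has_partial[OF smooth_partial[OF f ij(1)] ij(2)], of "x(i := u, j := v)"] sub by auto
  qed
  then obtain v where v: "v \<in> closed_segment (x j) (x j + s)"
    "partial i f (x(i := u, j := x j + s)) - partial i f (x(i := u, j := x j))
       = (x j + s - x j) * partial j (partial i f) (x(i := u, j := v))"
    by (rule mvt_real)
  have eqs: "x(i := x i + s, j := x j) = x(i := x i + s)" "x(i := x i, j := x j + s) = x(j := x j + s)"
    "x(i := x i, j := x j) = x"
    using ij(3) by auto
  show thesis
  proof (rule that)
    show "x(i := u, j := v) \<in> ebox n x d"
      using inb u' v(1) s by (auto simp: closed_segment_eq_real_ivl)
    show "f (x(i := x i + s, j := x j + s)) - f (x(i := x i + s)) - f (x(j := x j + s)) + f x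
       = s * s * partial j (partial i f) (x(i := u, j := v))"
      using u(2) v(2) unfolding g_def g'_def eqs by (simp add: mult.assoc)
  qed
qed

lemma partial_commute:
  assumes U: "openin (Euclidean_space n) U" and f: "smooth_fun n U f" and ij: "i < n" "j < n" and x: "x \<in> U"
  shows "partial i (partial j f) x = partial j (partial i f) x"
proof (cases "i = j")
  case False
  have xR: "x \<in> Rn n" using U x openin_E_subset by blast
  have "\<bar>partial i (partial j f) x - partial j (partial i f) x\<bar> \<le> e" if e: "e > 0" for e
  proof -
    have e2: "e/2 > 0" using e by simp
    obtain d1 where d1: "d1 > 0" "ebox n x d1 \<subseteq> U"
      "\<And>y. y \<in> ebox n x d1 \<Longrightarrow> \<bar>partial i (partial j f) y - partial i (partial j f) x\<bar> < e/2"
      using continuous_on_E_D[OF U smooth_continuous[OF smooth_partial[OF smooth_partial[OF f ij(2)] ij(1)]] x e2] by metis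
    obtain d2 where d2: "d2 > 0" "ebox n x d2 \<subseteq> U"
      "\<And>y. y \<in> ebox n x d2 \<Longrightarrow> \<bar>partial j (partial i f) y - partial j (partial i f) x\<bar> < e/2"
      using continuous_on_E_D[OF U smooth_continuous[OF smooth_partial[OF smooth_partial[OF f ij(1)] ij(2)]] x e2] by metis
    define d where "d = min d1 d2"
    have d: "ebox n x d \<subseteq> ebox n x d1" "ebox n x d \<subseteq> ebox n x d2" "d > 0"
      using d1(1) d2(1) by (auto simp: d_def intro!: ebox_mono)
    have sub: "ebox n x d \<subseteq> U" using d(1) d1(2) by blast
    have s: "0 < d/2" "d/2 < d" using d(3) by auto
    define D where "D = f (x(i := x i + d/2, j := x j + d/2)) - f (x(i := x i + d/2)) - f (x(j := x j + d/2)) + f x"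
    obtain p where p: "p \<in> ebox n x d" "D = d/2 * (d/2) * partial j (partial i f) p"
      using mixed_difference[OF U f ij False sub xR s] unfolding D_def by metis
    have D': "D = f (x(j := x j + d/2, i := x i + d/2)) - f (x(j := x j + d/2)) - f (x(i := x i + d/2)) + f x"
      using False unfolding D_def by (simp add: fun_upd_twist)
    obtain q where q: "q \<in> ebox n x d" "D = d/2 * (d/2) * partial i (partial j f) q"
      using mixed_difference[OF U f ij(2,1) False[symmetric] sub xR s] unfolding D' by metis
    \<comment> \<open>Both applications of \<open>mixed_difference\<close>, with \<open>i\<close>
      and \<open>j\<close> exchanged, evaluate the same second difference \<open>D\<close>.\<close>
    have "d/2 * (d/2) * partial j (partial i f) p = d/2 * (d/2) * partial i (partial j f) q"
      using p(2) q(2) by metis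
    then have "partial j (partial i f) p = partial i (partial j f) q"
      unfolding mult_cancel_left using d(3) by auto
    moreover have "\<bar>partial i (partial j f) q - partial i (partial j f) x\<bar> < e/2" using d1(3) q(1) d(1) by blast
    moreover have "\<bar>partial j (partial i f) p - partial j (partial i f) x\<bar> < e/2" using d2(3) p(1) d(2) by blast
    ultimately show ?thesis by linarith
  qed
  then have "\<bar>partial i (partial j f) x - partial j (partial i f) x\<bar> \<le> 0"
    by (rule field_le_epsilon) simp
  then show ?thesis by simp
qed simp

lemma dir_deriv_commute:
  assumes U: "openin (Euclidean_space n) U" and f: "smooth_fun n U f" and x: "x \<in> U"
  shows "dir_deriv n v (dir_deriv n w f) x = dir_deriv n w (dir_deriv n v f) x"
proof -
  have *: "dir_deriv n v (dir_deriv n w f) x = (\<Sum>j<n. \<Sum>i<n. v i * w j * partial i (partial j f) x)" for v w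
  proof -
    have "dir_deriv n v (dir_deriv n w f) x = (\<Sum>j<n. dir_deriv n v (\<lambda>y. w j * partial j f y) x)"
      unfolding dir_deriv_def[of n w f, abs_def]
      by (rule dir_deriv_sum[OF U _ x]) (intro smooth_cmult[OF U] smooth_partial[OF f], simp)
    also have "\<dots> = (\<Sum>j<n. w j * dir_deriv n v (partial j f) x)"
      by (intro sum.cong refl dir_deriv_cmult[OF smooth_partial[OF f] x]) simp
    finally show ?thesis by (simp add: dir_deriv_def sum_distrib_left algebra_simps)
  qed
  show ?thesis unfolding *
    by (subst sum.swap, intro sum.cong refl) (simp add: partial_commute[OF U f _ _ x] mult.commute)
qed

section \<open>Alternating forms and the exterior derivative\<close>

text \<open>The clause of \<open>eforms\<close> at a single point. Kept separate, it also serves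
  forms whose base point and vector arguments live in spaces of different dimension.\<close>

definition altml :: "nat \<Rightarrow> nat \<Rightarrow> ((nat \<Rightarrow> real) list \<Rightarrow> real) \<Rightarrow> bool" where
  "altml n k A \<longleftrightarrow> (\<forall>vs. length vs = k \<and> set vs \<subseteq> Rn n \<longrightarrow>
     (\<forall>i<k. \<forall>v\<in>Rn n. \<forall>w\<in>Rn n. \<forall>a b.
        A (vs[i := a *\<^sub>R v + b *\<^sub>R w]) = a * A (vs[i := v]) + b * A (vs[i := w])) \<and>
     (\<forall>i<k. \<forall>j<k. i \<noteq> j \<and> vs ! i = vs ! j \<longrightarrow> A vs = 0))"

lemma altml_linear:
  assumes "altml n k A" "length xs + Suc (length ys) = k" "set xs \<subseteq> Rn n" "set ys \<subseteq> Rn n" "v \<in> Rn n" "w \<in> Rn n"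
  shows "A (xs @ (a *\<^sub>R v + b *\<^sub>R w) # ys) = a * A (xs @ v # ys) + b * A (xs @ w # ys)"
proof -
  have "length (xs @ v # ys) = k \<and> set (xs @ v # ys) \<subseteq> Rn n" "length xs < k" using assms by auto
  then have "A ((xs @ v # ys)[length xs := a *\<^sub>R v + b *\<^sub>R w])
      = a * A ((xs @ v # ys)[length xs := v]) + b * A ((xs @ v # ys)[length xs := w])"
    using assms(1,5,6) unfolding altml_def by blast
  then show ?thesis by simp
qed

lemma altml_adjacent:
  assumes "altml n k A" "length xs + Suc (Suc (length ys)) = k" "set xs \<subseteq> Rn n" "set ys \<subseteq> Rn n" "v \<in> Rn n"
  shows "A (xs @ v # v # ys) = 0"
proof -
  have "length (xs @ v # v # ys) = k \<and> set (xs @ v # v # ys) \<subseteq> Rn n" "length xs < k" "Suc (length xs) < k"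
    using assms by auto
  moreover have "(xs @ v # v # ys) ! length xs = (xs @ v # v # ys) ! Suc (length xs)"
    by (simp add: nth_append)
  ultimately show ?thesis using assms(1) unfolding altml_def by (metis n_not_Suc_n)
qed

text \<open>Polarization: expand the vanishing value on \<open>v + w, v + w\<close>. The hypotheses
  are the two list conditions instead of \<open>altml\<close>, because \<open>altmlI\<close> needs
  the sign rule before \<open>altml\<close> is known.\<close>

lemma swap_of_adjacent:
  assumes lin: "\<And>xs ys v w a b. length xs + Suc (length ys) = k \<Longrightarrow> set xs \<subseteq> Rn n \<Longrightarrow> set ys \<subseteq> Rn n \<Longrightarrow>
      v \<in> Rn n \<Longrightarrow> w \<in> Rn n \<Longrightarrow> A (xs @ (a *\<^sub>R v + b *\<^sub>R w) # ys) = a * A (xs @ v # ys) + b * A (xs @ w # ys)"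
    and adj: "\<And>xs ys v. length xs + Suc (Suc (length ys)) = k \<Longrightarrow> set xs \<subseteq> Rn n \<Longrightarrow> set ys \<subseteq> Rn n \<Longrightarrow>
      v \<in> Rn n \<Longrightarrow> A (xs @ v # v # ys) = 0"
    and "length xs + Suc (Suc (length ys)) = k" "set xs \<subseteq> Rn n" "set ys \<subseteq> Rn n" "v \<in> Rn n" "w \<in> Rn n"
  shows "A (xs @ v # w # ys) = - A (xs @ w # v # ys)"
proof -
  have vw: "v + w \<in> Rn n" using assms by simp
  have "0 = A (xs @ (v + w) # (v + w) # ys)" using adj assms vw by metis
  also have "\<dots> = A (xs @ v # (v + w) # ys) + A (xs @ w # (v + w) # ys)"
    using lin[of xs "(v + w) # ys" v w 1 1] assms vw by simp
  also have "A (xs @ v # (v + w) # ys) = A (xs @ v # v # ys) + A (xs @ v # w # ys)"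
    using lin[of "xs @ [v]" ys v w 1 1] assms by simp
  also have "A (xs @ w # (v + w) # ys) = A (xs @ w # v # ys) + A (xs @ w # w # ys)"
    using lin[of "xs @ [w]" ys v w 1 1] assms by simp
  finally show ?thesis using adj[of xs ys v] adj[of xs ys w] assms by simp
qed

text \<open>Equal arguments at a distance are brought together by transpositions of neighbours, so
  adjacent repetitions suffice. The conditions are phrased with \<open>@\<close> and
  \<open>#\<close> to fit inductions over argument lists.\<close>

lemma altmlI:
  assumes lin: "\<And>xs ys v w a b. length xs + Suc (length ys) = k \<Longrightarrow> set xs \<subseteq> Rn n \<Longrightarrow> set ys \<subseteq> Rn n \<Longrightarrow>
      v \<in> Rn n \<Longrightarrow> w \<in> Rn n \<Longrightarrow> A (xs @ (a *\<^sub>R v + b *\<^sub>R w) # ys) = a * A (xs @ v # ys) + b * A (xs @ w # ys)"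
    and adj: "\<And>xs ys v. length xs + Suc (Suc (length ys)) = k \<Longrightarrow> set xs \<subseteq> Rn n \<Longrightarrow> set ys \<subseteq> Rn n \<Longrightarrow>
      v \<in> Rn n \<Longrightarrow> A (xs @ v # v # ys) = 0"
  shows "altml n k A"
proof -
  note swap = swap_of_adjacent[of k n A, OF lin adj]
  have sep: "A (xs @ v # ys @ v # zs) = 0"
    if "length xs + Suc (length ys + Suc (length zs)) = k" "set xs \<subseteq> Rn n" "set ys \<subseteq> Rn n" "set zs \<subseteq> Rn n" "v \<in> Rn n"
    for xs ys zs v
    using that
  proof (induction ys arbitrary: xs)
    case Nil
    then show ?case using adj[of xs zs v] by simp
  next
    case (Cons y ys)
    have "A (xs @ v # y # (ys @ v # zs)) = - A (xs @ y # v # (ys @ v # zs))"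
      by (rule swap) (use Cons.prems in auto)
    also have "A (xs @ y # v # (ys @ v # zs)) = 0"
      using Cons.IH[of "xs @ [y]"] Cons.prems by simp
    finally show ?case by simp
  qed
  have "A vs = 0" if "length vs = k" "set vs \<subseteq> Rn n" "i < j" "j < k" "vs ! i = vs ! j" for vs i j
  proof -
    have 1: "vs = take i vs @ vs ! i # drop (Suc i) vs" using that by (intro id_take_nth_drop) simp
    have 2: "drop (Suc i) vs = take (j - Suc i) (drop (Suc i) vs) @ drop (Suc i) vs ! (j - Suc i) # drop (Suc (j - Suc i)) (drop (Suc i) vs)"
      using that by (intro id_take_nth_drop) simp
    have 3: "drop (Suc i) vs ! (j - Suc i) = vs ! i" using that by simp
    have "A (take i vs @ vs ! i # take (j - Suc i) (drop (Suc i) vs) @ vs ! i # drop (Suc (j - Suc i)) (drop (Suc i) vs)) = 0"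
      by (rule sep) (use that in \<open>auto dest!: in_set_takeD in_set_dropD\<close>)
    then show ?thesis using 1 2 3 by metis
  qed
  then have "A vs = 0" if "length vs = k" "set vs \<subseteq> Rn n" "i < k" "j < k" "i \<noteq> j" "vs ! i = vs ! j" for vs i j
    using that by (metis nat_neq_iff)
  moreover have "A (vs[i := a *\<^sub>R v + b *\<^sub>R w]) = a * A (vs[i := v]) + b * A (vs[i := w])"
    if "length vs = k" "set vs \<subseteq> Rn n" "i < k" "v \<in> Rn n" "w \<in> Rn n" for vs i v w a b
  proof -
    have "A (take i vs @ (a *\<^sub>R v + b *\<^sub>R w) # drop (Suc i) vs)
        = a * A (take i vs @ v # drop (Suc i) vs) + b * A (take i vs @ w # drop (Suc i) vs)"
      by (rule lin) (use that in \<open>auto dest!: in_set_takeD in_set_dropD\<close>)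
    then show ?thesis using that by (simp add: upd_conv_take_nth_drop)
  qed
  ultimately show ?thesis unfolding altml_def by auto
qed

lemma altml_swap:
  assumes "altml n k A" "length xs + Suc (Suc (length ys)) = k" "set xs \<subseteq> Rn n" "set ys \<subseteq> Rn n" "v \<in> Rn n" "w \<in> Rn n"
  shows "A (xs @ v # w # ys) = - A (xs @ w # v # ys)"
  by (rule swap_of_adjacent[of k n A, OF altml_linear[OF assms(1)] altml_adjacent[OF assms(1)]]) (use assms in auto)

lemma altml_front:
  assumes "altml n k A" "length ps + Suc (length xs + length ys) = k" "set ps \<subseteq> Rn n" "set xs \<subseteq> Rn n" "set ys \<subseteq> Rn n" "v \<in> Rn n"
  shows "A (ps @ xs @ v # ys) = (-1) ^ length xs * A (ps @ v # xs @ ys)"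
  using assms(2-)
proof (induction xs arbitrary: ps)
  case (Cons x xs)
  have "A (ps @ (x # xs) @ v # ys) = (-1) ^ length xs * A (ps @ x # v # xs @ ys)"
    using Cons.IH[of "ps @ [x]"] Cons.prems by simp
  also have "A (ps @ x # v # xs @ ys) = - A (ps @ v # x # xs @ ys)"
    by (rule altml_swap[OF assms(1)]) (use Cons.prems in auto)
  finally show ?case by simp
qed simp

text \<open>Product rules replace an argument in place, whereas \<open>ext_deriv\<close> deletes it
  and carries a sign. This converts one kind of sum into the other.\<close>

lemma altml_update_front:
  assumes "altml n k A" "length vs = k" "set vs \<subseteq> Rn n" "v \<in> Rn n" "i < k"
  shows "A (vs[i := v]) = (-1) ^ i * A (v # take i vs @ drop (Suc i) vs)"
proof -
  have "A ([] @ take i vs @ v # drop (Suc i) vs) = (-1) ^ length (take i vs) * A ([] @ v # take i vs @ drop (Suc i) vs)"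
    by (rule altml_front[OF assms(1)]) (use assms in \<open>auto dest!: in_set_takeD in_set_dropD\<close>)
  then show ?thesis using assms by (simp add: upd_conv_take_nth_drop)
qed

definition unit_vec :: "nat \<Rightarrow> nat \<Rightarrow> real" where
  "unit_vec l = (\<lambda>i. if i = l then 1 else 0)"

lemma unit_vec_Rn [simp]: "l < n \<Longrightarrow> unit_vec l \<in> Rn n"
  by (auto simp: unit_vec_def Rn_iff)

lemma altml_Cons:
  assumes "altml n (Suc k) A" "v \<in> Rn n" shows "altml n k (\<lambda>us. A (v # us))"
proof (rule altmlI)
  show "A (v # xs @ (a *\<^sub>R u + b *\<^sub>R w) # ys) = a * A (v # xs @ u # ys) + b * A (v # xs @ w # ys)"
    if "length xs + Suc (length ys) = k" "set xs \<subseteq> Rn n" "set ys \<subseteq> Rn n" "u \<in> Rn n" "w \<in> Rn n" for xs ys u w a b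
    using altml_linear[OF assms(1), of "v # xs" ys u w a b] that assms(2) by simp
  show "A (v # xs @ u # u # ys) = 0"
    if "length xs + Suc (Suc (length ys)) = k" "set xs \<subseteq> Rn n" "set ys \<subseteq> Rn n" "u \<in> Rn n" for xs ys u
    using altml_adjacent[OF assms(1), of "v # xs" ys u] that assms(2) by simp
qed

lemma altml_linear_head:
  assumes "altml n (Suc k) A" "length us = k" "set us \<subseteq> Rn n" "v \<in> Rn n" "w \<in> Rn n"
  shows "A ((a *\<^sub>R v + b *\<^sub>R w) # us) = a * A (v # us) + b * A (w # us)"
  using altml_linear[OF assms(1), of "[]" us v w a b] assms by simp

text \<open>Expansion of the first argument in the standard basis. It reduces questions on varying
  arguments to the coefficient functions, which are smooth by definition.\<close>

lemma altml_expand: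
  assumes A: "altml n (Suc k) A" and us: "length us = k" "set us \<subseteq> Rn n" and v: "v \<in> Rn n"
  shows "A (v # us) = (\<Sum>l<n. v l * A (unit_vec l # us))"
proof -
  \<comment> \<open>Induction on the number of coordinates of \<open>v\<close> that are
    kept.\<close>
  have "A ((\<lambda>i. if i < m then v i else 0) # us) = (\<Sum>l<m. v l * A (unit_vec l # us))" if "m \<le> n" for m
    using that
  proof (induction m)
    case 0
    have "A (0 # us) = 0" using altml_linear_head[OF A us, of 0 0 0 0] by simp
    moreover have "(\<lambda>i. if i < 0 then v i else 0) = 0" by (simp add: fun_eq_iff)
    ultimately show ?case by simp
  next
    case (Suc m)
    have "(\<lambda>i. if i < Suc m then v i else 0) = 1 *\<^sub>R (\<lambda>i. if i < m then v i else 0) + v m *\<^sub>R unit_vec m"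
      by (auto simp: fun_eq_iff unit_vec_def less_Suc_eq)
    moreover have "(\<lambda>i. if i < m then v i else 0) \<in> Rn n" using Suc.prems by (auto simp: Rn_iff)
    ultimately show ?case using Suc altml_linear_head[OF A us, of "\<lambda>i. if i < m then v i else 0" "unit_vec m" 1 "v m"]
      by simp
  qed
  moreover have "(\<lambda>i. if i < n then v i else 0) = v" using v by (auto simp: fun_eq_iff Rn_iff)
  ultimately show ?thesis by (metis order_refl)
qed

text \<open>For forms along a map, the dimension \<open>n\<close> of the domain differs from the dimension \<open>m\<close> of the space of
  the vector arguments.\<close>

definition sform :: "nat \<Rightarrow> (nat \<Rightarrow> real) set \<Rightarrow> nat \<Rightarrow> nat \<Rightarrow> eform \<Rightarrow> bool" where
  "sform n U m k \<Omega> \<longleftrightarrow> (\<forall>x\<in>U. altml m k (\<Omega> x)) \<and>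
     (\<forall>us. length us = k \<and> set us \<subseteq> Rn m \<longrightarrow> smooth_fun n U (\<lambda>x. \<Omega> x us))"

text \<open>All coordinates are required to be smooth; those of index \<open>m\<close> and above
  vanish on \<open>U\<close> anyway (\<open>smooth_all_coords\<close>), and side conditions on
  \<open>j\<close> disappear.\<close>

definition smooth_field :: "nat \<Rightarrow> (nat \<Rightarrow> real) set \<Rightarrow> nat \<Rightarrow> ((nat \<Rightarrow> real) \<Rightarrow> nat \<Rightarrow> real) \<Rightarrow> bool" where
  "smooth_field n U m Z \<longleftrightarrow> (\<forall>x\<in>U. Z x \<in> Rn m) \<and> (\<forall>j. smooth_fun n U (\<lambda>x. Z x j))"

lemma smooth_all_coords:
  assumes "openin (Euclidean_space n) U" "f \<in> U \<rightarrow> Rn m" "\<And>j. j < m \<Longrightarrow> smooth_fun n U (\<lambda>x. f x j)"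
  shows "smooth_fun n U (\<lambda>x. f x j)"
proof (cases "j < m")
  case False
  show ?thesis by (rule smooth_cong[OF assms(1) _ smooth_const[of n U 0]]) (use assms(2) False RnD in force)
qed (rule assms(3))

lemma smooth_field_of_between:
  assumes "openin (Euclidean_space n) U" "smooth_between n U m W f" "W \<subseteq> Rn m"
  shows "smooth_field n U m f"
proof -
  have "f \<in> U \<rightarrow> Rn m" "\<And>j. j < m \<Longrightarrow> smooth_fun n U (\<lambda>x. f x j)"
    using assms(2,3) unfolding smooth_between_def by auto
  then show ?thesis using smooth_all_coords[OF assms(1)] unfolding smooth_field_def by blast
qed

lemma tangent_map_Rn:
  assumes "openin (Euclidean_space n) U" "x \<in> U" "\<And>y. y \<in> U \<Longrightarrow> f y \<in> Rn m"
  shows "tangent_map n f x v \<in> Rn m"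
  unfolding tangent_map_def Rn_iff
proof safe
  fix j assume "m \<le> j"
  then have "dir_deriv n v (\<lambda>y. f y j) x = dir_deriv n v (\<lambda>y. 0) x"
    by (intro dir_deriv_cong[OF assms(1,2)]) (use assms(3) RnD in blast)
  then show "dir_deriv n v (\<lambda>y. f y j) x = 0" by simp
qed

lemma smooth_field_tangent:
  assumes "openin (Euclidean_space n) U" "smooth_field n U m f"
  shows "smooth_field n U m (\<lambda>y. tangent_map n f y v)"
  using assms tangent_map_Rn[OF assms(1)] smooth_dir_deriv[OF assms(1)]
  unfolding smooth_field_def by (auto simp: tangent_map_def)

text \<open>Fixing the first argument, even by a varying field, leaves a form of lower degree. All
  inductions over the list of arguments, with the form generalized, pass through this.\<close>

lemma sform_insert:
  assumes U: "openin (Euclidean_space n) U" and \<Omega>: "sform n U m (Suc k) \<Omega>" and Z: "smooth_field n U m Z"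
  shows "sform n U m k (\<lambda>x us. \<Omega> x (Z x # us))"
  unfolding sform_def
proof safe
  show "altml m k (\<lambda>us. \<Omega> x (Z x # us))" if "x \<in> U" for x
    by (rule altml_Cons) (use \<Omega> Z that in \<open>simp_all add: sform_def smooth_field_def\<close>)
  fix us :: "(nat \<Rightarrow> real) list" assume us: "k = length us" "set us \<subseteq> Rn m"
  have "smooth_fun n U (\<lambda>x. \<Sum>l<m. Z x l * \<Omega> x (unit_vec l # us))"
    using \<Omega> Z us unfolding sform_def smooth_field_def
    by (intro smooth_sum[OF U] smooth_mult[OF U]) auto
  moreover have "(\<Sum>l<m. Z x l * \<Omega> x (unit_vec l # us)) = \<Omega> x (Z x # us)" if "x \<in> U" for x
    by (rule altml_expand[symmetric]) (use \<Omega> Z us that in \<open>simp_all add: sform_def smooth_field_def\<close>)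
  ultimately show "smooth_fun n U (\<lambda>x. \<Omega> x (Z x # us))" by (rule smooth_cong[OF U, rotated])
qed

lemma smooth_field_const [simp]: "v \<in> Rn m \<Longrightarrow> smooth_field n U m (\<lambda>x. v)"
  by (simp add: smooth_field_def)

lemma sform_smooth: "sform n U m k \<Omega> \<Longrightarrow> length us = k \<Longrightarrow> set us \<subseteq> Rn m \<Longrightarrow> smooth_fun n U (\<lambda>x. \<Omega> x us)"
  by (simp add: sform_def)

lemma sform_altml: "sform n U m k \<Omega> \<Longrightarrow> x \<in> U \<Longrightarrow> altml m k (\<Omega> x)"
  by (simp add: sform_def)

text \<open>The product rule for a form and one varying argument, obtained from
  \<open>altml_expand\<close>: either the coefficients are differentiated, with the field frozen at
  \<open>x\<close>, or the field is.\<close>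

lemma dir_deriv_head:
  assumes U: "openin (Euclidean_space n) U" and \<Omega>: "sform n U m (Suc k) \<Omega>" and Z: "smooth_field n U m Z"
    and us: "length us = k" "set us \<subseteq> Rn m" and x: "x \<in> U"
  shows "dir_deriv n w (\<lambda>y. \<Omega> y (Z y # us)) x
    = dir_deriv n w (\<lambda>y. \<Omega> y (Z x # us)) x + \<Omega> x (tangent_map n Z x w # us)"
proof -
  have sm: "smooth_fun n U (\<lambda>y. \<Omega> y (unit_vec l # us))" if "l < m" for l
    by (rule sform_smooth[OF \<Omega>]) (use us that in auto)
  have smZ: "smooth_fun n U (\<lambda>y. Z y l)" for l using Z by (simp add: smooth_field_def)
  have Zx: "Z y \<in> Rn m" if "y \<in> U" for y using Z that by (simp add: smooth_field_def)
  have exp: "\<Omega> y (v # us) = (\<Sum>l<m. v l * \<Omega> y (unit_vec l # us))" if "y \<in> U" "v \<in> Rn m" for y v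
    by (rule altml_expand[OF sform_altml[OF \<Omega> that(1)] us that(2)])
  have T: "\<Omega> x (tangent_map n Z x w # us) = (\<Sum>l<m. tangent_map n Z x w l * \<Omega> x (unit_vec l # us))"
    by (rule exp[OF x tangent_map_Rn[OF U x Zx]])
  have "dir_deriv n w (\<lambda>y. \<Omega> y (Z y # us)) x = dir_deriv n w (\<lambda>y. \<Sum>l<m. Z y l * \<Omega> y (unit_vec l # us)) x"
    by (rule dir_deriv_cong[OF U x]) (simp add: exp Zx)
  also have "\<dots> = (\<Sum>l<m. dir_deriv n w (\<lambda>y. Z y l * \<Omega> y (unit_vec l # us)) x)"
    by (rule dir_deriv_sum[OF U _ x]) (intro smooth_mult[OF U] smZ sm, simp)
  also have "\<dots> = (\<Sum>l<m. dir_deriv n w (\<lambda>y. Z y l) x * \<Omega> x (unit_vec l # us)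
      + Z x l * dir_deriv n w (\<lambda>y. \<Omega> y (unit_vec l # us)) x)"
    by (intro sum.cong refl dir_deriv_mult[OF smZ sm x]) simp
  also have "\<dots> = \<Omega> x (tangent_map n Z x w # us) + (\<Sum>l<m. Z x l * dir_deriv n w (\<lambda>y. \<Omega> y (unit_vec l # us)) x)"
    unfolding T sum.distrib by (simp add: tangent_map_def)
  also have "(\<Sum>l<m. Z x l * dir_deriv n w (\<lambda>y. \<Omega> y (unit_vec l # us)) x)
      = (\<Sum>l<m. dir_deriv n w (\<lambda>y. Z x l * \<Omega> y (unit_vec l # us)) x)"
    by (intro sum.cong refl dir_deriv_cmult[OF sm x, symmetric]) simp
  also have "\<dots> = dir_deriv n w (\<lambda>y. \<Sum>l<m. Z x l * \<Omega> y (unit_vec l # us)) x"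
    by (rule dir_deriv_sum[OF U _ x, symmetric]) (intro smooth_cmult[OF U] sm, simp)
  also have "\<dots> = dir_deriv n w (\<lambda>y. \<Omega> y (Z x # us)) x"
    by (rule dir_deriv_cong[OF U x]) (simp add: exp Zx[OF x])
  finally show ?thesis by simp
qed

lemma dir_deriv_fields:
  assumes U: "openin (Euclidean_space n) U" and x: "x \<in> U"
    and "sform n U m k \<Omega>" "length Zs = k" "\<And>Z. Z \<in> set Zs \<Longrightarrow> smooth_field n U m Z"
  shows "dir_deriv n w (\<lambda>y. \<Omega> y (map (\<lambda>Z. Z y) Zs)) x
    = dir_deriv n w (\<lambda>y. \<Omega> y (map (\<lambda>Z. Z x) Zs)) x
      + (\<Sum>l<k. \<Omega> x ((map (\<lambda>Z. Z x) Zs)[l := tangent_map n (Zs ! l) x w]))"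
  using assms(3-)
proof (induction Zs arbitrary: \<Omega> k)
  case (Cons Z Zs)
  then obtain k' where k: "k = Suc k'" "length Zs = k'" by auto
  have \<Omega>: "sform n U m (Suc k') \<Omega>" and Z: "smooth_field n U m Z" using Cons.prems k by auto
  have Zs: "set (map (\<lambda>Z. Z x) Zs) \<subseteq> Rn m"
    using Cons.prems(3) x unfolding smooth_field_def by auto
  have "dir_deriv n w (\<lambda>y. \<Omega> y (Z y # map (\<lambda>Z. Z y) Zs)) x
    = dir_deriv n w (\<lambda>y. \<Omega> y (Z y # map (\<lambda>Z. Z x) Zs)) x
      + (\<Sum>l<k'. \<Omega> x (Z x # (map (\<lambda>Z. Z x) Zs)[l := tangent_map n (Zs ! l) x w]))"
    by (rule Cons.IH[OF sform_insert[OF U \<Omega> Z] k(2)]) (use Cons.prems in auto)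
  also have "dir_deriv n w (\<lambda>y. \<Omega> y (Z y # map (\<lambda>Z. Z x) Zs)) x =
      dir_deriv n w (\<lambda>y. \<Omega> y (Z x # map (\<lambda>Z. Z x) Zs)) x + \<Omega> x (tangent_map n Z x w # map (\<lambda>Z. Z x) Zs)"
    by (rule dir_deriv_head[OF U \<Omega> Z _ Zs x]) (use k in simp)
  finally show ?case by (simp add: k sum.lessThan_Suc_shift del: sum.lessThan_Suc)
qed simp

text \<open>\<open>eform_d\<close> without its domain guard, so that it also applies to forms along
  a map and to forms with some arguments already inserted.\<close>

definition ext_deriv :: "nat \<Rightarrow> eform \<Rightarrow> eform" where
  "ext_deriv n \<Omega> x vs = (\<Sum>i<length vs. (-1) ^ i * dir_deriv n (vs ! i) (\<lambda>y. \<Omega> y (take i vs @ drop (Suc i) vs)) x)"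

lemma eform_d_eq: "eform_d n U \<omega> x vs = (if x \<in> U \<and> set vs \<subseteq> Rn n then ext_deriv n \<omega> x vs else 0)"
  by (simp add: eform_d_def ext_deriv_def)

lemma ext_deriv_Nil [simp]: "ext_deriv n \<Omega> x [] = 0"
  by (simp add: ext_deriv_def)

text \<open>Cartan's formula for a constant vector field. It reduces statements on \<open>d\<close> to an induction on
  the list of arguments.\<close>

lemma ext_deriv_Cons:
  "ext_deriv n \<Omega> x (v # vs) = dir_deriv n v (\<lambda>y. \<Omega> y vs) x - ext_deriv n (\<lambda>y us. \<Omega> y (v # us)) x vs"
  by (simp add: ext_deriv_def sum.lessThan_Suc_shift sum_negf del: sum.lessThan_Suc)

lemma ext_deriv_cong:
  assumes U: "openin (Euclidean_space n) U" and x: "x \<in> U"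
    and "\<And>y us. y \<in> U \<Longrightarrow> Suc (length us) = length vs \<Longrightarrow> set us \<subseteq> set vs \<Longrightarrow> \<Omega> y us = \<Omega>' y us"
  shows "ext_deriv n \<Omega> x vs = ext_deriv n \<Omega>' x vs"
  unfolding ext_deriv_def
  by (intro sum.cong refl arg_cong[of _ _ "(*) _"] dir_deriv_cong[OF U x] assms(3))
    (auto dest!: in_set_takeD in_set_dropD)

lemma ext_deriv_lincomb:
  assumes U: "openin (Euclidean_space n) U" and x: "x \<in> U" and vs: "set vs \<subseteq> Rn m"
    and "\<And>us. Suc (length us) = length vs \<Longrightarrow> set us \<subseteq> Rn m \<Longrightarrow> smooth_fun n U (\<lambda>y. \<Omega> y us)"
    and "\<And>us. Suc (length us) = length vs \<Longrightarrow> set us \<subseteq> Rn m \<Longrightarrow> smooth_fun n U (\<lambda>y. \<Omega>' y us)"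
  shows "ext_deriv n (\<lambda>y us. a * \<Omega> y us + b * \<Omega>' y us) x vs = a * ext_deriv n \<Omega> x vs + b * ext_deriv n \<Omega>' x vs"
proof -
  have "dir_deriv n v (\<lambda>y. a * \<Omega> y us + b * \<Omega>' y us) x = a * dir_deriv n v (\<lambda>y. \<Omega> y us) x + b * dir_deriv n v (\<lambda>y. \<Omega>' y us) x"
    if us: "Suc (length us) = length vs" "set us \<subseteq> Rn m" for us v
    using dir_deriv_add[OF smooth_cmult[OF U assms(4)[OF us], of a] smooth_cmult[OF U assms(5)[OF us], of b] x, of v]
      dir_deriv_cmult[OF assms(4)[OF us] x] dir_deriv_cmult[OF assms(5)[OF us] x] by simp
  moreover have "Suc (length (take i vs @ drop (Suc i) vs)) = length vs \<and> set (take i vs @ drop (Suc i) vs) \<subseteq> Rn m"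
    if "i < length vs" for i using that vs by (auto dest!: in_set_takeD in_set_dropD)
  ultimately show ?thesis
    unfolding ext_deriv_def by (simp add: algebra_simps sum.distrib sum_distrib_left)
qed

lemma ext_deriv_smooth:
  assumes U: "openin (Euclidean_space n) U" and vs: "set vs \<subseteq> Rn m"
    and "\<And>us. Suc (length us) = length vs \<Longrightarrow> set us \<subseteq> Rn m \<Longrightarrow> smooth_fun n U (\<lambda>y. \<Omega> y us)"
  shows "smooth_fun n U (\<lambda>x. ext_deriv n \<Omega> x vs)"
  unfolding ext_deriv_def
  by (intro smooth_sum[OF U] smooth_cmult[OF U] smooth_dir_deriv[OF U] assms(3))
    (use vs in \<open>auto dest!: in_set_takeD in_set_dropD\<close>)

lemma ext_deriv_linear:
  assumes U: "openin (Euclidean_space n) U" and x: "x \<in> U"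
    and "sform n U n k \<Omega>" "length xs + length ys = k" "set xs \<subseteq> Rn n" "set ys \<subseteq> Rn n" "v \<in> Rn n" "w \<in> Rn n"
  shows "ext_deriv n \<Omega> x (xs @ (a *\<^sub>R v + b *\<^sub>R w) # ys)
     = a * ext_deriv n \<Omega> x (xs @ v # ys) + b * ext_deriv n \<Omega> x (xs @ w # ys)"
  using assms(3-)
proof (induction xs arbitrary: \<Omega> k)
  case Nil
  have h: "ext_deriv n (\<lambda>y us. \<Omega> y ((a *\<^sub>R v + b *\<^sub>R w) # us)) x ys
      = a * ext_deriv n (\<lambda>y us. \<Omega> y (v # us)) x ys + b * ext_deriv n (\<lambda>y us. \<Omega> y (w # us)) x ys"
  proof (cases k)
    case (Suc k')
    have "ext_deriv n (\<lambda>y us. \<Omega> y ((a *\<^sub>R v + b *\<^sub>R w) # us)) x ys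
        = ext_deriv n (\<lambda>y us. a * \<Omega> y (v # us) + b * \<Omega> y (w # us)) x ys"
      by (rule ext_deriv_cong[OF U x], rule altml_linear_head[of n k'])
        (use Nil Suc sform_altml in auto)
    also have "\<dots> = a * ext_deriv n (\<lambda>y us. \<Omega> y (v # us)) x ys + b * ext_deriv n (\<lambda>y us. \<Omega> y (w # us)) x ys"
      by (rule ext_deriv_lincomb[OF U x, of _ n]) (use Nil sform_smooth[OF Nil(1)] in auto)
    finally show ?thesis .
  qed (use Nil in simp)
  show ?case unfolding append_Nil ext_deriv_Cons dir_deriv_linear h by (simp add: algebra_simps)
next
  case (Cons z xs)
  then obtain k' where k: "k = Suc k'" "length xs + length ys = k'" by auto
  have z: "z \<in> Rn n" using Cons by simp
  have \<Omega>: "sform n U n (Suc k') \<Omega>" using Cons k by simp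
  have IH: "ext_deriv n (\<lambda>y us. \<Omega> y (z # us)) x (xs @ (a *\<^sub>R v + b *\<^sub>R w) # ys)
     = a * ext_deriv n (\<lambda>y us. \<Omega> y (z # us)) x (xs @ v # ys) + b * ext_deriv n (\<lambda>y us. \<Omega> y (z # us)) x (xs @ w # ys)"
    by (rule Cons.IH[OF sform_insert[OF U \<Omega> smooth_field_const[OF z]] k(2)]) (use Cons.prems in auto)
  have sm: "smooth_fun n U (\<lambda>y. \<Omega> y (xs @ u # ys))" if "u \<in> Rn n" for u
    by (rule sform_smooth[OF \<Omega>]) (use Cons.prems k that in auto)
  have "dir_deriv n z (\<lambda>y. \<Omega> y (xs @ (a *\<^sub>R v + b *\<^sub>R w) # ys)) x
      = dir_deriv n z (\<lambda>y. a * \<Omega> y (xs @ v # ys) + b * \<Omega> y (xs @ w # ys)) x"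
    by (rule dir_deriv_cong[OF U x], rule altml_linear[OF sform_altml[OF \<Omega>]]) (use Cons.prems k in auto)
  also have "\<dots> = a * dir_deriv n z (\<lambda>y. \<Omega> y (xs @ v # ys)) x + b * dir_deriv n z (\<lambda>y. \<Omega> y (xs @ w # ys)) x"
    using dir_deriv_add[OF smooth_cmult[OF U sm[of v], of a] smooth_cmult[OF U sm[of w], of b] x, of z]
      dir_deriv_cmult[OF sm[of v] x] dir_deriv_cmult[OF sm[of w] x] Cons.prems by simp
  finally have D: "dir_deriv n z (\<lambda>y. \<Omega> y (xs @ (a *\<^sub>R v + b *\<^sub>R w) # ys)) x
      = a * dir_deriv n z (\<lambda>y. \<Omega> y (xs @ v # ys)) x + b * dir_deriv n z (\<lambda>y. \<Omega> y (xs @ w # ys)) x" .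
  show ?case unfolding append_Cons ext_deriv_Cons D IH by (simp add: algebra_simps)
qed

text \<open>If the equal vectors come first, unfolding the recursion twice cancels the two
  derivatives in direction \<open>v\<close> and leaves the derivative of \<open>\<Omega>\<close> on
  \<open>v, v\<close>, which is 0. Otherwise the recursion strips the first vector.\<close>

lemma ext_deriv_adjacent:
  assumes U: "openin (Euclidean_space n) U" and x: "x \<in> U"
    and "sform n U n k \<Omega>" "length xs + Suc (length ys) = k" "set xs \<subseteq> Rn n" "set ys \<subseteq> Rn n" "v \<in> Rn n"
  shows "ext_deriv n \<Omega> x (xs @ v # v # ys) = 0"
  using assms(3-)
proof (induction xs arbitrary: \<Omega> k)
  case Nil
  have "ext_deriv n (\<lambda>y us. \<Omega> y (v # v # us)) x ys = ext_deriv n (\<lambda>y us. 0) x ys"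
  proof (rule ext_deriv_cong[OF U x])
    fix y and us :: "(nat \<Rightarrow> real) list" assume "y \<in> U" "Suc (length us) = length ys" "set us \<subseteq> set ys"
    then show "\<Omega> y (v # v # us) = 0"
      using altml_adjacent[OF sform_altml[OF Nil(1)], of y "[]" us v] Nil by auto
  qed
  then show ?case by (simp add: ext_deriv_Cons) (simp add: ext_deriv_def)
next
  case (Cons z xs)
  then obtain k' where k: "k = Suc k'" "length xs + Suc (length ys) = k'" by auto
  have z: "z \<in> Rn n" using Cons by simp
  have \<Omega>: "sform n U n (Suc k') \<Omega>" using Cons k by simp
  have "ext_deriv n (\<lambda>y us. \<Omega> y (z # us)) x (xs @ v # v # ys) = 0"
    by (rule Cons.IH[OF sform_insert[OF U \<Omega> smooth_field_const[OF z]] k(2)]) (use Cons.prems in auto)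
  moreover have "dir_deriv n z (\<lambda>y. \<Omega> y (xs @ v # v # ys)) x = dir_deriv n z (\<lambda>y. 0) x"
    by (rule dir_deriv_cong[OF U x], rule altml_adjacent[OF sform_altml[OF \<Omega>]]) (use Cons.prems k in auto)
  ultimately show ?case by (simp add: ext_deriv_Cons)
qed

lemma sform_ext_deriv:
  assumes U: "openin (Euclidean_space n) U" and "sform n U n k \<Omega>"
  shows "sform n U n (Suc k) (ext_deriv n \<Omega>)"
  unfolding sform_def
proof safe
  fix x assume x: "x \<in> U"
  show "altml n (Suc k) (ext_deriv n \<Omega> x)"
  proof (rule altmlI)
    show "ext_deriv n \<Omega> x (xs @ (a *\<^sub>R v + b *\<^sub>R w) # ys) = a * ext_deriv n \<Omega> x (xs @ v # ys) + b * ext_deriv n \<Omega> x (xs @ w # ys)"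
      if "length xs + Suc (length ys) = Suc k" "set xs \<subseteq> Rn n" "set ys \<subseteq> Rn n" "v \<in> Rn n" "w \<in> Rn n" for xs ys v w a b
      by (rule ext_deriv_linear[OF U x assms(2)]) (use that in auto)
    show "ext_deriv n \<Omega> x (xs @ v # v # ys) = 0"
      if "length xs + Suc (Suc (length ys)) = Suc k" "set xs \<subseteq> Rn n" "set ys \<subseteq> Rn n" "v \<in> Rn n" for xs ys v
      by (rule ext_deriv_adjacent[OF U x assms(2)]) (use that in auto)
  qed
next
  fix us :: "(nat \<Rightarrow> real) list" assume us: "length us = Suc k" "set us \<subseteq> Rn n"
  show "smooth_fun n U (\<lambda>x. ext_deriv n \<Omega> x us)"
    by (rule ext_deriv_smooth[OF U us(2)]) (use us sform_smooth[OF assms(2)] in auto)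
qed

text \<open>Write \<open>D\<close> for the derivative in a constant direction \<open>v\<close> and
  \<open>i\<close> for insertion of \<open>v\<close>. The recursion says
  \<open>i d = D - d i\<close>, and \<open>D\<close> commutes with \<open>d\<close> because second
  derivatives are symmetric. Hence \<open>i d d = D d - d D + d d i = d d i\<close>, and the
  induction ends at the empty list.\<close>

lemma ext_deriv_ext_deriv:
  assumes U: "openin (Euclidean_space n) U" and x: "x \<in> U"
    and "set vs \<subseteq> Rn n" "\<And>us. set us \<subseteq> Rn n \<Longrightarrow> smooth_fun n U (\<lambda>y. \<Omega> y us)"
  shows "ext_deriv n (ext_deriv n \<Omega>) x vs = 0"
  using assms(3-)
proof (induction vs arbitrary: \<Omega>)
  case (Cons v vs)
  note sm = Cons.prems(2)
  have v: "v \<in> Rn n" and vs: "set vs \<subseteq> Rn n" using Cons.prems by auto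
  have "dir_deriv n v (\<lambda>y. ext_deriv n \<Omega> y vs) x
      = (\<Sum>i<length vs. (-1) ^ i * dir_deriv n v (dir_deriv n (vs ! i) (\<lambda>y. \<Omega> y (take i vs @ drop (Suc i) vs))) x)"
  proof -
    have sm': "smooth_fun n U (\<lambda>y. \<Omega> y (take i vs @ drop (Suc i) vs))" for i
      by (rule sm) (use vs in \<open>auto dest!: in_set_takeD in_set_dropD\<close>)
    show ?thesis unfolding ext_deriv_def
      by (subst dir_deriv_sum[OF U _ x])
        (intro smooth_cmult[OF U] smooth_dir_deriv[OF U] sm' sum.cong refl dir_deriv_cmult[OF smooth_dir_deriv[OF U sm'] x])+
  qed
  also have "\<dots> = ext_deriv n (\<lambda>y us. dir_deriv n v (\<lambda>z. \<Omega> z us) y) x vs"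
    unfolding ext_deriv_def
    by (intro sum.cong refl arg_cong[of _ _ "(*) _"] dir_deriv_commute[OF U _ x] sm)
      (use vs in \<open>auto dest!: in_set_takeD in_set_dropD\<close>)
  finally have 1: "dir_deriv n v (\<lambda>y. ext_deriv n \<Omega> y vs) x = ext_deriv n (\<lambda>y us. dir_deriv n v (\<lambda>z. \<Omega> z us) y) x vs" .
  have sm1: "smooth_fun n U (\<lambda>y. \<Omega> y (v # us))" if "set us \<subseteq> Rn n" for us
    by (rule sm) (use that v in auto)
  have "ext_deriv n (\<lambda>y us. ext_deriv n \<Omega> y (v # us)) x vs
      = ext_deriv n (\<lambda>y us. 1 * dir_deriv n v (\<lambda>z. \<Omega> z us) y + (-1) * ext_deriv n (\<lambda>y us. \<Omega> y (v # us)) y us) x vs"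
    by (simp add: ext_deriv_Cons)
  also have "\<dots> = 1 * ext_deriv n (\<lambda>y us. dir_deriv n v (\<lambda>z. \<Omega> z us) y) x vs
      + (-1) * ext_deriv n (ext_deriv n (\<lambda>y us. \<Omega> y (v # us))) x vs"
    by (rule ext_deriv_lincomb[OF U x vs])
      (auto intro!: smooth_dir_deriv[OF U] sm ext_deriv_smooth[OF U, of _ n] sm1)
  also have "ext_deriv n (ext_deriv n (\<lambda>y us. \<Omega> y (v # us))) x vs = 0"
    by (rule Cons.IH[OF vs sm1])
  finally show ?case using 1 by (simp add: ext_deriv_Cons[of n "ext_deriv n \<Omega>"])
qed simp

lemma map_take_drop_nth: "map f (take i vs @ drop (Suc i) vs) = take i (map f vs) @ drop (Suc i) (map f vs)"
  by (simp add: take_map drop_map)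

text \<open>The heart of the compatibility of \<open>d\<close> with pullback: the tangent map in the
  arguments may be frozen at \<open>x\<close>, since the additional terms involve second derivatives
  of \<open>f\<close> and cancel by symmetry.\<close>

lemma ext_deriv_along:
  assumes U: "openin (Euclidean_space n) U" and x: "x \<in> U" and f: "smooth_field n U m f"
    and "sform n U m k \<Omega>" "length ws = Suc k" "set ws \<subseteq> Rn n"
  shows "ext_deriv n (\<lambda>y us. \<Omega> y (map (tangent_map n f y) us)) x ws
       = ext_deriv n (\<lambda>y us. \<Omega> y (map (tangent_map n f x) us)) x ws"
  using assms(4-)
proof (induction ws arbitrary: \<Omega> k)
  case (Cons w ws)
  show ?case
  proof (cases k)
    case 0
    then have "ws = []" using Cons.prems by simp
    then show ?thesis by (simp add: ext_deriv_Cons)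
  next
    case (Suc k')
    define T where "T = tangent_map n f x"
    \<comment> \<open>The second derivative of \<open>f\<close> at \<open>x\<close> in the
      directions \<open>w\<close> and \<open>u\<close>; the fact \<open>sym\<close> is its
      symmetry.\<close>
    define B where "B u = tangent_map n (\<lambda>y. tangent_map n f y w) x u" for u
    have \<Omega>: "sform n U m (Suc k') \<Omega>" and len: "length ws = Suc k'" and ws: "set ws \<subseteq> Rn n"
      using Cons.prems Suc by auto
    have Tw: "smooth_field n U m (\<lambda>y. tangent_map n f y u)" for u
      by (rule smooth_field_tangent[OF U f])
    have fR: "\<And>y. y \<in> U \<Longrightarrow> f y \<in> Rn m" using f by (simp add: smooth_field_def)
    have TR: "T u \<in> Rn m" for u unfolding T_def by (rule tangent_map_Rn[OF U x fR])
    have BR: "B u \<in> Rn m" for u unfolding B_def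
      by (rule tangent_map_Rn[OF U x]) (rule tangent_map_Rn[OF U _ fR])
    have sym: "tangent_map n (\<lambda>y. tangent_map n f y u) x w = B u" for u
    proof
      fix j
      have "smooth_fun n U (\<lambda>y. f y j)" using f by (simp add: smooth_field_def)
      from dir_deriv_commute[OF U this x, of w u]
      show "tangent_map n (\<lambda>y. tangent_map n f y u) x w j = B u j"
        unfolding B_def tangent_map_def by simp
    qed
    have del: "length (map T (take i ws @ drop (Suc i) ws)) = k'" "set (map T (take i ws @ drop (Suc i) ws)) \<subseteq> Rn m"
      if "i < length ws" for i using that len TR by auto
    have "ext_deriv n (\<lambda>y us. \<Omega> y (tangent_map n f y w # map (tangent_map n f y) us)) x ws
        = ext_deriv n (\<lambda>y us. \<Omega> y (tangent_map n f y w # map T us)) x ws"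
      unfolding T_def by (rule Cons.IH[OF sform_insert[OF U \<Omega> Tw] len ws])
    also have "\<dots> = (\<Sum>i<length ws. (-1) ^ i * (dir_deriv n (ws ! i) (\<lambda>y. \<Omega> y (T w # map T (take i ws @ drop (Suc i) ws))) x
        + \<Omega> x (B (ws ! i) # map T (take i ws @ drop (Suc i) ws))))"
      unfolding ext_deriv_def B_def T_def
      by (intro sum.cong refl arg_cong[of _ _ "(*) _"] dir_deriv_head[OF U \<Omega> Tw _ _ x])
        (use del[unfolded T_def] in auto)
    also have "\<dots> = ext_deriv n (\<lambda>y us. \<Omega> y (T w # map T us)) x ws
        + (\<Sum>i<length ws. (-1) ^ i * \<Omega> x (B (ws ! i) # map T (take i ws @ drop (Suc i) ws)))"
      unfolding ext_deriv_def by (simp add: algebra_simps sum.distrib)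
    finally have 1: "ext_deriv n (\<lambda>y us. \<Omega> y (tangent_map n f y w # map (tangent_map n f y) us)) x ws
        = ext_deriv n (\<lambda>y us. \<Omega> y (T w # map T us)) x ws
        + (\<Sum>i<length ws. (-1) ^ i * \<Omega> x (B (ws ! i) # map T (take i ws @ drop (Suc i) ws)))" .
    have "dir_deriv n w (\<lambda>y. \<Omega> y (map (\<lambda>Z. Z y) (map (\<lambda>u y. tangent_map n f y u) ws))) x
      = dir_deriv n w (\<lambda>y. \<Omega> y (map (\<lambda>Z. Z x) (map (\<lambda>u y. tangent_map n f y u) ws))) x
      + (\<Sum>l<Suc k'. \<Omega> x ((map (\<lambda>Z. Z x) (map (\<lambda>u y. tangent_map n f y u) ws))[l :=
           tangent_map n (map (\<lambda>u y. tangent_map n f y u) ws ! l) x w]))"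
      by (rule dir_deriv_fields[OF U x \<Omega>]) (use len Tw in auto)
    then have "dir_deriv n w (\<lambda>y. \<Omega> y (map (tangent_map n f y) ws)) x
      = dir_deriv n w (\<lambda>y. \<Omega> y (map T ws)) x + (\<Sum>l<length ws. \<Omega> x ((map T ws)[l := B (ws ! l)]))"
      by (simp add: comp_def sym len T_def cong: sum.cong_simp)
    \<comment> \<open>With the replaced entry moved to the front, this is the correction term of the
      identity \<open>1\<close>, and \<open>ext_deriv_Cons\<close> subtracts one from the
      other.\<close>
    also have "(\<Sum>l<length ws. \<Omega> x ((map T ws)[l := B (ws ! l)]))
        = (\<Sum>l<length ws. (-1) ^ l * \<Omega> x (B (ws ! l) # map T (take l ws @ drop (Suc l) ws)))"
      unfolding map_take_drop_nth
      by (intro sum.cong refl altml_update_front[OF sform_altml[OF \<Omega> x]]) (use TR BR len in auto)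
    finally show ?thesis using 1 by (simp add: ext_deriv_Cons T_def)
  qed
qed simp

text \<open>The right side is the formula of \<open>eform_lie\<close>. Freezing \<open>Y\<close> at
  \<open>x\<close> turns the second term into the one of the recursion for a constant vector; the
  derivatives of \<open>Y\<close> produced on the way are the terms with
  \<open>tangent_map n Y x\<close>, brought into place by \<open>altml_update_front\<close>.\<close>

lemma cartan:
  assumes U: "openin (Euclidean_space n) U" and x: "x \<in> U" and Y: "smooth_field n U n Y"
    and \<omega>: "sform n U n k \<omega>" and vs: "length vs = k" "set vs \<subseteq> Rn n"
  shows "ext_deriv n \<omega> x (Y x # vs) + ext_deriv n (\<lambda>y us. \<omega> y (Y y # us)) x vs
     = dir_deriv n (Y x) (\<lambda>y. \<omega> y vs) x + (\<Sum>i<length vs. \<omega> x (vs[i := tangent_map n Y x (vs ! i)]))"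
proof (cases k)
  case 0
  then show ?thesis using vs by (simp add: ext_deriv_Cons)
next
  case (Suc k')
  have \<omega>': "sform n U n (Suc k') \<omega>" using \<omega> Suc by simp
  have TR: "tangent_map n Y x v \<in> Rn n" for v
    by (rule tangent_map_Rn[OF U x]) (use Y in \<open>simp add: smooth_field_def\<close>)
  have "ext_deriv n (\<lambda>y us. \<omega> y (Y y # us)) x vs
      = (\<Sum>i<length vs. (-1) ^ i * (dir_deriv n (vs ! i) (\<lambda>y. \<omega> y (Y x # take i vs @ drop (Suc i) vs)) x
          + \<omega> x (tangent_map n Y x (vs ! i) # take i vs @ drop (Suc i) vs)))"
    unfolding ext_deriv_def
    by (intro sum.cong refl arg_cong[of _ _ "(*) _"] dir_deriv_head[OF U \<omega>' Y _ _ x])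
      (use vs Suc in \<open>auto dest!: in_set_takeD in_set_dropD\<close>)
  also have "\<dots> = ext_deriv n (\<lambda>y us. \<omega> y (Y x # us)) x vs
      + (\<Sum>i<length vs. (-1) ^ i * \<omega> x (tangent_map n Y x (vs ! i) # take i vs @ drop (Suc i) vs))"
    unfolding ext_deriv_def by (simp add: algebra_simps sum.distrib)
  also have "(\<Sum>i<length vs. (-1) ^ i * \<omega> x (tangent_map n Y x (vs ! i) # take i vs @ drop (Suc i) vs))
      = (\<Sum>i<length vs. \<omega> x (vs[i := tangent_map n Y x (vs ! i)]))"
    by (intro sum.cong refl altml_update_front[OF sform_altml[OF \<omega> x], symmetric]) (use TR vs in auto)
  finally show ?thesis by (simp add: ext_deriv_Cons)
qed

section \<open>Forms on open sets: linearity, differential and pullback\<close>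

lemma eforms_iff:
  "\<omega> \<in> eforms n U k \<longleftrightarrow>
     (\<forall>x vs. \<not> (x \<in> U \<and> length vs = k \<and> set vs \<subseteq> Rn n) \<longrightarrow> \<omega> x vs = 0) \<and> sform n U n k \<omega>"
  unfolding eforms_def sform_def altml_def mem_Collect_eq by simp

lemma eforms_zero: "\<omega> \<in> eforms n U k \<Longrightarrow> \<not> (x \<in> U \<and> length vs = k \<and> set vs \<subseteq> Rn n) \<Longrightarrow> \<omega> x vs = 0"
  unfolding eforms_iff by blast

lemma eforms_sform: "\<omega> \<in> eforms n U k \<Longrightarrow> sform n U n k \<omega>"
  unfolding eforms_iff by blast

lemma eforms_smooth: "\<omega> \<in> eforms n U k \<Longrightarrow> set us \<subseteq> Rn n \<Longrightarrow> smooth_fun n U (\<lambda>x. \<omega> x us)"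
  by (cases "length us = k") (simp_all add: sform_smooth[OF eforms_sform] eforms_zero)

lemma altml_cong:
  assumes "altml n k A" "\<And>vs. length vs = k \<Longrightarrow> set vs \<subseteq> Rn n \<Longrightarrow> A vs = B vs"
  shows "altml n k B"
proof (rule altmlI)
  fix xs ys :: "(nat \<Rightarrow> real) list" and v w and a b :: real
  assume *: "length xs + Suc (length ys) = k" "set xs \<subseteq> Rn n" "set ys \<subseteq> Rn n" "v \<in> Rn n" "w \<in> Rn n"
  have "A (xs @ u # ys) = B (xs @ u # ys)" if "u \<in> Rn n" for u
    by (rule assms(2)) (use * that in auto)
  moreover have "a *\<^sub>R v + b *\<^sub>R w \<in> Rn n" by (intro Rn_add Rn_scaleR *)
  ultimately show "B (xs @ (a *\<^sub>R v + b *\<^sub>R w) # ys) = a * B (xs @ v # ys) + b * B (xs @ w # ys)"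
    using altml_linear[OF assms(1) *] *(4,5) by metis
next
  fix xs ys :: "(nat \<Rightarrow> real) list" and v
  assume *: "length xs + Suc (Suc (length ys)) = k" "set xs \<subseteq> Rn n" "set ys \<subseteq> Rn n" "v \<in> Rn n"
  have "A (xs @ v # v # ys) = B (xs @ v # v # ys)" by (rule assms(2)) (use * in auto)
  then show "B (xs @ v # v # ys) = 0" using altml_adjacent[OF assms(1) *] by metis
qed

lemma sform_cong:
  assumes "openin (Euclidean_space n) U" "sform n U m k \<Omega>"
    and "\<And>x vs. x \<in> U \<Longrightarrow> length vs = k \<Longrightarrow> set vs \<subseteq> Rn m \<Longrightarrow> \<Omega> x vs = \<Omega>' x vs"
  shows "sform n U m k \<Omega>'"
  unfolding sform_def
proof safe
  show "altml m k (\<Omega>' x)" if "x \<in> U" for x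
    by (rule altml_cong[OF sform_altml[OF assms(2) that]]) (rule assms(3)[OF that])
  show "smooth_fun n U (\<lambda>x. \<Omega>' x us)" if "k = length us" "set us \<subseteq> Rn m" for us
    by (rule smooth_cong[OF assms(1) _ sform_smooth[OF assms(2)]]) (use that assms(3) in auto)
qed

lemma altml_lincomb: "altml n k A \<Longrightarrow> altml n k B \<Longrightarrow> altml n k (\<lambda>vs. a * A vs + b * B vs)"
  by (rule altmlI) (simp_all add: altml_linear altml_adjacent algebra_simps)

lemma sform_lincomb:
  assumes "openin (Euclidean_space n) U" "sform n U m k \<Omega>" "sform n U m k \<Omega>'"
  shows "sform n U m k (\<lambda>x vs. a * \<Omega> x vs + b * \<Omega>' x vs)"
  unfolding sform_def
proof safe
  show "altml m k (\<lambda>vs. a * \<Omega> x vs + b * \<Omega>' x vs)" if "x \<in> U" for x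
    by (rule altml_lincomb) (use assms that in \<open>auto simp: sform_def\<close>)
  show "smooth_fun n U (\<lambda>x. a * \<Omega> x us + b * \<Omega>' x us)" if "k = length us" "set us \<subseteq> Rn m" for us
    by (intro smooth_add smooth_cmult assms sform_smooth[of n U m k]) (use that in auto)
qed

lemma altml_zero [simp]: "altml n k (\<lambda>vs. 0)"
  by (rule altmlI) auto

lemma zero_eforms: "(\<lambda>x vs. 0) \<in> eforms n U k"
  by (simp add: eforms_iff sform_def)

lemma eforms_lincomb:
  assumes "openin (Euclidean_space n) U" "\<omega> \<in> eforms n U k" "\<omega>' \<in> eforms n U k"
  shows "a *\<^sub>R \<omega> + b *\<^sub>R \<omega>' \<in> eforms n U k"
proof -
  have "a *\<^sub>R \<omega> + b *\<^sub>R \<omega>' = (\<lambda>x vs. a * \<omega> x vs + b * \<omega>' x vs)"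
    by (simp add: fun_eq_iff)
  moreover have "(\<lambda>x vs. a * \<omega> x vs + b * \<omega>' x vs) \<in> eforms n U k"
    unfolding eforms_iff using sform_lincomb[OF assms(1) eforms_sform[OF assms(2)] eforms_sform[OF assms(3)]]
      eforms_zero[OF assms(2)] eforms_zero[OF assms(3)] by simp
  ultimately show ?thesis by simp
qed

lemma ext_deriv_zero [simp]: "ext_deriv n (\<lambda>y us. 0) x vs = 0"
  by (simp add: ext_deriv_def)

lemma ext_deriv_wrong_length:
  assumes "openin (Euclidean_space n) U" "x \<in> U" "\<omega> \<in> eforms n U k" "length vs \<noteq> Suc k"
  shows "ext_deriv n \<omega> x vs = 0"
proof -
  have "ext_deriv n \<omega> x vs = ext_deriv n (\<lambda>y us. 0) x vs"
    by (rule ext_deriv_cong[OF assms(1,2)]) (use assms(3,4) eforms_zero in force)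
  then show ?thesis by simp
qed

lemma eform_d_in:
  assumes U: "openin (Euclidean_space n) U" and \<omega>: "\<omega> \<in> eforms n U k"
  shows "eform_d n U \<omega> \<in> eforms n U (Suc k)"
  unfolding eforms_iff
proof
  show "sform n U n (Suc k) (eform_d n U \<omega>)"
    by (rule sform_cong[OF U sform_ext_deriv[OF U eforms_sform[OF \<omega>]]]) (simp add: eform_d_eq)
  show "\<forall>x vs. \<not> (x \<in> U \<and> length vs = Suc k \<and> set vs \<subseteq> Rn n) \<longrightarrow> eform_d n U \<omega> x vs = 0"
    using ext_deriv_wrong_length[OF U _ \<omega>] by (simp add: eform_d_eq)
qed

lemma eform_d_zero [simp]: "eform_d n U 0 = 0"
  by (simp add: fun_eq_iff eform_d_eq zero_fun_def)

lemma eform_d_d: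
  assumes U: "openin (Euclidean_space n) U" and \<omega>: "\<omega> \<in> eforms n U k"
  shows "eform_d n U (eform_d n U \<omega>) = 0"
proof -
  have "ext_deriv n (eform_d n U \<omega>) x vs = 0" if x: "x \<in> U" and vs: "set vs \<subseteq> Rn n" for x vs
  proof -
    have "ext_deriv n (eform_d n U \<omega>) x vs = ext_deriv n (ext_deriv n \<omega>) x vs"
      by (rule ext_deriv_cong[OF U x]) (use vs in \<open>auto simp: eform_d_eq\<close>)
    also have "\<dots> = 0" by (rule ext_deriv_ext_deriv[OF U x vs eforms_smooth[OF \<omega>]])
    finally show ?thesis .
  qed
  then show ?thesis by (auto simp: fun_eq_iff eform_d_eq)
qed

lemma eform_d_lincomb:
  assumes U: "openin (Euclidean_space n) U" and "\<omega> \<in> eforms n U k" "\<omega>' \<in> eforms n U k"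
  shows "eform_d n U (a *\<^sub>R \<omega> + b *\<^sub>R \<omega>') = a *\<^sub>R eform_d n U \<omega> + b *\<^sub>R eform_d n U \<omega>'"
proof -
  have e: "a *\<^sub>R \<omega> + b *\<^sub>R \<omega>' = (\<lambda>x vs. a * \<omega> x vs + b * \<omega>' x vs)"
    by (simp add: fun_eq_iff)
  have "ext_deriv n (\<lambda>x vs. a * \<omega> x vs + b * \<omega>' x vs) x vs = a * ext_deriv n \<omega> x vs + b * ext_deriv n \<omega>' x vs"
    if "x \<in> U" "set vs \<subseteq> Rn n" for x vs
    by (rule ext_deriv_lincomb[OF U that]) (use assms eforms_smooth in blast)+
  then show ?thesis unfolding e by (auto simp: fun_eq_iff eform_d_eq)
qed

lemma smooth_between_id: "U \<subseteq> W \<Longrightarrow> smooth_between n U m W (\<lambda>x. x)"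
  unfolding smooth_between_def by auto

lemma smooth_between_subset: "smooth_between n U m W f \<Longrightarrow> V \<subseteq> U \<Longrightarrow> smooth_between n V m W f"
  unfolding smooth_between_def using smooth_subset by blast

text \<open>After \<open>ext_deriv_along\<close> has frozen the arguments, each summand is the
  derivative of a function composed with \<open>f\<close>, and the chain rule applies summand by
  summand.\<close>

lemma eform_d_pull:
  assumes V: "openin (Euclidean_space m) V" and U: "openin (Euclidean_space n) U"
    and f: "smooth_between m V n U f" and \<omega>: "\<omega> \<in> eforms n U k"
  shows "eform_d m V (eform_pull m V f \<omega>) = eform_pull m V f (eform_d n U \<omega>)"
proof (intro ext)
  fix x vs
  have fU: "f \<in> V \<rightarrow> U" and fs: "\<And>j. j < n \<Longrightarrow> smooth_fun m V (\<lambda>x. f x j)"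
    using f by (auto simp: smooth_between_def)
  have F: "smooth_field m V n f"
    by (rule smooth_field_of_between[OF V f openin_E_subset[OF U]])
  have TR: "tangent_map m f y v \<in> Rn n" if "y \<in> V" for y v
    by (rule tangent_map_Rn[OF V that]) (use F in \<open>simp add: smooth_field_def\<close>)
  show "eform_d m V (eform_pull m V f \<omega>) x vs = eform_pull m V f (eform_d n U \<omega>) x vs"
  proof (cases "x \<in> V \<and> set vs \<subseteq> Rn m")
    case True
    then have x: "x \<in> V" and vs: "set vs \<subseteq> Rn m" by auto
    have Tvs: "set (map (tangent_map m f x) vs) \<subseteq> Rn n" using TR[OF x] by auto
    have fx: "f x \<in> U" using fU x by auto
    have L: "eform_d m V (eform_pull m V f \<omega>) x vs = ext_deriv m (\<lambda>y us. \<omega> (f y) (map (tangent_map m f y) us)) x vs"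
    proof -
      have "ext_deriv m (eform_pull m V f \<omega>) x vs = ext_deriv m (\<lambda>y us. \<omega> (f y) (map (tangent_map m f y) us)) x vs"
        by (rule ext_deriv_cong[OF V x]) (use vs in \<open>auto simp: eform_pull_def\<close>)
      then show ?thesis using x vs by (simp add: eform_d_eq)
    qed
    have R: "eform_pull m V f (eform_d n U \<omega>) x vs = ext_deriv n \<omega> (f x) (map (tangent_map m f x) vs)"
      using x vs fx Tvs by (simp add: eform_d_eq eform_pull_def)
    show ?thesis
    proof (cases "length vs = Suc k")
      case True
      have S: "sform m V n k (\<lambda>y us. \<omega> (f y) us)"
        unfolding sform_def
      proof safe
        show "altml n k (\<omega> (f y))" if "y \<in> V" for y
          using sform_altml[OF eforms_sform[OF \<omega>]] fU that by auto
        show "smooth_fun m V (\<lambda>y. \<omega> (f y) us)" if "k = length us" "set us \<subseteq> Rn n" for us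
          by (rule smooth_comp[OF V U fU fs eforms_smooth[OF \<omega> that(2)]])
      qed
      have "ext_deriv m (\<lambda>y us. \<omega> (f y) (map (tangent_map m f y) us)) x vs
          = ext_deriv m (\<lambda>y us. \<omega> (f y) (map (tangent_map m f x) us)) x vs"
        by (rule ext_deriv_along[OF V x F S True vs])
      also have "\<dots> = ext_deriv n \<omega> (f x) (map (tangent_map m f x) vs)"
        unfolding ext_deriv_def length_map
      proof (intro sum.cong refl arg_cong[of _ _ "(*) _"])
        fix i assume i: "i \<in> {..<length vs}"
        let ?us = "map (tangent_map m f x) (take i vs @ drop (Suc i) vs)"
        have "dir_deriv m (vs ! i) (\<lambda>y. \<omega> (f y) ?us) x = dir_deriv n (tangent_map m f x (vs ! i)) (\<lambda>z. \<omega> z ?us) (f x)"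
          by (rule dir_deriv_comp[OF V U fU fs eforms_smooth[OF \<omega>] x]) (use TR[OF x] in auto)
        then show "dir_deriv m (vs ! i) (\<lambda>y. \<omega> (f y) ?us) x
          = dir_deriv n (map (tangent_map m f x) vs ! i) (\<lambda>z. \<omega> z (take i (map (tangent_map m f x) vs) @ drop (Suc i) (map (tangent_map m f x) vs))) (f x)"
          using i by (simp add: take_map drop_map)
      qed
      finally show ?thesis using L R by simp
    next
      case False
      have "ext_deriv m (\<lambda>y us. \<omega> (f y) (map (tangent_map m f y) us)) x vs = ext_deriv m (\<lambda>y us. 0) x vs"
        by (rule ext_deriv_cong[OF V x]) (use False eforms_zero[OF \<omega>] in auto)
      moreover have "ext_deriv n \<omega> (f x) (map (tangent_map m f x) vs) = 0"
        by (rule ext_deriv_wrong_length[OF U fx \<omega>]) (use False in simp)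
      ultimately show ?thesis using L R by simp
    qed
  qed (auto simp: eform_d_eq eform_pull_def)
qed

section \<open>Forms on diffeological spaces\<close>

lemma dforms_zero: "\<gamma> \<in> dforms D k \<Longrightarrow> p \<notin> D \<Longrightarrow> \<gamma> p = 0"
  unfolding dforms_def by blast

lemma dforms_eform: "\<gamma> \<in> dforms D k \<Longrightarrow> (n, U, \<alpha>) \<in> D \<Longrightarrow> \<gamma> (n, U, \<alpha>) \<in> eforms n U k"
  unfolding dforms_def by blast

lemma dforms_pull:
  assumes "\<gamma> \<in> dforms D k" "(n, U, \<alpha>) \<in> D" "openin (Euclidean_space m) V" "smooth_between m V n U f"
  shows "\<gamma> (m, V, restrict (\<alpha> \<circ> f) V) = eform_pull m V f (\<gamma> (n, U, \<alpha>))"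
  using assms unfolding dforms_def by blast

lemma dformsI:
  assumes "\<And>p. p \<notin> D \<Longrightarrow> \<gamma> p = 0"
    and "\<And>n U \<alpha>. (n, U, \<alpha>) \<in> D \<Longrightarrow> \<gamma> (n, U, \<alpha>) \<in> eforms n U k"
    and "\<And>n U \<alpha> m V f. (n, U, \<alpha>) \<in> D \<Longrightarrow> openin (Euclidean_space m) V \<Longrightarrow> smooth_between m V n U f \<Longrightarrow>
           \<gamma> (m, V, restrict (\<alpha> \<circ> f) V) = eform_pull m V f (\<gamma> (n, U, \<alpha>))"
  shows "\<gamma> \<in> dforms D k"
  unfolding dforms_def using assms by blast

lemma zero_eforms': "0 \<in> eforms n U k"
  using zero_eforms[of n U k] by (simp add: zero_fun_def)

lemma eform_pull_zero: "eform_pull m V f 0 = 0"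
  by (simp add: eform_pull_def fun_eq_iff)

lemma eform_pull_lincomb: "eform_pull m V f (a *\<^sub>R \<omega> + b *\<^sub>R \<omega>') = a *\<^sub>R eform_pull m V f \<omega> + b *\<^sub>R eform_pull m V f \<omega>'"
  by (simp add: eform_pull_def fun_eq_iff)

lemma dforms_lincomb:
  assumes D: "D \<subseteq> params X" and "\<gamma> \<in> dforms D k" "\<gamma>' \<in> dforms D k"
  shows "a *\<^sub>R \<gamma> + b *\<^sub>R \<gamma>' \<in> dforms D k"
proof (rule dformsI)
  have e: "(a *\<^sub>R \<gamma> + b *\<^sub>R \<gamma>') p = a *\<^sub>R \<gamma> p + b *\<^sub>R \<gamma>' p" for p by (simp only: plus_fun_apply scaleR_fun_def)
  show "(a *\<^sub>R \<gamma> + b *\<^sub>R \<gamma>') p = 0" if "p \<notin> D" for p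
    unfolding e dforms_zero[OF assms(2) that] dforms_zero[OF assms(3) that] by simp
  show "(a *\<^sub>R \<gamma> + b *\<^sub>R \<gamma>') (n, U, \<alpha>) \<in> eforms n U k" if p: "(n, U, \<alpha>) \<in> D" for n U \<alpha>
    unfolding e by (rule eforms_lincomb) (use p D assms dforms_eform in \<open>auto simp: params_def\<close>)
  show "(a *\<^sub>R \<gamma> + b *\<^sub>R \<gamma>') (m, V, restrict (\<alpha> \<circ> f) V) = eform_pull m V f ((a *\<^sub>R \<gamma> + b *\<^sub>R \<gamma>') (n, U, \<alpha>))"
    if *: "(n, U, \<alpha>) \<in> D" "openin (Euclidean_space m) V" "smooth_between m V n U f" for n U \<alpha> m V f
    unfolding e eform_pull_lincomb dforms_pull[OF assms(2) *] dforms_pull[OF assms(3) *] ..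
qed

lemma zero_dforms: "0 \<in> dforms D k"
  by (rule dformsI) (simp_all only: zero_fun_apply zero_eforms' eform_pull_zero)

lemma subspace_lincombI:
  assumes "0 \<in> S" "\<And>x y a b. x \<in> S \<Longrightarrow> y \<in> S \<Longrightarrow> a *\<^sub>R x + b *\<^sub>R y \<in> S"
  shows "subspace S"
  unfolding subspace_def
proof safe
  show "x + y \<in> S" if "x \<in> S" "y \<in> S" for x y using assms(2)[OF that, of 1 1] by (simp only: scaleR_one)
  show "c *\<^sub>R x \<in> S" if "x \<in> S" for c x using assms(2)[OF that that, of c 0] by (simp only: scaleR_zero_left add_0_right)
qed (rule assms(1))

lemma dform_d_apply: "dform_d \<gamma> (n, U, \<alpha>) = eform_d n U (\<gamma> (n, U, \<alpha>))"
  by (simp add: dform_d_def)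

lemma dform_d_in:
  assumes D: "D \<subseteq> params X" and "\<gamma> \<in> dforms D k"
  shows "dform_d \<gamma> \<in> dforms D (Suc k)"
proof (rule dformsI)
  show "dform_d \<gamma> p = 0" if "p \<notin> D" for p
    using dforms_zero[OF assms(2) that] by (cases p) (simp only: dform_d_apply eform_d_zero)
  have op: "openin (Euclidean_space n) U" if "(n, U, \<alpha>) \<in> D" for n U \<alpha>
    using that D by (auto simp: params_def)
  show "dform_d \<gamma> (n, U, \<alpha>) \<in> eforms n U (Suc k)" if p: "(n, U, \<alpha>) \<in> D" for n U \<alpha>
    unfolding dform_d_apply by (rule eform_d_in[OF op[OF p] dforms_eform[OF assms(2) p]])
  show "dform_d \<gamma> (m, V, restrict (\<alpha> \<circ> f) V) = eform_pull m V f (dform_d \<gamma> (n, U, \<alpha>))"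
    if *: "(n, U, \<alpha>) \<in> D" "openin (Euclidean_space m) V" "smooth_between m V n U f" for n U \<alpha> m V f
    unfolding dform_d_apply dforms_pull[OF assms(2) *]
    by (rule eform_d_pull[OF *(2) op[OF *(1)] *(3) dforms_eform[OF assms(2) *(1)]])
qed

lemma dform_d_lincomb:
  assumes D: "D \<subseteq> params X" and "\<gamma> \<in> dforms D k" "\<gamma>' \<in> dforms D k"
  shows "dform_d (a *\<^sub>R \<gamma> + b *\<^sub>R \<gamma>') = a *\<^sub>R dform_d \<gamma> + b *\<^sub>R dform_d \<gamma>'"
proof
  have e: "(a *\<^sub>R \<gamma> + b *\<^sub>R \<gamma>') p = a *\<^sub>R \<gamma> p + b *\<^sub>R \<gamma>' p" for p and \<gamma> \<gamma>' :: "'a dform"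
    by (simp only: plus_fun_apply scaleR_fun_def)
  fix p :: "'a param"
  obtain n U \<alpha> where p: "p = (n, U, \<alpha>)" by (cases p)
  show "dform_d (a *\<^sub>R \<gamma> + b *\<^sub>R \<gamma>') p = (a *\<^sub>R dform_d \<gamma> + b *\<^sub>R dform_d \<gamma>') p"
  proof (cases "p \<in> D")
    case True
    then have "openin (Euclidean_space n) U" using D p by (auto simp: params_def)
    then show ?thesis unfolding e p dform_d_apply
      by (rule eform_d_lincomb) (use True p assms dforms_eform in blast)+
  next
    case False
    then have "\<gamma> p = 0" "\<gamma>' p = 0" using assms dforms_zero by blast+
    then show ?thesis unfolding e p dform_d_apply by (simp only: scaleR_zero_right add_0_right eform_d_zero)
  qed
qed

lemma dform_d_d:
  assumes D: "D \<subseteq> params X" and "\<gamma> \<in> dforms D k"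
  shows "dform_d (dform_d \<gamma>) = 0"
proof
  fix p :: "'a param"
  obtain n U \<alpha> where p: "p = (n, U, \<alpha>)" by (cases p)
  have "eform_d n U (eform_d n U (\<gamma> p)) = 0"
  proof (cases "p \<in> D")
    case True
    then have "openin (Euclidean_space n) U" "\<gamma> p \<in> eforms n U k"
      using D p dforms_eform[OF assms(2)] by (auto simp: params_def)
    then show ?thesis by (rule eform_d_d)
  next
    case False
    then have "\<gamma> p = 0" using assms dforms_zero by blast
    then show ?thesis by (simp only: eform_d_zero)
  qed
  then show "dform_d (dform_d \<gamma>) p = 0 p" unfolding p dform_d_apply by (simp only: zero_fun_apply)
qed

lemma cochain_complex_subcomplex:
  assumes "D \<subseteq> params X" "\<And>k. C k \<subseteq> dforms D k" "\<And>k. subspace (C k)" "\<And>k \<gamma>. \<gamma> \<in> C k \<Longrightarrow> dform_d \<gamma> \<in> C (Suc k)"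
  shows "cochain_complex C dform_d"
  unfolding cochain_complex_def linear_map_on_def
proof (intro allI conjI ballI)
  show "dform_d (a *\<^sub>R x + b *\<^sub>R y) = a *\<^sub>R dform_d x + b *\<^sub>R dform_d y" if "x \<in> C k" "y \<in> C k" for k x y a b
    by (rule dform_d_lincomb[OF assms(1)]) (use that assms(2) in auto)
  show "dform_d (dform_d x) = 0" if "x \<in> C k" for k x
    by (rule dform_d_d[OF assms(1)]) (use that assms(2) in auto)
qed (use assms in auto)

lemma cochain_complex_dforms: "D \<subseteq> params X \<Longrightarrow> cochain_complex (dforms D) dform_d"
  by (rule cochain_complex_subcomplex)
    (auto intro: dform_d_in subspace_lincombI zero_dforms dforms_lincomb)

text \<open>\<open>D\<close> is an arbitrary set of parametrizations here. As
  \<open>dform_pull\<close> is 0 off \<open>D\<close>, naturality requires that composites with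
  smooth maps stay in \<open>D\<close>, which is the hypothesis \<open>comp\<close>.\<close>

lemma dform_pull_in:
  assumes sm: "param_comp f ` D \<subseteq> E"
    and comp: "\<And>n U \<alpha> m V g. (n, U, \<alpha>) \<in> D \<Longrightarrow> openin (Euclidean_space m) V \<Longrightarrow> smooth_between m V n U g \<Longrightarrow>
       (m, V, restrict (\<alpha> \<circ> g) V) \<in> D"
    and \<gamma>: "\<gamma> \<in> dforms E k"
  shows "dform_pull D f \<gamma> \<in> dforms D k"
proof (rule dformsI)
  show "dform_pull D f \<gamma> p = 0" if "p \<notin> D" for p using that by (simp only: dform_pull_def if_False)
  have E: "(n, U, restrict (f \<circ> \<alpha>) U) \<in> E" if "(n, U, \<alpha>) \<in> D" for n U \<alpha>
    using sm that unfolding param_comp_def by fastforce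
  have val: "dform_pull D f \<gamma> (n, U, \<alpha>) = \<gamma> (n, U, restrict (f \<circ> \<alpha>) U)" if "(n, U, \<alpha>) \<in> D" for n U \<alpha>
    using that by (simp add: dform_pull_def param_comp_def)
  show "dform_pull D f \<gamma> (n, U, \<alpha>) \<in> eforms n U k" if "(n, U, \<alpha>) \<in> D" for n U \<alpha>
    unfolding val[OF that] by (rule dforms_eform[OF \<gamma> E[OF that]])
  show "dform_pull D f \<gamma> (m, V, restrict (\<alpha> \<circ> g) V) = eform_pull m V g (dform_pull D f \<gamma> (n, U, \<alpha>))"
    if *: "(n, U, \<alpha>) \<in> D" "openin (Euclidean_space m) V" "smooth_between m V n U g" for n U \<alpha> m V g
  proof -
    have "restrict (f \<circ> restrict (\<alpha> \<circ> g) V) V = restrict (restrict (f \<circ> \<alpha>) U \<circ> g) V"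
      using *(3) by (auto simp: fun_eq_iff smooth_between_def)
    then show ?thesis
      unfolding val[OF *(1)] val[OF comp[OF *]] using dforms_pull[OF \<gamma> E[OF *(1)] *(2,3)] by simp
  qed
qed

lemma dform_pull_lincomb:
  "dform_pull D f (a *\<^sub>R \<gamma> + b *\<^sub>R \<gamma>') = a *\<^sub>R dform_pull D f \<gamma> + b *\<^sub>R dform_pull D f \<gamma>'"
  by (simp add: dform_pull_def fun_eq_iff)

lemma dform_pull_d: "dform_pull D f (dform_d \<gamma>) = dform_d (dform_pull D f \<gamma>)"
proof
  fix p :: "'a param"
  obtain n U \<alpha> where p: "p = (n, U, \<alpha>)" by (cases p)
  show "dform_pull D f (dform_d \<gamma>) p = dform_d (dform_pull D f \<gamma>) p"
    unfolding p dform_d_apply by (auto simp: dform_pull_def param_comp_def dform_d_apply simp del: zero_fun_apply)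
qed

text \<open>Restricting a plot is composing it with an inclusion, whose tangent map fixes exactly
  the vectors of \<open>Rn n\<close>. This makes all later comparisons of forms local.\<close>

lemma dforms_restrict:
  assumes \<gamma>: "\<gamma> \<in> dforms D k" and p: "(n, U, \<alpha>) \<in> D" and V: "openin (Euclidean_space n) V" "V \<subseteq> U"
    and x: "x \<in> V" and vs: "set vs \<subseteq> Rn n"
  shows "\<gamma> (n, V, restrict \<alpha> V) x vs = \<gamma> (n, U, \<alpha>) x vs"
proof -
  have "restrict (\<alpha> \<circ> (\<lambda>x. x)) V = restrict \<alpha> V" by (auto simp: fun_eq_iff)
  then have "\<gamma> (n, V, restrict \<alpha> V) = eform_pull n V (\<lambda>x. x) (\<gamma> (n, U, \<alpha>))"
    using dforms_pull[OF \<gamma> p V(1) smooth_between_id[OF V(2)]] by simp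
  moreover have "map (tangent_map n (\<lambda>x. x) x) vs = vs"
  proof (rule map_idI)
    fix v assume "v \<in> set vs"
    then have v: "v \<in> Rn n" using vs by auto
    show "tangent_map n (\<lambda>x. x) x v = v"
      by (rule Rn_ext[OF tangent_map_Rn[OF V(1) x] v])
        (use openin_E_subset[OF V(1)] in \<open>auto simp: tangent_map_def dir_deriv_proj\<close>)
  qed
  ultimately show ?thesis using x vs by (simp add: eform_pull_def)
qed

section \<open>Isomorphisms of complexes induce isomorphisms in cohomology\<close>

lemma coboundaries_subspace:
  assumes "cochain_complex C d" shows "subspace (coboundaries C d k)"
proof (cases k)
  case (Suc j)
  have C: "subspace (C j)" and lin: "linear_map_on (C j) d" using assms by (auto simp: cochain_complex_def)
  have "subspace (d ` C j)"
  proof (rule subspace_lincombI)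
    have "d 0 = 0" using lin subspace_0[OF C] unfolding linear_map_on_def
      by (metis add.right_neutral scaleR_zero_left)
    then show "0 \<in> d ` C j" using subspace_0[OF C] by force
    fix x y and a b :: real assume "x \<in> d ` C j" "y \<in> d ` C j"
    then obtain u v where "u \<in> C j" "v \<in> C j" "x = d u" "y = d v" by blast
    then show "a *\<^sub>R x + b *\<^sub>R y \<in> d ` C j"
      using lin C unfolding linear_map_on_def
      by (metis imageI subspace_add subspace_mul)
  qed
  then show ?thesis using Suc by (simp add: coboundaries_def)
qed (simp add: coboundaries_def subspace_0)

lemma cocycles_subspace:
  assumes "cochain_complex C d" shows "subspace (cocycles C d k)"
proof -
  have C: "subspace (C k)" and lin: "linear_map_on (C k) d" using assms by (auto simp: cochain_complex_def)
  show ?thesis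
  proof (rule subspace_lincombI)
    have "d 0 = 0" using lin subspace_0[OF C] unfolding linear_map_on_def
      by (metis add.right_neutral scaleR_zero_left)
    then show "0 \<in> cocycles C d k" using subspace_0[OF C] by (simp add: cocycles_def)
    fix x y and a b :: real assume "x \<in> cocycles C d k" "y \<in> cocycles C d k"
    then show "a *\<^sub>R x + b *\<^sub>R y \<in> cocycles C d k"
      using lin C unfolding linear_map_on_def cocycles_def
      by (simp add: subspace_add subspace_mul)
  qed
qed

lemma equiv_cohomologous:
  assumes "cochain_complex C d" shows "equiv (cocycles C d k) (cohomologous C d k)"
proof -
  note B = coboundaries_subspace[OF assms, of k]
  show ?thesis
  proof (rule equivI)
    show "cohomologous C d k \<subseteq> cocycles C d k \<times> cocycles C d k" by (auto simp: cohomologous_def)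
    show "refl_on (cocycles C d k) (cohomologous C d k)"
      using subspace_0[OF B] by (auto simp: refl_on_def cohomologous_def)
    show "sym (cohomologous C d k)"
    proof (rule symI)
      fix x y assume "(x, y) \<in> cohomologous C d k"
      then show "(y, x) \<in> cohomologous C d k"
        using subspace_neg[OF B, of "x - y"] by (auto simp: cohomologous_def)
    qed
    show "trans (cohomologous C d k)"
    proof (rule transI)
      fix x y z assume "(x, y) \<in> cohomologous C d k" "(y, z) \<in> cohomologous C d k"
      then show "(x, z) \<in> cohomologous C d k"
        using subspace_add[OF B, of "x - y" "y - z"] by (auto simp: cohomologous_def)
    qed
  qed
qed

text \<open>Operations on classes are unions over representatives; such a union collapses to one
  term when all representatives contribute the same set.\<close>

lemma Union_equiv_class:
  assumes "equiv A r" "S = r `` {x}" "x \<in> A" "\<And>y. (x, y) \<in> r \<Longrightarrow> F y = F x"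
  shows "(\<Union>y\<in>S. F y) = F x"
proof -
  have "x \<in> S" using equiv_class_self[OF assms(1,3)] assms(2) by simp
  moreover have "F y = F x" if "y \<in> S" for y using that assms(2,4) by (simp only: Image_singleton_iff)
  ultimately show ?thesis by (metis (no_types, lifting) SUP_eq_const empty_iff)
qed

lemma cohomology_add_class:
  assumes C: "cochain_complex C d" and x: "x \<in> cocycles C d k" and y: "y \<in> cocycles C d k"
  shows "cohomology_add C d k (cohomologous C d k `` {x}) (cohomologous C d k `` {y}) = cohomologous C d k `` {x + y}"
proof -
  note E = equiv_cohomologous[OF C, of k] and B = coboundaries_subspace[OF C, of k] and Z = cocycles_subspace[OF C, of k]
  have *: "cohomologous C d k `` {x' + y'} = cohomologous C d k `` {x + y}"
    if "(x, x') \<in> cohomologous C d k" "(y, y') \<in> cohomologous C d k" for x' y'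
  proof (rule equiv_class_eq[OF E, symmetric])
    have "(x - x') + (y - y') \<in> coboundaries C d k"
      using that by (intro subspace_add[OF B]) (auto simp: cohomologous_def)
    moreover have "(x - x') + (y - y') = (x + y) - (x' + y')" by simp
    ultimately show "(x + y, x' + y') \<in> cohomologous C d k"
      using that subspace_add[OF Z] by (auto simp: cohomologous_def)
  qed
  have xy: "(x, x) \<in> cohomologous C d k" "(y, y) \<in> cohomologous C d k"
    using x y subspace_0[OF B] by (simp_all add: cohomologous_def)
  show ?thesis unfolding cohomology_add_def
  proof (intro equalityI subsetI)
    fix z assume "z \<in> (\<Union>x'\<in>cohomologous C d k `` {x}. \<Union>y'\<in>cohomologous C d k `` {y}. cohomologous C d k `` {x' + y'})"
    then obtain x' y' where "(x, x') \<in> cohomologous C d k" "(y, y') \<in> cohomologous C d k"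
      "z \<in> cohomologous C d k `` {x' + y'}" by (elim UN_E) (simp only: Image_singleton_iff)
    then show "z \<in> cohomologous C d k `` {x + y}" using * by simp
  next
    fix z assume "z \<in> cohomologous C d k `` {x + y}"
    then show "z \<in> (\<Union>x'\<in>cohomologous C d k `` {x}. \<Union>y'\<in>cohomologous C d k `` {y}. cohomologous C d k `` {x' + y'})"
      using xy by (intro UN_I[of x] UN_I[of y]) simp_all
  qed
qed

lemma cohomology_scale_class:
  assumes C: "cochain_complex C d" and x: "x \<in> cocycles C d k"
  shows "cohomology_scale C d k a (cohomologous C d k `` {x}) = cohomologous C d k `` {a *\<^sub>R x}"
proof -
  note E = equiv_cohomologous[OF C, of k] and B = coboundaries_subspace[OF C, of k] and Z = cocycles_subspace[OF C, of k]
  have *: "cohomologous C d k `` {a *\<^sub>R x'} = cohomologous C d k `` {a *\<^sub>R x}"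
    if "(x, x') \<in> cohomologous C d k" for x'
  proof (rule equiv_class_eq[OF E, symmetric])
    have "a *\<^sub>R (x - x') \<in> coboundaries C d k"
      using that by (intro subspace_mul[OF B]) (auto simp: cohomologous_def)
    then show "(a *\<^sub>R x, a *\<^sub>R x') \<in> cohomologous C d k"
      using that subspace_mul[OF Z] by (auto simp: cohomologous_def scaleR_diff_right)
  qed
  have xx: "(x, x) \<in> cohomologous C d k" using x subspace_0[OF B] by (simp add: cohomologous_def)
  show ?thesis unfolding cohomology_scale_def
  proof (intro equalityI subsetI)
    fix z assume "z \<in> (\<Union>x'\<in>cohomologous C d k `` {x}. cohomologous C d k `` {a *\<^sub>R x'})"
    then obtain x' where "(x, x') \<in> cohomologous C d k" "z \<in> cohomologous C d k `` {a *\<^sub>R x'}"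
      by (elim UN_E) (simp only: Image_singleton_iff)
    then show "z \<in> cohomologous C d k `` {a *\<^sub>R x}" using * by simp
  next
    fix z assume "z \<in> cohomologous C d k `` {a *\<^sub>R x}"
    then show "z \<in> (\<Union>x'\<in>cohomologous C d k `` {x}. cohomologous C d k `` {a *\<^sub>R x'})"
      using xx by (intro UN_I[of x]) simp_all
  qed
qed

text \<open>Bijectivity in the neighbouring degrees makes the cochain map detect both cocycles
  (\<open>coc\<close>) and coboundaries (\<open>cob\<close>), so it preserves and reflects the
  relation of being cohomologous.\<close>

lemma cohomology_iso_of_cochain_iso:
  assumes iso: "cochain_iso C d C' d' f"
  shows "cohomology_iso C d C' d' k (cohomology_map C' d' k f)"
proof -
  have C: "cochain_complex C d" and C': "cochain_complex C' d'"
    and lin: "\<And>k. linear_map_on (C k) f" and bij: "\<And>k. bij_betw f (C k) (C' k)"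
    and comm: "\<And>k x. x \<in> C k \<Longrightarrow> f (d x) = d' (f x)"
    using iso by (auto simp: cochain_iso_def)
  let ?R = "cohomologous C d k" and ?R' = "cohomologous C' d' k"
  have sub: "subspace (C k)" for k using C by (simp add: cochain_complex_def)
  have dC: "d x \<in> C (Suc k)" if "x \<in> C k" for x k using C that by (auto simp: cochain_complex_def)
  have f0: "f 0 = 0" using lin[of 0] subspace_0[OF sub[of 0]] unfolding linear_map_on_def
    by (metis add.right_neutral scaleR_zero_left)
  have flin: "f (a *\<^sub>R x + b *\<^sub>R y) = a *\<^sub>R f x + b *\<^sub>R f y" if "x \<in> C k" "y \<in> C k" for k x y a b
    using lin that unfolding linear_map_on_def by blast
  have fC: "f x \<in> C' k" if "x \<in> C k" for x k using bij that by (auto simp: bij_betw_def)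
  have inj: "f x = f y \<longleftrightarrow> x = y" if "x \<in> C k" "y \<in> C k" for k x y
    using bij[of k] that by (auto simp: bij_betw_def inj_on_def)
  have coc: "f x \<in> cocycles C' d' k \<longleftrightarrow> x \<in> cocycles C d k" if "x \<in> C k" for x
    using that fC comm[OF that] inj[OF dC[OF that] subspace_0[OF sub]] f0 by (auto simp: cocycles_def)
  have cob: "f x \<in> coboundaries C' d' k \<longleftrightarrow> x \<in> coboundaries C d k" if x: "x \<in> C k" for x
  proof (cases k)
    \<comment> \<open>In degree 0 the only coboundary is 0, so injectivity decides instead of
      surjectivity in the degree below.\<close>
    case 0
    then show ?thesis using inj[OF x subspace_0[OF sub]] f0 by (simp add: coboundaries_def)
  next
    case (Suc j)
    have "C' j = f ` C j" using bij[of j] by (simp add: bij_betw_def)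
    then have "f x \<in> d' ` C' j \<longleftrightarrow> (\<exists>y\<in>C j. f x = d' (f y))" by auto
    also have "\<dots> \<longleftrightarrow> (\<exists>y\<in>C j. x = d y)"
      using comm inj[OF x] dC Suc by metis
    finally show ?thesis using Suc by (auto simp: coboundaries_def)
  qed
  have R: "(f x, f y) \<in> ?R' \<longleftrightarrow> (x, y) \<in> ?R" if "x \<in> C k" "y \<in> C k" for x y
  proof -
    have "f x - f y = f (x - y)" using flin[OF that, of 1 "-1"] by simp
    then show ?thesis using coc that cob[OF subspace_diff[OF sub that]] by (simp add: cohomologous_def)
  qed
  note E = equiv_cohomologous[OF C, of k] and E' = equiv_cohomologous[OF C', of k]
  have cocC: "x \<in> C k" if "x \<in> cocycles C d k" for x using that by (simp add: cocycles_def)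
  let ?F = "cohomology_map C' d' k f"
  have F: "?F (?R `` {x}) = ?R' `` {f x}" if x: "x \<in> cocycles C d k" for x
    unfolding cohomology_map_def
  proof (rule Union_equiv_class[OF E refl x])
    fix y assume y: "(x, y) \<in> ?R"
    then have "y \<in> C k" using cocC by (auto simp: cohomologous_def)
    then show "?R' `` {f y} = ?R' `` {f x}"
      using R[OF cocC[OF x]] y equiv_class_eq[OF E'] by metis
  qed
  have rep: "\<exists>x\<in>cocycles C d k. S = ?R `` {x}" if "S \<in> cohomology C d k" for S
    using that by (auto simp: cohomology_def quotient_def)
  have "bij_betw ?F (cohomology C d k) (cohomology C' d' k)"
    unfolding bij_betw_def
  proof
    show "inj_on ?F (cohomology C d k)"
    proof (rule inj_onI)
      fix S T assume "S \<in> cohomology C d k" "T \<in> cohomology C d k" and eq: "?F S = ?F T"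
      then obtain x y where x: "x \<in> cocycles C d k" "S = ?R `` {x}" and y: "y \<in> cocycles C d k" "T = ?R `` {y}"
        using rep by metis
      have "?R' `` {f x} = ?R' `` {f y}" using eq F x y by simp
      then have "(f x, f y) \<in> ?R'"
        using eq_equiv_class_iff[OF E'] x y coc cocC by metis
      then show "S = T" using R[OF cocC[OF x(1)] cocC[OF y(1)]] equiv_class_eq[OF E] x y by metis
    qed
    show "?F ` cohomology C d k = cohomology C' d' k"
    proof
      show "?F ` cohomology C d k \<subseteq> cohomology C' d' k"
        using rep F coc cocC by (force simp: cohomology_def quotient_def)
      show "cohomology C' d' k \<subseteq> ?F ` cohomology C d k"
      proof
        fix S assume "S \<in> cohomology C' d' k"
        then obtain z where z: "z \<in> cocycles C' d' k" "S = ?R' `` {z}"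
          by (auto simp: cohomology_def quotient_def)
        then obtain x where x: "x \<in> C k" "z = f x"
          using bij[of k] by (auto simp: cocycles_def bij_betw_def)
        then have "x \<in> cocycles C d k" using coc z by simp
        then show "S \<in> ?F ` cohomology C d k"
          using F x z by (force simp: cohomology_def quotient_def)
      qed
    qed
  qed
  moreover have "?F (cohomology_add C d k S T) = cohomology_add C' d' k (?F S) (?F T)"
    if S: "S \<in> cohomology C d k" and T: "T \<in> cohomology C d k" for S T
  proof -
    obtain x y where x: "x \<in> cocycles C d k" "S = ?R `` {x}" and y: "y \<in> cocycles C d k" "T = ?R `` {y}"
      using rep[OF S] rep[OF T] by blast
    have "x + y \<in> cocycles C d k" by (rule subspace_add[OF cocycles_subspace[OF C] x(1) y(1)])
    moreover have "f (x + y) = f x + f y" using flin[OF cocC[OF x(1)] cocC[OF y(1)], of 1 1] by simp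
    ultimately show ?thesis
      using x y F coc cocC by (simp add: cohomology_add_class[OF C] cohomology_add_class[OF C'])
  qed
  moreover have "?F (cohomology_scale C d k a S) = cohomology_scale C' d' k a (?F S)"
    if S: "S \<in> cohomology C d k" for a S
  proof -
    obtain x where x: "x \<in> cocycles C d k" "S = ?R `` {x}" using rep[OF S] by blast
    have "a *\<^sub>R x \<in> cocycles C d k" by (rule subspace_mul[OF cocycles_subspace[OF C] x(1)])
    moreover have "f (a *\<^sub>R x) = a *\<^sub>R f x" using flin[OF cocC[OF x(1)] cocC[OF x(1)], of a 0] by simp
    ultimately show ?thesis
      using x F coc cocC by (simp add: cohomology_scale_class[OF C] cohomology_scale_class[OF C'])
  qed
  ultimately show ?thesis unfolding cohomology_iso_def by blast
qed

section \<open>Plots of manifolds\<close>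

text \<open>Collects what composing plots with smooth maps uses. For the product of \<open>M\<close>
  and \<open>H\<close>, the source of the action map, exactly these properties are verified in
  \<open>premanifold_prod\<close>.\<close>

definition premanifold :: "'a manifold \<Rightarrow> bool" where
  "premanifold M \<longleftrightarrow> topspace (mtop M) = (\<Union>(U, \<phi>)\<in>atlas M. U) \<and>
     (\<forall>(U, \<phi>)\<in>atlas M. openin (mtop M) U \<and> openin (Euclidean_space (mdim M)) (\<phi> ` U) \<and> inj_on \<phi> U \<and>
        continuous_map (subtopology (Euclidean_space (mdim M)) (\<phi> ` U)) (mtop M) (inv_into U \<phi>))"

text \<open>Smoothness of a map from an open set, tested in the charts of the target alone. There is
  no extensionality, so composites can be formed without \<open>restrict\<close>;
  \<open>manifold_diffeology_iff\<close> is the link to the official plots.\<close>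

definition plot :: "'a manifold \<Rightarrow> nat \<Rightarrow> (nat \<Rightarrow> real) set \<Rightarrow> ((nat \<Rightarrow> real) \<Rightarrow> 'a) \<Rightarrow> bool" where
  "plot M n U \<alpha> \<longleftrightarrow> openin (Euclidean_space n) U \<and>
     continuous_map (subtopology (Euclidean_space n) U) (mtop M) \<alpha> \<and>
     (\<forall>(V, \<psi>)\<in>atlas M. \<forall>j<mdim M. smooth_fun n {x\<in>U. \<alpha> x \<in> V} (\<lambda>x. \<psi> (\<alpha> x) j))"

lemma smooth_manifold_premanifold:
  assumes "smooth_manifold M" shows "premanifold M"
proof -
  have "inj_on \<phi> U \<and> continuous_map (subtopology (Euclidean_space (mdim M)) (\<phi> ` U)) (mtop M) (inv_into U \<phi>)"
    if "(U, \<phi>) \<in> atlas M" for U \<phi>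
  proof -
    have U: "openin (mtop M) U" "openin (Euclidean_space (mdim M)) (\<phi> ` U)"
      and h: "homeomorphic_map (subtopology (mtop M) U) (subtopology (Euclidean_space (mdim M)) (\<phi> ` U)) \<phi>"
      using assms that by (auto simp: smooth_manifold_def)
    have ts: "topspace (subtopology (mtop M) U) = U" using openin_subset[OF U(1)] by auto
    have tsE: "topspace (subtopology (Euclidean_space (mdim M)) (\<phi> ` U)) = \<phi> ` U"
      using openin_subset[OF U(2)] by auto
    have inj: "inj_on \<phi> U" using h ts by (metis homeomorphic_imp_injective_map)
    obtain g where g: "homeomorphic_maps (subtopology (mtop M) U) (subtopology (Euclidean_space (mdim M)) (\<phi> ` U)) \<phi> g"
      using h by (metis homeomorphic_map_maps)
    then have "continuous_map (subtopology (Euclidean_space (mdim M)) (\<phi> ` U)) (subtopology (mtop M) U) g"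
      and gl: "\<And>x. x \<in> U \<Longrightarrow> g (\<phi> x) = x"
      using ts by (auto simp: homeomorphic_maps_def)
    then have "continuous_map (subtopology (Euclidean_space (mdim M)) (\<phi> ` U)) (mtop M) g"
      by (simp add: continuous_map_in_subtopology)
    then have "continuous_map (subtopology (Euclidean_space (mdim M)) (\<phi> ` U)) (mtop M) (inv_into U \<phi>)"
      by (rule continuous_map_eq) (use tsE gl inj in auto)
    then show ?thesis using inj by simp
  qed
  then show ?thesis using assms unfolding premanifold_def smooth_manifold_def by auto
qed

lemma premanifold_chart:
  assumes "premanifold M" "(U, \<phi>) \<in> atlas M"
  shows "openin (mtop M) U" "openin (Euclidean_space (mdim M)) (\<phi> ` U)" "inj_on \<phi> U"
    "continuous_map (subtopology (Euclidean_space (mdim M)) (\<phi> ` U)) (mtop M) (inv_into U \<phi>)"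
  using assms unfolding premanifold_def by auto

lemma premanifold_cover:
  assumes "premanifold M" "p \<in> topspace (mtop M)"
  obtains U \<phi> where "(U, \<phi>) \<in> atlas M" "p \<in> U"
  using assms unfolding premanifold_def by auto

lemma openin_E_continuous_preimage:
  assumes "openin (Euclidean_space n) U" "continuous_map (subtopology (Euclidean_space n) U) X f" "openin X W"
  shows "openin (Euclidean_space n) {x\<in>U. f x \<in> W}"
proof -
  have "topspace (subtopology (Euclidean_space n) U) = U" using openin_subset[OF assms(1)] by auto
  then have "openin (subtopology (Euclidean_space n) U) {x\<in>U. f x \<in> W}"
    using openin_continuous_map_preimage[OF assms(2,3)] by simp
  then show ?thesis using assms(1) by (simp add: openin_open_subtopology)
qed

lemma premanifold_open_image:
  assumes M: "premanifold M" "(U, \<phi>) \<in> atlas M" and O: "openin (mtop M) O'" "O' \<subseteq> U"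
  shows "openin (Euclidean_space (mdim M)) (\<phi> ` O')"
proof -
  have "openin (Euclidean_space (mdim M)) {x\<in>\<phi> ` U. inv_into U \<phi> x \<in> O'}"
    by (rule openin_E_continuous_preimage[OF premanifold_chart(2,4)[OF M] O(1)])
  moreover have "{x\<in>\<phi> ` U. inv_into U \<phi> x \<in> O'} = \<phi> ` O'"
    using premanifold_chart(3)[OF M] O(2) by auto
  ultimately show ?thesis by simp
qed

lemma plot_open: "plot M n U \<alpha> \<Longrightarrow> openin (Euclidean_space n) U"
  by (simp add: plot_def)

lemma plot_continuous: "plot M n U \<alpha> \<Longrightarrow> continuous_map (subtopology (Euclidean_space n) U) (mtop M) \<alpha>"
  by (simp add: plot_def)

lemma plot_topspace: "plot M n U \<alpha> \<Longrightarrow> x \<in> U \<Longrightarrow> \<alpha> x \<in> topspace (mtop M)"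
  using openin_subset[of "Euclidean_space n" U] unfolding plot_def continuous_map_def by auto

lemma plot_preimage: "plot M n U \<alpha> \<Longrightarrow> openin (mtop M) V \<Longrightarrow> openin (Euclidean_space n) {x\<in>U. \<alpha> x \<in> V}"
  by (rule openin_E_continuous_preimage[OF plot_open plot_continuous])

lemma plot_chart_smooth:
  "plot M n U \<alpha> \<Longrightarrow> (V, \<psi>) \<in> atlas M \<Longrightarrow> j < mdim M \<Longrightarrow> smooth_fun n {x\<in>U. \<alpha> x \<in> V} (\<lambda>x. \<psi> (\<alpha> x) j)"
  unfolding plot_def by blast

lemma plot_chart_between:
  assumes "plot M n U \<alpha>" "(V, \<psi>) \<in> atlas M"
  shows "smooth_between n {x\<in>U. \<alpha> x \<in> V} (mdim M) (\<psi> ` V) (\<lambda>x. \<psi> (\<alpha> x))"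
  unfolding smooth_between_def using plot_chart_smooth[OF assms] by auto

lemma plot_cong:
  assumes "plot M n U \<alpha>" "\<And>x. x \<in> U \<Longrightarrow> \<alpha> x = \<beta> x" "premanifold M"
  shows "plot M n U \<beta>"
  unfolding plot_def
proof (intro conjI ballI allI impI, goal_cases)
  case 1 show ?case by (rule plot_open[OF assms(1)])
next
  case 2 show ?case
    by (rule continuous_map_eq[OF plot_continuous[OF assms(1)]]) (use assms(2) in auto)
next
  case (3 c)
  obtain V \<psi> where c: "c = (V, \<psi>)" by (cases c)
  have eq: "{x\<in>U. \<beta> x \<in> V} = {x\<in>U. \<alpha> x \<in> V}" using assms(2) by auto
  have V: "(V, \<psi>) \<in> atlas M" using 3 c by simp
  have "smooth_fun n {x\<in>U. \<alpha> x \<in> V} (\<lambda>x. \<psi> (\<beta> x) j)" if j: "j < mdim M" for j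
    by (rule smooth_cong[OF plot_preimage[OF assms(1) premanifold_chart(1)[OF assms(3) V]] _ plot_chart_smooth[OF assms(1) V j]])
      (use assms(2) in auto)
  then show ?case by (simp add: c eq)
qed

lemma smooth_between_continuous_map:
  assumes U: "openin (Euclidean_space n) U" and f: "smooth_between n U m W f" and W: "W \<subseteq> Rn m"
  shows "continuous_map (subtopology (Euclidean_space n) U) (subtopology (Euclidean_space m) W) f"
proof -
  have F: "smooth_field n U m f" by (rule smooth_field_of_between[OF U f W])
  have "continuous_on U (\<lambda>x. f x j)" for j
    by (rule smooth_continuous[of n]) (use F in \<open>simp add: smooth_field_def\<close>)
  then have "continuous_on U f" by (rule continuous_on_coordinatewise_then_product)
  moreover have "f ` U \<subseteq> W" using f by (auto simp: smooth_between_def)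
  ultimately show ?thesis
    unfolding subtopology_E[OF W] subtopology_E[OF openin_E_subset[OF U]] by (simp add: continuous_map_in_subtopology image_subset_iff_funcset)
qed

lemma smooth_between_preimage:
  assumes U: "openin (Euclidean_space n) U" and f: "smooth_between n U m W f" and V: "openin (Euclidean_space m) V"
    and W: "W \<subseteq> Rn m"
  shows "openin (Euclidean_space n) {x\<in>U. f x \<in> V}"
proof -
  have "continuous_map (subtopology (Euclidean_space n) U) (Euclidean_space m) f"
    using smooth_between_continuous_map[OF U f W] by (simp add: continuous_map_in_subtopology)
  from openin_E_continuous_preimage[OF U this V] show ?thesis .
qed

lemma plot_compose:
  assumes M: "premanifold M" and \<alpha>: "plot M n U \<alpha>" and V: "openin (Euclidean_space m) V" and f: "smooth_between m V n U f"
  shows "plot M m V (\<lambda>x. \<alpha> (f x))"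
  unfolding plot_def
proof (intro conjI ballI, goal_cases)
  case 1 show ?case by (rule V)
next
  case 2
  have "continuous_map (subtopology (Euclidean_space m) V) (mtop M) (\<alpha> \<circ> f)"
    by (rule continuous_map_compose[OF smooth_between_continuous_map[OF V f openin_E_subset[OF plot_open[OF \<alpha>]]] plot_continuous[OF \<alpha>]])
  then show ?case by (simp add: comp_def)
next
  case (3 c)
  obtain W \<psi> where c: "c = (W, \<psi>)" by (cases c)
  have W: "(W, \<psi>) \<in> atlas M" using 3 c by simp
  let ?O = "{x\<in>U. \<alpha> x \<in> W}"
  have fU: "f \<in> V \<rightarrow> U" using f by (simp add: smooth_between_def)
  have O: "openin (Euclidean_space n) ?O" by (rule plot_preimage[OF \<alpha> premanifold_chart(1)[OF M W]])
  have "openin (Euclidean_space m) {x\<in>V. f x \<in> ?O}"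
    by (rule smooth_between_preimage[OF V f O openin_E_subset[OF plot_open[OF \<alpha>]]])
  moreover have eq: "{x\<in>V. f x \<in> ?O} = {x\<in>V. \<alpha> (f x) \<in> W}" using fU by auto
  ultimately have O': "openin (Euclidean_space m) {x\<in>V. \<alpha> (f x) \<in> W}" by simp
  have "smooth_fun m {x\<in>V. \<alpha> (f x) \<in> W} (\<lambda>x. \<psi> (\<alpha> (f x)) j)" if j: "j < mdim M" for j
  proof (rule smooth_comp[OF O' O _ _ plot_chart_smooth[OF \<alpha> W j]])
    show "f \<in> {x\<in>V. \<alpha> (f x) \<in> W} \<rightarrow> ?O" using fU by auto
    show "smooth_fun m {x\<in>V. \<alpha> (f x) \<in> W} (\<lambda>x. f x i)" if "i < n" for i
      using f that smooth_subset[of m V "\<lambda>x. f x i"] by (auto simp: smooth_between_def)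
  qed
  then show ?case unfolding c by simp
qed

lemma plot_subset:
  assumes "premanifold M" "plot M n U \<alpha>" "openin (Euclidean_space n) V" "V \<subseteq> U"
  shows "plot M n V \<alpha>"
  using plot_compose[OF assms(1-3) smooth_between_id[OF assms(4)]] .

lemma plot_const:
  assumes "premanifold M" "p \<in> topspace (mtop M)" "openin (Euclidean_space n) U"
  shows "plot M n U (\<lambda>x. p)"
  using assms unfolding plot_def by auto

text \<open>Near a given point the composite in a chart of \<open>N\<close> factors through the
  coordinate expression of \<open>f\<close> and that of \<open>\<alpha>\<close> in a chart of
  \<open>M\<close>; smoothness is local.\<close>

lemma plot_smooth_map:
  assumes M: "premanifold M" and N: "premanifold N" and \<alpha>: "plot M n U \<alpha>" and f: "smooth_map M N f"
  shows "plot N n U (\<lambda>x. f (\<alpha> x))"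
  unfolding plot_def
proof (intro conjI ballI, goal_cases)
  case 1 show ?case by (rule plot_open[OF \<alpha>])
next
  case 2
  have "continuous_map (mtop M) (mtop N) f" using f by (simp add: smooth_map_def)
  from continuous_map_compose[OF plot_continuous[OF \<alpha>] this] show ?case by (simp add: comp_def)
next
  case (3 c)
  obtain V \<psi> where c: "c = (V, \<psi>)" by (cases c)
  have V: "(V, \<psi>) \<in> atlas N" using 3 c by simp
  have cf: "continuous_map (mtop M) (mtop N) f" using f by (simp add: smooth_map_def)
  have fV: "openin (mtop M) {p\<in>topspace (mtop M). f p \<in> V}"
    by (rule openin_continuous_map_preimage[OF cf premanifold_chart(1)[OF N V]])
  have eq: "{x\<in>U. f (\<alpha> x) \<in> V} = {x\<in>U. \<alpha> x \<in> {p\<in>topspace (mtop M). f p \<in> V}}"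
    using plot_topspace[OF \<alpha>] by auto
  have O: "openin (Euclidean_space n) {x\<in>U. f (\<alpha> x) \<in> V}"
    unfolding eq by (rule plot_preimage[OF \<alpha> fV])
  have "smooth_fun n {x\<in>U. f (\<alpha> x) \<in> V} (\<lambda>x. \<psi> (f (\<alpha> x)) j)" if j: "j < mdim N" for j
  proof (rule smooth_local[OF O])
    fix x assume x: "x \<in> {x\<in>U. f (\<alpha> x) \<in> V}"
    then obtain W \<phi> where W: "(W, \<phi>) \<in> atlas M" "\<alpha> x \<in> W"
      using premanifold_cover[OF M plot_topspace[OF \<alpha>]] by blast
    let ?P = "{x\<in>U. f (\<alpha> x) \<in> V} \<inter> {x\<in>U. \<alpha> x \<in> W}"
    have P: "openin (Euclidean_space n) ?P"
      by (intro openin_Int O plot_preimage[OF \<alpha> premanifold_chart(1)[OF M W(1)]])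
    have "W \<inter> f -` V = W \<inter> {p\<in>topspace (mtop M). f p \<in> V}"
      using openin_subset[OF premanifold_chart(1)[OF M W(1)]] by auto
    then have Q: "openin (Euclidean_space (mdim M)) (\<phi> ` (W \<inter> f -` V))"
      using premanifold_open_image[OF M W(1)] openin_Int[OF premanifold_chart(1)[OF M W(1)] fV] by auto
    have f': "\<forall>(V, \<psi>)\<in>atlas N. smooth_between (mdim M) (\<phi> ` (W \<inter> f -` V)) (mdim N) (\<psi> ` V) (\<psi> \<circ> f \<circ> inv_into W \<phi>)"
      using bspec[OF conjunct2[OF f[unfolded smooth_map_def]] W(1)] by (simp only: prod.case)
    have g: "smooth_fun (mdim M) (\<phi> ` (W \<inter> f -` V)) (\<lambda>z. (\<psi> \<circ> f \<circ> inv_into W \<phi>) z j)"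
      using bspec[OF f' V] j by (simp only: prod.case smooth_between_def)
    have "smooth_fun n ?P (\<lambda>x. (\<psi> \<circ> f \<circ> inv_into W \<phi>) (\<phi> (\<alpha> x)) j)"
    proof (rule smooth_comp[OF P Q _ _ g])
      show "(\<lambda>x. \<phi> (\<alpha> x)) \<in> ?P \<rightarrow> \<phi> ` (W \<inter> f -` V)" by auto
      show "smooth_fun n ?P (\<lambda>x. \<phi> (\<alpha> x) i)" if "i < mdim M" for i
        by (rule smooth_subset[OF plot_chart_smooth[OF \<alpha> W(1) that]]) auto
    qed
    then have "smooth_fun n ?P (\<lambda>x. \<psi> (f (\<alpha> x)) j)"
      by (rule smooth_cong[OF P, rotated]) (use premanifold_chart(3)[OF M W(1)] in auto)
    then show "\<exists>T. openin (Euclidean_space n) T \<and> x \<in> T \<and> T \<subseteq> {x\<in>U. f (\<alpha> x) \<in> V} \<and> smooth_fun n T (\<lambda>x. \<psi> (f (\<alpha> x)) j)"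
      using P x W(2) by (intro exI[of _ ?P]) auto
  qed
  then show ?case unfolding c by simp
qed

lemma plot_chart:
  assumes M: "smooth_manifold M" and U: "(U, \<phi>) \<in> atlas M"
  shows "plot M (mdim M) (\<phi> ` U) (inv_into U \<phi>)"
  unfolding plot_def
proof (intro conjI ballI, goal_cases)
  case 1 show ?case by (rule premanifold_chart(2)[OF smooth_manifold_premanifold[OF M] U])
next
  case 2 show ?case by (rule premanifold_chart(4)[OF smooth_manifold_premanifold[OF M] U])
next
  case (3 c)
  obtain V \<psi> where c: "c = (V, \<psi>)" by (cases c)
  have "smooth_between (mdim M) (\<phi> ` (U \<inter> V)) (mdim M) (\<psi> ` (U \<inter> V)) (\<psi> \<circ> inv_into U \<phi>)"
    using M U 3 c by (auto simp: smooth_manifold_def)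
  moreover have "{x\<in>\<phi> ` U. inv_into U \<phi> x \<in> V} = \<phi> ` (U \<inter> V)"
    using premanifold_chart(3)[OF smooth_manifold_premanifold[OF M] U] by auto
  ultimately show ?case unfolding c by (simp add: smooth_between_def)
qed

lemma plot_Pair:
  assumes M: "premanifold M" and N: "premanifold N" and \<alpha>: "plot M n U \<alpha>" and \<beta>: "plot N n U \<beta>"
  shows "plot (prod_manifold M N) n U (\<lambda>x. (\<alpha> x, \<beta> x))"
  unfolding plot_def
proof (intro conjI ballI, goal_cases)
  case 1 show ?case by (rule plot_open[OF \<alpha>])
next
  case 2 show ?case
    using plot_continuous[OF \<alpha>] plot_continuous[OF \<beta>] by (simp add: prod_manifold_def continuous_map_pairwise comp_def)
next
  case (3 c)
  then obtain V \<phi> W \<psi> where c: "c = (V \<times> W, \<lambda>(x, y) i. if i < mdim M then \<phi> x i else \<psi> y (i - mdim M))"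
    and V: "(V, \<phi>) \<in> atlas M" and W: "(W, \<psi>) \<in> atlas N" by (auto simp: prod_manifold_def)
  have "smooth_fun n {x\<in>U. (\<alpha> x, \<beta> x) \<in> V \<times> W} (\<lambda>x. if j < mdim M then \<phi> (\<alpha> x) j else \<psi> (\<beta> x) (j - mdim M))"
    if j: "j < mdim M + mdim N" for j
  proof (cases "j < mdim M")
    case True
    then show ?thesis using smooth_subset[OF plot_chart_smooth[OF \<alpha> V True], of "{x\<in>U. (\<alpha> x, \<beta> x) \<in> V \<times> W}"] by auto
  next
    case False
    then have "j - mdim M < mdim N" using j by simp
    from smooth_subset[OF plot_chart_smooth[OF \<beta> W this], of "{x\<in>U. (\<alpha> x, \<beta> x) \<in> V \<times> W}"] False show ?thesis by auto
  qed
  then show ?case unfolding c by (simp add: prod_manifold_def)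
qed

section \<open>Concatenated coordinates, as in the charts of \<open>prod_manifold\<close>\<close>

definition cat :: "nat \<Rightarrow> (nat \<Rightarrow> real) \<Rightarrow> (nat \<Rightarrow> real) \<Rightarrow> nat \<Rightarrow> real" where
  "cat m a b = (\<lambda>i. if i < m then a i else b (i - m))"

definition cfst :: "nat \<Rightarrow> (nat \<Rightarrow> real) \<Rightarrow> nat \<Rightarrow> real" where
  "cfst m c = (\<lambda>i. if i < m then c i else 0)"

definition csnd :: "nat \<Rightarrow> (nat \<Rightarrow> real) \<Rightarrow> nat \<Rightarrow> real" where
  "csnd m c = (\<lambda>i. c (i + m))"

lemma cat_Rn: "b \<in> Rn d \<Longrightarrow> cat m a b \<in> Rn (m + d)"
  by (auto simp: cat_def Rn_iff)

lemma cfst_cat: "a \<in> Rn m \<Longrightarrow> cfst m (cat m a b) = a"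
  by (auto simp: cat_def cfst_def Rn_iff fun_eq_iff)

lemma csnd_cat [simp]: "csnd m (cat m a b) = b"
  by (auto simp: cat_def csnd_def)

lemma cat_cfst_csnd: "cat m (cfst m c) (csnd m c) = c"
  by (auto simp: cat_def cfst_def csnd_def)

lemma cfst_Rn: "cfst m c \<in> Rn m"
  by (auto simp: cfst_def Rn_iff)

lemma csnd_Rn: "c \<in> Rn (m + d) \<Longrightarrow> csnd m c \<in> Rn d"
  by (auto simp: csnd_def Rn_iff)

lemma smooth_cfst: "smooth_between n U m (Rn m) (cfst m)"
  unfolding smooth_between_def using cfst_Rn by (auto simp: cfst_def[abs_def])

lemma smooth_csnd: "U \<subseteq> Rn (m + d) \<Longrightarrow> smooth_between n U d (Rn d) (csnd m)"
  unfolding smooth_between_def using csnd_Rn by (auto simp: csnd_def[abs_def])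

definition cprod :: "nat \<Rightarrow> nat \<Rightarrow> (nat \<Rightarrow> real) set \<Rightarrow> (nat \<Rightarrow> real) set \<Rightarrow> (nat \<Rightarrow> real) set" where
  "cprod m d A B = {c \<in> Rn (m + d). cfst m c \<in> A \<and> csnd m c \<in> B}"

lemma openin_Rn [simp]: "openin (Euclidean_space n) (Rn n)"
  by simp

lemma cprod_open:
  assumes "openin (Euclidean_space m) A" "openin (Euclidean_space d) B"
  shows "openin (Euclidean_space (m + d)) (cprod m d A B)"
proof -
  have "cprod m d A B = {c \<in> Rn (m + d). cfst m c \<in> A} \<inter> {c \<in> Rn (m + d). csnd m c \<in> B}"
    by (auto simp: cprod_def)
  moreover have "openin (Euclidean_space (m + d)) {c \<in> Rn (m + d). cfst m c \<in> A}"
    by (rule smooth_between_preimage[OF openin_Rn smooth_cfst assms(1)]) simp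
  moreover have "openin (Euclidean_space (m + d)) {c \<in> Rn (m + d). csnd m c \<in> B}"
    by (rule smooth_between_preimage[OF openin_Rn smooth_csnd[OF order_refl] assms(2)]) simp
  ultimately show ?thesis by (simp only: openin_Int)
qed

lemma smooth_cfst_cprod: "smooth_between (m + d) (cprod m d A B) m A (cfst m)"
  using smooth_cfst[of "m + d" "cprod m d A B" m] by (auto simp: smooth_between_def cprod_def)

lemma smooth_csnd_cprod: "smooth_between (m + d) (cprod m d A B) d B (csnd m)"
  using smooth_csnd[of "cprod m d A B" m d "m + d"] by (auto simp: smooth_between_def cprod_def)

text \<open>The inverse of a product chart is the pair of inverse charts after \<open>cfst\<close>
  and \<open>csnd\<close>, hence continuous, and the image of the chart is the open set
  \<open>cprod\<close>.\<close>

lemma premanifold_prod: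
  assumes M: "premanifold M" and N: "premanifold N"
  shows "premanifold (prod_manifold M N)"
  unfolding premanifold_def
proof (intro conjI ballI, goal_cases)
  case 1
  have A: "(x, y) \<in> (\<Union>(U, \<phi>)\<in>atlas (prod_manifold M N). U)"
    if x: "x \<in> topspace (mtop M)" and y: "y \<in> topspace (mtop N)" for x y
  proof -
    obtain V \<phi> where V: "(V, \<phi>) \<in> atlas M" "x \<in> V" using premanifold_cover[OF M x] .
    obtain W \<psi> where W: "(W, \<psi>) \<in> atlas N" "y \<in> W" using premanifold_cover[OF N y] .
    have "(V \<times> W, \<lambda>(x, y) i. if i < mdim M then \<phi> x i else \<psi> y (i - mdim M)) \<in> atlas (prod_manifold M N)"
      using V W by (auto simp: prod_manifold_def)
    from UN_I[OF this, of "(x, y)" "\<lambda>c. case c of (U, \<phi>) \<Rightarrow> U"] V W show ?thesis by simp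
  qed
  have B: "z \<in> topspace (mtop M) \<times> topspace (mtop N)" if z: "z \<in> (\<Union>(U, \<phi>)\<in>atlas (prod_manifold M N). U)" for z
  proof -
    obtain c where c: "c \<in> atlas (prod_manifold M N)" "z \<in> (case c of (U, \<phi>) \<Rightarrow> U)"
      using z by (rule UN_E)
    obtain V \<phi> W \<psi> where VW: "(V, \<phi>) \<in> atlas M" "(W, \<psi>) \<in> atlas N" "z \<in> V \<times> W"
    proof -
      from c(1) obtain V \<phi> W \<psi> where "c = (V \<times> W, \<lambda>(x, y) i. if i < mdim M then \<phi> x i else \<psi> y (i - mdim M))"
        "(V, \<phi>) \<in> atlas M" "(W, \<psi>) \<in> atlas N" by (auto simp: prod_manifold_def)
      then show thesis using that c(2) by simp
    qed
    then show ?thesis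
      using openin_subset[OF premanifold_chart(1)[OF M VW(1)]] openin_subset[OF premanifold_chart(1)[OF N VW(2)]] by blast
  qed
  have T: "topspace (mtop (prod_manifold M N)) = topspace (mtop M) \<times> topspace (mtop N)"
    by (simp add: prod_manifold_def)
  show ?case unfolding T
  proof (intro equalityI subsetI)
    show "z \<in> (\<Union>(U, \<phi>)\<in>atlas (prod_manifold M N). U)" if "z \<in> topspace (mtop M) \<times> topspace (mtop N)" for z
      using that A[of "fst z" "snd z"] by (simp add: mem_Times_iff)
  qed (rule B)
next
  case (2 c)
  then obtain V \<phi> W \<psi> where c: "c = (V \<times> W, \<lambda>(x, y) i. if i < mdim M then \<phi> x i else \<psi> y (i - mdim M))"
    and V: "(V, \<phi>) \<in> atlas M" and W: "(W, \<psi>) \<in> atlas N" by (auto simp: prod_manifold_def)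
  let ?m = "mdim M" and ?d = "mdim N"
  define \<Phi> where "\<Phi> = (\<lambda>(x, y). cat ?m (\<phi> x) (\<psi> y))"
  have c': "c = (V \<times> W, \<Phi>)" unfolding c \<Phi>_def cat_def by (simp add: fun_eq_iff)
  have RV: "\<phi> x \<in> Rn ?m" if "x \<in> V" for x using openin_subset[OF premanifold_chart(2)[OF M V]] that by auto
  have RW: "\<psi> x \<in> Rn ?d" if "x \<in> W" for x using openin_subset[OF premanifold_chart(2)[OF N W]] that by auto
  have inj: "inj_on \<Phi> (V \<times> W)"
  proof (rule inj_onI, clarify)
    fix x y x' y' assume *: "x \<in> V" "y \<in> W" "x' \<in> V" "y' \<in> W" "\<Phi> (x, y) = \<Phi> (x', y')"
    then have e: "cat ?m (\<phi> x) (\<psi> y) = cat ?m (\<phi> x') (\<psi> y')" by (simp add: \<Phi>_def)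
    from arg_cong[OF e, of "cfst ?m"] have "\<phi> x = \<phi> x'" using * RV by (simp add: cfst_cat)
    moreover from arg_cong[OF e, of "csnd ?m"] have "\<psi> y = \<psi> y'" by simp
    ultimately show "x = x' \<and> y = y'"
      using * premanifold_chart(3)[OF M V] premanifold_chart(3)[OF N W] by (auto dest: inj_onD)
  qed
  have im: "\<Phi> ` (V \<times> W) = cprod ?m ?d (\<phi> ` V) (\<psi> ` W)"
  proof (intro equalityI subsetI)
    fix z assume "z \<in> \<Phi> ` (V \<times> W)"
    then show "z \<in> cprod ?m ?d (\<phi> ` V) (\<psi> ` W)"
      using RV RW cat_Rn by (auto simp: \<Phi>_def cprod_def cfst_cat)
  next
    fix z assume z: "z \<in> cprod ?m ?d (\<phi> ` V) (\<psi> ` W)"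
    then obtain x y where "x \<in> V" "y \<in> W" "cfst ?m z = \<phi> x" "csnd ?m z = \<psi> y" by (auto simp: cprod_def)
    then have "z = \<Phi> (x, y)" "(x, y) \<in> V \<times> W" using cat_cfst_csnd[of ?m z] by (auto simp: \<Phi>_def)
    then show "z \<in> \<Phi> ` (V \<times> W)" by blast
  qed
  have op: "openin (Euclidean_space (?m + ?d)) (cprod ?m ?d (\<phi> ` V) (\<psi> ` W))"
    by (rule cprod_open[OF premanifold_chart(2)[OF M V] premanifold_chart(2)[OF N W]])
  let ?X = "subtopology (Euclidean_space (?m + ?d)) (cprod ?m ?d (\<phi> ` V) (\<psi> ` W))"
  have "continuous_map ?X (mtop M) (inv_into V \<phi> \<circ> cfst ?m)"
    by (rule continuous_map_compose[OF smooth_between_continuous_map[OF op smooth_cfst_cprod] premanifold_chart(4)[OF M V]])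
      (rule openin_E_subset[OF premanifold_chart(2)[OF M V]])
  moreover have "continuous_map ?X (mtop N) (inv_into W \<psi> \<circ> csnd ?m)"
    by (rule continuous_map_compose[OF smooth_between_continuous_map[OF op smooth_csnd_cprod] premanifold_chart(4)[OF N W]])
      (rule openin_E_subset[OF premanifold_chart(2)[OF N W]])
  ultimately have "continuous_map ?X (prod_topology (mtop M) (mtop N))
      (\<lambda>z. (inv_into V \<phi> (cfst ?m z), inv_into W \<psi> (csnd ?m z)))"
    by (simp add: continuous_map_pairwise comp_def)
  then have "continuous_map ?X (prod_topology (mtop M) (mtop N)) (inv_into (V \<times> W) \<Phi>)"
  proof (rule continuous_map_eq)
    fix z assume "z \<in> topspace ?X"
    then have "z \<in> \<Phi> ` (V \<times> W)" using im by auto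
    then obtain x y where xy: "x \<in> V" "y \<in> W" "z = \<Phi> (x, y)" by auto
    then have "inv_into (V \<times> W) \<Phi> z = (x, y)" using inj by auto
    then show "(inv_into V \<phi> (cfst ?m z), inv_into W \<psi> (csnd ?m z)) = inv_into (V \<times> W) \<Phi> z"
      using xy RV premanifold_chart(3)[OF M V] premanifold_chart(3)[OF N W] by (simp add: \<Phi>_def cfst_cat)
  qed
  then show ?case
    using inj op im premanifold_chart(1)[OF M V] premanifold_chart(1)[OF N W]
    by (simp add: c' prod_manifold_def openin_prod_Times_iff)
qed

text \<open>The only chart of \<open>eucl_manifold n U\<close> is the identity, and
  \<open>inv_into U (\<lambda>x. x)\<close> is the identity on \<open>U\<close>; what remains of
  \<open>smooth_map\<close> is \<open>plot\<close>.\<close>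

lemma manifold_diffeology_iff:
  assumes M: "premanifold M"
  shows "(n, U, \<alpha>) \<in> manifold_diffeology M \<longleftrightarrow> \<alpha> \<in> extensional U \<and> plot M n U \<alpha>"
proof
  have inv: "inv_into U (\<lambda>x. x) x = x" if "x \<in> U" for x and U :: "(nat \<Rightarrow> real) set"
    using inv_into_f_f[of "\<lambda>x. x" U x] that by simp
  {
    assume L: "(n, U, \<alpha>) \<in> manifold_diffeology M"
    then have U: "openin (Euclidean_space n) U" and ext: "\<alpha> \<in> extensional U"
      and c: "continuous_map (subtopology (Euclidean_space n) U) (mtop M) \<alpha>"
      by (auto simp: manifold_diffeology_def params_def smooth_map_def eucl_manifold_def PiE_def)
    have "smooth_fun n {x\<in>U. \<alpha> x \<in> V} (\<lambda>x. \<psi> (\<alpha> x) j)" if V: "(V, \<psi>) \<in> atlas M" and j: "j < mdim M" for V \<psi> j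
    proof (rule smooth_cong)
      show "openin (Euclidean_space n) {x\<in>U. \<alpha> x \<in> V}"
        by (rule openin_E_continuous_preimage[OF U c premanifold_chart(1)[OF M V]])
      have "U \<inter> \<alpha> -` V = {x\<in>U. \<alpha> x \<in> V}" by auto
      then show "smooth_fun n {x\<in>U. \<alpha> x \<in> V} (\<lambda>x. (\<psi> \<circ> \<alpha> \<circ> inv_into U (\<lambda>x. x)) x j)"
        using L V j by (auto simp: manifold_diffeology_def smooth_map_def eucl_manifold_def smooth_between_def)
      show "(\<psi> \<circ> \<alpha> \<circ> inv_into U (\<lambda>x. x)) y j = \<psi> (\<alpha> y) j" if "y \<in> {x\<in>U. \<alpha> x \<in> V}" for y
        using that by (simp add: inv)
    qed
    then show "\<alpha> \<in> extensional U \<and> plot M n U \<alpha>" using U c ext by (auto simp: plot_def)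
  next
    assume R: "\<alpha> \<in> extensional U \<and> plot M n U \<alpha>"
    then have P: "plot M n U \<alpha>" by simp
    have "smooth_between n (U \<inter> \<alpha> -` V) (mdim M) (\<psi> ` V) (\<psi> \<circ> \<alpha> \<circ> inv_into U (\<lambda>x. x))"
      if V: "(V, \<psi>) \<in> atlas M" for V \<psi>
      unfolding smooth_between_def
    proof (intro conjI allI impI)
      show "\<psi> \<circ> \<alpha> \<circ> inv_into U (\<lambda>x. x) \<in> U \<inter> \<alpha> -` V \<rightarrow> \<psi> ` V" using inv by auto
      have eq: "U \<inter> \<alpha> -` V = {x\<in>U. \<alpha> x \<in> V}" by auto
      show "smooth_fun n (U \<inter> \<alpha> -` V) (\<lambda>x. (\<psi> \<circ> \<alpha> \<circ> inv_into U (\<lambda>x. x)) x j)" if "j < mdim M" for j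
        unfolding eq
        by (rule smooth_cong[OF plot_preimage[OF P premanifold_chart(1)[OF M V]] _ plot_chart_smooth[OF P V that]])
          (simp add: inv)
    qed
    then show "(n, U, \<alpha>) \<in> manifold_diffeology M"
      using R plot_topspace[OF P] plot_open[OF P] plot_continuous[OF P]
      by (auto simp: manifold_diffeology_def params_def smooth_map_def eucl_manifold_def PiE_def)
  }
qed

lemma manifold_diffeology_restrict:
  assumes M: "premanifold M" and \<alpha>: "plot M n U \<alpha>"
  shows "(n, U, restrict \<alpha> U) \<in> manifold_diffeology M"
  unfolding manifold_diffeology_iff[OF M] using plot_cong[OF \<alpha> _ M, of "restrict \<alpha> U"] by simp

lemma manifold_diffeology_params: "manifold_diffeology M \<subseteq> params (topspace (mtop M))"
  by (auto simp: manifold_diffeology_def)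

lemma manifold_diffeology_compose:
  assumes M: "premanifold M" and "(n, U, \<alpha>) \<in> manifold_diffeology M" "openin (Euclidean_space m) V" "smooth_between m V n U f"
  shows "(m, V, restrict (\<alpha> \<circ> f) V) \<in> manifold_diffeology M"
proof -
  have "plot M m V (\<alpha> \<circ> f)"
    using plot_compose[OF M _ assms(3,4), of \<alpha>] assms(2) by (simp add: manifold_diffeology_iff[OF M] comp_def)
  then show ?thesis by (rule manifold_diffeology_restrict[OF M])
qed

text \<open>Where a plot stays in \<open>U\<close>, it is the inverse chart after its own coordinate
  expression. Hence the values of \<open>\<omega>\<close> on chart plots determine it on all
  plots.\<close>

lemma dform_in_chart:
  assumes M: "smooth_manifold M" and \<omega>: "\<omega> \<in> dforms (manifold_diffeology M) k"
    and \<beta>: "plot M n V \<beta>" and x: "x \<in> V" and U: "(U, \<phi>) \<in> atlas M" "\<beta> x \<in> U" and vs: "set vs \<subseteq> Rn n"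
  shows "\<omega> (n, V, restrict \<beta> V) x vs
     = \<omega> (chart_plot M (U, \<phi>)) (\<phi> (\<beta> x)) (map (tangent_map n (\<lambda>y. \<phi> (\<beta> y)) x) vs)"
proof -
  note P = smooth_manifold_premanifold[OF M]
  let ?W = "{y\<in>V. \<beta> y \<in> U}"
  have W: "openin (Euclidean_space n) ?W" by (rule plot_preimage[OF \<beta> premanifold_chart(1)[OF P U(1)]])
  have sm: "smooth_between n ?W (mdim M) (\<phi> ` U) (\<lambda>y. \<phi> (\<beta> y))" by (rule plot_chart_between[OF \<beta> U(1)])
  have C: "(mdim M, \<phi> ` U, restrict (inv_into U \<phi>) (\<phi> ` U)) \<in> manifold_diffeology M"
    by (rule manifold_diffeology_restrict[OF P plot_chart[OF M U(1)]])
  have "restrict (restrict \<beta> V) ?W = restrict (restrict (inv_into U \<phi>) (\<phi> ` U) \<circ> (\<lambda>y. \<phi> (\<beta> y))) ?W"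
    using premanifold_chart(3)[OF P U(1)] by (auto simp: fun_eq_iff)
  moreover have "\<omega> (n, ?W, restrict (restrict \<beta> V) ?W) x vs = \<omega> (n, V, restrict \<beta> V) x vs"
    by (rule dforms_restrict[OF \<omega> manifold_diffeology_restrict[OF P \<beta>] W _ _ vs]) (use x U in auto)
  ultimately have "\<omega> (n, V, restrict \<beta> V) x vs
      = eform_pull n ?W (\<lambda>y. \<phi> (\<beta> y)) (\<omega> (chart_plot M (U, \<phi>))) x vs"
    using dforms_pull[OF \<omega> C W sm] by (simp add: chart_plot_def)
  then show ?thesis using x U vs by (simp add: eform_pull_def)
qed

section \<open>The action in coordinates\<close>

lemma smooth_cat: "smooth_fun n U (\<lambda>x. cat m x b j)" "smooth_fun n U (\<lambda>x. cat m a x j)"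
  by (cases "j < m"; simp add: cat_def)+

lemma dir_deriv_coord:
  assumes v: "v \<in> Rn n" shows "dir_deriv n v (\<lambda>y. y j) x = v j"
proof (cases "j < n")
  case False
  have "partial i (\<lambda>y. y j) x = 0" if "i < n" for i
    by (rule has_partialI) (use that False in auto)
  then show ?thesis using False RnD[OF v] by (simp add: dir_deriv_def)
qed (rule dir_deriv_proj)

locale smooth_action =
  fixes M :: "'a manifold" and H :: "('h, 'b) monoid_scheme" and HM :: "'h manifold" and act :: "'a \<Rightarrow> 'h \<Rightarrow> 'a"
  assumes lie: "lie_group H HM" and man: "smooth_manifold M"
    and action: "smooth_right_action M H HM act"
begin

abbreviation "m \<equiv> mdim M"
abbreviation "d \<equiv> mdim HM"

lemma preM: "premanifold M"
  by (rule smooth_manifold_premanifold[OF man])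

lemma manH: "smooth_manifold HM"
  using lie by (simp add: lie_group_def)

lemma preH: "premanifold HM"
  by (rule smooth_manifold_premanifold[OF manH])

lemma grp: "group H"
  using lie by (simp add: lie_group_def)

sublocale group H by (rule grp)

lemma topH: "topspace (mtop HM) = carrier H"
  using lie by (simp add: lie_group_def)

lemma act_one: "x \<in> topspace (mtop M) \<Longrightarrow> act x \<one>\<^bsub>H\<^esub> = x"
  using action by (simp add: smooth_right_action_def)

lemma act_mult:
  "x \<in> topspace (mtop M) \<Longrightarrow> g \<in> carrier H \<Longrightarrow> h \<in> carrier H \<Longrightarrow> act (act x g) h = act x (g \<otimes>\<^bsub>H\<^esub> h)"
  using action by (simp add: smooth_right_action_def)

lemma act_plot:
  assumes "plot M n U \<alpha>" "plot HM n U g" shows "plot M n U (\<lambda>x. act (\<alpha> x) (g x))"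
proof -
  have "smooth_map (prod_manifold M HM) M (\<lambda>(x, h). act x h)"
    using action by (simp add: smooth_right_action_def)
  from plot_smooth_map[OF premanifold_prod[OF preM preH] preM plot_Pair[OF preM preH assms] this]
  show ?thesis by simp
qed

lemma act_plot_const:
  assumes "plot M n U \<alpha>" "h \<in> carrier H" shows "plot M n U (\<lambda>x. act (\<alpha> x) h)"
  by (rule act_plot[OF assms(1) plot_const[OF preH _ plot_open[OF assms(1)]]]) (simp add: topH assms(2))

lemma act_continuous: "continuous_map (prod_topology (mtop M) (mtop HM)) (mtop M) (\<lambda>(x, h). act x h)"
  using action by (simp add: smooth_right_action_def smooth_map_def prod_manifold_def)

lemma mult_continuous: "continuous_map (prod_topology (mtop HM) (mtop HM)) (mtop HM) (\<lambda>(x, h). x \<otimes>\<^bsub>H\<^esub> h)"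
  using lie by (simp add: lie_group_def smooth_map_def prod_manifold_def)

lemma act_closed [simp]: "x \<in> topspace (mtop M) \<Longrightarrow> h \<in> carrier H \<Longrightarrow> act x h \<in> topspace (mtop M)"
  using act_continuous by (auto simp: continuous_map_def topH Pi_iff)

definition act_chart :: "'a chart \<Rightarrow> 'h chart \<Rightarrow> (nat \<Rightarrow> real) \<Rightarrow> 'a" where
  "act_chart = (\<lambda>(U, \<phi>) (W, \<psi>) c. act (inv_into U \<phi> (cfst m c)) (inv_into W \<psi> (csnd m c)))"

text \<open>The same chart of \<open>M\<close> serves for a point and its translate. This is enough
  near the identity of \<open>H\<close>, where the action is close to the identity map.\<close>

definition act_dom :: "'a chart \<Rightarrow> 'h chart \<Rightarrow> (nat \<Rightarrow> real) set" where
  "act_dom = (\<lambda>(U, \<phi>) (W, \<psi>). {c \<in> cprod m d (\<phi> ` U) (\<psi> ` W). act_chart (U, \<phi>) (W, \<psi>) c \<in> U})"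

definition act_coord :: "'a chart \<Rightarrow> 'h chart \<Rightarrow> (nat \<Rightarrow> real) \<Rightarrow> nat \<Rightarrow> real" where
  "act_coord = (\<lambda>(U, \<phi>) (W, \<psi>) c. \<phi> (act_chart (U, \<phi>) (W, \<psi>) c))"

text \<open>The fundamental vector field of the tangent vector \<open>u\<close> at the identity of
  \<open>H\<close>. It is written as the partial derivative of \<open>act_coord\<close> in the group
  variables, which makes its smoothness in \<open>x\<close> visible.\<close>

definition leaf_vec :: "'a chart \<Rightarrow> 'h chart \<Rightarrow> (nat \<Rightarrow> real) \<Rightarrow> (nat \<Rightarrow> real) \<Rightarrow> nat \<Rightarrow> real" where
  "leaf_vec = (\<lambda>(U, \<phi>) (W, \<psi>) u x. tangent_map (m + d) (act_coord (U, \<phi>) (W, \<psi>)) (cat m x (\<psi> \<one>\<^bsub>H\<^esub>)) (cat m 0 u))"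

context
  fixes U \<phi> W \<psi>
  assumes U: "(U, \<phi>) \<in> atlas M" and W: "(W, \<psi>) \<in> atlas HM" and one_W: "\<one>\<^bsub>H\<^esub> \<in> W"
begin

lemma chart_facts:
  "openin (Euclidean_space m) (\<phi> ` U)" "\<phi> ` U \<subseteq> Rn m" "inj_on \<phi> U" "U \<subseteq> topspace (mtop M)"
  "openin (Euclidean_space d) (\<psi> ` W)" "\<psi> ` W \<subseteq> Rn d" "inj_on \<psi> W" "W \<subseteq> carrier H"
  using premanifold_chart[OF preM U] premanifold_chart[OF preH W] openin_subset topH by metis+

lemma one_Rn: "\<psi> \<one>\<^bsub>H\<^esub> \<in> \<psi> ` W" "\<psi> \<one>\<^bsub>H\<^esub> \<in> Rn d"
  using one_W chart_facts by auto

lemma cprod_chart_open: "openin (Euclidean_space (m + d)) (cprod m d (\<phi> ` U) (\<psi> ` W))"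
  by (rule cprod_open) (rule chart_facts)+

lemma act_chart_plot: "plot M (m + d) (cprod m d (\<phi> ` U) (\<psi> ` W)) (act_chart (U, \<phi>) (W, \<psi>))"
  unfolding act_chart_def prod.case
  by (rule act_plot[OF plot_compose[OF preM plot_chart[OF man U] cprod_chart_open smooth_cfst_cprod]
      plot_compose[OF preH plot_chart[OF manH W] cprod_chart_open smooth_csnd_cprod]])

lemma act_dom_open: "openin (Euclidean_space (m + d)) (act_dom (U, \<phi>) (W, \<psi>))"
  unfolding act_dom_def prod.case by (rule plot_preimage[OF act_chart_plot premanifold_chart(1)[OF preM U]])

lemma act_coord_between: "smooth_between (m + d) (act_dom (U, \<phi>) (W, \<psi>)) m (\<phi> ` U) (act_coord (U, \<phi>) (W, \<psi>))"
  using plot_chart_between[OF act_chart_plot U] unfolding act_dom_def act_coord_def prod.case .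

lemma act_coord_field: "smooth_field (m + d) (act_dom (U, \<phi>) (W, \<psi>)) m (act_coord (U, \<phi>) (W, \<psi>))"
  by (rule smooth_field_of_between[OF act_dom_open act_coord_between chart_facts(2)])

lemma cat_in_cprod: "x \<in> \<phi> ` U \<Longrightarrow> z \<in> \<psi> ` W \<Longrightarrow> cat m x z \<in> cprod m d (\<phi> ` U) (\<psi> ` W)"
  using chart_facts(2,6) by (auto simp: cprod_def cfst_cat subset_iff intro!: cat_Rn)

lemma act_chart_cat:
  "p \<in> U \<Longrightarrow> h \<in> W \<Longrightarrow> act_chart (U, \<phi>) (W, \<psi>) (cat m (\<phi> p) (\<psi> h)) = act p h"
  using chart_facts by (auto simp: act_chart_def cfst_cat subset_iff)

lemma act_chart_one: "x \<in> \<phi> ` U \<Longrightarrow> act_chart (U, \<phi>) (W, \<psi>) (cat m x (\<psi> \<one>\<^bsub>H\<^esub>)) = inv_into U \<phi> x"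
  using act_chart_cat[OF _ one_W] act_one chart_facts(3,4) by auto

lemma base_in_dom: "x \<in> \<phi> ` U \<Longrightarrow> cat m x (\<psi> \<one>\<^bsub>H\<^esub>) \<in> act_dom (U, \<phi>) (W, \<psi>)"
  using cat_in_cprod[OF _ one_Rn(1)] act_chart_one by (simp add: act_dom_def inv_into_into)

lemma act_coord_one: "x \<in> \<phi> ` U \<Longrightarrow> act_coord (U, \<phi>) (W, \<psi>) (cat m x (\<psi> \<one>\<^bsub>H\<^esub>)) = x"
  by (simp add: act_coord_def act_chart_one f_inv_into_f)

text \<open>The identity of \<open>H\<close> acts trivially, so \<open>act_coord\<close> is the
  identity in \<open>x\<close> when the group coordinates are those of the identity, and so is its
  derivative in these directions.\<close>

lemma tangent_act_coord_fst:
  assumes x: "x \<in> \<phi> ` U" and v: "v \<in> Rn m"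
  shows "tangent_map (m + d) (act_coord (U, \<phi>) (W, \<psi>)) (cat m x (\<psi> \<one>\<^bsub>H\<^esub>)) (cat m v 0) = v"
proof
  fix j
  let ?f = "\<lambda>y. cat m y (\<psi> \<one>\<^bsub>H\<^esub>)"
  have sm: "smooth_fun (m + d) (act_dom (U, \<phi>) (W, \<psi>)) (\<lambda>c. act_coord (U, \<phi>) (W, \<psi>) c j)"
    using act_coord_field by (simp add: smooth_field_def)
  have T: "tangent_map m ?f x v = cat m v 0"
    using v by (auto simp: tangent_map_def cat_def fun_eq_iff dir_deriv_coord)
  have "dir_deriv m v (\<lambda>y. act_coord (U, \<phi>) (W, \<psi>) (?f y) j) x
      = dir_deriv (m + d) (tangent_map m ?f x v) (\<lambda>c. act_coord (U, \<phi>) (W, \<psi>) c j) (?f x)"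
  proof (rule dir_deriv_comp[OF chart_facts(1) act_dom_open _ _ sm x])
    show "?f \<in> \<phi> ` U \<rightarrow> act_dom (U, \<phi>) (W, \<psi>)" using base_in_dom by auto
    show "smooth_fun m (\<phi> ` U) (\<lambda>y. ?f y i)" for i by (rule smooth_cat)
  qed
  moreover have "dir_deriv m v (\<lambda>y. act_coord (U, \<phi>) (W, \<psi>) (?f y) j) x = dir_deriv m v (\<lambda>y. y j) x"
    by (rule dir_deriv_cong[OF chart_facts(1) x]) (simp add: act_coord_one)
  ultimately show "tangent_map (m + d) (act_coord (U, \<phi>) (W, \<psi>)) (cat m x (\<psi> \<one>\<^bsub>H\<^esub>)) (cat m v 0) j = v j"
    unfolding T using dir_deriv_coord[OF v] by (simp add: tangent_map_def)
qed

text \<open>The chain rule for the embedding of the group coordinates as the slice with first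
  component \<open>\<phi> p\<close>. The right side is the expression in
  \<open>leaf_tangent_space\<close>.\<close>

lemma leaf_vec_eq:
  assumes p: "p \<in> U" and u: "u \<in> Rn d"
  shows "leaf_vec (U, \<phi>) (W, \<psi>) u (\<phi> p) = tangent_map d (\<phi> \<circ> act p \<circ> inv_into W \<psi>) (\<psi> \<one>\<^bsub>H\<^esub>) u"
proof
  fix j
  have x: "\<phi> p \<in> \<phi> ` U" using p by simp
  let ?f = "\<lambda>z. cat m (\<phi> p) z"
  let ?V = "{z \<in> \<psi> ` W. ?f z \<in> act_dom (U, \<phi>) (W, \<psi>)}"
  have smf: "smooth_between d (\<psi> ` W) (m + d) (Rn (m + d)) ?f"
    using chart_facts(6) cat_Rn smooth_cat(2) by (auto simp: smooth_between_def)
  have V: "openin (Euclidean_space d) ?V"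
    by (rule smooth_between_preimage[OF chart_facts(5) smf act_dom_open]) simp
  have e: "\<psi> \<one>\<^bsub>H\<^esub> \<in> ?V" using one_Rn base_in_dom[OF x] by simp
  have sm: "smooth_fun (m + d) (act_dom (U, \<phi>) (W, \<psi>)) (\<lambda>c. act_coord (U, \<phi>) (W, \<psi>) c j)"
    using act_coord_field by (simp add: smooth_field_def)
  have T: "tangent_map d ?f (\<psi> \<one>\<^bsub>H\<^esub>) u = cat m 0 u"
    using u by (auto simp: tangent_map_def cat_def fun_eq_iff dir_deriv_coord)
  have "dir_deriv d u (\<lambda>z. act_coord (U, \<phi>) (W, \<psi>) (?f z) j) (\<psi> \<one>\<^bsub>H\<^esub>)
      = dir_deriv (m + d) (tangent_map d ?f (\<psi> \<one>\<^bsub>H\<^esub>) u) (\<lambda>c. act_coord (U, \<phi>) (W, \<psi>) c j) (?f (\<psi> \<one>\<^bsub>H\<^esub>))"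
  proof (rule dir_deriv_comp[OF V act_dom_open _ _ sm e])
    show "smooth_fun d ?V (\<lambda>z. ?f z i)" for i by (rule smooth_cat)
  qed auto
  moreover have "dir_deriv d u (\<lambda>z. act_coord (U, \<phi>) (W, \<psi>) (?f z) j) (\<psi> \<one>\<^bsub>H\<^esub>)
      = dir_deriv d u (\<lambda>z. (\<phi> \<circ> act p \<circ> inv_into W \<psi>) z j) (\<psi> \<one>\<^bsub>H\<^esub>)"
    by (rule dir_deriv_cong[OF V e]) (use p chart_facts(7) act_chart_cat[OF p] in \<open>auto simp: act_coord_def\<close>)
  ultimately show "leaf_vec (U, \<phi>) (W, \<psi>) u (\<phi> p) j = tangent_map d (\<phi> \<circ> act p \<circ> inv_into W \<psi>) (\<psi> \<one>\<^bsub>H\<^esub>) u j"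
    unfolding T by (simp add: tangent_map_def leaf_vec_def)
qed

lemma leaf_vec_Rn: "x \<in> \<phi> ` U \<Longrightarrow> leaf_vec (U, \<phi>) (W, \<psi>) u x \<in> Rn m"
  unfolding leaf_vec_def prod.case
  by (rule tangent_map_Rn[OF act_dom_open base_in_dom]) (use act_coord_field in \<open>simp_all add: smooth_field_def\<close>)

lemma leaf_vec_smooth: "smooth_between m (\<phi> ` U) m (Rn m) (leaf_vec (U, \<phi>) (W, \<psi>) u)"
  unfolding smooth_between_def
proof (intro conjI allI impI)
  show "leaf_vec (U, \<phi>) (W, \<psi>) u \<in> \<phi> ` U \<rightarrow> Rn m" using leaf_vec_Rn by blast
  fix j
  have sm: "smooth_fun (m + d) (act_dom (U, \<phi>) (W, \<psi>)) (dir_deriv (m + d) (cat m 0 u) (\<lambda>c. act_coord (U, \<phi>) (W, \<psi>) c j))"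
    by (rule smooth_dir_deriv[OF act_dom_open]) (use act_coord_field in \<open>simp add: smooth_field_def\<close>)
  have "smooth_fun m (\<phi> ` U) (\<lambda>x. dir_deriv (m + d) (cat m 0 u) (\<lambda>c. act_coord (U, \<phi>) (W, \<psi>) c j) (cat m x (\<psi> \<one>\<^bsub>H\<^esub>)))"
    by (rule smooth_comp[OF chart_facts(1) act_dom_open _ smooth_cat(1) sm]) (simp add: base_in_dom Pi_iff)
  then show "smooth_fun m (\<phi> ` U) (\<lambda>x. leaf_vec (U, \<phi>) (W, \<psi>) u x j)"
    by (simp add: leaf_vec_def tangent_map_def)
qed

end

text \<open>The chain rule for the orbit map of \<open>p\<close>, written in the second chart as the
  coordinate change after its expression in the first.\<close>

lemma leaf_vec_change:
  assumes U: "(U, \<phi>) \<in> atlas M" and U': "(U', \<phi>') \<in> atlas M" and W: "(W, \<psi>) \<in> atlas HM" "\<one>\<^bsub>H\<^esub> \<in> W"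
    and p: "p \<in> U \<inter> U'" and u: "u \<in> Rn d"
  shows "leaf_vec (U', \<phi>') (W, \<psi>) u (\<phi>' p)
    = tangent_map m (\<phi>' \<circ> inv_into U \<phi>) (\<phi> p) (leaf_vec (U, \<phi>) (W, \<psi>) u (\<phi> p))"
proof
  fix j
  have P: "p \<in> U" "p \<in> U'" using p by auto
  note cf = chart_facts[OF U W] and cf' = chart_facts[OF U' W]
  note e = one_Rn[OF U W]
  have pW: "plot M d (\<psi> ` W) (\<lambda>z. act p (inv_into W \<psi> z))"
    by (rule act_plot[OF plot_const[OF preM] plot_chart[OF manH W(1)]]) (use P cf in auto)
  have e1: "act p (inv_into W \<psi> (\<psi> \<one>\<^bsub>H\<^esub>)) = p" using act_one P cf W by auto
  let ?V = "{z\<in>\<psi> ` W. act p (inv_into W \<psi> z) \<in> U} \<inter> {z\<in>\<psi> ` W. act p (inv_into W \<psi> z) \<in> U'}"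
  have V: "openin (Euclidean_space d) ?V"
    by (intro openin_Int plot_preimage[OF pW] premanifold_chart(1)[OF preM U] premanifold_chart(1)[OF preM U'])
  have eV: "\<psi> \<one>\<^bsub>H\<^esub> \<in> ?V" using e e1 P by auto
  have Q: "openin (Euclidean_space m) (\<phi> ` (U \<inter> U'))"
    by (rule premanifold_open_image[OF preM U]) (use premanifold_chart(1)[OF preM U] premanifold_chart(1)[OF preM U'] in auto)
  have tr: "smooth_between m (\<phi> ` (U \<inter> U')) m (\<phi>' ` (U \<inter> U')) (\<phi>' \<circ> inv_into U \<phi>)"
    using man U U' by (auto simp: smooth_manifold_def)
  have trF: "smooth_fun m (\<phi> ` (U \<inter> U')) (\<lambda>y. (\<phi>' \<circ> inv_into U \<phi>) y j)"
    using smooth_field_of_between[OF Q tr] cf'(2) by (auto simp: smooth_field_def)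
  have "dir_deriv d u (\<lambda>z. (\<phi>' \<circ> inv_into U \<phi>) ((\<phi> \<circ> act p \<circ> inv_into W \<psi>) z) j) (\<psi> \<one>\<^bsub>H\<^esub>)
      = dir_deriv m (tangent_map d (\<phi> \<circ> act p \<circ> inv_into W \<psi>) (\<psi> \<one>\<^bsub>H\<^esub>) u) (\<lambda>y. (\<phi>' \<circ> inv_into U \<phi>) y j)
          ((\<phi> \<circ> act p \<circ> inv_into W \<psi>) (\<psi> \<one>\<^bsub>H\<^esub>))"
  proof (rule dir_deriv_comp[OF V Q _ _ trF eV])
    show "\<phi> \<circ> act p \<circ> inv_into W \<psi> \<in> ?V \<rightarrow> \<phi> ` (U \<inter> U')" by auto
    show "smooth_fun d ?V (\<lambda>z. (\<phi> \<circ> act p \<circ> inv_into W \<psi>) z i)" if "i < m" for i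
      using smooth_subset[OF plot_chart_smooth[OF pW U that], of ?V] by (simp add: comp_def)
  qed
  moreover have "dir_deriv d u (\<lambda>z. (\<phi>' \<circ> inv_into U \<phi>) ((\<phi> \<circ> act p \<circ> inv_into W \<psi>) z) j) (\<psi> \<one>\<^bsub>H\<^esub>)
      = dir_deriv d u (\<lambda>z. (\<phi>' \<circ> act p \<circ> inv_into W \<psi>) z j) (\<psi> \<one>\<^bsub>H\<^esub>)"
    by (rule dir_deriv_cong[OF V eV]) (use cf(3) in auto)
  ultimately show "leaf_vec (U', \<phi>') (W, \<psi>) u (\<phi>' p) j
    = tangent_map m (\<phi>' \<circ> inv_into U \<phi>) (\<phi> p) (leaf_vec (U, \<phi>) (W, \<psi>) u (\<phi> p)) j"
    unfolding leaf_vec_eq[OF U W P(1) u] leaf_vec_eq[OF U' W P(2) u]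
    using e1 by (simp add: tangent_map_def)
qed

lemma leaf_tangent_space_eq:
  assumes U: "(U, \<phi>) \<in> atlas M" and p: "p \<in> U"
  shows "leaf_tangent_space H HM act (U, \<phi>) p
     = {leaf_vec (U, \<phi>) (W, \<psi>) u (\<phi> p) |W \<psi> u. (W, \<psi>) \<in> atlas HM \<and> \<one>\<^bsub>H\<^esub> \<in> W \<and> u \<in> Rn d}"
  unfolding leaf_tangent_space_def prod.case
proof (intro equalityI subsetI)
  fix y assume "y \<in> {tangent_map d (\<phi> \<circ> act p \<circ> inv_into W \<psi>) (\<psi> \<one>\<^bsub>H\<^esub>) v |W \<psi> v.
        (W, \<psi>) \<in> atlas HM \<and> \<one>\<^bsub>H\<^esub> \<in> W \<and> v \<in> Rn d}"
  then obtain W \<psi> u where *: "(W, \<psi>) \<in> atlas HM" "\<one>\<^bsub>H\<^esub> \<in> W" "u \<in> Rn d"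
    and "y = tangent_map d (\<phi> \<circ> act p \<circ> inv_into W \<psi>) (\<psi> \<one>\<^bsub>H\<^esub>) u" by blast
  then have "y = leaf_vec (U, \<phi>) (W, \<psi>) u (\<phi> p)" using leaf_vec_eq[OF U *(1,2) p *(3)] by simp
  then show "y \<in> {leaf_vec (U, \<phi>) (W, \<psi>) u (\<phi> p) |W \<psi> u. (W, \<psi>) \<in> atlas HM \<and> \<one>\<^bsub>H\<^esub> \<in> W \<and> u \<in> Rn d}"
    using * by blast
next
  fix y assume "y \<in> {leaf_vec (U, \<phi>) (W, \<psi>) u (\<phi> p) |W \<psi> u. (W, \<psi>) \<in> atlas HM \<and> \<one>\<^bsub>H\<^esub> \<in> W \<and> u \<in> Rn d}"
  then obtain W \<psi> u where *: "(W, \<psi>) \<in> atlas HM" "\<one>\<^bsub>H\<^esub> \<in> W" "u \<in> Rn d"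
    and "y = leaf_vec (U, \<phi>) (W, \<psi>) u (\<phi> p)" by blast
  then have "y = tangent_map d (\<phi> \<circ> act p \<circ> inv_into W \<psi>) (\<psi> \<one>\<^bsub>H\<^esub>) u"
    using leaf_vec_eq[OF U *(1,2) p *(3)] by simp
  then show "y \<in> {tangent_map d (\<phi> \<circ> act p \<circ> inv_into W \<psi>) (\<psi> \<one>\<^bsub>H\<^esub>) v |W \<psi> v.
        (W, \<psi>) \<in> atlas HM \<and> \<one>\<^bsub>H\<^esub> \<in> W \<and> v \<in> Rn d}"
    using * by blast
qed

text \<open>Hence a basic form, defined by global vector fields, annihilates each single leaf tangent vector.\<close>

lemma fundamental_vector_field:
  assumes W: "(W, \<psi>) \<in> atlas HM" "\<one>\<^bsub>H\<^esub> \<in> W" and u: "u \<in> Rn d"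
  shows "vector_field M (\<lambda>c. leaf_vec c (W, \<psi>) u)" "tangent_to_leaves M H HM act (\<lambda>c. leaf_vec c (W, \<psi>) u)"
proof -
  show "vector_field M (\<lambda>c. leaf_vec c (W, \<psi>) u)"
    unfolding vector_field_def
  proof (rule conjI; clarify)
    fix U \<phi> assume "(U, \<phi>) \<in> atlas M"
    then show "smooth_between m (\<phi> ` U) m (Rn m) (leaf_vec (U, \<phi>) (W, \<psi>) u)" by (rule leaf_vec_smooth[OF _ W])
  next
    fix U \<phi> V \<psi>' p assume "(U, \<phi>) \<in> atlas M" "(V, \<psi>') \<in> atlas M" "p \<in> U" "p \<in> V"
    then show "leaf_vec (V, \<psi>') (W, \<psi>) u (\<psi>' p)
        = tangent_map m (\<psi>' \<circ> inv_into U \<phi>) (\<phi> p) (leaf_vec (U, \<phi>) (W, \<psi>) u (\<phi> p))"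
      by (intro leaf_vec_change W u) auto
  qed
  show "tangent_to_leaves M H HM act (\<lambda>c. leaf_vec c (W, \<psi>) u)"
    unfolding tangent_to_leaves_def
  proof (intro ballI, clarify)
    fix U \<phi> p assume "(U, \<phi>) \<in> atlas M" "p \<in> U"
    then show "leaf_vec (U, \<phi>) (W, \<psi>) u (\<phi> p) \<in> leaf_tangent_space H HM act (U, \<phi>) p"
      using W u by (subst leaf_tangent_space_eq) blast+
  qed
qed

section \<open>Horizontal forms\<close>

text \<open>The pointwise form of \<open>\<iota>_Y \<omega> = 0\<close>, tested on leaf vectors
  instead of vector fields.\<close>

definition horizontal :: "'a dform \<Rightarrow> bool" where
  "horizontal \<omega> \<longleftrightarrow> (\<forall>U \<phi> W \<psi> u x vs. (U, \<phi>) \<in> atlas M \<and> (W, \<psi>) \<in> atlas HM \<and> \<one>\<^bsub>H\<^esub> \<in> W \<and> u \<in> Rn d \<and> x \<in> \<phi> ` U \<longrightarrow>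
     \<omega> (chart_plot M (U, \<phi>)) x (leaf_vec (U, \<phi>) (W, \<psi>) u x # vs) = 0)"

lemma chart_plot_in:
  assumes "(U, \<phi>) \<in> atlas M" shows "chart_plot M (U, \<phi>) \<in> manifold_diffeology M"
  unfolding chart_plot_def prod.case by (rule manifold_diffeology_restrict[OF preM plot_chart[OF man assms]])

lemma chart_eform:
  assumes "\<omega> \<in> dforms (manifold_diffeology M) k" "(U, \<phi>) \<in> atlas M"
  shows "\<omega> (chart_plot M (U, \<phi>)) \<in> eforms m (\<phi> ` U) k"
  using dforms_eform[OF assms(1)] chart_plot_in[OF assms(2)] by (simp add: chart_plot_def)

lemma chart_d: "dform_d \<omega> (chart_plot M (U, \<phi>)) = eform_d m (\<phi> ` U) (\<omega> (chart_plot M (U, \<phi>)))"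
  by (simp add: chart_plot_def dform_d_apply)

text \<open>In Cartan's formula \<open>L_Y = \<iota>_Y d + d \<iota>_Y\<close> the last term
  vanishes by \<open>int\<close>.\<close>

lemma interior_lie_d:
  assumes \<omega>: "\<omega> \<in> dforms (manifold_diffeology M) k" and U: "(U, \<phi>) \<in> atlas M"
    and Y: "smooth_between m (\<phi> ` U) m (Rn m) Y"
    and int: "eform_interior Y (\<omega> (chart_plot M (U, \<phi>))) = 0"
  shows "eform_interior Y (dform_d \<omega> (chart_plot M (U, \<phi>))) = eform_lie m (\<phi> ` U) Y (\<omega> (chart_plot M (U, \<phi>)))"
proof (intro ext)
  fix x vs
  let ?w = "\<omega> (chart_plot M (U, \<phi>))"
  note op = premanifold_chart(2)[OF preM U]
  note w = chart_eform[OF \<omega> U]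
  have F: "smooth_field m (\<phi> ` U) m Y" by (rule smooth_field_of_between[OF op Y order_refl])
  have YR: "Y x \<in> Rn m" if "x \<in> \<phi> ` U" using F that unfolding smooth_field_def by blast
  have int': "?w y (Y y # us) = 0" for y us using int by (simp add: eform_interior_def fun_eq_iff)
  show "eform_interior Y (dform_d \<omega> (chart_plot M (U, \<phi>))) x vs = eform_lie m (\<phi> ` U) Y ?w x vs"
  proof (cases "x \<in> \<phi> ` U \<and> set vs \<subseteq> Rn m")
    case False
    then show ?thesis unfolding chart_d by (auto simp: eform_interior_def eform_lie_def eform_d_eq)
  next
    case True
    then have x: "x \<in> \<phi> ` U" and vs: "set vs \<subseteq> Rn m" by auto
    have L: "eform_interior Y (dform_d \<omega> (chart_plot M (U, \<phi>))) x vs = ext_deriv m ?w x (Y x # vs)"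
      unfolding chart_d using x vs YR[OF x] by (simp add: eform_interior_def eform_d_eq)
    show ?thesis
    proof (cases "length vs = k")
      case True
      from cartan[OF op x F eforms_sform[OF w] True vs] show ?thesis
        using L x vs by (simp add: int' eform_lie_def)
    next
      case False
      have "ext_deriv m ?w x (Y x # vs) = 0" by (rule ext_deriv_wrong_length[OF op x w]) (use False in simp)
      moreover have "?w y us = 0" if "length us = length vs" for y us using eforms_zero[OF w] False that by simp
      ultimately show ?thesis using L by (simp add: eform_lie_def)
    qed
  qed
qed

text \<open>Fundamental fields are global, so a basic form kills each leaf vector, and
  \<open>interior_lie_d\<close> turns the Lie condition into the same condition on
  \<open>d\<omega>\<close>. Conversely, every value of a field tangent to the leaves is a leaf
  vector.\<close>

lemma basic_forms_iff:
  "\<omega> \<in> basic_forms M H HM act k \<longleftrightarrow>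
     \<omega> \<in> dforms (manifold_diffeology M) k \<and> horizontal \<omega> \<and> horizontal (dform_d \<omega>)"
proof safe
  assume \<omega>: "\<omega> \<in> basic_forms M H HM act k"
  then show \<omega>d: "\<omega> \<in> dforms (manifold_diffeology M) k" by (simp add: basic_forms_def)
  have b: "eform_interior (leaf_vec (U, \<phi>) (W, \<psi>) u) (\<omega> (chart_plot M (U, \<phi>))) = 0
       \<and> eform_lie m (\<phi> ` U) (leaf_vec (U, \<phi>) (W, \<psi>) u) (\<omega> (chart_plot M (U, \<phi>))) = 0"
    if "(U, \<phi>) \<in> atlas M" "(W, \<psi>) \<in> atlas HM" "\<one>\<^bsub>H\<^esub> \<in> W" "u \<in> Rn d" for U \<phi> W \<psi> u
  proof -
    have "\<forall>Y. vector_field M Y \<and> tangent_to_leaves M H HM act Y \<longrightarrow> (\<forall>(U, \<phi>)\<in>atlas M.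
        eform_interior (Y (U, \<phi>)) (\<omega> (chart_plot M (U, \<phi>))) = 0 \<and>
        eform_lie m (\<phi> ` U) (Y (U, \<phi>)) (\<omega> (chart_plot M (U, \<phi>))) = 0)"
      using \<omega> unfolding basic_forms_def mem_Collect_eq by (rule conjunct2)
    from mp[OF spec[OF this, of "\<lambda>c. leaf_vec c (W, \<psi>) u"] conjI[OF fundamental_vector_field[OF that(2-4)]]]
    show ?thesis using that(1) by (auto simp del: zero_fun_apply)
  qed
  show "horizontal \<omega>"
    unfolding horizontal_def using b by (auto simp: eform_interior_def fun_eq_iff)
  show "horizontal (dform_d \<omega>)"
    unfolding horizontal_def
  proof (intro allI impI, elim conjE)
    fix U \<phi> W \<psi> u x and vs :: "(nat \<Rightarrow> real) list"
    assume *: "(U, \<phi>) \<in> atlas M" "(W, \<psi>) \<in> atlas HM" "\<one>\<^bsub>H\<^esub> \<in> W" "u \<in> Rn d" "x \<in> \<phi> ` U"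
    have "eform_interior (leaf_vec (U, \<phi>) (W, \<psi>) u) (dform_d \<omega> (chart_plot M (U, \<phi>))) = 0"
      using interior_lie_d[OF \<omega>d *(1) leaf_vec_smooth[OF *(1-3)]] b[OF *(1-4)] by metis
    then show "dform_d \<omega> (chart_plot M (U, \<phi>)) x (leaf_vec (U, \<phi>) (W, \<psi>) u x # vs) = 0"
      by (simp add: eform_interior_def fun_eq_iff)
  qed
next
  assume \<omega>: "\<omega> \<in> dforms (manifold_diffeology M) k" and h: "horizontal \<omega>" and hd: "horizontal (dform_d \<omega>)"
  have int: "eform_interior (Y (U, \<phi>)) (\<eta> (chart_plot M (U, \<phi>))) = 0"
    if Y: "tangent_to_leaves M H HM act Y" and U: "(U, \<phi>) \<in> atlas M"
      and \<eta>: "horizontal \<eta>" "\<eta> \<in> dforms (manifold_diffeology M) l" for Y U \<phi> \<eta> l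
  proof (intro ext)
    fix x vs
    show "eform_interior (Y (U, \<phi>)) (\<eta> (chart_plot M (U, \<phi>))) x vs = 0 x vs"
    proof (cases "x \<in> \<phi> ` U")
      case True
      then obtain p where p: "p \<in> U" "x = \<phi> p" by auto
      have "Y (U, \<phi>) (\<phi> p) \<in> leaf_tangent_space H HM act (U, \<phi>) p"
        using Y U p(1) unfolding tangent_to_leaves_def by blast
      \<comment> \<open>The chart of \<open>H\<close> and the vector \<open>u\<close> may depend on
        the point; \<open>horizontal\<close>, being pointwise, allows this.\<close>
      then obtain W \<psi> u where "(W, \<psi>) \<in> atlas HM" "\<one>\<^bsub>H\<^esub> \<in> W" "u \<in> Rn d"
        "Y (U, \<phi>) x = leaf_vec (U, \<phi>) (W, \<psi>) u x"
        unfolding leaf_tangent_space_eq[OF U p(1)] p(2) by blast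
      then show ?thesis using \<eta>(1) U True unfolding horizontal_def eform_interior_def by simp
    next
      case False
      then show ?thesis using eforms_zero[OF chart_eform[OF \<eta>(2) U]] by (simp add: eform_interior_def)
    qed
  qed
  have dd: "dform_d \<omega> \<in> dforms (manifold_diffeology M) (Suc k)"
    by (rule dform_d_in[OF manifold_diffeology_params \<omega>])
  show "\<omega> \<in> basic_forms M H HM act k"
    unfolding basic_forms_def mem_Collect_eq
  proof (intro conjI \<omega> allI impI ballI, goal_cases)
    case (1 Y c)
    obtain U \<phi> where c: "c = (U, \<phi>)" by (cases c)
    have U: "(U, \<phi>) \<in> atlas M" using 1 c by simp
    have Y: "smooth_between m (\<phi> ` U) m (Rn m) (Y (U, \<phi>))" using 1 U unfolding vector_field_def by blast
    have tl: "tangent_to_leaves M H HM act Y" using 1 by simp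
    note i = int[OF tl U h \<omega>]
    show ?case
      using i interior_lie_d[OF \<omega> U Y i] int[OF tl U hd dd] by (simp only: c prod.case)
  qed
qed

lemma horizontal_lincomb: "horizontal \<omega> \<Longrightarrow> horizontal \<eta> \<Longrightarrow> horizontal (a *\<^sub>R \<omega> + b *\<^sub>R \<eta>)"
  unfolding horizontal_def by simp

lemma horizontal_zero: "horizontal 0"
  unfolding horizontal_def by simp

text \<open>Stability under \<open>d\<close> is immediate from the pointwise description:
  \<open>d\<omega>\<close> is horizontal for a basic \<open>\<omega>\<close>, and
  \<open>d d\<omega> = 0\<close> is horizontal trivially.\<close>

lemma basic_complex: "cochain_complex (invariant_basic_forms M H HM act) dform_d"
proof (rule cochain_complex_subcomplex[OF manifold_diffeology_params[of M]])
  fix k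
  let ?D = "manifold_diffeology M"
  show "invariant_basic_forms M H HM act k \<subseteq> dforms ?D k"
    by (auto simp: invariant_basic_forms_def basic_forms_def)
  have inv: "\<omega> \<in> invariant_basic_forms M H HM act k \<longleftrightarrow> \<omega> \<in> dforms ?D k \<and> horizontal \<omega> \<and> horizontal (dform_d \<omega>) \<and>
     (\<forall>h\<in>carrier H. dform_pull ?D (\<lambda>x. act x h) \<omega> = \<omega>)" for \<omega> k
    by (auto simp: invariant_basic_forms_def basic_forms_iff)
  have d0: "dform_d (0 :: 'a dform) = 0"
    using dform_d_lincomb[OF manifold_diffeology_params[of M] zero_dforms[of _ 0] zero_dforms[of _ 0], of 0 0]
    by (simp only: scaleR_zero_left add_0_left)
  have pull0: "dform_pull ?D f (0 :: 'a dform) = 0" for f :: "'a \<Rightarrow> 'a"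
    by (simp add: dform_pull_def fun_eq_iff)
  show "subspace (invariant_basic_forms M H HM act k)"
  proof (rule subspace_lincombI)
    show "0 \<in> invariant_basic_forms M H HM act k"
      unfolding inv d0 using zero_dforms horizontal_zero pull0 by blast
    fix x y a b assume "x \<in> invariant_basic_forms M H HM act k" "y \<in> invariant_basic_forms M H HM act k"
    then show "a *\<^sub>R x + b *\<^sub>R y \<in> invariant_basic_forms M H HM act k"
      unfolding inv
      by (simp only: dform_pull_lincomb dform_d_lincomb[OF manifold_diffeology_params[of M], of _ k] horizontal_lincomb
          dforms_lincomb[OF manifold_diffeology_params]) simp
  qed
  fix \<omega> assume "\<omega> \<in> invariant_basic_forms M H HM act k"
  then have \<omega>: "\<omega> \<in> dforms ?D k" "horizontal (dform_d \<omega>)" "\<forall>h\<in>carrier H. dform_pull ?D (\<lambda>x. act x h) \<omega> = \<omega>"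
    unfolding inv by blast+
  show "dform_d \<omega> \<in> invariant_basic_forms M H HM act (Suc k)"
    unfolding inv dform_d_d[OF manifold_diffeology_params \<omega>(1)]
    using dform_d_in[OF manifold_diffeology_params \<omega>(1)] \<omega>(2,3) horizontal_zero by (simp only: dform_pull_d) simp
qed

end

section \<open>Estimates for smooth fields\<close>

lemma nrm_zero [simp]: "nrm n 0 = 0"
  by (simp add: nrm_def)

lemma nrm_eq_zero:
  assumes "v \<in> Rn n" "nrm n v = 0" shows "v = 0"
proof (rule Rn_ext[OF assms(1)])
  show "v i = 0 i" if "i < n" for i using nrm_coord[OF that, of v] assms(2) by simp
qed simp

lemma tangent_map_linear:
  "tangent_map n f x (a *\<^sub>R v + b *\<^sub>R w) = a *\<^sub>R tangent_map n f x v + b *\<^sub>R tangent_map n f x w"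
  unfolding tangent_map_def dir_deriv_linear by (simp add: fun_eq_iff)

lemma tangent_map_diff: "tangent_map n f x (v - w) = tangent_map n f x v - tangent_map n f x w"
  unfolding tangent_map_def dir_deriv_minus by (simp add: fun_eq_iff)

lemma tangent_map_add: "tangent_map n f x (v + w) = tangent_map n f x v + tangent_map n f x w"
  unfolding tangent_map_def dir_deriv_plus by (simp add: fun_eq_iff)

lemma tangent_map_scale: "tangent_map n f x (a *\<^sub>R v) = a *\<^sub>R tangent_map n f x v"
  unfolding tangent_map_def dir_deriv_scale by (simp add: fun_eq_iff)

lemma tangent_map_bound:
  obtains C where "C \<ge> 0" "\<And>v. nrm m (tangent_map n f x v) \<le> C * nrm n v"
proof
  define C where "C = (\<Sum>j<m. nrm n (\<lambda>i. partial i (\<lambda>y. f y j) x))"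
  show "C \<ge> 0" by (simp add: C_def sum_nonneg)
  show "nrm m (tangent_map n f x v) \<le> C * nrm n v" for v
  proof -
    have "\<bar>tangent_map n f x v j\<bar> \<le> nrm n (\<lambda>i. partial i (\<lambda>y. f y j) x) * nrm n v" for j
    proof -
      have "\<bar>tangent_map n f x v j\<bar> \<le> (\<Sum>i<n. \<bar>v i\<bar> * \<bar>partial i (\<lambda>y. f y j) x\<bar>)"
        unfolding tangent_map_def dir_deriv_def by (rule order_trans[OF sum_abs]) (simp add: abs_mult)
      also have "\<dots> \<le> (\<Sum>i<n. \<bar>v i\<bar> * nrm n (\<lambda>i. partial i (\<lambda>y. f y j) x))"
        by (intro sum_mono mult_left_mono nrm_coord) auto
      finally show ?thesis
        unfolding sum_distrib_right[symmetric] nrm_def[of n v, symmetric] by (simp add: mult.commute)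
    qed
    then have "nrm m (tangent_map n f x v) \<le> (\<Sum>j<m. nrm n (\<lambda>i. partial i (\<lambda>y. f y j) x) * nrm n v)"
      unfolding nrm_def[of m] by (intro sum_mono)
    then show ?thesis by (simp add: C_def sum_distrib_right)
  qed
qed

lemma strict_diff_field:
  assumes U: "openin (Euclidean_space n) U" and f: "smooth_field n U m f" and x0: "x0 \<in> U" and e: "e > 0"
  obtains d where "d > 0" "ebox n x0 d \<subseteq> U"
    "\<And>x y. x \<in> ebox n x0 d \<Longrightarrow> y \<in> ebox n x0 d \<Longrightarrow>
       nrm m (f y - f x - tangent_map n f x0 (y - x)) \<le> e * nrm n (y - x)"
proof -
  \<comment> \<open>The error is shared among the \<open>m\<close> components; the added 1 avoids
    dividing by 0 when \<open>m = 0\<close>.\<close>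
  have e': "e / (real m + 1) > 0" using e by simp
  have "\<exists>d>0. ebox n x0 d \<subseteq> U \<and> (\<forall>x\<in>ebox n x0 d. \<forall>y\<in>ebox n x0 d.
      \<bar>f y j - f x j - dir_deriv n (y - x) (\<lambda>y. f y j) x0\<bar> \<le> e / (real m + 1) * nrm n (y - x))" for j
    using strict_diff[OF U _ x0 e', of "\<lambda>y. f y j"] f unfolding smooth_field_def by metis
  then obtain D where D: "\<And>j. D j > 0" "\<And>j. ebox n x0 (D j) \<subseteq> U"
    "\<And>j x y. x \<in> ebox n x0 (D j) \<Longrightarrow> y \<in> ebox n x0 (D j) \<Longrightarrow>
      \<bar>f y j - f x j - dir_deriv n (y - x) (\<lambda>y. f y j) x0\<bar> \<le> e / (real m + 1) * nrm n (y - x)" by metis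
  \<comment> \<open>The index \<open>m\<close>, beyond the components in use, keeps the set nonempty
    when \<open>m = 0\<close>.\<close>
  define d where "d = Min (D ` {..m})"
  have d: "d > 0" using D(1) by (auto simp: d_def)
  have dD: "d \<le> D j" if "j \<le> m" for j using that by (auto simp: d_def)
  show thesis
  proof (rule that[OF d])
    show "ebox n x0 d \<subseteq> U" using ebox_mono[OF dD[of 0]] D(2) by blast
    fix x y assume xy: "x \<in> ebox n x0 d" "y \<in> ebox n x0 d"
    have "nrm m (f y - f x - tangent_map n f x0 (y - x)) \<le> (\<Sum>j<m. e / (real m + 1) * nrm n (y - x))"
      unfolding nrm_def[of m]
    proof (rule sum_mono)
      fix j assume "j \<in> {..<m}"
      then have "ebox n x0 d \<subseteq> ebox n x0 (D j)" by (intro ebox_mono dD) simp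
      then show "\<bar>(f y - f x - tangent_map n f x0 (y - x)) j\<bar> \<le> e / (real m + 1) * nrm n (y - x)"
        using D(3)[of x j y] xy by (auto simp: tangent_map_def)
    qed
    also have "\<dots> = (e * nrm n (y - x)) * (real m / (real m + 1))" by simp
    also have "\<dots> \<le> (e * nrm n (y - x)) * 1" using e by (intro mult_left_mono) auto
    finally show "nrm m (f y - f x - tangent_map n f x0 (y - x)) \<le> e * nrm n (y - x)" by simp
  qed
qed

text \<open>A closed subset of a product of compact intervals, with the factor \<open>{0}\<close>
  from index \<open>d\<close> on. The choice \<open>a = 0\<close> gives closed balls,
  \<open>a = r\<close> spheres.\<close>

lemma compact_shell:
  assumes e0: "e0 \<in> Rn d" shows "compact {z \<in> Rn d. a \<le> nrm d (z - e0) \<and> nrm d (z - e0) \<le> r}"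
proof -
  define C where "C i = (if i < d then {e0 i - r..e0 i + r} else {0::real})" for i
  have "compactin (product_topology (\<lambda>i. euclideanreal) UNIV) (Pi\<^sub>E UNIV C)"
    by (simp add: compactin_PiE C_def)
  then have P: "compact (Pi\<^sub>E UNIV C)"
    by (simp add: euclidean_product_topology)
  have cont: "continuous_on UNIV (\<lambda>z. nrm d (z - e0))"
    unfolding nrm_def by (auto intro!: continuous_intros continuous_on_coord)
  have "closed {z. a \<le> nrm d (z - e0)}" "closed {z. nrm d (z - e0) \<le> r}"
    by (auto intro!: closed_Collect_le cont)
  then have "compact (Pi\<^sub>E UNIV C \<inter> ({z. a \<le> nrm d (z - e0)} \<inter> {z. nrm d (z - e0) \<le> r}))"
    by (intro compact_Int_closed P closed_Int)
  moreover have "{z \<in> Rn d. a \<le> nrm d (z - e0) \<and> nrm d (z - e0) \<le> r}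
      = Pi\<^sub>E UNIV C \<inter> ({z. a \<le> nrm d (z - e0)} \<inter> {z. nrm d (z - e0) \<le> r})" (is "?L = ?R")
  proof (intro equalityI subsetI)
    fix z assume z: "z \<in> ?L"
    have "z i \<in> C i" for i
      using z nrm_coord[of i d "z - e0"] by (cases "i < d") (auto simp: C_def Rn_iff abs_le_iff)
    then show "z \<in> ?R" using z by auto
  next
    fix z assume z: "z \<in> ?R"
    then have "z i = 0" if "i \<ge> d" for i using that by (auto simp: PiE_iff C_def dest!: spec[of _ i])
    then show "z \<in> ?L" using z by (auto simp: Rn_iff)
  qed
  ultimately show ?thesis by simp
qed

lemma cat_add: "cat m a b + cat m a' b' = cat m (a + a') (b + b')"
  by (auto simp: cat_def fun_eq_iff)

lemma cat_diff: "cat m a b - cat m a' b' = cat m (a - a') (b - b')"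
  by (auto simp: cat_def fun_eq_iff)

lemma cat_scale: "r *\<^sub>R cat m a b = cat m (r *\<^sub>R a) (r *\<^sub>R b)"
  by (auto simp: cat_def fun_eq_iff)

text \<open>The sum of absolute values is used as norm because it splits exactly over a
  concatenation, so that estimates on a product separate into the two factors.\<close>

lemma nrm_cat: "nrm (m + d) (cat m a b) = nrm m a + nrm d b"
proof -
  have "nrm (m + d) (cat m a b) = (\<Sum>i<m. \<bar>cat m a b i\<bar>) + (\<Sum>i=m..<m+d. \<bar>cat m a b i\<bar>)"
    unfolding nrm_def by (simp add: sum.atLeastLessThan_concat lessThan_atLeast0)
  also have "(\<Sum>i=m..<m+d. \<bar>cat m a b i\<bar>) = (\<Sum>i<d. \<bar>b i\<bar>)"
    using sum.shift_bounds_nat_ivl[of "\<lambda>i. \<bar>cat m a b i\<bar>" 0 m d]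
    by (simp add: cat_def lessThan_atLeast0 add.commute)
  finally show ?thesis by (simp add: nrm_def cat_def)
qed

lemma cat_in_ebox: "a \<in> ebox m a0 e \<Longrightarrow> b \<in> ebox d b0 e \<Longrightarrow> cat m a b \<in> ebox (m + d) (cat m a0 b0) e"
  using cat_Rn[of b d m a] by (auto simp: ebox_def cat_def)

lemma nrm_sum3: "nrm n (a + b + c) \<le> nrm n a + nrm n b + nrm n c"
  using nrm_triangle[of n "a + b" c] nrm_triangle[of n a b] by linarith

lemma continuous_tangent_cat: "continuous_on S (\<lambda>u. tangent_map n f x (cat m 0 u) j)"
proof -
  have "continuous_on S (\<lambda>u. cat m 0 u i)" for i
    by (cases "i < m") (simp_all add: cat_def continuous_on_coord)
  then show ?thesis unfolding tangent_map_def dir_deriv_def by (intro continuous_intros)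
qed

text \<open>The minimum of \<open>nrm m (A u)\<close> over the compact unit sphere is positive by
  injectivity, and homogeneity extends the bound to all of \<open>Rn d\<close>.\<close>

lemma injective_bound:
  fixes A :: "(nat \<Rightarrow> real) \<Rightarrow> nat \<Rightarrow> real"
  assumes scale: "\<And>r u. A (r *\<^sub>R u) = r *\<^sub>R A u" and cont: "\<And>j. continuous_on UNIV (\<lambda>u. A u j)"
    and inj: "\<And>u. u \<in> Rn d \<Longrightarrow> A u = 0 \<Longrightarrow> u = 0" and AR: "\<And>u. u \<in> Rn d \<Longrightarrow> A u \<in> Rn m"
  obtains c where "c > 0" "\<And>u. u \<in> Rn d \<Longrightarrow> c * nrm d u \<le> nrm m (A u)"
proof -
  define S where "S = {u \<in> Rn d. 1 \<le> nrm d (u - 0) \<and> nrm d (u - 0) \<le> 1}"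
  have S: "compact S" unfolding S_def by (rule compact_shell) simp
  have norm_in: "(1 / nrm d u) *\<^sub>R u \<in> S" if "u \<in> Rn d" "nrm d u \<noteq> 0" for u
  proof -
    have "nrm d ((1 / nrm d u) *\<^sub>R u) = 1" unfolding nrm_scaleR using that(2) nrm_nonneg[of d u] by simp
    then show ?thesis unfolding S_def diff_0_right using Rn_scaleR[OF that(1)] by simp
  qed
  have cA: "continuous_on S (\<lambda>u. nrm m (A u))"
    unfolding nrm_def by (intro continuous_intros continuous_on_subset[OF cont]) auto
  show thesis
  \<comment> \<open>The sphere is empty when \<open>d = 0\<close>; the bound is then
    trivial.\<close>
  proof (cases "S = {}")
    case True
    then have "nrm d u = 0" if "u \<in> Rn d" for u using norm_in[OF that] by blast
    then show thesis by (intro that[of 1]) auto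
  next
    case False
    then obtain u0 where u0: "u0 \<in> S" "\<And>u. u \<in> S \<Longrightarrow> nrm m (A u0) \<le> nrm m (A u)"
      using continuous_attains_inf[OF S False cA] by blast
    have u0R: "u0 \<in> Rn d" "nrm d u0 = 1" using u0(1) by (auto simp: S_def simp del: zero_fun_apply)
    have "u0 \<noteq> 0" using u0R(2) by auto
    then have pos: "nrm m (A u0) > 0"
      using inj[OF u0R(1)] nrm_eq_zero[OF AR[OF u0R(1)]] nrm_nonneg[of m "A u0"]
      by (metis less_eq_real_def)
    show thesis
    proof (rule that[OF pos])
      fix u assume u: "u \<in> Rn d"
      show "nrm m (A u0) * nrm d u \<le> nrm m (A u)"
      proof (cases "nrm d u = 0")
        case False
        then have p: "nrm d u > 0" using nrm_nonneg[of d u] by linarith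
        have "nrm m (A u0) \<le> nrm m ((1 / nrm d u) *\<^sub>R A u)"
          using u0(2)[OF norm_in[OF u False]] unfolding scale .
        then show ?thesis using p unfolding nrm_scaleR by (simp add: field_simps)
      qed simp
    qed
  qed
qed

text \<open>If \<open>b' y = F (b y, \<eta> y)\<close> for some \<open>\<eta> y\<close> that tends to \<open>e0\<close>, then the difference
  quotients of \<open>\<eta>\<close> are bounded because the partial derivative of \<open>F\<close> in the second variable is
  injective; a limit point \<open>u\<close> of them relates the derivatives. No regularity of \<open>\<eta>\<close> is needed.\<close>

lemma implicit_direction:
  assumes V: "openin (Euclidean_space n) V" and b: "smooth_field n V m b" and b': "smooth_field n V m b'"
    and O: "openin (Euclidean_space (m + d)) O'" and F: "smooth_field (m + d) O' m F"
    and x: "x \<in> V" and e0: "e0 \<in> Rn d" and c0: "cat m (b x) e0 \<in> O'" and Fc0: "F (cat m (b x) e0) = b' x"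
    and inj: "\<And>u. u \<in> Rn d \<Longrightarrow> tangent_map (m + d) F (cat m (b x) e0) (cat m 0 u) = 0 \<Longrightarrow> u = 0"
    and approx: "\<And>\<delta>. \<delta> > 0 \<Longrightarrow> \<exists>\<tau>>0. \<forall>y\<in>ebox n x \<tau>. \<exists>\<eta>\<in>ebox d e0 \<delta>. b' y = F (cat m (b y) \<eta>)"
    and v: "v \<in> Rn n"
  shows "\<exists>u\<in>Rn d. tangent_map n b' x v
    = tangent_map (m + d) F (cat m (b x) e0) (cat m (tangent_map n b x v) 0)
      + tangent_map (m + d) F (cat m (b x) e0) (cat m 0 u)"
proof -
  define A where "A u = tangent_map (m + d) F (cat m (b x) e0) (cat m 0 u)" for u
  define B where "B w = tangent_map (m + d) F (cat m (b x) e0) (cat m w 0)" for w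
  \<comment> \<open>The part of the derivative of \<open>b'\<close> not explained by that of
    \<open>b\<close>; it has to be shown to lie in the image of \<open>A\<close>.\<close>
  define D where "D = tangent_map n b' x v - B (tangent_map n b x v)"
  have xR: "x \<in> Rn n" using x openin_E_subset[OF V] by blast
  have FR: "\<And>c. c \<in> O' \<Longrightarrow> F c \<in> Rn m" and bR: "\<And>y. y \<in> V \<Longrightarrow> b y \<in> Rn m" and b'R: "\<And>y. y \<in> V \<Longrightarrow> b' y \<in> Rn m"
    using F b b' by (auto simp: smooth_field_def)
  have TR: "tangent_map (m + d) F (cat m (b x) e0) w \<in> Rn m" for w
    by (rule tangent_map_Rn[OF O c0 FR])
  have AR: "A u \<in> Rn m" for u unfolding A_def by (rule TR)
  have DR: "D \<in> Rn m" unfolding D_def B_def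
    by (intro Rn_diff TR tangent_map_Rn[OF V x b'R])
  have Ascale: "A (r *\<^sub>R u) = r *\<^sub>R A u" for r u
    unfolding A_def tangent_map_scale[symmetric] cat_scale scaleR_zero_right ..
  have Bscale: "B (r *\<^sub>R u) = r *\<^sub>R B u" for r u
    unfolding B_def tangent_map_scale[symmetric] cat_scale scaleR_zero_right ..
  have Bdiff: "B (u - w) = B u - B w" for u w
    unfolding B_def tangent_map_diff[symmetric] cat_diff diff_self ..
  have split: "tangent_map (m + d) F (cat m (b x) e0) (cat m w u) = B w + A u" for w u
    unfolding A_def B_def tangent_map_add[symmetric] cat_add add_0_left add_0_right ..
  have Acont: "continuous_on S (\<lambda>u. A u j)" for S j unfolding A_def by (rule continuous_tangent_cat)
  obtain c where c: "c > 0" "\<And>u. u \<in> Rn d \<Longrightarrow> c * nrm d u \<le> nrm m (A u)"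
    using injective_bound[of A d m, OF Ascale Acont _ AR] inj[folded A_def] by metis
  obtain C where C: "C \<ge> 0" "\<And>w. nrm m (tangent_map (m + d) F (cat m (b x) e0) w) \<le> C * nrm (m + d) w"
    using tangent_map_bound by metis
  have CB: "nrm m (B w) \<le> C * nrm m w" for w
    using C(2)[of "cat m w 0"] unfolding B_def nrm_cat by (simp only: nrm_zero add_0_right)
  define l where "l = nrm m (tangent_map n b x v) + 1"
  define l' where "l' = nrm m (tangent_map n b' x v) + 1"
  have l: "l \<ge> 1" "l' \<ge> 1" by (simp_all add: l_def l'_def)
  \<comment> \<open>For the increments \<open>h\<close> of \<open>\<eta>\<close> belonging to a step
    \<open>t v\<close> one will get \<open>c * nrm d h \<le> t * Q + c / 2 * nrm d h\<close>, hence
    \<open>nrm d h \<le> t * R\<close>. The summands of \<open>Z\<close> are the factors of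
    \<open>\<epsilon> * t\<close> in the final error: 1 from \<open>b'\<close>, \<open>C\<close>
    from \<open>b\<close>, and \<open>l\<close> and \<open>R\<close> from the remainder of
    \<open>F\<close>.\<close>
  define Q where "Q = l' + (C + 1) * l"
  define R where "R = 2 * Q / c"
  define Z where "Z = 1 + C + l + R"
  have Q: "Q > 0" unfolding Q_def using l C(1) by (intro add_pos_nonneg) auto
  have R: "R > 0" unfolding R_def using Q c(1) by simp
  have Z: "Z > 0" unfolding Z_def using R l C(1) by linarith
  define K where "K = {u \<in> Rn d. 0 \<le> nrm d (u - 0) \<and> nrm d (u - 0) \<le> R}"
  have K: "compact K" unfolding K_def by (rule compact_shell) simp
  have K0: "K \<noteq> {}"
  proof -
    have "0 \<in> K" unfolding K_def mem_Collect_eq diff_self nrm_zero using R by simp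
    then show ?thesis by blast
  qed
  have close: "\<exists>u\<in>K. nrm m (D - A u) \<le> \<epsilon> * Z" if \<epsilon>: "0 < \<epsilon>" "\<epsilon> \<le> 1" "\<epsilon> \<le> c / 2" for \<epsilon>
  proof -
    define nv where "nv = nrm n v"
    have nv: "nv \<ge> 0" by (simp add: nv_def)
    \<comment> \<open>The step has norm \<open>t * nv\<close>, so this accuracy gives an error of at
      most \<open>\<epsilon> * t\<close> for \<open>b\<close> and \<open>b'\<close>; the added 1
      covers \<open>v = 0\<close>.\<close>
    have \<epsilon>': "\<epsilon> / (nv + 1) > 0" using \<epsilon> nv by simp
    obtain \<delta>F where \<delta>F: "\<delta>F > 0" "\<And>y z. y \<in> ebox (m + d) (cat m (b x) e0) \<delta>F \<Longrightarrow> z \<in> ebox (m + d) (cat m (b x) e0) \<delta>F \<Longrightarrow>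
       nrm m (F z - F y - tangent_map (m + d) F (cat m (b x) e0) (z - y)) \<le> \<epsilon> * nrm (m + d) (z - y)"
      using strict_diff_field[OF O F c0 \<epsilon>(1)] by metis
    obtain \<delta>b where \<delta>b: "\<delta>b > 0" "ebox n x \<delta>b \<subseteq> V" "\<And>y z. y \<in> ebox n x \<delta>b \<Longrightarrow> z \<in> ebox n x \<delta>b \<Longrightarrow>
       nrm m (b z - b y - tangent_map n b x (z - y)) \<le> \<epsilon> / (nv + 1) * nrm n (z - y)"
      using strict_diff_field[OF V b x \<epsilon>'] by metis
    obtain \<delta>b' where \<delta>b': "\<delta>b' > 0" "\<And>y z. y \<in> ebox n x \<delta>b' \<Longrightarrow> z \<in> ebox n x \<delta>b' \<Longrightarrow>
       nrm m (b' z - b' y - tangent_map n b' x (z - y)) \<le> \<epsilon> / (nv + 1) * nrm n (z - y)"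
      using strict_diff_field[OF V b' x \<epsilon>'] by metis
    obtain \<tau> where \<tau>: "\<tau> > 0" "\<And>y. y \<in> ebox n x \<tau> \<Longrightarrow> \<exists>\<eta>\<in>ebox d e0 \<delta>F. b' y = F (cat m (b y) \<eta>)"
      using approx[OF \<delta>F(1)] by metis
    define \<mu> where "\<mu> = min (min \<tau> \<delta>b) (min \<delta>b' \<delta>F)"
    have \<mu>: "\<mu> > 0" "\<mu> \<le> \<tau>" "\<mu> \<le> \<delta>b" "\<mu> \<le> \<delta>b'" "\<mu> \<le> \<delta>F" using \<tau> \<delta>b \<delta>b' \<delta>F by (auto simp: \<mu>_def)
    \<comment> \<open>Small enough that both the step, of norm \<open>t * nv\<close>, and the
      resulting change of \<open>b\<close>, of norm at most \<open>t * l\<close>, stay within the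
      box of size \<open>\<mu>\<close>.\<close>
    define t where "t = \<mu> / (nv + l + 1)"
    have t: "t > 0" using \<mu>(1) nv l by (simp add: t_def)
    have tt: "t * (nv + l + 1) = \<mu>" using nv l by (simp add: t_def)
    have tnv: "t * nv < \<mu>" and tl: "t * l < \<mu>"
    proof -
      have "t * nv < t * (nv + l + 1)" "t * l < t * (nv + l + 1)"
        using t nv l by (intro mult_strict_left_mono; simp)+
      then show "t * nv < \<mu>" "t * l < \<mu>" unfolding tt .
    qed
    define y where "y = x + t *\<^sub>R v"
    have yx: "y - x = t *\<^sub>R v" by (simp add: y_def)
    have yR: "y \<in> Rn n" unfolding y_def by (intro Rn_add Rn_scaleR xR v)
    have nyx: "nrm n (y - x) = t * nv" unfolding yx nrm_scaleR nv_def using t by simp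
    have y_in: "y \<in> ebox n x \<mu>" by (rule ebox_nrm[OF yR]) (simp only: nyx tnv)
    have boxes: "y \<in> ebox n x \<tau>" "y \<in> ebox n x \<delta>b" "y \<in> ebox n x \<delta>b'" "x \<in> ebox n x \<delta>b" "x \<in> ebox n x \<delta>b'"
      using y_in ebox_mono[OF \<mu>(2), of n x] ebox_mono[OF \<mu>(3), of n x] ebox_mono[OF \<mu>(4), of n x]
        ebox_refl[OF xR \<delta>b(1)] ebox_refl[OF xR \<delta>b'(1)] by auto
    have yV: "y \<in> V" using boxes(2) \<delta>b(2) by blast
    have eps_t: "\<epsilon> / (nv + 1) * (t * nv) \<le> \<epsilon> * t"
    proof -
      have "\<epsilon> / (nv + 1) * (t * nv) = (\<epsilon> * t) * (nv / (nv + 1))" by simp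
      also have "\<dots> \<le> (\<epsilon> * t) * 1" using \<epsilon> t nv by (intro mult_left_mono) auto
      finally show ?thesis by simp
    qed
    have eb: "nrm m (b y - b x - t *\<^sub>R tangent_map n b x v) \<le> \<epsilon> * t"
      using \<delta>b(3)[OF boxes(4,2)] eps_t unfolding nyx unfolding yx tangent_map_scale by linarith
    have eb': "nrm m (b' y - b' x - t *\<^sub>R tangent_map n b' x v) \<le> \<epsilon> * t"
      using \<delta>b'(2)[OF boxes(5,3)] eps_t unfolding nyx unfolding yx tangent_map_scale by linarith
    have et: "\<epsilon> * t \<le> t" using \<epsilon> t by simp
    have db: "nrm m (b y - b x) \<le> t * l"
    proof -
      have "nrm m (b y - b x) \<le> nrm m (b y - b x - t *\<^sub>R tangent_map n b x v) + nrm m (t *\<^sub>R tangent_map n b x v)"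
        using nrm_triangle[of m "b y - b x - t *\<^sub>R tangent_map n b x v" "t *\<^sub>R tangent_map n b x v"] by simp
      also have "\<dots> \<le> t + t * nrm m (tangent_map n b x v)" unfolding nrm_scaleR abs_of_pos[OF t] using eb et by linarith
      finally show ?thesis by (simp add: l_def algebra_simps)
    qed
    have db': "nrm m (b' y - b' x) \<le> t * l'"
    proof -
      have "nrm m (b' y - b' x) \<le> nrm m (b' y - b' x - t *\<^sub>R tangent_map n b' x v) + nrm m (t *\<^sub>R tangent_map n b' x v)"
        using nrm_triangle[of m "b' y - b' x - t *\<^sub>R tangent_map n b' x v" "t *\<^sub>R tangent_map n b' x v"] by simp
      also have "\<dots> \<le> t + t * nrm m (tangent_map n b' x v)" unfolding nrm_scaleR abs_of_pos[OF t] using eb' et by linarith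
      finally show ?thesis by (simp add: l'_def algebra_simps)
    qed
    obtain \<eta> where \<eta>: "\<eta> \<in> ebox d e0 \<delta>F" "b' y = F (cat m (b y) \<eta>)" using \<tau>(2)[OF boxes(1)] by blast
    have \<eta>R: "\<eta> \<in> Rn d" using \<eta>(1) by (simp add: ebox_def)
    define h where "h = \<eta> - e0"
    have hR: "h \<in> Rn d" unfolding h_def by (rule Rn_diff[OF \<eta>R e0])
    have "b y \<in> ebox m (b x) \<delta>F"
      by (rule ebox_nrm[OF bR[OF yV]]) (use db tl \<mu>(5) in linarith)
    then have c1: "cat m (b y) \<eta> \<in> ebox (m + d) (cat m (b x) e0) \<delta>F"
      by (rule cat_in_ebox) (rule \<eta>(1))
    have c0': "cat m (b x) e0 \<in> ebox (m + d) (cat m (b x) e0) \<delta>F"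
      using openin_E_subset[OF O] c0 by (intro ebox_refl \<delta>F(1)) blast
    have rem: "nrm m (b' y - b' x - (B (b y - b x) + A h)) \<le> \<epsilon> * (nrm m (b y - b x) + nrm d h)"
      using \<delta>F(2)[OF c0' c1] unfolding cat_diff split nrm_cat Fc0 \<eta>(2)[symmetric] h_def .
    have rem': "nrm m (b' y - b' x - (B (b y - b x) + A h)) \<le> \<epsilon> * (t * l) + \<epsilon> * nrm d h"
    proof -
      have "\<epsilon> * nrm m (b y - b x) \<le> \<epsilon> * (t * l)" using db \<epsilon> by (intro mult_left_mono) auto
      then show ?thesis using rem by (simp add: distrib_left)
    qed
    have nB: "nrm m (B (b y - b x)) \<le> C * (t * l)"
      by (rule order_trans[OF CB mult_left_mono[OF db C(1)]])
    have "A h = (b' y - b' x) + ((-1) *\<^sub>R B (b y - b x)) + ((-1) *\<^sub>R (b' y - b' x - (B (b y - b x) + A h)))"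
      by (simp add: fun_eq_iff)
    then have "nrm m (A h) \<le> nrm m (b' y - b' x) + nrm m ((-1) *\<^sub>R B (b y - b x))
        + nrm m ((-1) *\<^sub>R (b' y - b' x - (B (b y - b x) + A h)))"
      using nrm_sum3 by metis
    then have "nrm m (A h) \<le> t * l' + C * (t * l) + (\<epsilon> * (t * l) + \<epsilon> * nrm d h)"
      unfolding nrm_scaleR using db' nB rem' by simp
    \<comment> \<open>The bound \<open>\<epsilon> \<le> c / 2\<close> is made for this line: half of
      the lower bound \<open>c * nrm d h\<close> for \<open>A h\<close> then absorbs the term with
      \<open>h\<close>.\<close>
    also have "\<dots> \<le> t * l' + C * (t * l) + (1 * (t * l) + c / 2 * nrm d h)"
      by (intro add_left_mono add_mono mult_right_mono \<epsilon>) (use t l in auto)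
    also have "\<dots> = t * Q + c / 2 * nrm d h" by (simp add: Q_def algebra_simps)
    finally have "c / 2 * nrm d h \<le> t * Q" using c(2)[OF hR] by linarith
    then have nh: "nrm d h \<le> t * R" using c(1) by (simp add: R_def field_simps)
    define u where "u = (1 / t) *\<^sub>R h"
    have th: "h = t *\<^sub>R u" using t by (simp add: u_def)
    have uR: "u \<in> Rn d" unfolding u_def by (rule Rn_scaleR[OF hR])
    have nu: "nrm d u \<le> R" using nh t unfolding u_def nrm_scaleR by (simp add: field_simps)
    have uK: "u \<in> K" unfolding K_def mem_Collect_eq diff_0_right using uR nu by simp
    have e1: "t *\<^sub>R (D - A u) = ((-1) *\<^sub>R (b' y - b' x - t *\<^sub>R tangent_map n b' x v))
        + B (b y - b x - t *\<^sub>R tangent_map n b x v) + (b' y - b' x - (B (b y - b x) + A h))"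
      unfolding th D_def Ascale Bdiff Bscale by (simp add: fun_eq_iff algebra_simps)
    have "t * nrm m (D - A u) \<le> nrm m ((-1) *\<^sub>R (b' y - b' x - t *\<^sub>R tangent_map n b' x v))
        + nrm m (B (b y - b x - t *\<^sub>R tangent_map n b x v)) + nrm m (b' y - b' x - (B (b y - b x) + A h))"
      using nrm_sum3[of m "(-1) *\<^sub>R (b' y - b' x - t *\<^sub>R tangent_map n b' x v)"
          "B (b y - b x - t *\<^sub>R tangent_map n b x v)" "b' y - b' x - (B (b y - b x) + A h)"]
        nrm_scaleR[of m t "D - A u"] t unfolding e1[symmetric] by simp
    also have "\<dots> \<le> \<epsilon> * t + C * (\<epsilon> * t) + (\<epsilon> * (t * l) + \<epsilon> * (t * R))"
    proof (intro add_mono)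
      show "nrm m ((-1) *\<^sub>R (b' y - b' x - t *\<^sub>R tangent_map n b' x v)) \<le> \<epsilon> * t"
        unfolding nrm_scaleR using eb' by simp
      show "nrm m (B (b y - b x - t *\<^sub>R tangent_map n b x v)) \<le> C * (\<epsilon> * t)"
        by (rule order_trans[OF CB mult_left_mono[OF eb C(1)]])
      have "\<epsilon> * nrm d h \<le> \<epsilon> * (t * R)" using nh \<epsilon> by (intro mult_left_mono) auto
      then show "nrm m (b' y - b' x - (B (b y - b x) + A h)) \<le> \<epsilon> * (t * l) + \<epsilon> * (t * R)" using rem' by linarith
    qed
    also have "\<dots> = t * (\<epsilon> * Z)" by (simp add: Z_def algebra_simps)
    finally have "nrm m (D - A u) \<le> \<epsilon> * Z" using t by simp
    then show ?thesis using uK by blast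
  qed
  \<comment> \<open>By \<open>close\<close> the defect \<open>nrm m (D - A u)\<close> becomes
    arbitrarily small on the compact set \<open>K\<close>, so its minimum there is 0.\<close>
  have "continuous_on K (\<lambda>u. nrm m (D - A u))"
    unfolding nrm_def minus_apply by (intro continuous_intros Acont)
  then obtain u where u: "u \<in> K" "\<And>w. w \<in> K \<Longrightarrow> nrm m (D - A u) \<le> nrm m (D - A w)"
    using continuous_attains_inf[OF K K0] by metis
  have "nrm m (D - A u) \<le> 0 + e" if e: "e > 0" for e
  proof -
    define \<epsilon> where "\<epsilon> = min (e / Z) (min 1 (c / 2))"
    have "0 < \<epsilon>" using e Z c(1) by (simp add: \<epsilon>_def)
    moreover have "\<epsilon> \<le> 1" "\<epsilon> \<le> c / 2" "\<epsilon> \<le> e / Z" unfolding \<epsilon>_def by linarith+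
    moreover from this(3) have "\<epsilon> * Z \<le> e" using Z by (simp add: field_simps)
    ultimately obtain w where "w \<in> K" "nrm m (D - A w) \<le> e" using close by force
    then show ?thesis using u(2)[of w] by linarith
  qed
  then have "nrm m (D - A u) \<le> 0" by (rule field_le_epsilon)
  then have "nrm m (D - A u) = 0" using nrm_nonneg[of m "D - A u"] by linarith
  then have "D - A u = 0" by (rule nrm_eq_zero[OF Rn_diff[OF DR AR]])
  then have "D = A u" by simp
  then have "tangent_map n b' x v = B (tangent_map n b x v) + A u" unfolding D_def by (simp add: algebra_simps)
  moreover have "u \<in> Rn d" using u(1) by (simp add: K_def)
  ultimately show ?thesis unfolding A_def B_def by blast
qed

lemma chart_preimage_open:
  assumes M: "smooth_manifold M" and U: "(U, \<phi>) \<in> atlas M" and B: "openin (Euclidean_space (mdim M)) B"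
  shows "openin (mtop M) {p\<in>U. \<phi> p \<in> B}"
proof -
  have op: "openin (mtop M) U" and "homeomorphic_map (subtopology (mtop M) U) (subtopology (Euclidean_space (mdim M)) (\<phi> ` U)) \<phi>"
    using M U by (auto simp: smooth_manifold_def)
  then have "continuous_map (subtopology (mtop M) U) (Euclidean_space (mdim M)) \<phi>"
    by (metis continuous_map_in_subtopology homeomorphic_imp_continuous_map)
  from openin_continuous_map_preimage[OF this B]
  have "openin (subtopology (mtop M) U) {p\<in>U. \<phi> p \<in> B}"
    using openin_subset[OF op] by (simp add: inf.absorb2)
  then show ?thesis using op by (simp add: openin_open_subtopology)
qed

section \<open>Products and powers near the identity of the group\<close>

context smooth_action
begin

text \<open>The coordinate expression of this action is the group law in a chart at the identity, so the results
  on actions apply to the group law.\<close>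

lemma translation_action: "smooth_action HM H HM (\<lambda>x h. x \<otimes>\<^bsub>H\<^esub> h)"
proof
  show "smooth_right_action HM H HM (\<lambda>x h. x \<otimes>\<^bsub>H\<^esub> h)"
    using lie m_assoc by (auto simp: smooth_right_action_def lie_group_def topH)
qed (rule lie manH)+

lemma leaf_vec_linear:
  "leaf_vec (U, \<phi>) (W, \<psi>) (a *\<^sub>R u + b *\<^sub>R w) x = a *\<^sub>R leaf_vec (U, \<phi>) (W, \<psi>) u x + b *\<^sub>R leaf_vec (U, \<phi>) (W, \<psi>) w x"
proof -
  have "cat m 0 (a *\<^sub>R u + b *\<^sub>R w) = a *\<^sub>R cat m 0 u + b *\<^sub>R cat m 0 w"
    unfolding cat_scale cat_add scaleR_zero_right add_0_left ..
  then show ?thesis unfolding leaf_vec_def prod.case by (simp only: tangent_map_linear)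
qed

lemma leaf_vec_scale: "leaf_vec (U, \<phi>) (W, \<psi>) (a *\<^sub>R u) x = a *\<^sub>R leaf_vec (U, \<phi>) (W, \<psi>) u x"
  using leaf_vec_linear[of U \<phi> W \<psi> a u 0 0 x] by (simp only: scaleR_zero_left add_0_right)

text \<open>Strict differentiability of the group law at the pair of identities, applied to
  \<open>(g, h)\<close> and \<open>(g, 1)\<close>. Only the second variable changes, so the error is
  proportional to the distance of \<open>h\<close> from the identity.\<close>

lemma group_law_estimate:
  assumes W: "(W, \<psi>) \<in> atlas HM" "\<one>\<^bsub>H\<^esub> \<in> W" and e: "e > 0"
  obtains \<delta> where "\<delta> > 0" "ebox d (\<psi> \<one>\<^bsub>H\<^esub>) \<delta> \<subseteq> \<psi> ` W"
    "\<And>g h. g \<in> W \<Longrightarrow> h \<in> W \<Longrightarrow> \<psi> g \<in> ebox d (\<psi> \<one>\<^bsub>H\<^esub>) \<delta> \<Longrightarrow> \<psi> h \<in> ebox d (\<psi> \<one>\<^bsub>H\<^esub>) \<delta> \<Longrightarrow>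
       g \<otimes>\<^bsub>H\<^esub> h \<in> W \<and> nrm d (\<psi> (g \<otimes>\<^bsub>H\<^esub> h) - \<psi> g - (\<psi> h - \<psi> \<one>\<^bsub>H\<^esub>)) \<le> e * nrm d (\<psi> h - \<psi> \<one>\<^bsub>H\<^esub>)"
proof -
  interpret G: smooth_action HM H HM "\<lambda>x h. x \<otimes>\<^bsub>H\<^esub> h" by (rule translation_action)
  let ?e0 = "\<psi> \<one>\<^bsub>H\<^esub>"
  note cf = G.chart_facts[OF W(1) W] and one = G.one_Rn[OF W(1) W]
  obtain \<delta>1 where \<delta>1: "\<delta>1 > 0" "ebox (d + d) (cat d ?e0 ?e0) \<delta>1 \<subseteq> G.act_dom (W, \<psi>) (W, \<psi>)"
    "\<And>x y. x \<in> ebox (d + d) (cat d ?e0 ?e0) \<delta>1 \<Longrightarrow> y \<in> ebox (d + d) (cat d ?e0 ?e0) \<delta>1 \<Longrightarrow>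
       nrm d (G.act_coord (W, \<psi>) (W, \<psi>) y - G.act_coord (W, \<psi>) (W, \<psi>) x
         - tangent_map (d + d) (G.act_coord (W, \<psi>) (W, \<psi>)) (cat d ?e0 ?e0) (y - x)) \<le> e * nrm (d + d) (y - x)"
    using strict_diff_field[OF G.act_dom_open[OF W(1) W] G.act_coord_field[OF W(1) W] G.base_in_dom[OF W(1) W one(1)] e]
    by metis
  obtain \<delta>0 where \<delta>0: "\<delta>0 > 0" "ebox d ?e0 \<delta>0 \<subseteq> \<psi> ` W"
    using cf(5) one(1) unfolding openin_ebox_iff by blast
  define \<delta> where "\<delta> = min \<delta>0 \<delta>1"
  have \<delta>: "\<delta> > 0" using \<delta>0 \<delta>1 by (simp add: \<delta>_def)
  have sub: "ebox d ?e0 \<delta> \<subseteq> ebox d ?e0 \<delta>0" "ebox d ?e0 \<delta> \<subseteq> ebox d ?e0 \<delta>1" by (auto simp: \<delta>_def intro!: ebox_mono)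
  \<comment> \<open>Left multiplication by the identity is the identity map, so the derivative of
    the group law in its second variable is the identity.\<close>
  have id: "G.leaf_vec (W, \<psi>) (W, \<psi>) u ?e0 = u" if u: "u \<in> Rn d" for u
  proof
    fix j
    have "tangent_map d (\<psi> \<circ> (\<otimes>\<^bsub>H\<^esub>) \<one>\<^bsub>H\<^esub> \<circ> inv_into W \<psi>) ?e0 u j = dir_deriv d u (\<lambda>z. z j) ?e0"
      unfolding tangent_map_def
    proof (rule dir_deriv_cong[OF cf(5) one(1)])
      fix z assume "z \<in> \<psi> ` W"
      then have "inv_into W \<psi> z \<in> carrier H" "\<psi> (inv_into W \<psi> z) = z"
        using inv_into_into[of z \<psi> W] cf(8) by (auto simp: f_inv_into_f)
      then show "(\<psi> \<circ> (\<otimes>\<^bsub>H\<^esub>) \<one>\<^bsub>H\<^esub> \<circ> inv_into W \<psi>) z j = z j" by simp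
    qed
    then show "G.leaf_vec (W, \<psi>) (W, \<psi>) u ?e0 j = u j"
      unfolding G.leaf_vec_eq[OF W(1) W W(2) u] dir_deriv_coord[OF u] .
  qed
  show thesis
  proof (rule that[OF \<delta>])
    show "ebox d ?e0 \<delta> \<subseteq> \<psi> ` W" using sub(1) \<delta>0(2) by blast
    fix g h assume gh: "g \<in> W" "h \<in> W" "\<psi> g \<in> ebox d ?e0 \<delta>" "\<psi> h \<in> ebox d ?e0 \<delta>"
    have b: "cat d (\<psi> g) (\<psi> h) \<in> ebox (d + d) (cat d ?e0 ?e0) \<delta>1" "cat d (\<psi> g) ?e0 \<in> ebox (d + d) (cat d ?e0 ?e0) \<delta>1"
      using gh(3,4) sub(2) ebox_refl[OF one(2) \<delta>1(1)] by (auto intro!: cat_in_ebox)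
    have "G.act_chart (W, \<psi>) (W, \<psi>) (cat d (\<psi> g) (\<psi> h)) \<in> W"
      using b(1) \<delta>1(2) by (auto simp: G.act_dom_def)
    then have prod: "g \<otimes>\<^bsub>H\<^esub> h \<in> W" unfolding G.act_chart_cat[OF W(1) W gh(1,2)] .
    have "nrm d (\<psi> (g \<otimes>\<^bsub>H\<^esub> h) - \<psi> g - (\<psi> h - ?e0)) \<le> e * nrm d (\<psi> h - ?e0)"
    proof -
      have 1: "G.act_coord (W, \<psi>) (W, \<psi>) (cat d (\<psi> g) (\<psi> h)) = \<psi> (g \<otimes>\<^bsub>H\<^esub> h)"
        using G.act_chart_cat[OF W(1) W gh(1,2)] by (simp add: G.act_coord_def)
      have 2: "G.act_coord (W, \<psi>) (W, \<psi>) (cat d (\<psi> g) ?e0) = \<psi> g"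
        by (rule G.act_coord_one[OF W(1) W]) (use gh in auto)
      have 3: "cat d (\<psi> g) (\<psi> h) - cat d (\<psi> g) ?e0 = cat d 0 (\<psi> h - ?e0)" unfolding cat_diff diff_self ..
      have 4: "tangent_map (d + d) (G.act_coord (W, \<psi>) (W, \<psi>)) (cat d ?e0 ?e0) (cat d 0 (\<psi> h - ?e0)) = \<psi> h - ?e0"
        using id[of "\<psi> h - ?e0"] gh(2) cf(6) one(2) Rn_diff by (simp only: G.leaf_vec_def prod.case) blast
      show ?thesis using \<delta>1(3)[OF b(2,1)] unfolding 1 2 3 4 nrm_cat by (simp only: nrm_zero add_0_left)
    qed
    with prod show "g \<otimes>\<^bsub>H\<^esub> h \<in> W \<and> nrm d (\<psi> (g \<otimes>\<^bsub>H\<^esub> h) - \<psi> g - (\<psi> h - ?e0)) \<le> e * nrm d (\<psi> h - ?e0)" by blast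
  qed
qed

text \<open>Each further factor \<open>g\<close> moves the coordinates by
  \<open>t *\<^sub>R w\<close> up to an error of \<open>t / 2\<close>. After \<open>k\<close>
  factors the distance from the identity is at most \<open>k * t + k * t / 2\<close>; this is the
  origin of \<open>3/2\<close>, and the bound by \<open>\<delta>\<close> keeps all powers where
  \<open>\<delta>\<close> applies.\<close>

lemma powers_estimate:
  assumes W: "(W, \<psi>) \<in> atlas HM" "\<one>\<^bsub>H\<^esub> \<in> W"
    and \<delta>: "\<And>g h. g \<in> W \<Longrightarrow> h \<in> W \<Longrightarrow> \<psi> g \<in> ebox d (\<psi> \<one>\<^bsub>H\<^esub>) \<delta> \<Longrightarrow> \<psi> h \<in> ebox d (\<psi> \<one>\<^bsub>H\<^esub>) \<delta> \<Longrightarrow>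
       g \<otimes>\<^bsub>H\<^esub> h \<in> W \<and> nrm d (\<psi> (g \<otimes>\<^bsub>H\<^esub> h) - \<psi> g - (\<psi> h - \<psi> \<one>\<^bsub>H\<^esub>)) \<le> 1/2 * nrm d (\<psi> h - \<psi> \<one>\<^bsub>H\<^esub>)"
    and g: "g \<in> W" "\<psi> g \<in> ebox d (\<psi> \<one>\<^bsub>H\<^esub>) \<delta>" "\<psi> g - \<psi> \<one>\<^bsub>H\<^esub> = t *\<^sub>R w" and w: "nrm d w = 1" and t: "t > 0"
    and k: "3/2 * (real k * t) < \<delta>"
  shows "g [^]\<^bsub>H\<^esub> k \<in> W \<and> \<psi> (g [^]\<^bsub>H\<^esub> k) \<in> ebox d (\<psi> \<one>\<^bsub>H\<^esub>) \<delta>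
    \<and> nrm d (\<psi> (g [^]\<^bsub>H\<^esub> k) - \<psi> \<one>\<^bsub>H\<^esub> - (real k * t) *\<^sub>R w) \<le> real k * t / 2"
  using k
proof (induction k)
  have WR: "\<psi> h \<in> Rn d" if "h \<in> W" for h
    using openin_E_subset[OF premanifold_chart(2)[OF preH W(1)]] that by auto
  case 0
  have "\<delta> > 0" using 0 by simp
  then show ?case using W(2) ebox_refl[OF WR[OF W(2)]] by (simp add: nrm_def)
next
  have WR: "\<psi> h \<in> Rn d" if "h \<in> W" for h
    using openin_E_subset[OF premanifold_chart(2)[OF preH W(1)]] that by auto
  case (Suc k)
  have "3/2 * (real k * t) < \<delta>" using Suc.prems t by (simp add: algebra_simps)
  note IH = Suc.IH[OF this]
  let ?e0 = "\<psi> \<one>\<^bsub>H\<^esub>" and ?h = "g [^]\<^bsub>H\<^esub> k"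
  have nt: "nrm d (\<psi> g - ?e0) = t" using w t unfolding g(3) nrm_scaleR by simp
  have S: "g [^]\<^bsub>H\<^esub> Suc k = ?h \<otimes>\<^bsub>H\<^esub> g" by simp
  have *: "?h \<otimes>\<^bsub>H\<^esub> g \<in> W" "nrm d (\<psi> (?h \<otimes>\<^bsub>H\<^esub> g) - \<psi> ?h - (\<psi> g - ?e0)) \<le> 1/2 * t"
    using \<delta>[of ?h g] IH g(1,2) unfolding nt by blast+
  have "\<psi> (?h \<otimes>\<^bsub>H\<^esub> g) - ?e0 - (real (Suc k) * t) *\<^sub>R w
      = (\<psi> (?h \<otimes>\<^bsub>H\<^esub> g) - \<psi> ?h - (\<psi> g - ?e0)) + (\<psi> ?h - ?e0 - (real k * t) *\<^sub>R w)"
    unfolding g(3) by (simp add: fun_eq_iff algebra_simps)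
  then have "nrm d (\<psi> (?h \<otimes>\<^bsub>H\<^esub> g) - ?e0 - (real (Suc k) * t) *\<^sub>R w)
      \<le> nrm d (\<psi> (?h \<otimes>\<^bsub>H\<^esub> g) - \<psi> ?h - (\<psi> g - ?e0)) + nrm d (\<psi> ?h - ?e0 - (real k * t) *\<^sub>R w)"
    by (metis nrm_triangle)
  moreover have "real (Suc k) * t = real k * t + t" by (simp add: algebra_simps)
  moreover have "nrm d (\<psi> ?h - ?e0 - (real k * t) *\<^sub>R w) \<le> real k * t / 2" using IH by blast
  ultimately have est: "nrm d (\<psi> (?h \<otimes>\<^bsub>H\<^esub> g) - ?e0 - (real (Suc k) * t) *\<^sub>R w) \<le> real (Suc k) * t / 2"
    using *(2) by linarith
  have "nrm d (\<psi> (?h \<otimes>\<^bsub>H\<^esub> g) - ?e0) \<le> real (Suc k) * t / 2 + real (Suc k) * t"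
  proof -
    have "nrm d (\<psi> (?h \<otimes>\<^bsub>H\<^esub> g) - ?e0)
        \<le> nrm d (\<psi> (?h \<otimes>\<^bsub>H\<^esub> g) - ?e0 - (real (Suc k) * t) *\<^sub>R w) + nrm d ((real (Suc k) * t) *\<^sub>R w)"
      using nrm_triangle[of d "\<psi> (?h \<otimes>\<^bsub>H\<^esub> g) - ?e0 - (real (Suc k) * t) *\<^sub>R w" "(real (Suc k) * t) *\<^sub>R w"] by simp
    also have "nrm d ((real (Suc k) * t) *\<^sub>R w) = real (Suc k) * t" unfolding nrm_scaleR w using t by simp
    finally show ?thesis using est by linarith
  qed
  then have "\<psi> (?h \<otimes>\<^bsub>H\<^esub> g) \<in> ebox d ?e0 \<delta>"
    using Suc.prems by (intro ebox_nrm WR *(1)) linarith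
  with * est show ?case unfolding S by blast
qed

end

section \<open>Orbit maps of locally free actions are immersions\<close>

locale locally_free_action = smooth_action M H HM act
  for M :: "'a manifold" and H :: "('h, 'b) monoid_scheme" and HM :: "'h manifold" and act :: "'a \<Rightarrow> 'h \<Rightarrow> 'a" +
  assumes free: "locally_free M H HM act"
begin

lemma stabilizer_nbhd:
  assumes "p \<in> topspace (mtop M)"
  obtains N where "openin (mtop HM) N" "\<one>\<^bsub>H\<^esub> \<in> N" "\<And>h. h \<in> N \<Longrightarrow> act p h = p \<Longrightarrow> h = \<one>\<^bsub>H\<^esub>"
proof -
  define S where "S = {h \<in> carrier H. act p h = p}"
  have "subtopology (mtop HM) S = discrete_topology S"
    using free assms by (simp add: locally_free_def S_def Let_def)
  moreover have 1: "\<one>\<^bsub>H\<^esub> \<in> S" using act_one[OF assms] by (simp add: S_def)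
  ultimately have "openin (subtopology (mtop HM) S) {\<one>\<^bsub>H\<^esub>}" by simp
  then obtain N where N: "openin (mtop HM) N" "{\<one>\<^bsub>H\<^esub>} = N \<inter> S" by (auto simp: openin_subtopology)
  have "N \<subseteq> carrier H" using openin_subset[OF N(1)] topH by simp
  then show thesis using N by (intro that[of N]) (auto simp: S_def)
qed

text \<open>If \<open>D o\<^sub>p(w) = 0\<close> for the orbit map \<open>o\<^sub>p\<close>, then \<open>p\<close> is moved by \<open>O(1/t) * o(t)\<close> under the
  approximately \<open>1/t\<close>-th power of the element with coordinates \<open>e0 + t w\<close>. These powers stay at a
  definite distance from the identity, and a limit point of them is a nontrivial element of the
  stabilizer near the identity. This replaces the one-parameter subgroup generated by \<open>w\<close>.\<close>

lemma leaf_vec_nonzero: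
  assumes U: "(U, \<phi>) \<in> atlas M" and W: "(W, \<psi>) \<in> atlas HM" "\<one>\<^bsub>H\<^esub> \<in> W" and p: "p \<in> U"
    and w: "w \<in> Rn d" "nrm d w = 1"
  shows "leaf_vec (U, \<phi>) (W, \<psi>) w (\<phi> p) \<noteq> 0"
proof
  assume zero: "leaf_vec (U, \<phi>) (W, \<psi>) w (\<phi> p) = 0"
  note cf = chart_facts[OF U W] and one = one_Rn[OF U W]
  let ?e0 = "\<psi> \<one>\<^bsub>H\<^esub>" and ?x = "\<phi> p" and ?F = "act_coord (U, \<phi>) (W, \<psi>)"
  let ?T = "tangent_map (m + d) ?F (cat m ?x ?e0)"
  have x: "?x \<in> \<phi> ` U" using p by simp
  have xR: "?x \<in> Rn m" using x cf(2) by blast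
  have pM: "p \<in> topspace (mtop M)" using p cf(4) by blast
  obtain N where N: "openin (mtop HM) N" "\<one>\<^bsub>H\<^esub> \<in> N" "\<And>h. h \<in> N \<Longrightarrow> act p h = p \<Longrightarrow> h = \<one>\<^bsub>H\<^esub>"
    using stabilizer_nbhd[OF pM] by metis
  have "openin (Euclidean_space d) (\<psi> ` (N \<inter> W))"
    by (rule premanifold_open_image[OF preH W(1)]) (auto intro: N premanifold_chart(1)[OF preH W(1)])
  moreover have "?e0 \<in> \<psi> ` (N \<inter> W)" using N W by blast
  ultimately obtain \<delta>0 where \<delta>0: "\<delta>0 > 0" "ebox d ?e0 \<delta>0 \<subseteq> \<psi> ` (N \<inter> W)"
    unfolding openin_ebox_iff by blast
  obtain \<delta>1 where \<delta>1: "\<delta>1 > 0" "ebox d ?e0 \<delta>1 \<subseteq> \<psi> ` W"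
    "\<And>g h. g \<in> W \<Longrightarrow> h \<in> W \<Longrightarrow> \<psi> g \<in> ebox d ?e0 \<delta>1 \<Longrightarrow> \<psi> h \<in> ebox d ?e0 \<delta>1 \<Longrightarrow>
       g \<otimes>\<^bsub>H\<^esub> h \<in> W \<and> nrm d (\<psi> (g \<otimes>\<^bsub>H\<^esub> h) - \<psi> g - (\<psi> h - ?e0)) \<le> 1/2 * nrm d (\<psi> h - ?e0)"
    using group_law_estimate[OF W, of "1/2"] by auto
  note strict = strict_diff_field[OF act_dom_open[OF U W] act_coord_field[OF U W] base_in_dom[OF U W x]]
  obtain \<delta>2 where \<delta>2: "\<delta>2 > 0" "ebox (m + d) (cat m ?x ?e0) \<delta>2 \<subseteq> act_dom (U, \<phi>) (W, \<psi>)"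
    "\<And>y z. y \<in> ebox (m + d) (cat m ?x ?e0) \<delta>2 \<Longrightarrow> z \<in> ebox (m + d) (cat m ?x ?e0) \<delta>2 \<Longrightarrow>
       nrm m (?F z - ?F y - ?T (z - y)) \<le> 1 * nrm (m + d) (z - y)"
    using strict[of 1] by (metis zero_less_one)
  define \<delta> where "\<delta> = min \<delta>0 (min \<delta>1 \<delta>2)"
  have \<delta>: "\<delta> > 0" "\<delta> \<le> \<delta>0" "\<delta> \<le> \<delta>1" "\<delta> \<le> \<delta>2" using \<delta>0 \<delta>1 \<delta>2 by (auto simp: \<delta>_def)
  \<comment> \<open>Strictly below \<open>\<delta>\<close>, so that the closed shell
    \<open>K\<close> lies in the box of size \<open>\<delta>\<close>.\<close>
  define \<rho> where "\<rho> = \<delta> / 2"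
  have \<rho>: "\<rho> > 0" "\<rho> < \<delta>" using \<delta>(1) by (auto simp: \<rho>_def)
  have box1: "ebox d ?e0 \<delta> \<subseteq> ebox d ?e0 \<delta>1" by (rule ebox_mono[OF \<delta>(3)])
  have grp_law: "g \<otimes>\<^bsub>H\<^esub> h \<in> W \<and> nrm d (\<psi> (g \<otimes>\<^bsub>H\<^esub> h) - \<psi> g - (\<psi> h - ?e0)) \<le> 1/2 * nrm d (\<psi> h - ?e0)"
    if "g \<in> W" "h \<in> W" "\<psi> g \<in> ebox d ?e0 \<delta>" "\<psi> h \<in> ebox d ?e0 \<delta>" for g h
    using \<delta>1(3)[OF that(1,2)] that(3,4) box1 by blast
  have cat_box: "cat m y z \<in> ebox (m + d) (cat m ?x ?e0) \<delta>2" if "y \<in> ebox m ?x \<delta>" "z \<in> ebox d ?e0 \<delta>" for y z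
    using cat_in_ebox[OF that] ebox_mono[OF \<delta>(4)] by blast
  have xbox: "?x \<in> ebox m ?x \<delta>" by (rule ebox_refl[OF xR \<delta>(1)])
  have dom: "cat m y z \<in> act_dom (U, \<phi>) (W, \<psi>)" if "y \<in> ebox m ?x \<delta>" "z \<in> ebox d ?e0 \<delta>" for y z
    using cat_box[OF that] \<delta>2(2) by blast
  \<comment> \<open>The Lipschitz constant 2 is 1 for the derivative, the identity by
    \<open>tangent_act_coord_fst\<close>, plus 1 for the accuracy chosen for
    \<open>\<delta>2\<close>.\<close>
  have Flip: "nrm m (?F (cat m y z) - ?F (cat m ?x z)) \<le> 2 * nrm m (y - ?x)"
    if y: "y \<in> ebox m ?x \<delta>" and z: "z \<in> ebox d ?e0 \<delta>" for y z
  proof -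
    have yx: "y - ?x \<in> Rn m" using y xR ebox_subset_Rn by (intro Rn_diff) auto
    have c: "cat m y z - cat m ?x z = cat m (y - ?x) 0" unfolding cat_diff diff_self ..
    have "nrm m (?F (cat m y z) - ?F (cat m ?x z) - (y - ?x)) \<le> nrm m (y - ?x)"
      using \<delta>2(3)[OF cat_box[OF xbox z] cat_box[OF y z]]
      unfolding c tangent_act_coord_fst[OF U W x yx] nrm_cat by (simp only: nrm_zero add_0_right mult_1_left)
    then show ?thesis
      using nrm_triangle[of m "?F (cat m y z) - ?F (cat m ?x z) - (y - ?x)" "y - ?x"] by simp
  qed
  have Fact: "?F (cat m (\<phi> q) (\<psi> h)) = \<phi> (act q h)" if "q \<in> U" "h \<in> W" for q h
    using act_chart_cat[OF U W that] by (simp add: act_coord_def)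
  have actU: "act q h \<in> U" if "q \<in> U" "h \<in> W" "\<phi> q \<in> ebox m ?x \<delta>" "\<psi> h \<in> ebox d ?e0 \<delta>" for q h
    using dom[OF that(3,4)] act_chart_cat[OF U W that(1,2)] by (simp add: act_dom_def)
  \<comment> \<open>Where the chosen powers end up. They are at most
    \<open>3/2 * k * t \<le> \<rho>\<close> away from the identity; as
    \<open>k * t > 2/3 * \<rho> - t\<close> and \<open>t < \<rho> / 3\<close>, they are at least
    \<open>k * t / 2 > \<rho> / 6\<close> away.\<close>
  define K where "K = {z \<in> Rn d. \<rho> / 6 \<le> nrm d (z - ?e0) \<and> nrm d (z - ?e0) \<le> \<rho>}"
  have K: "compact K" unfolding K_def by (rule compact_shell[OF one(2)])
  have K_box: "z \<in> ebox d ?e0 \<delta>" if "z \<in> K" for z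
    using that \<rho>(2) by (intro ebox_nrm) (auto simp: K_def)
  have close: "\<exists>z\<in>K. nrm m (?F (cat m ?x z) - ?x) \<le> 2 * \<epsilon> * \<rho>" if \<epsilon>: "\<epsilon> > 0" for \<epsilon>
  proof -
    obtain \<delta>3 where \<delta>3: "\<delta>3 > 0"
      "\<And>y z. y \<in> ebox (m + d) (cat m ?x ?e0) \<delta>3 \<Longrightarrow> z \<in> ebox (m + d) (cat m ?x ?e0) \<delta>3 \<Longrightarrow>
         nrm m (?F z - ?F y - ?T (z - y)) \<le> \<epsilon> * nrm (m + d) (z - y)"
      using strict[OF \<epsilon>] by metis
    \<comment> \<open>The bound \<open>\<rho> / 3\<close> serves the lower radius of
      \<open>K\<close>; \<open>\<delta> / (\<epsilon> + 1)\<close> keeps the point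
      \<open>q1\<close>, displaced by at most \<open>\<epsilon> * t\<close>, in the box. Halving
      \<open>\<mu>\<close> makes all bounds on \<open>t\<close> strict.\<close>
    define \<mu> where "\<mu> = min (min \<delta>3 \<delta>) (min (\<rho> / 3) (\<delta> / (\<epsilon> + 1)))"
    define t where "t = \<mu> / 2"
    have t: "t > 0" "t < \<delta>3" "t < \<delta>" "t < \<rho> / 3" "t < \<delta> / (\<epsilon> + 1)"
    proof -
      have "0 < \<mu>" using \<delta>3(1) \<delta>(1) \<rho>(1) \<epsilon> by (simp add: \<mu>_def)
      moreover have "\<mu> \<le> \<delta>3" "\<mu> \<le> \<delta>" "\<mu> \<le> \<rho> / 3" "\<mu> \<le> \<delta> / (\<epsilon> + 1)"
        by (simp_all only: \<mu>_def min.coboundedI1 min.coboundedI2 order_refl)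
      ultimately show "t > 0" "t < \<delta>3" "t < \<delta>" "t < \<rho> / 3" "t < \<delta> / (\<epsilon> + 1)" unfolding t_def by linarith+
    qed
    define z1 where "z1 = ?e0 + t *\<^sub>R w"
    have z1: "z1 - ?e0 = t *\<^sub>R w" "z1 \<in> Rn d" unfolding z1_def using Rn_add[OF one(2) Rn_scaleR[OF w(1)]] by simp_all
    have nz1: "nrm d (z1 - ?e0) = t" unfolding z1 nrm_scaleR w using t by simp
    have z1box: "z1 \<in> ebox d ?e0 \<delta>" "z1 \<in> ebox d ?e0 \<delta>3" by (rule ebox_nrm[OF z1(2)], simp only: nz1 t)+
    then have "z1 \<in> \<psi> ` W" using box1 \<delta>1(2) by blast
    then obtain g where g: "g \<in> W" "\<psi> g = z1" by blast
    define q1 where "q1 = act p g"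
    have q1U: "q1 \<in> U" unfolding q1_def by (rule actU[OF p g(1) xbox]) (simp only: g z1box)
    have q1: "\<phi> q1 = ?F (cat m ?x z1)" unfolding q1_def using Fact[OF p g(1)] g(2) by simp
    have q1x: "nrm m (\<phi> q1 - ?x) \<le> \<epsilon> * t"
    proof -
      have b: "cat m ?x ?e0 \<in> ebox (m + d) (cat m ?x ?e0) \<delta>3" "cat m ?x z1 \<in> ebox (m + d) (cat m ?x ?e0) \<delta>3"
        by (intro cat_in_ebox ebox_refl xR one(2) \<delta>3(1) z1box(2))+
      have c: "cat m ?x z1 - cat m ?x ?e0 = cat m 0 (t *\<^sub>R w)" unfolding cat_diff diff_self z1 ..
      have T0: "?T (cat m 0 (t *\<^sub>R w)) = 0"
        using leaf_vec_scale[of U \<phi> W \<psi> t w ?x] unfolding zero scaleR_zero_right by (simp only: leaf_vec_def prod.case)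
      from \<delta>3(2)[OF b] show ?thesis
        unfolding c T0 nrm_cat q1 act_coord_one[OF U W x] nrm_scaleR w using t by (simp only: nrm_zero diff_0_right) simp
    qed
    have q1box: "\<phi> q1 \<in> ebox m ?x \<delta>"
    proof (rule ebox_nrm)
      show "\<phi> q1 \<in> Rn m" using q1U cf(2) by blast
      have "\<epsilon> * t \<le> (\<epsilon> + 1) * t" using t by simp
      also have "\<dots> < \<delta>" using t(5) \<epsilon> by (simp add: field_simps)
      finally show "nrm m (\<phi> q1 - ?x) < \<delta>" using q1x by linarith
    qed
    \<comment> \<open>The largest \<open>k\<close> with
      \<open>3/2 * k * t \<le> \<rho>\<close>.\<close>
    define k where "k = nat \<lfloor>2 * \<rho> / (3 * t)\<rfloor>"
    have k: "real k \<le> 2 * \<rho> / (3 * t)" "2 * \<rho> / (3 * t) < real k + 1"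
    proof -
      have "0 \<le> 2 * \<rho> / (3 * t)" using \<rho> t by simp
      then have "real k = of_int \<lfloor>2 * \<rho> / (3 * t)\<rfloor>" unfolding k_def by simp
      then show "real k \<le> 2 * \<rho> / (3 * t)" "2 * \<rho> / (3 * t) < real k + 1" by linarith+
    qed
    have kt: "3/2 * (real k * t) \<le> \<rho>" "2/3 * \<rho> < real k * t + t"
      using k t(1) by (simp_all add: field_simps)
    have gdiff: "\<psi> g - ?e0 = t *\<^sub>R w" using g(2) z1 by simp
    have gbox: "\<psi> g \<in> ebox d ?e0 \<delta>" using g(2) z1box by simp
    have pow: "g [^]\<^bsub>H\<^esub> i \<in> W \<and> \<psi> (g [^]\<^bsub>H\<^esub> i) \<in> ebox d ?e0 \<delta>
        \<and> nrm d (\<psi> (g [^]\<^bsub>H\<^esub> i) - ?e0 - (real i * t) *\<^sub>R w) \<le> real i * t / 2" if i: "i \<le> k" for i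
    proof (rule powers_estimate[OF W grp_law g(1) gbox gdiff w(2) t(1)])
      have "real i * t \<le> real k * t" using i t(1) by (intro mult_right_mono) auto
      then show "3/2 * (real i * t) < \<delta>" using kt(1) \<rho>(2) by linarith
    qed
    have gH: "g \<in> carrier H" using g(1) cf(8) by blast
    have drift: "nrm m (\<phi> (act p (g [^]\<^bsub>H\<^esub> i)) - ?x) \<le> real i * (2 * \<epsilon> * t)" if "i \<le> k" for i
      using that
    proof (induction i)
      case 0
      show ?case using act_one[OF pM] by (simp add: nrm_def)
    next
      case (Suc i)
      then have i: "i \<le> k" by simp
      let ?h = "g [^]\<^bsub>H\<^esub> i"
      have hW: "?h \<in> W" and hb: "\<psi> ?h \<in> ebox d ?e0 \<delta>" using pow[OF i] by auto
      \<comment> \<open>Splitting off the first factor shows \<open>p g^(i+1) = q1 g^i\<close>. It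
        differs from \<open>p g^i\<close> only in the starting point, and \<open>Flip\<close> at
        most doubles that difference, so the displacements merely add up.\<close>
      have "g [^]\<^bsub>H\<^esub> Suc i = g \<otimes>\<^bsub>H\<^esub> ?h" by (rule nat_pow_Suc2[OF gH])
      then have "act p (g [^]\<^bsub>H\<^esub> Suc i) = act q1 ?h"
        unfolding q1_def using act_mult[OF pM gH, of ?h] hW cf(8) by auto
      then have e: "\<phi> (act p (g [^]\<^bsub>H\<^esub> Suc i)) = ?F (cat m (\<phi> q1) (\<psi> ?h))" using Fact[OF q1U hW] by simp
      have "nrm m (\<phi> (act p (g [^]\<^bsub>H\<^esub> Suc i)) - \<phi> (act p ?h)) \<le> 2 * nrm m (\<phi> q1 - ?x)"
        using Flip[OF q1box hb] Fact[OF p hW] unfolding e by simp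
      then have "nrm m (\<phi> (act p (g [^]\<^bsub>H\<^esub> Suc i)) - \<phi> (act p ?h)) \<le> 2 * \<epsilon> * t" using q1x by linarith
      moreover have "nrm m (\<phi> (act p (g [^]\<^bsub>H\<^esub> Suc i)) - ?x)
          \<le> nrm m (\<phi> (act p (g [^]\<^bsub>H\<^esub> Suc i)) - \<phi> (act p ?h)) + nrm m (\<phi> (act p ?h) - ?x)"
        by (rule nrm_triangle_diff)
      moreover have "real (Suc i) * (2 * \<epsilon> * t) = real i * (2 * \<epsilon> * t) + 2 * \<epsilon> * t" by (simp add: algebra_simps)
      ultimately show ?case using Suc.IH[OF i] by linarith
    qed
    let ?h = "g [^]\<^bsub>H\<^esub> k"
    have hW: "?h \<in> W" and hb: "\<psi> ?h \<in> ebox d ?e0 \<delta>"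
      and he: "nrm d (\<psi> ?h - ?e0 - (real k * t) *\<^sub>R w) \<le> real k * t / 2" using pow[of k] by auto
    have nkt: "nrm d ((real k * t) *\<^sub>R w) = real k * t" unfolding nrm_scaleR w using t by simp
    have up: "nrm d (\<psi> ?h - ?e0) \<le> \<rho>"
      using nrm_triangle[of d "\<psi> ?h - ?e0 - (real k * t) *\<^sub>R w" "(real k * t) *\<^sub>R w"] he nkt kt(1) by simp
    have lo: "\<rho> / 6 \<le> nrm d (\<psi> ?h - ?e0)"
    proof -
      have "nrm d ((real k * t) *\<^sub>R w) \<le> nrm d ((real k * t) *\<^sub>R w - (\<psi> ?h - ?e0)) + nrm d (\<psi> ?h - ?e0)"
        using nrm_triangle[of d "(real k * t) *\<^sub>R w - (\<psi> ?h - ?e0)" "\<psi> ?h - ?e0"] by simp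
      also have "nrm d ((real k * t) *\<^sub>R w - (\<psi> ?h - ?e0)) \<le> real k * t / 2"
        using he nrm_minus[of d "(real k * t) *\<^sub>R w" "\<psi> ?h - ?e0"] by simp
      finally show ?thesis using nkt kt(2) t(4) by linarith
    qed
    have "\<psi> ?h \<in> K" unfolding K_def using up lo hb by (simp add: ebox_def)
    moreover have "nrm m (?F (cat m ?x (\<psi> ?h)) - ?x) \<le> 2 * \<epsilon> * \<rho>"
    proof -
      have "nrm m (?F (cat m ?x (\<psi> ?h)) - ?x) \<le> real k * (2 * \<epsilon> * t)"
        using drift[of k] Fact[OF p hW] by simp
      also have "\<dots> = 2 * \<epsilon> * (real k * t)" by simp
      also have "\<dots> \<le> 2 * \<epsilon> * \<rho>"
      proof (rule mult_left_mono)
        have "0 \<le> real k * t" using t(1) by simp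
        then show "real k * t \<le> \<rho>" using kt(1) by linarith
      qed (use \<epsilon> in simp)
      finally show ?thesis .
    qed
    ultimately show ?thesis by blast
  qed
  have K0: "K \<noteq> {}" using close[of 1] by auto
  have "continuous_on K (\<lambda>z. nrm m (?F (cat m ?x z) - ?x))"
  proof -
    have sm: "smooth_fun d (ebox d ?e0 \<delta>) (\<lambda>z. ?F (cat m ?x z) j)" for j
    proof (rule smooth_comp[OF openin_ebox act_dom_open[OF U W] _ smooth_cat(2)])
      show "(\<lambda>z. cat m ?x z) \<in> ebox d ?e0 \<delta> \<rightarrow> act_dom (U, \<phi>) (W, \<psi>)" using dom[OF xbox] by blast
      show "smooth_fun (m + d) (act_dom (U, \<phi>) (W, \<psi>)) (\<lambda>c. ?F c j)"
        using act_coord_field[OF U W] by (simp add: smooth_field_def)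
    qed
    have "continuous_on K (\<lambda>z. ?F (cat m ?x z) j)" for j
      by (rule continuous_on_subset[OF smooth_continuous[OF sm]], rule subsetI, rule K_box)
    then show ?thesis unfolding nrm_def minus_apply by (intro continuous_intros)
  qed
  \<comment> \<open>\<open>\<epsilon>\<close> is arbitrary in \<open>close\<close>, so the minimum
    over \<open>K\<close> is 0. The minimizer is the coordinate of a stabilizing element away from
    the identity.\<close>
  then obtain z where z: "z \<in> K" "\<And>y. y \<in> K \<Longrightarrow> nrm m (?F (cat m ?x z) - ?x) \<le> nrm m (?F (cat m ?x y) - ?x)"
    using continuous_attains_inf[OF K K0] by blast
  have "nrm m (?F (cat m ?x z) - ?x) \<le> 0 + e" if e: "e > 0" for e
  proof -
    obtain y where "y \<in> K" "nrm m (?F (cat m ?x y) - ?x) \<le> 2 * (e / (2 * \<rho>)) * \<rho>"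
      using close[of "e / (2 * \<rho>)"] e \<rho>(1) by auto
    then show ?thesis using z(2)[of y] \<rho>(1) by simp
  qed
  then have "nrm m (?F (cat m ?x z) - ?x) \<le> 0" by (rule field_le_epsilon)
  then have nz: "nrm m (?F (cat m ?x z) - ?x) = 0" using nrm_nonneg[of m "?F (cat m ?x z) - ?x"] by linarith
  have zb: "z \<in> ebox d ?e0 \<delta>" by (rule K_box[OF z(1)])
  then have "z \<in> \<psi> ` (N \<inter> W)" using ebox_mono[OF \<delta>(2)] \<delta>0(2) by blast
  then obtain h where h: "h \<in> N" "h \<in> W" "\<psi> h = z" by blast
  have hU: "act p h \<in> U" by (rule actU[OF p h(2) xbox]) (simp only: h zb)
  have "?F (cat m ?x z) = \<phi> (act p h)" using Fact[OF p h(2)] h(3) by simp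
  moreover have "\<phi> (act p h) \<in> Rn m" using hU cf(2) by blast
  ultimately have "\<phi> (act p h) - ?x = 0" using nz nrm_eq_zero[OF Rn_diff[OF _ xR]] by metis
  then have "\<phi> (act p h) = \<phi> p" by simp
  then have "act p h = p" using cf(3) hU p by (auto dest: inj_onD)
  then have "h = \<one>\<^bsub>H\<^esub>" by (rule N(3)[OF h(1)])
  then have "nrm d (z - ?e0) = 0" using h(3) by simp
  then show False using z(1) \<rho>(1) by (simp add: K_def)
qed

lemma leaf_vec_injective:
  assumes U: "(U, \<phi>) \<in> atlas M" and W: "(W, \<psi>) \<in> atlas HM" "\<one>\<^bsub>H\<^esub> \<in> W" and p: "p \<in> U"
    and u: "u \<in> Rn d" and zero: "leaf_vec (U, \<phi>) (W, \<psi>) u (\<phi> p) = 0"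
  shows "u = 0"
proof (rule ccontr)
  assume "u \<noteq> 0"
  then have n: "nrm d u \<noteq> 0" using nrm_eq_zero[OF u] by blast
  let ?w = "(1 / nrm d u) *\<^sub>R u"
  have "nrm d ?w = 1" unfolding nrm_scaleR using n nrm_nonneg[of d u] by simp
  moreover have "leaf_vec (U, \<phi>) (W, \<psi>) ?w (\<phi> p) = 0" unfolding leaf_vec_scale zero scaleR_zero_right ..
  ultimately show False using leaf_vec_nonzero[OF U W p Rn_scaleR[OF u]] by blast
qed

end

section \<open>Independence of the lift\<close>

text \<open>Arguments are changed one at a time, with those already treated collected in
  \<open>ps\<close>; each difference vector is moved to the front, where \<open>A\<close> kills
  it.\<close>

lemma altml_modify:
  assumes A: "altml n k A"
    and "list_all2 (\<lambda>v v'. v \<in> Rn n \<and> (\<exists>y\<in>Rn n. v' = v + y \<and> (\<forall>ws. A (y # ws) = 0))) vs vs'"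
    and "length ps + length vs = k" "set ps \<subseteq> Rn n"
  shows "A (ps @ vs') = A (ps @ vs)"
  using assms(2-)
proof (induction arbitrary: ps rule: list_all2_induct)
  case (Cons v vs v' vs')
  then obtain y where v: "v \<in> Rn n" and y: "y \<in> Rn n" "v' = v + y" "\<And>ws. A (y # ws) = 0" by blast
  have vs': "set vs' \<subseteq> Rn n" "length vs' = length vs"
  proof -
    show "length vs' = length vs" using list_all2_lengthD[OF Cons.hyps(2)] by simp
    show "set vs' \<subseteq> Rn n"
      using Cons.hyps(2) by (induction rule: list_all2_induct) auto
  qed
  have "A (ps @ v' # vs') = A (ps @ v # vs') + A (ps @ y # vs')"
    using altml_linear[OF A, of ps vs' v y 1 1] Cons.prems vs' v y by simp
  also have "A (ps @ y # vs') = 0"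
    using altml_front[OF A, of "[]" ps vs' y] Cons.prems vs' y by simp
  also have "A (ps @ v # vs') = A (ps @ v # vs)"
    using Cons.IH[of "ps @ [v]"] Cons.prems v by simp
  finally show ?case by simp
qed simp

context locally_free_action
begin

text \<open>\<open>near\<close> is a weak continuity at \<open>x\<close>, with the identity as
  value, of an otherwise arbitrary group element. \<open>implicit_direction\<close> applies to
  \<open>act_coord\<close>, with injectivity from \<open>leaf_vec_injective\<close>. Since the
  derivative of \<open>act_coord\<close> along \<open>M\<close> is the identity, the tangent maps of
  the two lifts differ by leaf vectors, which \<open>altml_modify\<close> removes.\<close>

lemma lifts_agree_at:
  assumes \<omega>: "\<omega> \<in> dforms (manifold_diffeology M) k" and hor: "horizontal \<omega>"
    and \<beta>: "plot M n V \<beta>" and \<beta>': "plot M n V \<beta>'" and x: "x \<in> V" and eq: "\<beta> x = \<beta>' x"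
    and near: "\<And>N. openin (mtop HM) N \<Longrightarrow> \<one>\<^bsub>H\<^esub> \<in> N \<Longrightarrow>
      \<exists>T. openin (Euclidean_space n) T \<and> x \<in> T \<and> T \<subseteq> V \<and> (\<forall>y\<in>T. \<exists>h\<in>N. \<beta>' y = act (\<beta> y) h)"
    and vs: "set vs \<subseteq> Rn n"
  shows "\<omega> (n, V, restrict \<beta> V) x vs = \<omega> (n, V, restrict \<beta>' V) x vs"
proof -
  have "\<beta> x \<in> topspace (mtop M)" by (rule plot_topspace[OF \<beta> x])
  then obtain U \<phi> where U: "(U, \<phi>) \<in> atlas M" and px: "\<beta> x \<in> U" using premanifold_cover[OF preM] by metis
  have "\<one>\<^bsub>H\<^esub> \<in> topspace (mtop HM)" using topH by simp
  then obtain W \<psi> where W: "(W, \<psi>) \<in> atlas HM" "\<one>\<^bsub>H\<^esub> \<in> W" using premanifold_cover[OF preH] by metis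
  note cf = chart_facts[OF U W] and one = one_Rn[OF U W]
  let ?e0 = "\<psi> \<one>\<^bsub>H\<^esub>"
  define b where "b y = \<phi> (\<beta> y)" for y
  define b' where "b' y = \<phi> (\<beta>' y)" for y
  define V' where "V' = {y\<in>V. \<beta> y \<in> U} \<inter> {y\<in>V. \<beta>' y \<in> U}"
  have V': "openin (Euclidean_space n) V'" unfolding V'_def
    by (intro openin_Int plot_preimage[OF \<beta>] plot_preimage[OF \<beta>'] premanifold_chart(1)[OF preM U])
  have xV': "x \<in> V'" using x px eq by (simp add: V'_def)
  have fb: "smooth_field n V' m b" unfolding b_def
    by (rule smooth_field_of_between[OF V' smooth_between_subset[OF plot_chart_between[OF \<beta> U]] cf(2)]) (simp add: V'_def)
  have fb': "smooth_field n V' m b'" unfolding b'_def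
    by (rule smooth_field_of_between[OF V' smooth_between_subset[OF plot_chart_between[OF \<beta>' U]] cf(2)]) (simp add: V'_def)
  have bx: "b x \<in> \<phi> ` U" "b' x = b x" using px eq by (auto simp: b_def b'_def)
  let ?F = "act_coord (U, \<phi>) (W, \<psi>)"
  have dir: "\<exists>u\<in>Rn d. tangent_map n b' x v = tangent_map n b x v + leaf_vec (U, \<phi>) (W, \<psi>) u (b x)"
    if v: "v \<in> Rn n" for v
  proof -
    have "\<exists>u\<in>Rn d. tangent_map n b' x v
      = tangent_map (m + d) ?F (cat m (b x) ?e0) (cat m (tangent_map n b x v) 0)
        + tangent_map (m + d) ?F (cat m (b x) ?e0) (cat m 0 u)"
    proof (rule implicit_direction[OF V' fb fb' act_dom_open[OF U W] act_coord_field[OF U W] xV' one(2) base_in_dom[OF U W bx(1)] _ _ _ v])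
      show "?F (cat m (b x) ?e0) = b' x" using act_coord_one[OF U W bx(1)] bx(2) by simp
      show "u = 0" if "u \<in> Rn d" "tangent_map (m + d) ?F (cat m (b x) ?e0) (cat m 0 u) = 0" for u
        using leaf_vec_injective[OF U W px that(1)] that(2) by (simp only: leaf_vec_def prod.case b_def)
      fix \<delta> :: real assume \<delta>: "\<delta> > 0"
      let ?N = "{h\<in>W. \<psi> h \<in> ebox d ?e0 \<delta>}"
      have N: "openin (mtop HM) ?N" by (rule chart_preimage_open[OF manH W(1) openin_ebox])
      have "\<one>\<^bsub>H\<^esub> \<in> ?N" using W(2) ebox_refl[OF one(2) \<delta>] by simp
      then obtain T where T: "openin (Euclidean_space n) T" "x \<in> T" "\<And>y. y \<in> T \<Longrightarrow> \<exists>h\<in>?N. \<beta>' y = act (\<beta> y) h"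
        using near[OF N] by blast
      have "openin (Euclidean_space n) (T \<inter> V')" by (rule openin_Int[OF T(1) V'])
      moreover have "x \<in> T \<inter> V'" using T(2) xV' by simp
      ultimately obtain \<tau> where \<tau>: "\<tau> > 0" "ebox n x \<tau> \<subseteq> T \<inter> V'" unfolding openin_ebox_iff by blast
      have "\<exists>\<eta>\<in>ebox d ?e0 \<delta>. b' y = ?F (cat m (b y) \<eta>)" if y: "y \<in> ebox n x \<tau>" for y
      proof -
        have yT: "y \<in> T" "\<beta> y \<in> U" using y \<tau>(2) by (auto simp: V'_def)
        obtain h where h: "h \<in> W" "\<psi> h \<in> ebox d ?e0 \<delta>" "\<beta>' y = act (\<beta> y) h" using T(3)[OF yT(1)] by blast
        have "b' y = ?F (cat m (b y) (\<psi> h))"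
          using act_chart_cat[OF U W yT(2) h(1)] h(3) by (simp add: b'_def b_def act_coord_def)
        then show ?thesis using h(2) by blast
      qed
      then show "\<exists>\<tau>>0. \<forall>y\<in>ebox n x \<tau>. \<exists>\<eta>\<in>ebox d ?e0 \<delta>. b' y = ?F (cat m (b y) \<eta>)" using \<tau>(1) by blast
    qed
    moreover have "tangent_map n b x v \<in> Rn m"
      by (rule tangent_map_Rn[OF V' xV']) (use fb in \<open>simp add: smooth_field_def\<close>)
    ultimately show ?thesis
      using tangent_act_coord_fst[OF U W bx(1)] by (simp only: leaf_vec_def prod.case)
  qed
  let ?w = "\<omega> (chart_plot M (U, \<phi>))"
  have w: "?w \<in> eforms m (\<phi> ` U) k" by (rule chart_eform[OF \<omega> U])
  have L: "\<omega> (n, V, restrict \<beta> V) x vs = ?w (b x) (map (tangent_map n b x) vs)"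
    unfolding b_def by (rule dform_in_chart[OF man \<omega> \<beta> x U px vs])
  have R: "\<omega> (n, V, restrict \<beta>' V) x vs = ?w (b x) (map (tangent_map n b' x) vs)"
    using dform_in_chart[OF man \<omega> \<beta>' x U _ vs] px eq unfolding b'_def b_def by simp
  show ?thesis
  proof (cases "length vs = k")
    case True
    have bR: "tangent_map n b x v \<in> Rn m" for v
      by (rule tangent_map_Rn[OF V' xV']) (use fb in \<open>simp add: smooth_field_def\<close>)
    have "list_all2 (\<lambda>v v'. v \<in> Rn m \<and> (\<exists>y\<in>Rn m. v' = v + y \<and> (\<forall>ws. ?w (b x) (y # ws) = 0)))
        (map (tangent_map n b x) vs) (map (tangent_map n b' x) vs)"
      unfolding list_all2_map1 list_all2_map2
    proof (rule list.rel_refl_strong)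
      fix v assume "v \<in> set vs"
      then obtain u where u: "u \<in> Rn d" "tangent_map n b' x v = tangent_map n b x v + leaf_vec (U, \<phi>) (W, \<psi>) u (b x)"
        using dir vs by blast
      moreover have "leaf_vec (U, \<phi>) (W, \<psi>) u (b x) \<in> Rn m" by (rule leaf_vec_Rn[OF U W bx(1)])
      moreover have "\<forall>ws. ?w (b x) (leaf_vec (U, \<phi>) (W, \<psi>) u (b x) # ws) = 0"
        using hor U W u(1) bx(1) unfolding horizontal_def by blast
      ultimately show "tangent_map n b x v \<in> Rn m \<and> (\<exists>y\<in>Rn m. tangent_map n b' x v = tangent_map n b x v + y \<and>
          (\<forall>ws. ?w (b x) (y # ws) = 0))"
        using bR by blast
    qed
    from altml_modify[OF sform_altml[OF eforms_sform[OF w] bx(1)] this, of "[]"] show ?thesis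
      using L R True by simp
  next
    case False
    then show ?thesis using L R eforms_zero[OF w] by simp
  qed
qed

section \<open>From weakly continuous to arbitrary group elements\<close>

lemma lifts_translate:
  assumes \<omega>: "\<omega> \<in> invariant_basic_forms M H HM act k" and \<beta>: "plot M n V \<beta>" and h: "h \<in> carrier H"
  shows "\<omega> (n, V, restrict (\<lambda>y. act (\<beta> y) h) V) = \<omega> (n, V, restrict \<beta> V)"
proof -
  have "dform_pull (manifold_diffeology M) (\<lambda>x. act x h) \<omega> = \<omega>"
    using \<omega> h by (simp add: invariant_basic_forms_def)
  then have "\<omega> (n, V, restrict \<beta> V) = dform_pull (manifold_diffeology M) (\<lambda>x. act x h) \<omega> (n, V, restrict \<beta> V)" by simp
  also have "\<dots> = \<omega> (param_comp (\<lambda>x. act x h) (n, V, restrict \<beta> V))"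
    using manifold_diffeology_restrict[OF preM \<beta>] by (simp add: dform_pull_def)
  also have "param_comp (\<lambda>x. act x h) (n, V, restrict \<beta> V) = (n, V, restrict (\<lambda>y. act (\<beta> y) h) V)"
    by (auto simp: param_comp_def fun_eq_iff)
  finally show ?thesis by (rule sym)
qed

text \<open>A chart image is second countable and locally compact, so it suffices to take, in each
  chart, those members of a countable base whose closures are compact and inside the image. The sets
  found fit into any given \<open>N\<close>, and their compactness makes the orbit sets
  closed.\<close>

lemma countable_compact_family:
  assumes C: "countable C" "C \<subseteq> atlas HM" and L: "L \<subseteq> (\<Union>(W, \<psi>)\<in>C. W)"
  obtains B where "countable B" "\<And>K. K \<in> B \<Longrightarrow> compactin (mtop HM) K"
    "\<And>h N. h \<in> L \<Longrightarrow> openin (mtop HM) N \<Longrightarrow> h \<in> N \<Longrightarrow> \<exists>K\<in>B. h \<in> K \<and> K \<subseteq> N"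
proof -
  obtain G :: "(nat \<Rightarrow> real) set set" where G: "countable G" "topological_basis G"
    using ex_countable_basis by blast
  define F where "F = (\<lambda>(W :: 'h set, \<psi> :: 'h \<Rightarrow> nat \<Rightarrow> real) g. inv_into W \<psi> ` closure (g \<inter> Rn d))"
  define ok where "ok = (\<lambda>(W :: 'h set, \<psi> :: 'h \<Rightarrow> nat \<Rightarrow> real) g. compact (closure (g \<inter> Rn d)) \<and> closure (g \<inter> Rn d) \<subseteq> \<psi> ` W)"
  define B where "B = (\<lambda>(c, g). F c g) ` {(c, g) \<in> C \<times> G. ok c g}"
  show thesis
  proof (rule that)
    show "countable B" unfolding B_def
      by (intro countable_image countable_subset[OF _ countable_SIGMA[OF C(1) G(1)]]) auto
    fix K assume "K \<in> B"
    then obtain W \<psi> g where K: "(W, \<psi>) \<in> C" "compact (closure (g \<inter> Rn d))" "closure (g \<inter> Rn d) \<subseteq> \<psi> ` W"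
      "K = inv_into W \<psi> ` closure (g \<inter> Rn d)" by (auto simp: B_def F_def ok_def)
    have W: "(W, \<psi>) \<in> atlas HM" using K(1) C(2) by blast
    have "compactin (subtopology (Euclidean_space d) (\<psi> ` W)) (closure (g \<inter> Rn d))"
      using K(2,3) subtopology_E[OF openin_E_subset[OF premanifold_chart(2)[OF preH W]]] by (simp add: compactin_subtopology)
    then show "compactin (mtop HM) K"
      unfolding K(4) by (rule image_compactin[OF _ premanifold_chart(4)[OF preH W]])
  next
    fix h N assume h: "h \<in> L" and N: "openin (mtop HM) N" "h \<in> N"
    then obtain W \<psi> where W': "(W, \<psi>) \<in> C" "h \<in> W" using L by auto
    then have W: "(W, \<psi>) \<in> atlas HM" using C(2) by blast
    note inj = premanifold_chart(3)[OF preH W]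
    have "openin (Euclidean_space d) (\<psi> ` (N \<inter> W))"
      by (rule premanifold_open_image[OF preH W]) (auto intro: N premanifold_chart(1)[OF preH W])
    then obtain e where e: "e > 0" "ebox d (\<psi> h) e \<subseteq> \<psi> ` (N \<inter> W)"
      using N(2) W'(2) unfolding openin_ebox_iff by blast
    have zR: "\<psi> h \<in> Rn d" using openin_E_subset[OF premanifold_chart(2)[OF preH W]] W'(2) by blast
    define S where "S = {y \<in> Rn d. 0 \<le> nrm d (y - \<psi> h) \<and> nrm d (y - \<psi> h) \<le> e / 2}"
    have S: "compact S" unfolding S_def by (rule compact_shell[OF zR])
    have Sbox: "S \<subseteq> ebox d (\<psi> h) e" using e(1) by (auto simp: S_def intro!: ebox_nrm)
    have "continuous_on UNIV (\<lambda>y. nrm d (y - \<psi> h))"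
      unfolding nrm_def by (auto intro!: continuous_intros continuous_on_coord)
    then have "open {y. nrm d (y - \<psi> h) < e / 2}" by (intro open_Collect_less continuous_on_const)
    moreover have "\<psi> h \<in> {y. nrm d (y - \<psi> h) < e / 2}" using e(1) by (simp add: nrm_def)
    ultimately obtain g where g: "g \<in> G" "\<psi> h \<in> g" "g \<subseteq> {y. nrm d (y - \<psi> h) < e / 2}"
      using topological_basisE[OF G(2)] by metis
    have "g \<inter> Rn d \<subseteq> S" using g(3) by (auto simp: S_def)
    then have clS: "closure (g \<inter> Rn d) \<subseteq> S" by (rule closure_minimal[OF _ compact_imp_closed[OF S]])
    have sub: "closure (g \<inter> Rn d) \<subseteq> \<psi> ` (N \<inter> W)" using clS Sbox e(2) by blast
    have "compact (closure (g \<inter> Rn d))"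
      using compact_Int_closed[OF S closed_closure[of "g \<inter> Rn d"]] clS by (simp add: inf.absorb2)
    then have "ok (W, \<psi>) g" using sub by (auto simp: ok_def)
    then have KB: "F (W, \<psi>) g \<in> B" unfolding B_def using W'(1) g(1) by (intro image_eqI[of _ _ "((W, \<psi>), g)"]) auto
    have "\<psi> h \<in> closure (g \<inter> Rn d)" using closure_subset[of "g \<inter> Rn d"] g(2) zR by blast
    then have "h \<in> F (W, \<psi>) g" using W'(2) inj unfolding F_def prod.case by (intro image_eqI[of _ _ "\<psi> h"]) auto
    moreover have "F (W, \<psi>) g \<subseteq> N" using sub inj by (auto simp: F_def)
    ultimately show "\<exists>K\<in>B. h \<in> K \<and> K \<subseteq> N" using KB by blast
  qed
qed

text \<open>The pairs \<open>(y, h)\<close> that solve the equation form a closed set because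
  \<open>M\<close> is Hausdorff, and projection along a compact factor is a closed map.\<close>

lemma orbit_set_closed:
  assumes \<beta>: "plot M n V \<beta>" and \<beta>': "plot M n V \<beta>'" and K: "compactin (mtop HM) K"
  shows "closedin (subtopology (Euclidean_space n) V) {y\<in>V. \<exists>h\<in>K. \<beta>' y = act (\<beta> y) h}"
proof -
  let ?X = "subtopology (Euclidean_space n) V" and ?K = "subtopology (mtop HM) K"
  have tX: "topspace ?X = V" using openin_E_subset[OF plot_open[OF \<beta>]] by auto
  have KH: "K \<subseteq> topspace (mtop HM)" using K by (rule compactin_subset_topspace)
  have tK: "topspace ?K = K" using KH by auto
  have f: "continuous_map (prod_topology ?X ?K) (mtop M) (\<lambda>p. \<beta>' (fst p))"
    using continuous_map_compose[OF continuous_map_fst plot_continuous[OF \<beta>']] by (simp add: comp_def)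
  have b: "continuous_map (prod_topology ?X ?K) (mtop M) (\<lambda>p. \<beta> (fst p))"
    using continuous_map_compose[OF continuous_map_fst plot_continuous[OF \<beta>]] by (simp add: comp_def)
  have s: "continuous_map (prod_topology ?X ?K) (mtop HM) snd"
    using continuous_map_snd[of ?X ?K] by (simp add: continuous_map_in_subtopology)
  have g: "continuous_map (prod_topology ?X ?K) (mtop M) (\<lambda>p. act (\<beta> (fst p)) (snd p))"
    using continuous_map_compose[OF _ act_continuous, of "prod_topology ?X ?K" "\<lambda>p. (\<beta> (fst p), snd p)"] b s
    by (simp add: continuous_map_pairwise comp_def)
  have "Hausdorff_space (mtop M)" using man by (simp add: smooth_manifold_def)
  from closedin_continuous_maps_eq[OF this f g]
  have "closedin (prod_topology ?X ?K) {p \<in> V \<times> K. \<beta>' (fst p) = act (\<beta> (fst p)) (snd p)}"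
    unfolding topspace_prod_topology tX tK .
  moreover have "closed_map (prod_topology ?X ?K) ?X fst"
    by (rule closed_map_fst) (use K in \<open>simp add: compact_space_subtopology\<close>)
  ultimately have "closedin ?X (fst ` {p \<in> V \<times> K. \<beta>' (fst p) = act (\<beta> (fst p)) (snd p)})"
    unfolding closed_map_def by blast
  moreover have "fst ` {p \<in> V \<times> K. \<beta>' (fst p) = act (\<beta> (fst p)) (snd p)} = {y\<in>V. \<exists>h\<in>K. \<beta>' y = act (\<beta> y) h}"
    by (force simp: image_iff)
  ultimately show ?thesis by simp
qed

text \<open>Off the boundaries of the closed sets \<open>{y. \<beta>' y \<in> \<beta> y \<cdot> K}\<close>, \<open>lifts_agree_at\<close> applies after a
  translation; the complement is dense by Baire's theorem.\<close>

lemma lifts_agree_countable: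
  assumes \<omega>: "\<omega> \<in> invariant_basic_forms M H HM act k"
    and \<beta>: "plot M n V \<beta>" and \<beta>': "plot M n V \<beta>'"
    and C: "countable C" "C \<subseteq> atlas HM" and L: "L \<subseteq> (\<Union>(W, \<psi>)\<in>C. W)" and LH: "L \<subseteq> carrier H"
    and rel: "\<And>y. y \<in> V \<Longrightarrow> \<exists>h\<in>L. \<beta>' y = act (\<beta> y) h"
  shows "\<omega> (n, V, restrict \<beta> V) = \<omega> (n, V, restrict \<beta>' V)"
proof (intro ext)
  fix x vs
  have \<omega>d: "\<omega> \<in> dforms (manifold_diffeology M) k" and hor: "horizontal \<omega>"
    using \<omega> by (auto simp: invariant_basic_forms_def basic_forms_iff)
  let ?X = "subtopology (Euclidean_space n) V"
  have V: "openin (Euclidean_space n) V" by (rule plot_open[OF \<beta>])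
  have opX: "openin ?X T \<longleftrightarrow> openin (Euclidean_space n) T \<and> T \<subseteq> V" for T using V by (simp add: openin_open_subtopology)
  have e: "\<omega> (n, V, restrict \<beta> V) \<in> eforms n V k" "\<omega> (n, V, restrict \<beta>' V) \<in> eforms n V k"
    using dforms_eform[OF \<omega>d] manifold_diffeology_restrict[OF preM] \<beta> \<beta>' by blast+
  obtain B where B: "countable B" "\<And>K. K \<in> B \<Longrightarrow> compactin (mtop HM) K"
    "\<And>h N. h \<in> L \<Longrightarrow> openin (mtop HM) N \<Longrightarrow> h \<in> N \<Longrightarrow> \<exists>K\<in>B. h \<in> K \<and> K \<subseteq> N"
    using countable_compact_family[OF C L] by metis
  define A where "A K = {y\<in>V. \<exists>h\<in>K. \<beta>' y = act (\<beta> y) h}" for K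
  \<comment> \<open>The boundary of a closed set: closed and without interior.\<close>
  define bad where "bad K = A K - ?X interior_of A K" for K
  have Acl: "closedin ?X (A K)" if "K \<in> B" for K
    unfolding A_def by (rule orbit_set_closed[OF \<beta> \<beta>' B(2)[OF that]])
  have "closedin ?X T \<and> ?X interior_of T = {}" if T: "T \<in> bad ` B" for T
  proof -
    obtain K where K: "K \<in> B" "T = bad K" using T by blast
    have "closedin ?X T" unfolding K(2) bad_def by (rule closedin_diff[OF Acl[OF K(1)] openin_interior_of])
    moreover have "?X interior_of T = {}"
    proof -
      have "?X interior_of T \<subseteq> ?X interior_of A K" by (rule interior_of_mono) (auto simp: K(2) bad_def)
      moreover have "?X interior_of T \<subseteq> T" by (rule interior_of_subset)
      ultimately show ?thesis unfolding K(2) bad_def by blast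
    qed
    ultimately show ?thesis by blast
  qed
  \<comment> \<open>Baire's theorem on \<open>V\<close>, which is completely metrizable as an open
    subset of a Euclidean space; the union is countable because \<open>B\<close> is.\<close>
  then have dense: "?X interior_of \<Union>(bad ` B) = {}"
    using completely_metrizable_space_openin[OF completely_metrizable_Euclidean_space V] B(1)
    by (intro Baire_category_alt) auto
  have good: "\<omega> (n, V, restrict \<beta> V) y vs = \<omega> (n, V, restrict \<beta>' V) y vs"
    if y: "y \<in> V" "y \<notin> \<Union>(bad ` B)" and vs: "set vs \<subseteq> Rn n" for y
  proof -
    obtain h0 where h0: "h0 \<in> L" "\<beta>' y = act (\<beta> y) h0" using rel[OF y(1)] by blast
    have h0H: "h0 \<in> carrier H" using h0 LH by blast
    have "\<omega> (n, V, restrict (\<lambda>y. act (\<beta> y) h0) V) y vs = \<omega> (n, V, restrict \<beta>' V) y vs"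
    proof (rule lifts_agree_at[OF \<omega>d hor act_plot_const[OF \<beta> h0H] \<beta>' y(1) _ _ vs])
      show "act (\<beta> y) h0 = \<beta>' y" using h0(2) by simp
      fix N assume N: "openin (mtop HM) N" "\<one>\<^bsub>H\<^esub> \<in> N"
      have "continuous_map (mtop HM) (mtop HM) (\<lambda>g. inv\<^bsub>H\<^esub> h0 \<otimes>\<^bsub>H\<^esub> g)"
        using continuous_map_compose[OF _ mult_continuous, of "mtop HM" "\<lambda>g. (inv\<^bsub>H\<^esub> h0, g)"] h0H topH
        by (simp add: continuous_map_pairwise comp_def)
      from openin_continuous_map_preimage[OF this N(1)]
      \<comment> \<open>The left translate of \<open>N\<close> by \<open>h0\<close>: group elements
        in it differ from \<open>h0\<close> by an element of \<open>N\<close>.\<close>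
      have N': "openin (mtop HM) {g\<in>carrier H. inv\<^bsub>H\<^esub> h0 \<otimes>\<^bsub>H\<^esub> g \<in> N}" unfolding topH .
      have "h0 \<in> {g\<in>carrier H. inv\<^bsub>H\<^esub> h0 \<otimes>\<^bsub>H\<^esub> g \<in> N}" using h0H N(2) by simp
      then obtain K where K: "K \<in> B" "h0 \<in> K" "K \<subseteq> {g\<in>carrier H. inv\<^bsub>H\<^esub> h0 \<otimes>\<^bsub>H\<^esub> g \<in> N}"
        using B(3)[OF h0(1) N'] by blast
      have "y \<in> A K" using y(1) K(2) h0(2) by (auto simp: A_def)
      then have yi: "y \<in> ?X interior_of A K" using y(2) K(1) by (auto simp: bad_def)
      have op: "openin (Euclidean_space n) (?X interior_of A K)" "?X interior_of A K \<subseteq> V"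
        using openin_interior_of[of ?X "A K"] unfolding opX by blast+
      \<comment> \<open>A single \<open>K\<close> serves on the whole interior of
        \<open>A K\<close>. This yields the hypothesis \<open>near\<close> for the lift translated
        by \<open>h0\<close>.\<close>
      have "\<exists>g\<in>N. \<beta>' z = act (act (\<beta> z) h0) g" if z: "z \<in> ?X interior_of A K" for z
      proof -
        have "z \<in> A K" by (rule subsetD[OF interior_of_subset z])
        then obtain h where h: "z \<in> V" "h \<in> K" "\<beta>' z = act (\<beta> z) h" by (auto simp: A_def)
        have hH: "h \<in> carrier H" "inv\<^bsub>H\<^esub> h0 \<otimes>\<^bsub>H\<^esub> h \<in> N" using K(3) h(2) by auto
        have "act (act (\<beta> z) h0) (inv\<^bsub>H\<^esub> h0 \<otimes>\<^bsub>H\<^esub> h) = act (\<beta> z) (h0 \<otimes>\<^bsub>H\<^esub> (inv\<^bsub>H\<^esub> h0 \<otimes>\<^bsub>H\<^esub> h))"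
          by (rule act_mult[OF plot_topspace[OF \<beta> h(1)] h0H]) (use h0H hH in simp)
        also have "h0 \<otimes>\<^bsub>H\<^esub> (inv\<^bsub>H\<^esub> h0 \<otimes>\<^bsub>H\<^esub> h) = h" using h0H hH by (simp add: m_assoc[symmetric])
        finally show ?thesis using h(3) hH(2) by metis
      qed
      then show "\<exists>T. openin (Euclidean_space n) T \<and> y \<in> T \<and> T \<subseteq> V \<and> (\<forall>z\<in>T. \<exists>g\<in>N. \<beta>' z = act (act (\<beta> z) h0) g)"
        using op yi by blast
    qed
    then show ?thesis using lifts_translate[OF \<omega> \<beta> h0H] by simp
  qed
  show "\<omega> (n, V, restrict \<beta> V) x vs = \<omega> (n, V, restrict \<beta>' V) x vs"
  proof (cases "x \<in> V \<and> set vs \<subseteq> Rn n")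
    case True
    show ?thesis
    proof (rule ccontr)
      assume ne: "\<omega> (n, V, restrict \<beta> V) x vs \<noteq> \<omega> (n, V, restrict \<beta>' V) x vs"
      let ?f = "\<lambda>y. \<omega> (n, V, restrict \<beta> V) y vs - \<omega> (n, V, restrict \<beta>' V) y vs"
      have "continuous_on V ?f"
        using True by (intro smooth_continuous[of n] smooth_diff[OF V] eforms_smooth[OF e(1)] eforms_smooth[OF e(2)]) auto
      then have T: "openin (Euclidean_space n) {y\<in>V. ?f y \<in> - {0}}"
        by (rule continuous_on_E_preimage[OF V]) auto
      \<comment> \<open>The points where the two values differ form an open set that avoids all good
        points, hence lie in the interior of the exceptional set, which is empty.\<close>
      have "{y\<in>V. ?f y \<in> - {0}} \<subseteq> \<Union>(bad ` B)"
      proof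
        fix y assume "y \<in> {y\<in>V. ?f y \<in> - {0}}"
        then show "y \<in> \<Union>(bad ` B)" using good[of y] True by auto
      qed
      moreover have "openin ?X {y\<in>V. ?f y \<in> - {0}}" using T unfolding opX by blast
      ultimately have "{y\<in>V. ?f y \<in> - {0}} \<subseteq> ?X interior_of \<Union>(bad ` B)" by (rule interior_of_maximal)
      moreover have "x \<in> {y\<in>V. ?f y \<in> - {0}}" using True ne by simp
      ultimately show False using dense by blast
    qed
  next
    case False
    then show ?thesis using eforms_zero[OF e(1)] eforms_zero[OF e(2)] by simp
  qed
qed

end

section \<open>The identity component\<close>

lemma ebox_nrm_le: "y \<in> ebox n x e \<Longrightarrow> nrm n (y - x) \<le> real n * e"
  unfolding nrm_def using sum_bounded_above[of "{..<n}" "\<lambda>i. \<bar>(y - x) i\<bar>" e] by (force simp: ebox_def)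

context smooth_action
begin

lemma inv_continuous: "continuous_map (mtop HM) (mtop HM) (\<lambda>h. inv\<^bsub>H\<^esub> h)"
  using lie by (simp add: lie_group_def smooth_map_def)

lemma left_mult_continuous: "g \<in> carrier H \<Longrightarrow> continuous_map (mtop HM) (mtop HM) (\<lambda>h. g \<otimes>\<^bsub>H\<^esub> h)"
  using continuous_map_compose[OF _ mult_continuous, of "mtop HM" "\<lambda>h. (g, h)"] topH
  by (simp add: continuous_map_pairwise comp_def)

lemma right_mult_continuous: "g \<in> carrier H \<Longrightarrow> continuous_map (mtop HM) (mtop HM) (\<lambda>h. h \<otimes>\<^bsub>H\<^esub> g)"
  using continuous_map_compose[OF _ mult_continuous, of "mtop HM" "\<lambda>h. (h, g)"] topH
  by (simp add: continuous_map_pairwise comp_def)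

abbreviation "H0 \<equiv> identity_component H HM"

lemma H0_connected: "connectedin (mtop HM) H0"
  unfolding identity_component_def by (rule connectedin_connected_component_of)

lemma H0_one: "\<one>\<^bsub>H\<^esub> \<in> H0"
  unfolding identity_component_def using topH by (simp add: connected_component_of_refl)

lemma H0_carrier: "H0 \<subseteq> carrier H"
  using connectedin_subset_topspace[OF H0_connected] topH by simp

lemma H0_maximal: "connectedin (mtop HM) S \<Longrightarrow> g \<in> S \<Longrightarrow> g \<in> H0 \<Longrightarrow> S \<subseteq> H0"
  unfolding identity_component_def
  by (metis connected_component_of_equiv connected_component_of_maximal mem_Collect_eq)

text \<open>Left translation by an element of \<open>H0\<close> and inversion carry
  \<open>H0\<close> to connected sets that meet it, and \<open>H0_maximal\<close> absorbs them.
  Conjugation is treated in the same way in \<open>H0_normal\<close>.\<close>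

lemma H0_subgroup: "subgroup H0 H"
proof
  show "H0 \<subseteq> carrier H" by (rule H0_carrier)
  show "\<one>\<^bsub>H\<^esub> \<in> H0" by (rule H0_one)
  show "g \<otimes>\<^bsub>H\<^esub> h \<in> H0" if "g \<in> H0" "h \<in> H0" for g h
  proof -
    have g: "g \<in> carrier H" using that H0_carrier by blast
    have c: "connectedin (mtop HM) ((\<lambda>h. g \<otimes>\<^bsub>H\<^esub> h) ` H0)"
      by (rule connectedin_continuous_map_image[OF left_mult_continuous[OF g] H0_connected])
    have "g \<in> (\<lambda>h. g \<otimes>\<^bsub>H\<^esub> h) ` H0" using H0_one g by (intro image_eqI[of _ _ "\<one>\<^bsub>H\<^esub>"]) auto
    from H0_maximal[OF c this that(1)] that(2) show ?thesis by blast
  qed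
  show "inv\<^bsub>H\<^esub> g \<in> H0" if "g \<in> H0" for g
  proof -
    have c: "connectedin (mtop HM) ((\<lambda>h. inv\<^bsub>H\<^esub> h) ` H0)"
      by (rule connectedin_continuous_map_image[OF inv_continuous H0_connected])
    have "\<one>\<^bsub>H\<^esub> \<in> (\<lambda>h. inv\<^bsub>H\<^esub> h) ` H0" using H0_one by (intro image_eqI[of _ _ "\<one>\<^bsub>H\<^esub>"]) auto
    from H0_maximal[OF c this H0_one] that show ?thesis by blast
  qed
qed

lemma H0_normal: "H0 \<lhd> H"
  unfolding normal_inv_iff
proof (intro conjI ballI H0_subgroup)
  fix a h assume a: "a \<in> carrier H" and h: "h \<in> H0"
  have "continuous_map (mtop HM) (mtop HM) (\<lambda>h. a \<otimes>\<^bsub>H\<^esub> h \<otimes>\<^bsub>H\<^esub> inv\<^bsub>H\<^esub> a)"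
    using continuous_map_compose[OF left_mult_continuous[OF a] right_mult_continuous[of "inv\<^bsub>H\<^esub> a"]] a by (simp add: comp_def)
  then have c: "connectedin (mtop HM) ((\<lambda>h. a \<otimes>\<^bsub>H\<^esub> h \<otimes>\<^bsub>H\<^esub> inv\<^bsub>H\<^esub> a) ` H0)"
    by (rule connectedin_continuous_map_image[OF _ H0_connected])
  have "\<one>\<^bsub>H\<^esub> \<in> (\<lambda>h. a \<otimes>\<^bsub>H\<^esub> h \<otimes>\<^bsub>H\<^esub> inv\<^bsub>H\<^esub> a) ` H0" using H0_one a by (intro image_eqI[of _ _ "\<one>\<^bsub>H\<^esub>"]) auto
  from H0_maximal[OF c this H0_one] h show "a \<otimes>\<^bsub>H\<^esub> h \<otimes>\<^bsub>H\<^esub> inv\<^bsub>H\<^esub> a \<in> H0" by blast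
qed

text \<open>Several charts may share a domain. One chart is selected for each, so that countability
  or finiteness passes from the cover to the set of charts.\<close>

lemma charts_of_family:
  assumes "\<V> \<subseteq> fst ` atlas HM"
  obtains C where "C \<subseteq> atlas HM" "\<V> = fst ` C" "inj_on fst C"
  using assms by (meson subset_image_inj)

lemma countable_charts_second_countable:
  assumes "second_countable (mtop HM)"
  obtains C where "countable C" "C \<subseteq> atlas HM" "carrier H \<subseteq> (\<Union>(W, \<psi>)\<in>C. W)"
proof -
  have op: "\<forall>U\<in>fst ` atlas HM. openin (mtop HM) U" using premanifold_chart(1)[OF preH] by auto
  have "\<Union>(fst ` atlas HM) = topspace (mtop HM)" using preH by (auto simp: premanifold_def case_prod_unfold)
  then obtain \<V> where \<V>: "countable \<V>" "\<V> \<subseteq> fst ` atlas HM" "\<Union>\<V> = topspace (mtop HM)"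
    using second_countable_imp_Lindelof_space[OF assms] op unfolding Lindelof_space_def by meson
  obtain C where C: "C \<subseteq> atlas HM" "\<V> = fst ` C" "inj_on fst C" using charts_of_family[OF \<V>(2)] .
  show thesis
  proof (rule that[OF _ C(1)])
    show "countable C" using \<V>(1) C by (simp add: countable_image_inj_eq)
    show "carrier H \<subseteq> (\<Union>(W, \<psi>)\<in>C. W)" using \<V>(3) topH by (simp add: C(2) case_prod_unfold)
  qed
qed

lemma finite_charts_compact:
  assumes "compactin (mtop HM) K"
  obtains C where "finite C" "C \<subseteq> atlas HM" "K \<subseteq> (\<Union>(W, \<psi>)\<in>C. W)"
proof -
  have "K \<subseteq> \<Union>(fst ` atlas HM)"
    using compactin_subset_topspace[OF assms] preH by (auto simp: premanifold_def case_prod_unfold)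
  moreover have "openin (mtop HM) U" if "U \<in> fst ` atlas HM" for U
    using that premanifold_chart(1)[OF preH] by auto
  ultimately obtain \<V> where \<V>: "finite \<V>" "\<V> \<subseteq> fst ` atlas HM" "K \<subseteq> \<Union>\<V>"
    using compactinD[OF assms, of "fst ` atlas HM"] by blast
  obtain C where C: "C \<subseteq> atlas HM" "\<V> = fst ` C" "inj_on fst C" using charts_of_family[OF \<V>(2)] .
  show thesis
  proof (rule that[OF _ C(1)])
    show "finite C" using \<V>(1) C by (simp add: finite_image_iff)
    show "K \<subseteq> (\<Union>(W, \<psi>)\<in>C. W)" using \<V>(3) by (simp add: C(2) case_prod_unfold)
  qed
qed

text \<open>The subgroup generated by a compact neighbourhood of the identity is \<open>\<sigma>\<close>-compact and
  clopen, hence contains the identity component.\<close>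

lemma compactly_generated_subgroup:
  obtains L C where "countable C" "C \<subseteq> atlas HM" "L \<subseteq> (\<Union>(W, \<psi>)\<in>C. W)" "L \<subseteq> carrier H" "H0 \<subseteq> L"
    "\<And>g h. g \<in> L \<Longrightarrow> h \<in> L \<Longrightarrow> g \<otimes>\<^bsub>H\<^esub> h \<in> L"
proof -
  have "\<one>\<^bsub>H\<^esub> \<in> topspace (mtop HM)" using topH by simp
  then obtain W \<psi> where W: "(W, \<psi>) \<in> atlas HM" "\<one>\<^bsub>H\<^esub> \<in> W" using premanifold_cover[OF preH] by metis
  let ?e0 = "\<psi> \<one>\<^bsub>H\<^esub>"
  note opW = premanifold_chart(2)[OF preH W(1)] and inj = premanifold_chart(3)[OF preH W(1)]
  have e0: "?e0 \<in> \<psi> ` W" "?e0 \<in> Rn d" using W(2) openin_E_subset[OF opW] by auto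
  obtain \<delta> where \<delta>: "\<delta> > 0" "ebox d ?e0 \<delta> \<subseteq> \<psi> ` W" using opW e0(1) unfolding openin_ebox_iff by blast
  define S where "S = {y \<in> Rn d. 0 \<le> nrm d (y - ?e0) \<and> nrm d (y - ?e0) \<le> \<delta> / 2}"
  have S: "compact S" unfolding S_def by (rule compact_shell[OF e0(2)])
  have SW: "S \<subseteq> \<psi> ` W" using \<delta> by (auto simp: S_def intro!: subsetD[OF \<delta>(2)] ebox_nrm)
  define B0 where "B0 = inv_into W \<psi> ` S"
  have "compactin (subtopology (Euclidean_space d) (\<psi> ` W)) S"
    using S SW subtopology_E[OF openin_E_subset[OF opW]] by (simp add: compactin_subtopology)
  then have B0: "compactin (mtop HM) B0"
    unfolding B0_def by (rule image_compactin[OF _ premanifold_chart(4)[OF preH W(1)]])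
  \<comment> \<open>By \<open>ebox_nrm_le\<close> the norm is at most \<open>d\<close> times the
    half side of a box; the factor \<open>2 * (real d + 1)\<close> puts this box into the ball of
    radius \<open>\<delta> / 2\<close>, also when \<open>d = 0\<close>.\<close>
  define N where "N = {h\<in>W. \<psi> h \<in> ebox d ?e0 (\<delta> / (2 * (real d + 1)))}"
  have N: "openin (mtop HM) N" unfolding N_def by (rule chart_preimage_open[OF manH W(1) openin_ebox])
  have N1: "\<one>\<^bsub>H\<^esub> \<in> N" using W(2) ebox_refl[OF e0(2)] \<delta>(1) by (simp add: N_def)
  have NB0: "N \<subseteq> B0"
  proof
    fix h assume h: "h \<in> N"
    then have hb: "\<psi> h \<in> ebox d ?e0 (\<delta> / (2 * (real d + 1)))" by (simp add: N_def)
    have "nrm d (\<psi> h - ?e0) \<le> real d * (\<delta> / (2 * (real d + 1)))" by (rule ebox_nrm_le[OF hb])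
    also have "\<dots> = \<delta> / 2 * (real d / (real d + 1))" by (simp add: field_simps)
    also have "\<dots> \<le> \<delta> / 2 * 1" using \<delta>(1) by (intro mult_left_mono) auto
    finally have "\<psi> h \<in> S" using hb by (simp add: S_def ebox_def)
    then show "h \<in> B0" using h inj unfolding B0_def by (intro image_eqI[of _ _ "\<psi> h"]) (auto simp: N_def)
  qed
  \<comment> \<open>Closing under inverses preserves compactness and will make the complement of
    \<open>L\<close> open.\<close>
  define B where "B = B0 \<union> (\<lambda>h. inv\<^bsub>H\<^esub> h) ` B0"
  have Bc: "compactin (mtop HM) B" unfolding B_def
    by (intro compactin_Un B0 image_compactin[OF B0 inv_continuous])
  have BH: "B \<subseteq> carrier H" using compactin_subset_topspace[OF Bc] topH by simp
  have B0H: "B0 \<subseteq> carrier H" using BH by (simp add: B_def)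
  have Binv: "inv\<^bsub>H\<^esub> b \<in> B" if "b \<in> B" for b
    using that B0H unfolding B_def by auto
  have NB: "N \<subseteq> B" using NB0 by (auto simp: B_def)
  \<comment> \<open>The set of products of \<open>k\<close> elements of \<open>B\<close>, compact as
    an iterated image under the group law.\<close>
  define P where "P k = ((\<lambda>S. (\<lambda>(a, b). a \<otimes>\<^bsub>H\<^esub> b) ` (S \<times> B)) ^^ k) {\<one>\<^bsub>H\<^esub>}" for k
  have P0: "P 0 = {\<one>\<^bsub>H\<^esub>}" by (simp add: P_def)
  have PS: "P (Suc k) = (\<lambda>(a, b). a \<otimes>\<^bsub>H\<^esub> b) ` (P k \<times> B)" for k by (simp add: P_def)
  have Pc: "compactin (mtop HM) (P k)" for k
  proof (induction k)
    case 0 then show ?case using topH by (simp add: P0)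
  next
    case (Suc k)
    have "compactin (prod_topology (mtop HM) (mtop HM)) (P k \<times> B)" using Suc Bc by (simp add: compactin_Times)
    then show ?case unfolding PS by (rule image_compactin[OF _ mult_continuous])
  qed
  have PH: "P k \<subseteq> carrier H" for k using compactin_subset_topspace[OF Pc] topH by simp
  define L where "L = (\<Union>k. P k)"
  have LH: "L \<subseteq> carrier H" using PH by (auto simp: L_def)
  have Pmult: "a \<otimes>\<^bsub>H\<^esub> b \<in> P (j + k)" if "a \<in> P j" "b \<in> P k" for a b j k
    using that(2)
  proof (induction k arbitrary: b)
    case 0
    have "a \<in> carrier H" using that(1) PH by blast
    then show ?case using 0 that(1) by (simp add: P0)
  next
    case (Suc k)
    then obtain b' c where bc: "b' \<in> P k" "c \<in> B" "b = b' \<otimes>\<^bsub>H\<^esub> c" by (auto simp: PS)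
    have "a \<in> carrier H" "b' \<in> carrier H" "c \<in> carrier H" using that(1) bc PH BH by blast+
    then have "a \<otimes>\<^bsub>H\<^esub> b = (a \<otimes>\<^bsub>H\<^esub> b') \<otimes>\<^bsub>H\<^esub> c" unfolding bc(3) by (simp add: m_assoc)
    then show ?case using Suc.IH[OF bc(1)] bc(2) by (force simp: PS)
  qed
  have LB: "l \<otimes>\<^bsub>H\<^esub> b \<in> L" if l: "l \<in> L" and b: "b \<in> B" for l b
  proof -
    obtain k where "l \<in> P k" using l by (auto simp: L_def)
    then have "l \<otimes>\<^bsub>H\<^esub> b \<in> P (Suc k)" unfolding PS using b by (intro image_eqI[of _ _ "(l, b)"]) auto
    then show ?thesis by (auto simp: L_def)
  qed
  have nb: "openin (mtop HM) {g\<in>carrier H. inv\<^bsub>H\<^esub> h \<otimes>\<^bsub>H\<^esub> g \<in> N}" "h \<in> {g\<in>carrier H. inv\<^bsub>H\<^esub> h \<otimes>\<^bsub>H\<^esub> g \<in> N}"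
    if h: "h \<in> carrier H" for h
    using openin_continuous_map_preimage[OF left_mult_continuous[of "inv\<^bsub>H\<^esub> h"] N] h N1 unfolding topH by simp_all
  have Lo: "openin (mtop HM) L"
  proof (subst openin_subopen, intro ballI)
    fix h assume h: "h \<in> L"
    then have hH: "h \<in> carrier H" using LH by blast
    have "{g\<in>carrier H. inv\<^bsub>H\<^esub> h \<otimes>\<^bsub>H\<^esub> g \<in> N} \<subseteq> L"
    proof
      fix g assume g: "g \<in> {g\<in>carrier H. inv\<^bsub>H\<^esub> h \<otimes>\<^bsub>H\<^esub> g \<in> N}"
      then have "h \<otimes>\<^bsub>H\<^esub> (inv\<^bsub>H\<^esub> h \<otimes>\<^bsub>H\<^esub> g) \<in> L" using LB[OF h] NB by blast
      then show "g \<in> L" using g hH by (simp add: m_assoc[symmetric])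
    qed
    then show "\<exists>T. openin (mtop HM) T \<and> h \<in> T \<and> T \<subseteq> L" using nb[OF hH] by blast
  qed
  have "openin (mtop HM) (carrier H - L)"
  proof (subst openin_subopen, intro ballI)
    fix h assume h: "h \<in> carrier H - L"
    then have hH: "h \<in> carrier H" by blast
    \<comment> \<open>If such a \<open>g\<close> were in \<open>L\<close>, then \<open>h\<close>,
      which is \<open>g\<close> times the inverse of an element of \<open>N \<subseteq> B\<close>,
      would be in \<open>L\<close> as well.\<close>
    have "{g\<in>carrier H. inv\<^bsub>H\<^esub> h \<otimes>\<^bsub>H\<^esub> g \<in> N} \<subseteq> carrier H - L"
    proof
      fix g assume g: "g \<in> {g\<in>carrier H. inv\<^bsub>H\<^esub> h \<otimes>\<^bsub>H\<^esub> g \<in> N}"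
      have "g \<notin> L"
      proof
        assume gL: "g \<in> L"
        have "inv\<^bsub>H\<^esub> (inv\<^bsub>H\<^esub> h \<otimes>\<^bsub>H\<^esub> g) \<in> B" using g NB Binv by blast
        from LB[OF gL this] have "g \<otimes>\<^bsub>H\<^esub> inv\<^bsub>H\<^esub> (inv\<^bsub>H\<^esub> h \<otimes>\<^bsub>H\<^esub> g) \<in> L" .
        moreover have "g \<otimes>\<^bsub>H\<^esub> inv\<^bsub>H\<^esub> (inv\<^bsub>H\<^esub> h \<otimes>\<^bsub>H\<^esub> g) = h"
          using g hH by (simp add: inv_mult_group m_assoc[symmetric])
        ultimately show False using h by simp
      qed
      then show "g \<in> carrier H - L" using g by blast
    qed
    then show "\<exists>T. openin (mtop HM) T \<and> h \<in> T \<and> T \<subseteq> carrier H - L" using nb[OF hH] by blast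
  qed
  then have Lc: "closedin (mtop HM) L" using LH topH by (simp add: closedin_def)
  have "\<one>\<^bsub>H\<^esub> \<in> L" using P0 by (auto simp: L_def)
  then have H0L: "H0 \<subseteq> L"
    using connectedin_clopen_cases[OF H0_connected Lc Lo] H0_one by (auto simp: disjnt_iff)
  have "\<exists>C. finite C \<and> C \<subseteq> atlas HM \<and> P k \<subseteq> (\<Union>(W, \<psi>)\<in>C. W)" for k
    using finite_charts_compact[OF Pc] by metis
  then obtain C where C: "\<And>k. finite (C k)" "\<And>k. C k \<subseteq> atlas HM" "\<And>k. P k \<subseteq> (\<Union>(W, \<psi>)\<in>C k. W)" by metis
  show thesis
  proof (rule that[of "\<Union>k. C k" L])
    show "countable (\<Union>k. C k)" using C(1) by (simp add: countable_finite)
    show "(\<Union>k. C k) \<subseteq> atlas HM" using C(2) by blast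
    show "L \<subseteq> (\<Union>(W, \<psi>)\<in>\<Union>k. C k. W)" using C(3) by (fastforce simp: L_def)
    show "L \<subseteq> carrier H" by (rule LH)
    show "H0 \<subseteq> L" by (rule H0L)
    show "g \<otimes>\<^bsub>H\<^esub> h \<in> L" if "g \<in> L" "h \<in> L" for g h using that Pmult unfolding L_def by blast
  qed
qed

section \<open>Orbit spaces\<close>

abbreviation "T \<equiv> topspace (mtop M)"

lemma orbit_proj_iff: "y \<in> orbit_proj T G act x \<longleftrightarrow> x \<in> T \<and> y \<in> T \<and> (\<exists>g\<in>G. y = act x g)"
  by (simp add: orbit_proj_def orbit_rel_def)

lemma orbit_proj_in: "x \<in> T \<Longrightarrow> orbit_proj T G act x \<in> orbit_space T G act"
  by (simp add: orbit_proj_def orbit_space_def quotientI)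

lemma orbit_space_rep: "A \<in> orbit_space T G act \<Longrightarrow> \<exists>x\<in>T. A = orbit_proj T G act x"
  by (auto simp: orbit_proj_def orbit_space_def elim!: quotientE)

lemma orbit_proj_self: "x \<in> T \<Longrightarrow> subgroup G H \<Longrightarrow> x \<in> orbit_proj T G act x"
  unfolding orbit_proj_iff using act_one subgroup.one_closed by metis

lemma orbit_proj_act:
  assumes "x \<in> T" "h \<in> carrier H"
  shows "orbit_proj T (carrier H) act (act x h) = orbit_proj T (carrier H) act x"
proof (intro equalityI subsetI)
  fix y assume "y \<in> orbit_proj T (carrier H) act (act x h)"
  then obtain g where "y \<in> T" "g \<in> carrier H" "y = act (act x h) g" unfolding orbit_proj_iff by blast
  then show "y \<in> orbit_proj T (carrier H) act x"
    unfolding orbit_proj_iff using assms act_mult by (intro conjI bexI[of _ "h \<otimes>\<^bsub>H\<^esub> g"]) auto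
next
  fix y assume "y \<in> orbit_proj T (carrier H) act x"
  then obtain g where g: "y \<in> T" "g \<in> carrier H" "y = act x g" unfolding orbit_proj_iff by blast
  have "act (act x h) (inv\<^bsub>H\<^esub> h \<otimes>\<^bsub>H\<^esub> g) = act x (h \<otimes>\<^bsub>H\<^esub> (inv\<^bsub>H\<^esub> h \<otimes>\<^bsub>H\<^esub> g))" using assms g by (intro act_mult) auto
  also have "h \<otimes>\<^bsub>H\<^esub> (inv\<^bsub>H\<^esub> h \<otimes>\<^bsub>H\<^esub> g) = g" using assms g by (simp add: m_assoc[symmetric])
  finally show "y \<in> orbit_proj T (carrier H) act (act x h)"
    unfolding orbit_proj_iff using assms g by (intro conjI bexI[of _ "inv\<^bsub>H\<^esub> h \<otimes>\<^bsub>H\<^esub> g"]) auto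
qed

lemma orbit_plot:
  assumes \<beta>: "(n, V, \<beta>) \<in> manifold_diffeology M"
  shows "(n, V, restrict (orbit_proj T G act \<circ> \<beta>) V) \<in> orbit_diffeology M G act"
proof -
  have V: "openin (Euclidean_space n) V" "\<beta> \<in> V \<rightarrow>\<^sub>E T" using \<beta> by (auto simp: manifold_diffeology_def params_def)
  have "(n, V, restrict (orbit_proj T G act \<circ> \<beta>) V) \<in> params (orbit_space T G act)"
  proof -
    have "\<beta> z \<in> T" if "z \<in> V" for z using V(2) that by auto
    then show ?thesis using V(1) orbit_proj_in by (simp add: params_def)
  qed
  then show ?thesis unfolding orbit_diffeology_def quotient_diffeology_def using V(1) \<beta> by auto
qed

lemma orbit_diffeology_params: "orbit_diffeology M G act \<subseteq> params (orbit_space T G act)"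
  by (auto simp: orbit_diffeology_def quotient_diffeology_def)

text \<open>A constant parametrization lifts to a constant plot at a representative of its value, so
  the two clauses of the quotient diffeology need not be distinguished afterwards.\<close>

lemma orbit_diffeology_lift:
  assumes \<gamma>: "(n, U, \<gamma>) \<in> orbit_diffeology M G act" and x: "x \<in> U"
  obtains V \<beta> where "openin (Euclidean_space n) V" "x \<in> V" "V \<subseteq> U" "(n, V, \<beta>) \<in> manifold_diffeology M"
    "\<And>z. z \<in> V \<Longrightarrow> \<gamma> z = orbit_proj T G act (\<beta> z)"
proof -
  have p: "openin (Euclidean_space n) U" "\<gamma> \<in> U \<rightarrow>\<^sub>E orbit_space T G act"
    using \<gamma> orbit_diffeology_params[of G] by (auto simp: params_def)
  have "(\<exists>y. \<forall>z\<in>U. \<gamma> z = y) \<or> (\<forall>x\<in>U. \<exists>V \<beta>. openin (Euclidean_space n) V \<and> x \<in> V \<and> V \<subseteq> U \<and>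
      (n, V, \<beta>) \<in> manifold_diffeology M \<and> (\<forall>z\<in>V. \<gamma> z = orbit_proj T G act (\<beta> z)))"
    using \<gamma> unfolding orbit_diffeology_def quotient_diffeology_def mem_Collect_eq prod.case by (rule conjunct2)
  then consider y where "\<And>z. z \<in> U \<Longrightarrow> \<gamma> z = y"
    | V \<beta> where "openin (Euclidean_space n) V" "x \<in> V" "V \<subseteq> U" "(n, V, \<beta>) \<in> manifold_diffeology M"
        "\<And>z. z \<in> V \<Longrightarrow> \<gamma> z = orbit_proj T G act (\<beta> z)"
    using x by metis
  then show thesis
  proof cases
    case 1
    have "\<gamma> x \<in> orbit_space T G act" using p x by auto
    then obtain m0 where m0: "m0 \<in> T" "\<gamma> x = orbit_proj T G act m0" using orbit_space_rep by blast
    have "(n, U, restrict (\<lambda>z. m0) U) \<in> manifold_diffeology M"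
      by (rule manifold_diffeology_restrict[OF preM plot_const[OF preM m0(1) p(1)]])
    then show thesis using that[of U "restrict (\<lambda>z. m0) U"] p(1) x 1 m0(2) by auto
  next
    case 2
    then show thesis using that by blast
  qed
qed

lemma orbit_diffeology_compose:
  assumes \<alpha>: "(n, U, \<alpha>) \<in> orbit_diffeology M G act" and V: "openin (Euclidean_space m') V" and f: "smooth_between m' V n U f"
  shows "(m', V, restrict (\<alpha> \<circ> f) V) \<in> orbit_diffeology M G act"
proof -
  have p: "openin (Euclidean_space n) U" "\<alpha> \<in> U \<rightarrow>\<^sub>E orbit_space T G act"
    using \<alpha> orbit_diffeology_params[of G] by (auto simp: params_def)
  have fU: "f \<in> V \<rightarrow> U" using f by (simp add: smooth_between_def)
  have "(m', V, restrict (\<alpha> \<circ> f) V) \<in> params (orbit_space T G act)"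
    using V p(2) fU by (fastforce simp: params_def)
  moreover have "\<exists>V' \<beta>. openin (Euclidean_space m') V' \<and> x \<in> V' \<and> V' \<subseteq> V \<and> (m', V', \<beta>) \<in> manifold_diffeology M
      \<and> (\<forall>z\<in>V'. restrict (\<alpha> \<circ> f) V z = orbit_proj T G act (\<beta> z))" if x: "x \<in> V" for x
  proof -
    have "f x \<in> U" using fU x by auto
    then obtain V1 \<beta> where L: "openin (Euclidean_space n) V1" "f x \<in> V1" "V1 \<subseteq> U" "(n, V1, \<beta>) \<in> manifold_diffeology M"
      "\<And>z. z \<in> V1 \<Longrightarrow> \<alpha> z = orbit_proj T G act (\<beta> z)" using orbit_diffeology_lift[OF \<alpha>] by metis
    let ?V2 = "{y\<in>V. f y \<in> V1}"
    have V2: "openin (Euclidean_space m') ?V2"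
      by (rule smooth_between_preimage[OF V f L(1) openin_E_subset[OF p(1)]])
    have f2: "smooth_between m' ?V2 n V1 f"
      using smooth_between_subset[OF f, of ?V2] by (auto simp: smooth_between_def)
    have "(m', ?V2, restrict (\<beta> \<circ> f) ?V2) \<in> manifold_diffeology M"
      by (rule manifold_diffeology_compose[OF preM L(4) V2 f2])
    then show ?thesis using V2 x L(2,5) by (intro exI[of _ ?V2] exI[of _ "restrict (\<beta> \<circ> f) ?V2"]) auto
  qed
  ultimately show ?thesis unfolding orbit_diffeology_def quotient_diffeology_def by blast
qed

text \<open>Normality of \<open>H0\<close> gives \<open>x H0 (H0 a) = x H0 a = x a H0\<close>; both
  inclusions move \<open>a\<close> past \<open>H0\<close> by equality of left and right
  cosets.\<close>

lemma coset_act_orbit: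
  assumes x: "x \<in> T" and a: "a \<in> carrier H"
  shows "coset_act act (orbit_proj T H0 act x) (H0 #>\<^bsub>H\<^esub> a) = orbit_proj T H0 act (act x a)"
proof (intro equalityI subsetI)
  interpret S: subgroup H0 H by (rule H0_subgroup)
  note nc = normal.coset_eq[OF H0_normal]
  fix y assume "y \<in> coset_act act (orbit_proj T H0 act x) (H0 #>\<^bsub>H\<^esub> a)"
  then obtain g1 g2 where g: "g1 \<in> H0" "g2 \<in> H0" "y = act (act x g1) (g2 \<otimes>\<^bsub>H\<^esub> a)" "act x g1 \<in> T"
    unfolding coset_act_def by (auto simp: orbit_proj_iff r_coset_def)
  then have gc: "g1 \<in> carrier H" "g2 \<in> carrier H" using H0_carrier by blast+
  have "(g1 \<otimes>\<^bsub>H\<^esub> g2) \<otimes>\<^bsub>H\<^esub> a \<in> H0 #>\<^bsub>H\<^esub> a" using g by (auto simp: r_coset_def)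
  then have "(g1 \<otimes>\<^bsub>H\<^esub> g2) \<otimes>\<^bsub>H\<^esub> a \<in> a <#\<^bsub>H\<^esub> H0" using nc a by blast
  then obtain g3 where g3: "g3 \<in> H0" "(g1 \<otimes>\<^bsub>H\<^esub> g2) \<otimes>\<^bsub>H\<^esub> a = a \<otimes>\<^bsub>H\<^esub> g3" by (auto simp: l_coset_def)
  have "y = act x (a \<otimes>\<^bsub>H\<^esub> g3)"
    unfolding g(3) g3(2)[symmetric] using act_mult[OF x gc(1), of "g2 \<otimes>\<^bsub>H\<^esub> a"] gc a by (simp add: m_assoc)
  then have "y = act (act x a) g3" using act_mult[OF x a] g3(1) H0_carrier by auto
  moreover have "act (act x a) g3 \<in> T" using x a g3(1) H0_carrier by auto
  ultimately show "y \<in> orbit_proj T H0 act (act x a)" using x a g3(1) by (auto simp: orbit_proj_iff)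
next
  note nc = normal.coset_eq[OF H0_normal]
  fix y assume "y \<in> orbit_proj T H0 act (act x a)"
  then obtain g where g: "g \<in> H0" "y = act (act x a) g" by (auto simp: orbit_proj_iff)
  have gc: "g \<in> carrier H" using g(1) H0_carrier by blast
  have "a \<otimes>\<^bsub>H\<^esub> g \<in> H0 #>\<^bsub>H\<^esub> a" using nc a g(1) by (auto simp: l_coset_def)
  moreover have "y = act x (a \<otimes>\<^bsub>H\<^esub> g)" using g(2) act_mult[OF x a gc] by simp
  ultimately show "y \<in> coset_act act (orbit_proj T H0 act x) (H0 #>\<^bsub>H\<^esub> a)"
    unfolding coset_act_def using orbit_proj_self[OF x H0_subgroup] by blast
qed

lemma component_group: "carrier (H Mod H0) = {H0 #>\<^bsub>H\<^esub> a |a. a \<in> carrier H}"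
  by (auto simp: FactGroup_def RCOSETS_def)

lemma orbit_proj_component:
  assumes x: "x \<in> T"
  shows "orbit_proj (orbit_space T H0 act) (carrier (H Mod H0)) (coset_act act) (orbit_proj T H0 act x)
     = {orbit_proj T H0 act (act x a) |a. a \<in> carrier H}"
proof -
  have "orbit_proj T H0 act x \<in> orbit_space T H0 act" using orbit_proj_in[OF x] .
  moreover have "orbit_proj T H0 act (act x a) \<in> orbit_space T H0 act" if "a \<in> carrier H" for a
    by (rule orbit_proj_in) (use x that in simp)
  ultimately show ?thesis
    unfolding orbit_proj_def[of "orbit_space T H0 act"] orbit_rel_def[of "orbit_space T H0 act"] component_group
    using coset_act_orbit[OF x] by fastforce
qed

text \<open>By \<open>orbit_proj_component\<close> the orbit of a class consists of the classes of
  all \<open>act x a\<close>; passing from \<open>x\<close> to \<open>act x h\<close> only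
  reparametrizes it by a left translation of \<open>H\<close>.\<close>

lemma same_component_orbit:
  assumes x: "x \<in> T" and h: "h \<in> carrier H"
  shows "(orbit_proj T H0 act x, orbit_proj T H0 act (act x h))
     \<in> orbit_fibre_product (orbit_space T H0 act) (carrier (H Mod H0)) (coset_act act)"
proof -
  have xh: "act x h \<in> T" using x h by simp
  have "{orbit_proj T H0 act (act x a) |a. a \<in> carrier H} = {orbit_proj T H0 act (act (act x h) a) |a. a \<in> carrier H}"
    (is "?L = ?R")
  proof (intro equalityI subsetI)
    fix A assume "A \<in> ?L"
    then obtain a where a: "a \<in> carrier H" "A = orbit_proj T H0 act (act x a)" by blast
    have "act (act x h) (inv\<^bsub>H\<^esub> h \<otimes>\<^bsub>H\<^esub> a) = act x (h \<otimes>\<^bsub>H\<^esub> (inv\<^bsub>H\<^esub> h \<otimes>\<^bsub>H\<^esub> a))" using x h a by (intro act_mult) auto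
    also have "h \<otimes>\<^bsub>H\<^esub> (inv\<^bsub>H\<^esub> h \<otimes>\<^bsub>H\<^esub> a) = a" using h a by (simp add: m_assoc[symmetric])
    finally have "A = orbit_proj T H0 act (act (act x h) (inv\<^bsub>H\<^esub> h \<otimes>\<^bsub>H\<^esub> a))" using a(2) by simp
    moreover have "inv\<^bsub>H\<^esub> h \<otimes>\<^bsub>H\<^esub> a \<in> carrier H" using h a by simp
    ultimately show "A \<in> ?R" by blast
  next
    fix A assume "A \<in> ?R"
    then obtain a where a: "a \<in> carrier H" "A = orbit_proj T H0 act (act (act x h) a)" by blast
    then have "A = orbit_proj T H0 act (act x (h \<otimes>\<^bsub>H\<^esub> a))" using act_mult[OF x h] by simp
    moreover have "h \<otimes>\<^bsub>H\<^esub> a \<in> carrier H" using h a by simp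
    ultimately show "A \<in> ?L" by blast
  qed
  then show ?thesis
    unfolding orbit_fibre_product_def using orbit_proj_in[OF x] orbit_proj_in[OF xh]
    by (simp add: orbit_proj_component[OF x] orbit_proj_component[OF xh])
qed

text \<open>The pair of projected lifts is a plot of the fibre product, so it lifts locally through
  the shear map. The second component of the lift is a plot of a discrete space, hence locally
  constant: near \<open>x\<close> one coset relates the two classes.\<close>

lemma shear_local_coset:
  assumes shear: "shear_is_subduction M H HM act"
    and \<beta>: "plot M n V \<beta>" and \<beta>': "plot M n V \<beta>'" and x: "x \<in> V"
    and rel: "\<And>y. y \<in> V \<Longrightarrow> \<exists>h\<in>carrier H. \<beta>' y = act (\<beta> y) h"
  obtains V' a where "openin (Euclidean_space n) V'" "x \<in> V'" "V' \<subseteq> V" "a \<in> carrier H"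
    "\<And>y. y \<in> V' \<Longrightarrow> \<exists>g\<in>H0. \<exists>g'\<in>H0. \<beta>' y = act (\<beta> y) ((g \<otimes>\<^bsub>H\<^esub> g') \<otimes>\<^bsub>H\<^esub> a)"
proof -
  let ?\<pi> = "orbit_proj T H0 act" and ?X = "orbit_space T H0 act" and ?K = "carrier (H Mod H0)"
  let ?DX = "orbit_diffeology M H0 act" and ?P = "orbit_fibre_product (orbit_space T H0 act) (carrier (H Mod H0)) (coset_act act)"
  let ?\<Delta> = "\<lambda>(x, k). (x, coset_act act x k)"
  have sub: "?\<Delta> ` (?X \<times> ?K) = ?P"
    "subset_diffeology (product_diffeology ?DX ?DX) ?P
      = quotient_diffeology (product_diffeology ?DX (discrete_diffeology ?K)) ?\<Delta> ?P"
    using shear by (simp_all add: shear_is_subduction_def subduction_def Let_def)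
  have V: "openin (Euclidean_space n) V" by (rule plot_open[OF \<beta>])
  have bT: "\<beta> y \<in> T" "\<beta>' y \<in> T" if "y \<in> V" for y using plot_topspace \<beta> \<beta>' that by metis+
  let ?f = "\<lambda>y. (?\<pi> (\<beta> y), ?\<pi> (\<beta>' y))"
  have fP: "?f y \<in> ?P" if y: "y \<in> V" for y
  proof -
    obtain h where "h \<in> carrier H" "\<beta>' y = act (\<beta> y) h" using rel[OF y] by blast
    then show ?thesis using same_component_orbit[OF bT(1)[OF y]] by simp
  qed
  have c: "param_comp fst (n, V, restrict ?f V) = (n, V, restrict (?\<pi> \<circ> restrict \<beta> V) V)"
    "param_comp snd (n, V, restrict ?f V) = (n, V, restrict (?\<pi> \<circ> restrict \<beta>' V) V)"
    by (auto simp: param_comp_def fun_eq_iff)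
  have "(n, V, restrict ?f V) \<in> product_diffeology ?DX ?DX"
    unfolding product_diffeology_def mem_Collect_eq c
    using orbit_plot[OF manifold_diffeology_restrict[OF preM \<beta>], of H0]
      orbit_plot[OF manifold_diffeology_restrict[OF preM \<beta>'], of H0] V by (simp add: params_def)
  moreover have "(n, V, restrict ?f V) \<in> params ?P" using V fP by (simp add: params_def)
  ultimately have "(n, V, restrict ?f V) \<in> subset_diffeology (product_diffeology ?DX ?DX) ?P"
    unfolding subset_diffeology_def by (rule IntI)
  then have "(n, V, restrict ?f V) \<in> quotient_diffeology (product_diffeology ?DX (discrete_diffeology ?K)) ?\<Delta> ?P"
    unfolding sub(2) .
  then have "(\<exists>c. \<forall>y\<in>V. restrict ?f V y = c) \<or> (\<forall>x\<in>V. \<exists>V' \<alpha>. openin (Euclidean_space n) V' \<and> x \<in> V' \<and> V' \<subseteq> V \<and>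
      (n, V', \<alpha>) \<in> product_diffeology ?DX (discrete_diffeology ?K) \<and> (\<forall>z\<in>V'. restrict ?f V z = ?\<Delta> (\<alpha> z)))"
    unfolding quotient_diffeology_def mem_Collect_eq prod.case by (rule conjunct2)
  then obtain V' k where V': "openin (Euclidean_space n) V'" "x \<in> V'" "V' \<subseteq> V" and k: "k \<in> ?K"
    and rel': "\<And>y. y \<in> V' \<Longrightarrow> ?\<pi> (\<beta>' y) = coset_act act (?\<pi> (\<beta> y)) k"
  proof (elim disjE exE)
    \<comment> \<open>The constant clause of the quotient diffeology: a preimage of the one value
      under the surjective shear map supplies a single coset for all of \<open>V\<close>.\<close>
    fix c assume c: "\<forall>y\<in>V. restrict ?f V y = c"
    then have c': "?f y = c" if "y \<in> V" for y using that by auto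
    obtain A k where Ak: "k \<in> ?K" "c = (A, coset_act act A k)"
      using fP[OF x] unfolding c'[OF x] sub(1)[symmetric] by auto
    have "?\<pi> (\<beta>' y) = coset_act act (?\<pi> (\<beta> y)) k" if "y \<in> V" for y using c'[OF that] Ak(2) by simp
    then show thesis using that[of V k] V x Ak(1) by blast
  next
    assume all: "\<forall>x\<in>V. \<exists>V' \<alpha>. openin (Euclidean_space n) V' \<and> x \<in> V' \<and> V' \<subseteq> V \<and>
      (n, V', \<alpha>) \<in> product_diffeology ?DX (discrete_diffeology ?K) \<and> (\<forall>z\<in>V'. restrict ?f V z = ?\<Delta> (\<alpha> z))"
    from bspec[OF all x] obtain V1 \<alpha> where V1: "openin (Euclidean_space n) V1" "x \<in> V1" "V1 \<subseteq> V"
      and \<alpha>: "(n, V1, \<alpha>) \<in> product_diffeology ?DX (discrete_diffeology ?K)"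
      and eq: "\<forall>z\<in>V1. restrict ?f V z = ?\<Delta> (\<alpha> z)" by (elim exE conjE) (rule that)
    have d: "(n, V1, restrict (snd \<circ> \<alpha>) V1) \<in> discrete_diffeology ?K"
      using \<alpha> by (simp add: product_diffeology_def param_comp_def)
    then have "\<forall>x\<in>V1. \<exists>V. openin (Euclidean_space n) V \<and> x \<in> V \<and> V \<subseteq> V1 \<and>
        (\<forall>z\<in>V. restrict (snd \<circ> \<alpha>) V1 z = restrict (snd \<circ> \<alpha>) V1 x)"
      unfolding discrete_diffeology_def mem_Collect_eq prod.case by (rule conjunct2)
    from bspec[OF this V1(2)] obtain V2 where V2: "openin (Euclidean_space n) V2" "x \<in> V2" "V2 \<subseteq> V1"
      "\<And>z. z \<in> V2 \<Longrightarrow> restrict (snd \<circ> \<alpha>) V1 z = restrict (snd \<circ> \<alpha>) V1 x"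
      by blast
    have k: "snd (\<alpha> x) \<in> ?K" using d V1(2) by (auto simp: discrete_diffeology_def params_def)
    have "?\<pi> (\<beta>' y) = coset_act act (?\<pi> (\<beta> y)) (snd (\<alpha> x))" if y: "y \<in> V2" for y
    proof -
      have y1: "y \<in> V1" using y V2(3) by blast
      then have "?f y = ?\<Delta> (\<alpha> y)" using bspec[OF eq y1] subsetD[OF V1(3) y1] by simp
      moreover have "snd (\<alpha> y) = snd (\<alpha> x)" using V2(4)[OF y] y1 V1(2) by simp
      ultimately show ?thesis by (auto simp: case_prod_unfold)
    qed
    then show thesis using that[of V2 "snd (\<alpha> x)"] V2 V1(3) k by blast
  qed
  obtain a where a: "a \<in> carrier H" "k = H0 #>\<^bsub>H\<^esub> a" using k unfolding component_group by blast
  show thesis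
  proof (rule that[OF V' a(1)])
    fix y assume y: "y \<in> V'"
    then have yT: "\<beta> y \<in> T" "\<beta>' y \<in> T" using bT V'(3) by blast+
    have "\<beta>' y \<in> coset_act act (?\<pi> (\<beta> y)) k"
      using orbit_proj_self[OF yT(2) H0_subgroup] rel'[OF y] by simp
    \<comment> \<open>\<open>g\<close> comes from the choice of a point in the class of
      \<open>\<beta> y\<close>, and \<open>g'\<close> from the coset \<open>H0 a\<close>.\<close>
    then obtain g g' where g: "g \<in> H0" "g' \<in> H0" "\<beta>' y = act (act (\<beta> y) g) (g' \<otimes>\<^bsub>H\<^esub> a)"
      unfolding coset_act_def a(2) by (auto simp: orbit_proj_iff r_coset_def)
    moreover have "g \<in> carrier H" "g' \<in> carrier H" using g H0_carrier by blast+
    ultimately have "\<beta>' y = act (\<beta> y) ((g \<otimes>\<^bsub>H\<^esub> g') \<otimes>\<^bsub>H\<^esub> a)"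
      using act_mult[OF yT(1)] a(1) by (simp add: m_assoc)
    then show "\<exists>g\<in>H0. \<exists>g'\<in>H0. \<beta>' y = act (\<beta> y) ((g \<otimes>\<^bsub>H\<^esub> g') \<otimes>\<^bsub>H\<^esub> a)" using g by blast
  qed
qed

section \<open>Pullback to the total space\<close>

abbreviation "DM \<equiv> manifold_diffeology M"
abbreviation "DQ \<equiv> orbit_diffeology M (carrier H) act"
abbreviation "proj \<equiv> orbit_proj T (carrier H) act"

lemma param_comp_proj: "p \<in> DM \<Longrightarrow> param_comp proj p \<in> DQ"
  by (cases p) (simp add: param_comp_def orbit_plot)

lemma pull_in: "\<gamma> \<in> dforms DQ k \<Longrightarrow> dform_pull DM proj \<gamma> \<in> dforms DM k"
  by (rule dform_pull_in[OF _ manifold_diffeology_compose[OF preM]]) (use param_comp_proj in auto)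

lemma pull_value: "(n, V, \<beta>) \<in> DM \<Longrightarrow> dform_pull DM proj \<gamma> (n, V, \<beta>) = \<gamma> (n, V, restrict (proj \<circ> \<beta>) V)"
  by (simp add: dform_pull_def param_comp_def)

text \<open>The orbit projection coequalizes the action and the projection \<open>M \<times> H \<rightarrow> M\<close>, and the
  latter kills the directions tangent to \<open>H\<close>.\<close>

lemma pull_horizontal:
  assumes \<gamma>: "\<gamma> \<in> dforms DQ k"
  shows "horizontal (dform_pull DM proj \<gamma>)"
  unfolding horizontal_def
proof (intro allI impI, elim conjE)
  fix U \<phi> W \<psi> u x and ws :: "(nat \<Rightarrow> real) list"
  assume U: "(U, \<phi>) \<in> atlas M" and W: "(W, \<psi>) \<in> atlas HM" "\<one>\<^bsub>H\<^esub> \<in> W" and u: "u \<in> Rn d" and x: "x \<in> \<phi> ` U"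
  let ?\<omega> = "dform_pull DM proj \<gamma>"
  let ?w = "?\<omega> (chart_plot M (U, \<phi>))"
  have \<omega>: "?\<omega> \<in> dforms DM k" by (rule pull_in[OF \<gamma>])
  have w: "?w \<in> eforms m (\<phi> ` U) k" by (rule chart_eform[OF \<omega> U])
  note cf = chart_facts[OF U W]
  show "?w x (leaf_vec (U, \<phi>) (W, \<psi>) u x # ws) = 0"
  proof (cases "Suc (length ws) = k \<and> set ws \<subseteq> Rn m")
    case False
    then show ?thesis using eforms_zero[OF w] by auto
  next
    case True
    let ?A = "act_chart (U, \<phi>) (W, \<psi>)" and ?O = "cprod m d (\<phi> ` U) (\<psi> ` W)"
    let ?c0 = "cat m x (\<psi> \<one>\<^bsub>H\<^esub>)"
    \<comment> \<open>The action sends these vectors to the leaf vector followed by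
      \<open>ws\<close>, whereas \<open>cfst\<close> sends the first of them to 0. The form on the
      product of the charts is evaluated on them in both ways.\<close>
    let ?vs = "cat m 0 u # map (\<lambda>w. cat m w 0) ws"
    have A: "plot M (m + d) ?O ?A" by (rule act_chart_plot[OF U W])
    have c0: "?c0 \<in> ?O" by (rule cat_in_cprod[OF U W x one_Rn(1)[OF U W]])
    have Ac0: "?A ?c0 = inv_into U \<phi> x" by (rule act_chart_one[OF U W x])
    have AU: "?A ?c0 \<in> U" unfolding Ac0 by (rule inv_into_into[OF x])
    have vsR: "set ?vs \<subseteq> Rn (m + d)"
    proof -
      have "cat m 0 u \<in> Rn (m + d)" by (rule cat_Rn[OF u])
      moreover have "cat m w 0 \<in> Rn (m + d)" for w by (rule cat_Rn) simp
      ultimately show ?thesis by auto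
    qed
    have eta: "(\<lambda>y. \<phi> (?A y)) = act_coord (U, \<phi>) (W, \<psi>)" by (simp add: act_coord_def fun_eq_iff)
    have T1: "tangent_map (m + d) (\<lambda>y. \<phi> (?A y)) ?c0 (cat m 0 u) = leaf_vec (U, \<phi>) (W, \<psi>) u x"
      unfolding eta leaf_vec_def prod.case ..
    have T2: "map (tangent_map (m + d) (\<lambda>y. \<phi> (?A y)) ?c0) (map (\<lambda>w. cat m w 0) ws) = ws"
      unfolding eta map_map comp_def
      by (rule map_idI) (use tangent_act_coord_fst[OF U W x] True in blast)
    have "?\<omega> (m + d, ?O, restrict ?A ?O) ?c0 ?vs
        = ?w (\<phi> (?A ?c0)) (map (tangent_map (m + d) (\<lambda>y. \<phi> (?A y)) ?c0) ?vs)"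
      by (rule dform_in_chart[OF man \<omega> A c0 U AU vsR])
    also have "\<phi> (?A ?c0) = x" unfolding Ac0 by (rule f_inv_into_f[OF x])
    finally have L: "?\<omega> (m + d, ?O, restrict ?A ?O) ?c0 ?vs = ?w x (leaf_vec (U, \<phi>) (W, \<psi>) u x # ws)"
      unfolding list.map(2) T1 T2 .
    let ?p = "restrict (inv_into U \<phi>) (\<phi> ` U)"
    have pin: "(m, \<phi> ` U, ?p) \<in> DM" by (rule manifold_diffeology_restrict[OF preM plot_chart[OF man U]])
    have qin: "(m, \<phi> ` U, restrict (proj \<circ> ?p) (\<phi> ` U)) \<in> DQ" by (rule orbit_plot[OF pin])
    have eqp: "restrict (proj \<circ> restrict ?A ?O) ?O = restrict (restrict (proj \<circ> ?p) (\<phi> ` U) \<circ> cfst m) ?O"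
    proof (rule restrict_ext)
      fix c assume c: "c \<in> ?O"
      then have "cfst m c \<in> \<phi> ` U" "csnd m c \<in> \<psi> ` W" by (auto simp: cprod_def)
      moreover from this have "inv_into U \<phi> (cfst m c) \<in> T" "inv_into W \<psi> (csnd m c) \<in> carrier H"
        using inv_into_into[of "cfst m c" \<phi> U] inv_into_into[of "csnd m c" \<psi> W] cf by blast+
      ultimately show "(proj \<circ> restrict ?A ?O) c = (restrict (proj \<circ> ?p) (\<phi> ` U) \<circ> cfst m) c"
        using c orbit_proj_act by (simp add: act_chart_def)
    qed
    have "?\<omega> (m + d, ?O, restrict ?A ?O) = \<gamma> (m + d, ?O, restrict (restrict (proj \<circ> ?p) (\<phi> ` U) \<circ> cfst m) ?O)"
      unfolding pull_value[OF manifold_diffeology_restrict[OF preM A]] eqp ..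
    also have "\<dots> = eform_pull (m + d) ?O (cfst m) (\<gamma> (m, \<phi> ` U, restrict (proj \<circ> ?p) (\<phi> ` U)))"
      by (rule dforms_pull[OF \<gamma> qin plot_open[OF A] smooth_cfst_cprod])
    finally have R: "?\<omega> (m + d, ?O, restrict ?A ?O) ?c0 ?vs
        = \<gamma> (m, \<phi> ` U, restrict (proj \<circ> ?p) (\<phi> ` U)) (cfst m ?c0) (map (tangent_map (m + d) (cfst m) ?c0) ?vs)"
      using c0 vsR by (simp only: eform_pull_def) simp
    have T3: "tangent_map (m + d) (cfst m) ?c0 (cat m 0 u) = 0"
    proof
      fix j
      show "tangent_map (m + d) (cfst m) ?c0 (cat m 0 u) j = 0 j"
      proof (cases "j < m")
        case True
        have "tangent_map (m + d) (cfst m) ?c0 (cat m 0 u) j = dir_deriv (m + d) (cat m 0 u) (\<lambda>y. y j) ?c0"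
          using True by (simp add: tangent_map_def cfst_def)
        also have "\<dots> = cat m 0 u j" using True by (intro dir_deriv_proj) simp
        finally show ?thesis using True by (simp add: cat_def)
      qed (simp add: tangent_map_def cfst_def)
    qed
    let ?g = "\<gamma> (m, \<phi> ` U, restrict (proj \<circ> ?p) (\<phi> ` U))"
    have g: "?g \<in> eforms m (\<phi> ` U) k" by (rule dforms_eform[OF \<gamma> qin])
    have cx: "cfst m ?c0 = x" using x cf(2) by (intro cfst_cat) blast
    let ?us = "map (tangent_map (m + d) (cfst m) ?c0) (map (\<lambda>w. cat m w 0) ws)"
    have "?g x (0 # ?us) = 0"
    \<comment> \<open>Outside \<open>Rn m\<close> the value is 0 by the convention in
      \<open>eforms\<close>; inside, a zero argument gives 0 by linearity.\<close>
    proof (cases "set ?us \<subseteq> Rn m")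
      case usR: True
      have alt: "altml m (Suc (length ws)) (?g x)" using sform_altml[OF eforms_sform[OF g] x] True by simp
      from altml_linear_head[OF alt _ usR, of 0 0 0 0] show ?thesis
        by (simp only: length_map scaleR_zero_left add_0_left mult_zero_left Rn_zero)
    next
      case False
      then show ?thesis using eforms_zero[OF g] by auto
    qed
    then show ?thesis using L R unfolding list.map(2) T3 cx by simp
  qed
qed

lemma pull_invariant: "dform_pull DM proj \<gamma> \<in> invariant_basic_forms M H HM act k" if \<gamma>: "\<gamma> \<in> dforms DQ k"
  unfolding invariant_basic_forms_def mem_Collect_eq basic_forms_iff
proof (intro conjI ballI)
  show "dform_pull DM proj \<gamma> \<in> dforms DM k" by (rule pull_in[OF \<gamma>])
  show "horizontal (dform_pull DM proj \<gamma>)" by (rule pull_horizontal[OF \<gamma>])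
  \<comment> \<open>As \<open>d\<close> commutes with pullback, this is the horizontality of the
    pullback of \<open>d\<gamma>\<close>.\<close>
  show "horizontal (dform_d (dform_pull DM proj \<gamma>))"
    unfolding dform_pull_d[symmetric] by (rule pull_horizontal[OF dform_d_in[OF orbit_diffeology_params \<gamma>]])
  fix h assume h: "h \<in> carrier H"
  show "dform_pull DM (\<lambda>x. act x h) (dform_pull DM proj \<gamma>) = dform_pull DM proj \<gamma>"
  proof
    fix p :: "'a param"
    obtain n V \<beta> where p: "p = (n, V, \<beta>)" by (cases p)
    show "dform_pull DM (\<lambda>x. act x h) (dform_pull DM proj \<gamma>) p = dform_pull DM proj \<gamma> p"
    proof (cases "p \<in> DM")
      case True
      then have \<beta>: "plot M n V \<beta>" "\<beta> \<in> extensional V" unfolding p manifold_diffeology_iff[OF preM] by auto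
      have q: "param_comp (\<lambda>x. act x h) p = (n, V, restrict (\<lambda>y. act (\<beta> y) h) V)"
        by (auto simp: p param_comp_def fun_eq_iff)
      have q': "(n, V, restrict (\<lambda>y. act (\<beta> y) h) V) \<in> DM"
        by (rule manifold_diffeology_restrict[OF preM act_plot_const[OF \<beta>(1) h]])
      have "restrict (proj \<circ> restrict (\<lambda>y. act (\<beta> y) h) V) V = restrict (proj \<circ> \<beta>) V"
        by (rule restrict_ext) (use orbit_proj_act[OF plot_topspace[OF \<beta>(1)] h] in simp)
      then have "dform_pull DM proj \<gamma> (param_comp (\<lambda>x. act x h) p) = dform_pull DM proj \<gamma> p"
        unfolding q pull_value[OF q'] unfolding p pull_value[OF True[unfolded p]] by simp
      then show ?thesis using True by (simp only: dform_pull_def[of DM "\<lambda>x. act x h"] if_True)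
    next
      case False
      then show ?thesis by (simp only: dform_pull_def if_False)
    qed
  qed
qed

text \<open>Every plot of \<open>M/H\<close> is locally the projection of a plot of
  \<open>M\<close>, on which the pullback records the value of the form.\<close>

lemma pull_injective:
  assumes \<gamma>: "\<gamma> \<in> dforms DQ k" and \<eta>: "\<eta> \<in> dforms DQ k" and eq: "dform_pull DM proj \<gamma> = dform_pull DM proj \<eta>"
  shows "\<gamma> = \<eta>"
proof
  fix p :: "'a set param"
  obtain n U \<alpha> where p: "p = (n, U, \<alpha>)" by (cases p)
  show "\<gamma> p = \<eta> p"
  proof (cases "p \<in> DQ")
    case True
    then have \<alpha>: "(n, U, \<alpha>) \<in> DQ" by (simp add: p)
    show ?thesis
    proof (intro ext)
      fix x vs
      show "\<gamma> p x vs = \<eta> p x vs"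
      proof (cases "x \<in> U \<and> set vs \<subseteq> Rn n")
        case True
        then obtain V \<beta> where V: "openin (Euclidean_space n) V" "x \<in> V" "V \<subseteq> U" "(n, V, \<beta>) \<in> DM"
          "\<And>z. z \<in> V \<Longrightarrow> \<alpha> z = proj (\<beta> z)" using orbit_diffeology_lift[OF \<alpha>] by metis
        have e: "restrict \<alpha> V = restrict (proj \<circ> \<beta>) V" by (rule restrict_ext) (simp add: V(5))
        have "\<gamma> (n, V, restrict \<alpha> V) = \<eta> (n, V, restrict \<alpha> V)"
          unfolding e pull_value[OF V(4), symmetric] eq ..
        then show ?thesis
          using dforms_restrict[OF \<gamma> \<alpha> V(1,3,2)] dforms_restrict[OF \<eta> \<alpha> V(1,3,2)] True unfolding p by metis
      next
        case False
        then show ?thesis unfolding p using eforms_zero[OF dforms_eform[OF \<gamma> \<alpha>]] eforms_zero[OF dforms_eform[OF \<eta> \<alpha>]] by auto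
      qed
    qed
  next
    case False
    then show ?thesis using dforms_zero[OF \<gamma>] dforms_zero[OF \<eta>] by simp
  qed
qed

end

section \<open>Descent of invariant basic forms\<close>

context locally_free_action
begin

lemma lifts_agree:
  assumes hyp: "second_countable (mtop HM) \<or> shear_is_subduction M H HM act"
    and \<omega>: "\<omega> \<in> invariant_basic_forms M H HM act k"
    and \<beta>: "plot M n V \<beta>" and \<beta>': "plot M n V \<beta>'" and eq: "\<And>y. y \<in> V \<Longrightarrow> proj (\<beta> y) = proj (\<beta>' y)"
  shows "\<omega> (n, V, restrict \<beta> V) = \<omega> (n, V, restrict \<beta>' V)"
proof -
  have rel: "\<exists>h\<in>carrier H. \<beta>' y = act (\<beta> y) h" if y: "y \<in> V" for y
  proof -
    have "\<beta>' y \<in> proj (\<beta>' y)" by (rule orbit_proj_self[OF plot_topspace[OF \<beta>' y] subgroup_self])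
    then show ?thesis unfolding eq[OF y, symmetric] orbit_proj_iff by blast
  qed
  from hyp show ?thesis
  proof
    assume "second_countable (mtop HM)"
    then obtain C where "countable C" "C \<subseteq> atlas HM" "carrier H \<subseteq> (\<Union>(W, \<psi>)\<in>C. W)"
      by (rule countable_charts_second_countable)
    from lifts_agree_countable[OF \<omega> \<beta> \<beta>' this order_refl rel] show ?thesis .
  next
    assume shear: "shear_is_subduction M H HM act"
    have \<omega>d: "\<omega> \<in> dforms DM k" using \<omega> by (simp add: invariant_basic_forms_def basic_forms_iff)
    have b: "(n, V, restrict \<beta> V) \<in> DM" "(n, V, restrict \<beta>' V) \<in> DM"
      using manifold_diffeology_restrict[OF preM] \<beta> \<beta>' by blast+
    obtain L C where C: "countable C" "C \<subseteq> atlas HM" "L \<subseteq> (\<Union>(W, \<psi>)\<in>C. W)" and L: "L \<subseteq> carrier H" "H0 \<subseteq> L"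
      "\<And>g h. g \<in> L \<Longrightarrow> h \<in> L \<Longrightarrow> g \<otimes>\<^bsub>H\<^esub> h \<in> L" using compactly_generated_subgroup by metis
    show ?thesis
    proof (intro ext)
      fix x vs
      show "\<omega> (n, V, restrict \<beta> V) x vs = \<omega> (n, V, restrict \<beta>' V) x vs"
      proof (cases "x \<in> V \<and> set vs \<subseteq> Rn n")
        case True
        then have x: "x \<in> V" and vs: "set vs \<subseteq> Rn n" by auto
        obtain V' a where V': "openin (Euclidean_space n) V'" "x \<in> V'" "V' \<subseteq> V" and a: "a \<in> carrier H"
          and r: "\<And>y. y \<in> V' \<Longrightarrow> \<exists>g\<in>H0. \<exists>g'\<in>H0. \<beta>' y = act (\<beta> y) ((g \<otimes>\<^bsub>H\<^esub> g') \<otimes>\<^bsub>H\<^esub> a)"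
          using shear_local_coset[OF shear \<beta> \<beta>' x rel] by metis
        have p: "plot M n V' \<beta>" "plot M n V' \<beta>'" using plot_subset[OF preM _ V'(1,3)] \<beta> \<beta>' by auto
        have ia: "inv\<^bsub>H\<^esub> a \<in> carrier H" using a by simp
        \<comment> \<open>Translating \<open>\<beta>'\<close> by the inverse of \<open>a\<close>
          leaves a difference in \<open>H0 H0\<close>, which is inside the subgroup covered by
          countably many charts; \<open>lifts_translate\<close> undoes the translation
          afterwards.\<close>
        have "\<omega> (n, V', restrict \<beta> V') = \<omega> (n, V', restrict (\<lambda>y. act (\<beta>' y) (inv\<^bsub>H\<^esub> a)) V')"
        proof (rule lifts_agree_countable[OF \<omega> p(1) act_plot_const[OF p(2) ia] C L(1)])
          fix y assume y: "y \<in> V'"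
          then obtain g g' where g: "g \<in> H0" "g' \<in> H0" "\<beta>' y = act (\<beta> y) ((g \<otimes>\<^bsub>H\<^esub> g') \<otimes>\<^bsub>H\<^esub> a)" using r by blast
          have gL: "g \<otimes>\<^bsub>H\<^esub> g' \<in> L" using g L(2,3) by blast
          then have gH: "g \<otimes>\<^bsub>H\<^esub> g' \<in> carrier H" using L(1) by blast
          have "act (\<beta>' y) (inv\<^bsub>H\<^esub> a) = act (\<beta> y) (((g \<otimes>\<^bsub>H\<^esub> g') \<otimes>\<^bsub>H\<^esub> a) \<otimes>\<^bsub>H\<^esub> inv\<^bsub>H\<^esub> a)"
            unfolding g(3) by (rule act_mult[OF plot_topspace[OF p(1) y]]) (use gH a in auto)
          also have "((g \<otimes>\<^bsub>H\<^esub> g') \<otimes>\<^bsub>H\<^esub> a) \<otimes>\<^bsub>H\<^esub> inv\<^bsub>H\<^esub> a = g \<otimes>\<^bsub>H\<^esub> g'" using gH a by (simp add: inv_solve_right')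
          finally show "\<exists>h\<in>L. act (\<beta>' y) (inv\<^bsub>H\<^esub> a) = act (\<beta> y) h" using gL by blast
        qed
        also have "\<dots> = \<omega> (n, V', restrict \<beta>' V')" by (rule lifts_translate[OF \<omega> p(2) ia])
        finally have "\<omega> (n, V', restrict \<beta> V') x vs = \<omega> (n, V', restrict \<beta>' V') x vs" by simp
        moreover have "restrict (restrict \<beta> V) V' = restrict \<beta> V'" "restrict (restrict \<beta>' V) V' = restrict \<beta>' V'"
          using V'(3) by (auto simp: fun_eq_iff)
        ultimately show ?thesis
          using dforms_restrict[OF \<omega>d b(1) V'(1,3,2) vs] dforms_restrict[OF \<omega>d b(2) V'(1,3,2) vs] by simp
      next
        case False
        then show ?thesis using eforms_zero[OF dforms_eform[OF \<omega>d b(1)]] eforms_zero[OF dforms_eform[OF \<omega>d b(2)]] by auto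
      qed
    qed
  qed
qed

section \<open>Construction of the descended form\<close>

definition is_lift :: "nat \<Rightarrow> (nat \<Rightarrow> real) set \<Rightarrow> ((nat \<Rightarrow> real) \<Rightarrow> 'a set) \<Rightarrow> (nat \<Rightarrow> real) \<Rightarrow>
    (nat \<Rightarrow> real) set \<times> ((nat \<Rightarrow> real) \<Rightarrow> 'a) \<Rightarrow> bool" where
  "is_lift n U \<alpha> x = (\<lambda>(V, \<beta>). openin (Euclidean_space n) V \<and> x \<in> V \<and> V \<subseteq> U \<and> (n, V, \<beta>) \<in> DM \<and> (\<forall>z\<in>V. \<alpha> z = proj (\<beta> z)))"

text \<open>The lift is chosen separately at every \<open>x\<close>. The choices cohere because, by
  \<open>lift_value\<close>, all lifts give the same value; the guard makes the result
  extensional.\<close>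

definition descend :: "'a dform \<Rightarrow> 'a set dform" where
  "descend \<omega> = (\<lambda>(n, U, \<alpha>) x vs. if (n, U, \<alpha>) \<in> DQ \<and> x \<in> U \<and> set vs \<subseteq> Rn n
     then (case SOME l. is_lift n U \<alpha> x l of (V, \<beta>) \<Rightarrow> \<omega> (n, V, \<beta>) x vs) else 0)"

lemma lift_exists:
  assumes "(n, U, \<alpha>) \<in> DQ" "x \<in> U"
  shows "\<exists>V \<beta>. is_lift n U \<alpha> x (V, \<beta>)"
proof -
  obtain V \<beta> where "openin (Euclidean_space n) V" "x \<in> V" "V \<subseteq> U" "(n, V, \<beta>) \<in> DM"
    "\<And>z. z \<in> V \<Longrightarrow> \<alpha> z = proj (\<beta> z)" using orbit_diffeology_lift[OF assms] by metis
  then have "is_lift n U \<alpha> x (V, \<beta>)" by (simp add: is_lift_def)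
  then show ?thesis by blast
qed

text \<open>On the intersection of their domains two lifts project to the same plot, so
  \<open>lifts_agree\<close> applies there; locality of forms does the rest.\<close>

lemma lift_value:
  assumes hyp: "second_countable (mtop HM) \<or> shear_is_subduction M H HM act"
    and \<omega>: "\<omega> \<in> invariant_basic_forms M H HM act k"
    and l: "is_lift n U \<alpha> x (V, \<beta>)" "is_lift n U \<alpha> x (V', \<beta>')" and vs: "set vs \<subseteq> Rn n"
  shows "\<omega> (n, V, \<beta>) x vs = \<omega> (n, V', \<beta>') x vs"
proof -
  have \<omega>d: "\<omega> \<in> dforms DM k" using \<omega> by (simp add: invariant_basic_forms_def basic_forms_iff)
  let ?W = "V \<inter> V'"
  have V: "openin (Euclidean_space n) V" "openin (Euclidean_space n) V'" "x \<in> ?W"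
    "(n, V, \<beta>) \<in> DM" "(n, V', \<beta>') \<in> DM" "\<And>z. z \<in> ?W \<Longrightarrow> proj (\<beta> z) = proj (\<beta>' z)"
    using l by (auto simp: is_lift_def)
  have W: "openin (Euclidean_space n) ?W" using V by blast
  have p: "plot M n ?W \<beta>" "plot M n ?W \<beta>'"
    using V(4,5) plot_subset[OF preM _ W] unfolding manifold_diffeology_iff[OF preM] by auto
  have "\<omega> (n, ?W, restrict \<beta> ?W) = \<omega> (n, ?W, restrict \<beta>' ?W)"
    by (rule lifts_agree[OF hyp \<omega> p V(6)])
  then show ?thesis
    using dforms_restrict[OF \<omega>d V(4) W Int_lower1 V(3) vs] dforms_restrict[OF \<omega>d V(5) W Int_lower2 V(3) vs] by simp
qed

lemma descend_value:
  assumes hyp: "second_countable (mtop HM) \<or> shear_is_subduction M H HM act"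
    and \<omega>: "\<omega> \<in> invariant_basic_forms M H HM act k"
    and \<alpha>: "(n, U, \<alpha>) \<in> DQ" and l: "is_lift n U \<alpha> x (V, \<beta>)" and vs: "set vs \<subseteq> Rn n"
  shows "descend \<omega> (n, U, \<alpha>) x vs = \<omega> (n, V, \<beta>) x vs"
proof -
  have x: "x \<in> U" using l by (auto simp: is_lift_def)
  obtain V' \<beta>' where l': "(SOME l. is_lift n U \<alpha> x l) = (V', \<beta>')" by (cases "SOME l. is_lift n U \<alpha> x l")
  have "is_lift n U \<alpha> x (V', \<beta>')" unfolding l'[symmetric] by (rule someI[where P = "is_lift n U \<alpha> x", OF l])
  from lift_value[OF hyp \<omega> this l vs] show ?thesis using \<alpha> x vs l' by (simp add: descend_def)
qed

text \<open>Near each point one fixed lift computes all values, so smoothness and alternation are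
  inherited from \<open>\<omega>\<close>; composing a lift with a smooth map lifts the composed
  plot, which gives naturality.\<close>

lemma descend_in:
  assumes hyp: "second_countable (mtop HM) \<or> shear_is_subduction M H HM act"
    and \<omega>: "\<omega> \<in> invariant_basic_forms M H HM act k"
  shows "descend \<omega> \<in> dforms DQ k"
proof (rule dformsI)
  have \<omega>d: "\<omega> \<in> dforms DM k" using \<omega> by (simp add: invariant_basic_forms_def basic_forms_iff)
  note val = descend_value[OF hyp \<omega>]
  show "descend \<omega> p = 0" if "p \<notin> DQ" for p
    using that by (cases p) (simp add: descend_def fun_eq_iff)
  fix n U \<alpha> assume \<alpha>: "(n, U, \<alpha>) \<in> DQ"
  have U: "openin (Euclidean_space n) U" using \<alpha> orbit_diffeology_params by (auto simp: params_def)
  have out: "descend \<omega> (n, U, \<alpha>) x vs = 0" if "\<not> (x \<in> U \<and> set vs \<subseteq> Rn n)" for x vs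
    using that by (auto simp: descend_def)
  show "descend \<omega> (n, U, \<alpha>) \<in> eforms n U k"
    unfolding eforms_iff
  proof (intro conjI allI impI)
    fix x vs assume no: "\<not> (x \<in> U \<and> length vs = k \<and> set vs \<subseteq> Rn n)"
    show "descend \<omega> (n, U, \<alpha>) x vs = 0"
    proof (cases "x \<in> U \<and> set vs \<subseteq> Rn n")
      case True
      then obtain V \<beta> where l: "is_lift n U \<alpha> x (V, \<beta>)" using lift_exists[OF \<alpha>] by blast
      then have "(n, V, \<beta>) \<in> DM" by (simp add: is_lift_def)
      from eforms_zero[OF dforms_eform[OF \<omega>d this]] show ?thesis using val[OF \<alpha> l] True no by simp
    qed (rule out)
  next
    show "sform n U n k (descend \<omega> (n, U, \<alpha>))"
      unfolding sform_def
    proof (intro conjI ballI allI impI)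
      fix x assume x: "x \<in> U"
      then obtain V \<beta> where l: "is_lift n U \<alpha> x (V, \<beta>)" using lift_exists[OF \<alpha>] by blast
      then have b: "(n, V, \<beta>) \<in> DM" "x \<in> V" by (auto simp: is_lift_def)
      show "altml n k (descend \<omega> (n, U, \<alpha>) x)"
        by (rule altml_cong[OF sform_altml[OF eforms_sform[OF dforms_eform[OF \<omega>d b(1)]] b(2)]]) (simp add: val[OF \<alpha> l])
    next
      fix vs :: "(nat \<Rightarrow> real) list" assume vs: "length vs = k \<and> set vs \<subseteq> Rn n"
      show "smooth_fun n U (\<lambda>x. descend \<omega> (n, U, \<alpha>) x vs)"
      proof (rule smooth_local[OF U])
        fix x assume "x \<in> U"
        then obtain V \<beta> where l: "is_lift n U \<alpha> x (V, \<beta>)" using lift_exists[OF \<alpha>] by blast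
        then have V: "openin (Euclidean_space n) V" "x \<in> V" "V \<subseteq> U" "(n, V, \<beta>) \<in> DM" by (auto simp: is_lift_def)
        have eq: "\<omega> (n, V, \<beta>) y vs = descend \<omega> (n, U, \<alpha>) y vs" if "y \<in> V" for y
        proof -
          \<comment> \<open>The lift found at \<open>x\<close> is also a lift at every other point
            of its domain, although \<open>descend\<close> may have chosen a different one
            there.\<close>
          have "is_lift n U \<alpha> y (V, \<beta>)" using l that by (simp add: is_lift_def)
          then show ?thesis using val[OF \<alpha>] vs by metis
        qed
        have "smooth_fun n V (\<lambda>x. \<omega> (n, V, \<beta>) x vs)"
          by (rule eforms_smooth[OF dforms_eform[OF \<omega>d V(4)]]) (use vs in blast)
        then have "smooth_fun n V (\<lambda>x. descend \<omega> (n, U, \<alpha>) x vs)"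
          by (rule smooth_cong[OF V(1), rotated]) (rule eq)
        then show "\<exists>V. openin (Euclidean_space n) V \<and> x \<in> V \<and> V \<subseteq> U \<and> smooth_fun n V (\<lambda>x. descend \<omega> (n, U, \<alpha>) x vs)"
          using V by blast
      qed
    qed
  qed
  fix m' V f assume V: "openin (Euclidean_space m') V" and f: "smooth_between m' V n U f"
  have fU: "f \<in> V \<rightarrow> U" using f by (simp add: smooth_between_def)
  have \<alpha>f: "(m', V, restrict (\<alpha> \<circ> f) V) \<in> DQ" by (rule orbit_diffeology_compose[OF \<alpha> V f])
  show "descend \<omega> (m', V, restrict (\<alpha> \<circ> f) V) = eform_pull m' V f (descend \<omega> (n, U, \<alpha>))"
  proof (intro ext)
    fix x vs
    show "descend \<omega> (m', V, restrict (\<alpha> \<circ> f) V) x vs = eform_pull m' V f (descend \<omega> (n, U, \<alpha>)) x vs"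
    proof (cases "x \<in> V \<and> set vs \<subseteq> Rn m'")
      case True
      then have x: "x \<in> V" and vs: "set vs \<subseteq> Rn m'" by auto
      have "f x \<in> U" using fU x by auto
      then obtain V1 \<beta> where l: "is_lift n U \<alpha> (f x) (V1, \<beta>)" using lift_exists[OF \<alpha>] by blast
      then have L: "openin (Euclidean_space n) V1" "f x \<in> V1" "V1 \<subseteq> U" "(n, V1, \<beta>) \<in> DM"
        "\<And>z. z \<in> V1 \<Longrightarrow> \<alpha> z = proj (\<beta> z)" by (auto simp: is_lift_def)
      let ?V2 = "{y\<in>V. f y \<in> V1}"
      have V2: "openin (Euclidean_space m') ?V2"
        by (rule smooth_between_preimage[OF V f L(1) openin_E_subset[OF U]])
      have f2: "smooth_between m' ?V2 n V1 f"
        using smooth_between_subset[OF f, of ?V2] by (auto simp: smooth_between_def)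
      have "(m', ?V2, restrict (\<beta> \<circ> f) ?V2) \<in> DM"
        by (rule manifold_diffeology_compose[OF preM L(4) V2 f2])
      then have l2: "is_lift m' V (restrict (\<alpha> \<circ> f) V) x (?V2, restrict (\<beta> \<circ> f) ?V2)"
        using V2 x L(2,5) by (auto simp: is_lift_def)
      have TR: "set (map (tangent_map m' f x) vs) \<subseteq> Rn n"
      proof -
        have "tangent_map m' f x v \<in> Rn n" for v
          by (rule tangent_map_Rn[OF V x]) (use fU openin_E_subset[OF U] in blast)
        then show ?thesis by auto
      qed
      have "descend \<omega> (m', V, restrict (\<alpha> \<circ> f) V) x vs = \<omega> (m', ?V2, restrict (\<beta> \<circ> f) ?V2) x vs"
        by (rule val[OF \<alpha>f l2 vs])
      also have "\<dots> = eform_pull m' ?V2 f (\<omega> (n, V1, \<beta>)) x vs"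
        unfolding dforms_pull[OF \<omega>d L(4) V2 f2] ..
      also have "\<dots> = \<omega> (n, V1, \<beta>) (f x) (map (tangent_map m' f x) vs)"
        using x L(2) vs by (simp add: eform_pull_def)
      also have "\<dots> = descend \<omega> (n, U, \<alpha>) (f x) (map (tangent_map m' f x) vs)"
        by (rule val[OF \<alpha> l TR, symmetric])
      finally show ?thesis using x vs by (simp add: eform_pull_def)
    next
      case False
      then show ?thesis by (auto simp: descend_def eform_pull_def)
    qed
  qed
qed

text \<open>A plot \<open>\<beta>\<close> of \<open>M\<close> is itself a lift of its projection,
  and every lift may be used to evaluate \<open>descend\<close>.\<close>

lemma pull_descend:
  assumes hyp: "second_countable (mtop HM) \<or> shear_is_subduction M H HM act"
    and \<omega>: "\<omega> \<in> invariant_basic_forms M H HM act k"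
  shows "dform_pull DM proj (descend \<omega>) = \<omega>"
proof
  have \<omega>d: "\<omega> \<in> dforms DM k" using \<omega> by (simp add: invariant_basic_forms_def basic_forms_iff)
  fix p :: "'a param"
  obtain n V \<beta> where p: "p = (n, V, \<beta>)" by (cases p)
  show "dform_pull DM proj (descend \<omega>) p = \<omega> p"
  proof (cases "p \<in> DM")
    case True
    then have \<beta>: "(n, V, \<beta>) \<in> DM" by (simp add: p)
    have V: "openin (Euclidean_space n) V" using \<beta> by (auto simp: manifold_diffeology_def params_def)
    show ?thesis
    proof (intro ext)
      fix x vs
      show "dform_pull DM proj (descend \<omega>) p x vs = \<omega> p x vs"
      proof (cases "x \<in> V \<and> set vs \<subseteq> Rn n")
        case True
        then have "is_lift n V (restrict (proj \<circ> \<beta>) V) x (V, \<beta>)" using V \<beta> by (simp add: is_lift_def)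
        from descend_value[OF hyp \<omega> orbit_plot[OF \<beta>] this] True show ?thesis
          unfolding p pull_value[OF \<beta>] by blast
      next
        case False
        then show ?thesis unfolding p pull_value[OF \<beta>] using eforms_zero[OF dforms_eform[OF \<omega>d \<beta>]]
          by (auto simp: descend_def)
      qed
    qed
  next
    case False
    then show ?thesis using dforms_zero[OF \<omega>d False] by (simp only: dform_pull_def if_False)
  qed
qed

lemma pull_iso:
  assumes hyp: "second_countable (mtop HM) \<or> shear_is_subduction M H HM act"
  shows "cochain_iso (dforms DQ) dform_d (invariant_basic_forms M H HM act) dform_d (dform_pull DM proj)"
  unfolding cochain_iso_def
proof (intro conjI allI ballI)
  show "cochain_complex (dforms DQ) dform_d" by (rule cochain_complex_dforms[OF orbit_diffeology_params])
  show "cochain_complex (invariant_basic_forms M H HM act) dform_d" by (rule basic_complex)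
  fix k
  show "linear_map_on (dforms DQ k) (dform_pull DM proj)"
    unfolding linear_map_on_def by (intro ballI allI dform_pull_lincomb)
  show "bij_betw (dform_pull DM proj) (dforms DQ k) (invariant_basic_forms M H HM act k)"
    unfolding bij_betw_def
  proof (intro conjI equalityI subsetI)
    show "inj_on (dform_pull DM proj) (dforms DQ k)" by (rule inj_onI) (rule pull_injective)
    show "\<omega> \<in> invariant_basic_forms M H HM act k" if "\<omega> \<in> dform_pull DM proj ` dforms DQ k" for \<omega>
      using that pull_invariant by blast
    show "\<omega> \<in> dform_pull DM proj ` dforms DQ k" if "\<omega> \<in> invariant_basic_forms M H HM act k" for \<omega>
      using imageI[OF descend_in[OF hyp that], of "dform_pull DM proj"] unfolding pull_descend[OF hyp that] .
  qed
  show "dform_pull DM proj (dform_d x) = dform_d (dform_pull DM proj x)" for x by (rule dform_pull_d)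
qed

end

theorem theorem3p3:
  fixes M :: "'a manifold"
    and H :: "('h, 'b) monoid_scheme" and HM :: "'h manifold"
    and act :: "'a \<Rightarrow> 'h \<Rightarrow> 'a"
  assumes "lie_group H HM"
    and "smooth_manifold M" and "second_countable (mtop M)"
    and "smooth_right_action M H HM act" and "locally_free M H HM act"
    and "second_countable (mtop HM) \<or> shear_is_subduction M H HM act"
  shows "let \<Omega>MH = dforms (orbit_diffeology M (carrier H) act);
             \<Omega>bas = invariant_basic_forms M H HM act;
             \<pi>\<^sub>H = orbit_proj (topspace (mtop M)) (carrier H) act;
             pull = dform_pull (manifold_diffeology M) \<pi>\<^sub>H
         in cochain_iso \<Omega>MH dform_d \<Omega>bas dform_d pull \<and>
            (\<forall>k. cohomology_iso \<Omega>MH dform_d \<Omega>bas dform_d k (cohomology_map \<Omega>bas dform_d k pull))"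
proof -
  interpret locally_free_action M H HM act
    by unfold_locales (use assms in auto)
  show ?thesis
    unfolding Let_def
    using pull_iso[OF assms(6)] cohomology_iso_of_cochain_iso[OF pull_iso[OF assms(6)]] by blast
qed

end
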